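(* Let $(R,\mathfrak m)$ be an $F$-finite noetherian local ring of characteristic $p>0$ and dimension $d$. For an $\mathfrak m$-primary ideal $I$, the following statements are equivalent. (1) $e_{HK}(I,R)>\dfrac{e(I,R)}{d!}$. (2) The minimal stable point $\alpha_{R,I,I}$ of $h_{R,I,I}$ is strictly larger than $1$. (3) There exists a $q=p^e$ such that $I^{q+1}$ is not contained in $(I^{[q]})^*$.
   Context: $F$-finite means the Frobenius endomorphism is finite. $I^{[q]}$ is the ideal generated by $q$-th powers of elements of $I$. The tight closure $\mathfrak a^*$ of an ideal $\mathfrak a$ is the ideal of all $x\in R$ for which there is $c\in R$, not in any minimal prime of $R$, with $cx^{p^n}\in\mathfrak a^{[p^n]}$ for all large $n$. $e(I,R)$ is the Hilbert–Samuel multiplicity and $e_{HK}(I,R)=\lim_{n\to\infty}l(R/I^{[p^n]})/p^{nd}$ is the Hilbert–Kunz multiplicity ($l$ is length). The $h$-function is $h_{R,I,I}(s)=\lim_{n\to\infty}\frac1{p^{nd}}l\big(R/(I^{\lceil sp^n\rceil}+I^{[p^n]})\big)$ for $s\in\mathbb R$, with nonpositive powers of $I$ being the unit ideal (the limit exists for all $s$), and its minimal stable point is $\alpha_{R,I,I}=\sup\{s\in\mathbb R\mid h_{R,I,I}(s)\ne e_{HK}(I,R)\}$. *)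

theory Defs
  imports "HOL-Algebra.Algebra" "HOL-Library.Extended_Real"
begin

section \<open>Local rings, dimension, length\<close>

definition local_ring :: "('a, 'b) ring_scheme \<Rightarrow> 'a set \<Rightarrow> bool" where
  "local_ring R \<mm> \<longleftrightarrow> cring R \<and> maximalideal \<mm> R \<and> (\<forall>M. maximalideal M R \<longrightarrow> M = \<mm>)"

(* group.ord is 0 for an element of infinite order, so this is 0 in characteristic zero. *)
definition ring_char :: "('a, 'b) ring_scheme \<Rightarrow> nat" where
  "ring_char R = group.ord (add_monoid R) \<one>\<^bsub>R\<^esub>"

(* A chain C 0 < C 1 < ... < C n is counted with its number n of strict inclusions. *)
definition chain_height :: "'a set set \<Rightarrow> enat" where
  "chain_height F =
     Sup {enat n | n. \<exists>C. (\<forall>i\<le>n. C i \<in> F) \<and> (\<forall>i<n. C i \<subset> C (Suc i))}"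

definition krull_dim :: "('a, 'b) ring_scheme \<Rightarrow> enat" where
  "krull_dim R = chain_height {P. primeideal P R}"

definition module_length :: "('a, 'b) ring_scheme \<Rightarrow> ('a, 'm, 'c) module_scheme \<Rightarrow> enat" where
  "module_length R M = chain_height {N. submodule N R M}"

(* R/J as an R-module: the quotient ring, extended by the scalar multiplication. *)
definition quot_module :: "('a, 'b) ring_scheme \<Rightarrow> 'a set \<Rightarrow> ('a, 'a set) module" where
  "quot_module R J =
     ring.extend (R Quot J)
       (module.fields (\<lambda>r A. (J +>\<^bsub>R\<^esub> r) \<otimes>\<^bsub>R Quot J\<^esub> A))"

lemma (in cring) module_quot_module:
  assumes "ideal J R"
  shows "module R (quot_module R J)"
proof -
  interpret J: ideal J R by fact
  interpret Q: ring "R Quot J" by (rule J.quotient_is_ring)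
  have eqs: "carrier (quot_module R J) = carrier (R Quot J)"
    "ring.add (quot_module R J) = ring.add (R Quot J)" "\<zero>\<^bsub>quot_module R J\<^esub> = \<zero>\<^bsub>R Quot J\<^esub>"
    "\<And>r A. r \<odot>\<^bsub>quot_module R J\<^esub> A = (J +> r) \<otimes>\<^bsub>R Quot J\<^esub> A"
    by (simp_all add: quot_module_def ring.defs module.defs)
  have am: "abelian_group (quot_module R J)"
    by (rule abelian_groupI)
       (use Q.l_neg in \<open>auto simp: eqs Q.add.m_ac\<close>)
  have cl: "J +> r \<in> carrier (R Quot J)" if "r \<in> carrier R" for r
    using that by (auto simp: FactRing_simps)
  have hom: "J +> (a \<oplus> b) = (J +> a) \<oplus>\<^bsub>R Quot J\<^esub> (J +> b)"
       "J +> (a \<otimes> b) = (J +> a) \<otimes>\<^bsub>R Quot J\<^esub> (J +> b)"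
    if "a \<in> carrier R" "b \<in> carrier R" for a b
    using J.a_rcos_sum[OF that] J.rcoset_mult_add[OF that] by (simp_all add: FactRing_def)
  have one: "J +> \<one> = \<one>\<^bsub>R Quot J\<^esub>" by (simp add: FactRing_def)
  show ?thesis
    by (rule moduleI[OF is_cring am])
       (simp_all add: eqs cl hom one Q.l_distr Q.r_distr Q.m_assoc)
qed

(* l(R/J) as a real number, meant for J with R/J of finite length. *)
definition colength :: "('a, 'b) ring_scheme \<Rightarrow> 'a set \<Rightarrow> real" where
  "colength R J = real (the_enat (module_length R (quot_module R J)))"


section \<open>Primary ideals, minimal primes\<close>

definition radical_ideal :: "('a, 'b) ring_scheme \<Rightarrow> 'a set \<Rightarrow> 'a set" where
  "radical_ideal R I = {x \<in> carrier R. \<exists>n::nat. x [^]\<^bsub>R\<^esub> n \<in> I}"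

definition primary_ideal :: "('a, 'b) ring_scheme \<Rightarrow> 'a set \<Rightarrow> bool" where
  "primary_ideal R I \<longleftrightarrow> ideal I R \<and> I \<noteq> carrier R \<and>
     (\<forall>a \<in> carrier R. \<forall>b \<in> carrier R. a \<otimes>\<^bsub>R\<^esub> b \<in> I \<longrightarrow> a \<in> I \<or> b \<in> radical_ideal R I)"

definition primary_to :: "('a, 'b) ring_scheme \<Rightarrow> 'a set \<Rightarrow> 'a set \<Rightarrow> bool" where
  "primary_to R P I \<longleftrightarrow> primary_ideal R I \<and> radical_ideal R I = P"

definition minimal_prime :: "('a, 'b) ring_scheme \<Rightarrow> 'a set \<Rightarrow> bool" where
  "minimal_prime R P \<longleftrightarrow> primeideal P R \<and> (\<forall>Q. primeideal Q R \<and> Q \<subseteq> P \<longrightarrow> Q = P)"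


section \<open>Frobenius, tight closure\<close>

definition finite_ring_hom ::
  "('a, 'b) ring_scheme \<Rightarrow> ('c, 'd) ring_scheme \<Rightarrow> ('a \<Rightarrow> 'c) \<Rightarrow> bool" where
  "finite_ring_hom R S f \<longleftrightarrow> f \<in> ring_hom R S \<and>
     (\<exists>B \<subseteq> carrier S. finite B \<and>
        (\<forall>x \<in> carrier S. \<exists>a \<in> B \<rightarrow> carrier R. x = (\<Oplus>\<^bsub>S\<^esub>b\<in>B. f (a b) \<otimes>\<^bsub>S\<^esub> b)))"

definition F_finite :: "('a, 'b) ring_scheme \<Rightarrow> nat \<Rightarrow> bool" where
  "F_finite R p \<longleftrightarrow> finite_ring_hom R R (\<lambda>x. x [^]\<^bsub>R\<^esub> p)"

definition ideal_pow :: "('a, 'b) ring_scheme \<Rightarrow> 'a set \<Rightarrow> nat \<Rightarrow> 'a set" where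
  "ideal_pow R I n = I [^]\<^bsub>ideals_set R\<^esub> n"

definition frob_pow :: "('a, 'b) ring_scheme \<Rightarrow> 'a set \<Rightarrow> nat \<Rightarrow> 'a set" where
  "frob_pow R I q = Idl\<^bsub>R\<^esub> ((\<lambda>x. x [^]\<^bsub>R\<^esub> q) ` I)"

definition tight_closure :: "('a, 'b) ring_scheme \<Rightarrow> nat \<Rightarrow> 'a set \<Rightarrow> 'a set" where
  "tight_closure R p \<aa> =
     {x \<in> carrier R. \<exists>c \<in> carrier R. (\<forall>P. minimal_prime R P \<longrightarrow> c \<notin> P) \<and>
        (\<forall>\<^sub>F n in sequentially. c \<otimes>\<^bsub>R\<^esub> (x [^]\<^bsub>R\<^esub> (p ^ n)) \<in> frob_pow R \<aa> (p ^ n))}"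


section \<open>Multiplicities and the h-function\<close>

text \<open>Below, \<open>p\<close> is the characteristic and \<open>d\<close> the dimension of \<open>R\<close>.\<close>

definition hilbert_samuel_mult :: "('a, 'b) ring_scheme \<Rightarrow> nat \<Rightarrow> 'a set \<Rightarrow> real" where
  "hilbert_samuel_mult R d I =
     lim (\<lambda>n. fact d * colength R (ideal_pow R I n) / real n ^ d)"

definition hilbert_kunz_mult :: "('a, 'b) ring_scheme \<Rightarrow> nat \<Rightarrow> nat \<Rightarrow> 'a set \<Rightarrow> real" where
  "hilbert_kunz_mult R p d I = lim (\<lambda>n. colength R (frob_pow R I (p ^ n)) / real p ^ (n * d))"

(* The function nat sends negative exponents to 0, and the 0-th power is the unit ideal. *)
definition h_function :: "('a, 'b) ring_scheme \<Rightarrow> nat \<Rightarrow> nat \<Rightarrow> 'a set \<Rightarrow> real \<Rightarrow> real" where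
  "h_function R p d I s =
     lim (\<lambda>n. colength R (ideal_pow R I (nat \<lceil>s * real p ^ n\<rceil>) <+>\<^bsub>R\<^esub> frob_pow R I (p ^ n))
              / real p ^ (n * d))"

definition min_stable_point :: "('a, 'b) ring_scheme \<Rightarrow> nat \<Rightarrow> nat \<Rightarrow> 'a set \<Rightarrow> ereal" where
  "min_stable_point R p d I =
     Sup (ereal ` {s. h_function R p d I s \<noteq> hilbert_kunz_mult R p d I})"

end

theory Submission
  imports Defs
begin

text \<open>
  In dimension \<open>d \<ge> 2\<close> all three statements hold, and in dimension \<open>d \<le> 1\<close> all three fail. Let
  \<open>L = e(I,R)/d!\<close>, the limit of \<open>l(R/I^n)/n^d\<close>, and let \<open>I\<close> have \<open>r\<close> generators.

  For \<open>d \<ge> 2\<close>, the ideal \<open>(I^[q] + I^(q+t))/I^(q+t)\<close> is generated by \<open>r\<close> elements killed by \<open>I^t\<close>, so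
  \<open>l(R/I^[q]) \<ge> l(R/I^(q+t)) - r l(R/I^t)\<close>. With \<open>t\<close> a small fraction of \<open>q\<close> this gives \<open>e_HK > L\<close>
  (an argument of Hanes). As \<open>h(s) \<le> L s^d\<close>, also \<open>h(s) < e_HK\<close> for some \<open>s > 1\<close>. If \<open>I^(Q+1)\<close> were
  in the tight closure of \<open>I^[Q]\<close> for all \<open>Q = p^e\<close>, then comparing the Frobenius powers of both
  ideals would give \<open>e_HK \<le> L ((Q+1+r)/Q)^d\<close> for all \<open>Q\<close>, hence \<open>e_HK \<le> L\<close>.

  For \<open>d \<le> 1\<close> there is a constant \<open>c\<close> with \<open>I^(q+c) \<subseteq> I^[q]\<close> for all \<open>q\<close>. Then \<open>h(s) = e_HK = L\<close> for
  \<open>s > 1\<close>, and \<open>I^(Q+1)\<close> lies in the tight closure of \<open>I^[Q]\<close> with multiplier \<open>1\<close>.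

  The limits defining \<open>e_HK\<close> and \<open>h\<close> are obtained as by Monsky: after a Frobenius power that kills
  the nilradical, colengths are sums over the minimal primes \<open>P\<close> up to an error \<open>O(q^(d-1))\<close>, and
  passing from \<open>J\<close> to \<open>J^[p]\<close> multiplies the colength of \<open>P + J\<close> by \<open>p^d\<close> up to such an error.
\<close>

text \<open>The invariants are defined through \<open>lim\<close>, which carries no information
  unless a limit exists, so convergence is proved along with every comparison. Everything is phrased
  inside \<open>R\<close>: a module \<open>A/B\<close> is the interval of submodules between
  \<open>B\<close> and \<open>A\<close>, and its length is the height of that interval. Passing to
  the Frobenius pushforward then only changes the set of scalars, and multiplies lengths by the
  degree of the residue field over its \<open>q\<close>-th powers.

  The error terms have one source: a kernel or cokernel killed by an element outside the relevant
  primes, hence of dimension below \<open>d\<close>.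

  The two ranges of \<open>d\<close> separate for this reason: with \<open>t = \<epsilon> q\<close>
  the gain in the inequality for \<open>l(R/I^[q])\<close> is about \<open>d L \<epsilon>\<close>
  and the loss is \<open>r L \<epsilon>^d\<close>, of higher order once \<open>d \<ge> 2\<close>.
  Strictness also needs \<open>L > 0\<close>, that is, growth of degree \<open>d\<close> forced by a
  chain of \<open>d\<close> primes. In dimension at most one, a finite residue field can prevent
  \<open>I\<close> from having a principal reduction; all generators are therefore treated together,
  in the associated graded ring of \<open>I\<close>.\<close>

no_notation Sum_Type.Plus (infixr \<open><+>\<close> 65)

section \<open>Heights of chains\<close>

definition strict_chain :: "'a set set \<Rightarrow> nat \<Rightarrow> (nat \<Rightarrow> 'a set) \<Rightarrow> bool" where
  "strict_chain F n C \<longleftrightarrow> (\<forall>i\<le>n. C i \<in> F) \<and> (\<forall>i<n. C i \<subset> C (Suc i))"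

lemma strict_chain_le: "strict_chain F n C \<Longrightarrow> m \<le> n \<Longrightarrow> strict_chain F m C"
  by (auto simp: strict_chain_def)

lemma chain_height_strict_chain: "chain_height F = Sup {enat n | n. \<exists>C. strict_chain F n C}"
  by (simp add: chain_height_def strict_chain_def)

lemma strict_chain_imp_le: "strict_chain F n C \<Longrightarrow> enat n \<le> chain_height F"
  by (auto simp: chain_height_strict_chain intro!: Sup_upper)

lemma le_chain_height_iff:
  assumes "F \<noteq> {}"
  shows "enat n \<le> chain_height F \<longleftrightarrow> (\<exists>C. strict_chain F n C)"
proof
  assume l: "enat n \<le> chain_height F"
  show "\<exists>C. strict_chain F n C"
  proof (cases n)
    case 0
    then show ?thesis using assms by (auto simp: strict_chain_def)
  next
    case (Suc k)
    show ?thesis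
    proof (rule ccontr)
      assume no: "\<not> ?thesis"
      have "x \<le> enat k" if "x \<in> {enat n | n. \<exists>C. strict_chain F n C}" for x
      proof -
        from that obtain m C where m: "x = enat m" "strict_chain F m C" by auto
        then have "\<not> n \<le> m" using no strict_chain_le by blast
        then show ?thesis using m Suc by simp
      qed
      then have "chain_height F \<le> enat k"
        unfolding chain_height_strict_chain by (rule Sup_least)
      with l have "enat n \<le> enat k" by (rule order_trans)
      with Suc show False by simp
    qed
  qed
qed (auto intro: strict_chain_imp_le)

lemma chain_height_leI:
  assumes "\<And>n C. strict_chain F n C \<Longrightarrow> enat n \<le> b"
  shows "chain_height F \<le> b"
  unfolding chain_height_strict_chain using assms by (auto intro: Sup_least)

lemma chain_height_le_map:
  assumes "\<And>M. M \<in> F \<Longrightarrow> f M \<in> G"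
    and "\<And>M Y. M \<in> F \<Longrightarrow> Y \<in> F \<Longrightarrow> M \<subset> Y \<Longrightarrow> f M \<subset> f Y"
  shows "chain_height F \<le> chain_height G"
proof (rule chain_height_leI)
  fix n C assume "strict_chain F n C"
  then have "strict_chain G n (\<lambda>i. f (C i))"
    using assms by (auto simp: strict_chain_def)
  then show "enat n \<le> chain_height G" by (rule strict_chain_imp_le)
qed

text \<open>Dropping the repetitions leaves a strict chain. The traces of a strict chain in a
  submodule and in a quotient are only weakly increasing, which is where this count is used.\<close>

lemma weak_chain_card_le:
  assumes "\<And>i. i \<le> n \<Longrightarrow> D i \<in> F" and "\<And>i. i < n \<Longrightarrow> D i \<subseteq> D (Suc i)"
  shows "enat (card {i. i < n \<and> D i \<noteq> D (Suc i)}) \<le> chain_height F"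
proof -
  \<comment> \<open>The last member \<open>D n\<close> is recorded so that the induction can append
    \<open>D (Suc n)\<close>.\<close>
  have "\<exists>C. strict_chain F (card {i. i < n \<and> D i \<noteq> D (Suc i)}) C \<and>
          C (card {i. i < n \<and> D i \<noteq> D (Suc i)}) = D n"
    using assms
  proof (induction n)
    case 0
    then show ?case by (auto simp: strict_chain_def)
  next
    case (Suc n)
    let ?s = "card {i. i < n \<and> D i \<noteq> D (Suc i)}"
    from Suc obtain C where C: "strict_chain F ?s C" "C ?s = D n" by force
    show ?case
    proof (cases "D n = D (Suc n)")
      case True
      then have "{i. i < Suc n \<and> D i \<noteq> D (Suc i)} = {i. i < n \<and> D i \<noteq> D (Suc i)}"
        by (auto simp: less_Suc_eq)
      with C True show ?thesis by auto
    next
      case False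
      then have "{i. i < Suc n \<and> D i \<noteq> D (Suc i)} = insert n {i. i < n \<and> D i \<noteq> D (Suc i)}"
        by (auto simp: less_Suc_eq)
      then have s: "card {i. i < Suc n \<and> D i \<noteq> D (Suc i)} = Suc ?s" by simp
      have "D n \<subset> D (Suc n)" using Suc.prems(2)[of n] False by auto
      moreover have "D (Suc n) \<in> F" using Suc.prems(1) by auto
      ultimately have "strict_chain F (Suc ?s) (C(Suc ?s := D (Suc n)))"
        using C by (auto simp: strict_chain_def le_Suc_eq less_Suc_eq)
      then show ?thesis unfolding s by (intro exI[of _ "C(Suc ?s := D (Suc n))"]) (simp add: fun_upd_def)
    qed
  qed
  then show ?thesis by (auto intro: strict_chain_imp_le)
qed

text \<open>Pairs of finite lower bounds suffice even for an infinite summand: with \<open>0\<close>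
  for the other one, every \<open>k\<close> is already below \<open>z\<close>. Additivity of length
  thus covers infinite lengths.\<close>

lemma enat_add_leI:
  fixes x y z :: enat
  assumes "\<And>m n. enat m \<le> x \<Longrightarrow> enat n \<le> y \<Longrightarrow> enat (m + n) \<le> z"
  shows "x + y \<le> z"
proof (cases "x = \<infinity> \<or> y = \<infinity>")
  case True
  have "enat k \<le> z" for k
    using True assms[of k 0] assms[of 0 k] by (auto simp: zero_enat_def[symmetric])
  then have "z = \<infinity>" by (metis enat_ord_simps(4) Suc_ile_eq not_less_iff_gr_or_eq enat.exhaust)
  then show ?thesis by simp
next
  case False
  then obtain a b where "x = enat a" "y = enat b" by auto
  then show ?thesis using assms[of a b] by simp
qed


section \<open>Additive subgroups closed under a set of scalars\<close>

text \<open>For \<open>S = carrier R\<close> these are the ideals; for \<open>S\<close> the set of \<open>q\<close>-th powers they are the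
  submodules of \<open>R\<close> viewed as a module over itself through the Frobenius. Quotient modules are
  replaced by intervals: \<open>len R S A B\<close> below is the length of \<open>A/B\<close>.\<close>

definition subm :: "('a, 'b) ring_scheme \<Rightarrow> 'a set \<Rightarrow> 'a set \<Rightarrow> bool" where
  "subm R S N \<longleftrightarrow> N \<subseteq> carrier R \<and> \<zero>\<^bsub>R\<^esub> \<in> N \<and> (\<forall>x\<in>N. \<forall>y\<in>N. x \<oplus>\<^bsub>R\<^esub> y \<in> N)
     \<and> (\<forall>x\<in>N. \<ominus>\<^bsub>R\<^esub> x \<in> N) \<and> (\<forall>s\<in>S. \<forall>x\<in>N. s \<otimes>\<^bsub>R\<^esub> x \<in> N)"

definition len :: "('a, 'b) ring_scheme \<Rightarrow> 'a set \<Rightarrow> 'a set \<Rightarrow> 'a set \<Rightarrow> enat" where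
  "len R S A B = chain_height {N. subm R S N \<and> B \<subseteq> N \<and> N \<subseteq> A}"

text \<open>Scalars correspond in both directions because submodules are moved both ways: the first
  correspondence serves preimages, the second images. The main example sends \<open>a\<close> to
  \<open>a^q u\<close>, with the whole ring as scalars on the source and the \<open>q\<close>-th
  powers on the target.\<close>

definition semilinear :: "('a, 'b) ring_scheme \<Rightarrow> 'a set \<Rightarrow> 'a set \<Rightarrow> ('a \<Rightarrow> 'a) \<Rightarrow> bool" where
  "semilinear R S S' f \<longleftrightarrow> f \<in> carrier R \<rightarrow> carrier R
     \<and> (\<forall>x\<in>carrier R. \<forall>y\<in>carrier R. f (x \<oplus>\<^bsub>R\<^esub> y) = f x \<oplus>\<^bsub>R\<^esub> f y)
     \<and> (\<forall>s\<in>S. \<exists>t\<in>S'. \<forall>x\<in>carrier R. f (s \<otimes>\<^bsub>R\<^esub> x) = t \<otimes>\<^bsub>R\<^esub> f x)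
     \<and> (\<forall>t\<in>S'. \<exists>s\<in>S. \<forall>x\<in>carrier R. f (s \<otimes>\<^bsub>R\<^esub> x) = t \<otimes>\<^bsub>R\<^esub> f x)"

context cring begin

lemma submI:
  assumes "N \<subseteq> carrier R" "\<zero> \<in> N" "\<And>x y. x \<in> N \<Longrightarrow> y \<in> N \<Longrightarrow> x \<oplus> y \<in> N"
    "\<And>x. x \<in> N \<Longrightarrow> \<ominus> x \<in> N" "\<And>s x. s \<in> S \<Longrightarrow> x \<in> N \<Longrightarrow> s \<otimes> x \<in> N"
  shows "subm R S N"
  using assms by (auto simp: subm_def)

lemma subm_carr: "subm R S N \<Longrightarrow> N \<subseteq> carrier R"
  and subm_zero: "subm R S N \<Longrightarrow> \<zero> \<in> N"
  and subm_add: "subm R S N \<Longrightarrow> x \<in> N \<Longrightarrow> y \<in> N \<Longrightarrow> x \<oplus> y \<in> N"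
  and subm_neg: "subm R S N \<Longrightarrow> x \<in> N \<Longrightarrow> \<ominus> x \<in> N"
  and subm_mult: "subm R S N \<Longrightarrow> s \<in> S \<Longrightarrow> x \<in> N \<Longrightarrow> s \<otimes> x \<in> N"
  and subm_mem: "subm R S N \<Longrightarrow> x \<in> N \<Longrightarrow> x \<in> carrier R"
  by (auto simp: subm_def)

lemma subm_diff: "subm R S N \<Longrightarrow> x \<in> N \<Longrightarrow> y \<in> N \<Longrightarrow> x \<ominus> y \<in> N"
  by (simp add: a_minus_def subm_add subm_neg)

lemma subm_add_cancel:
  assumes "subm R S N" "x \<in> carrier R" "y \<in> N" "x \<oplus> y \<in> N"
  shows "x \<in> N"
proof -
  have "x = (x \<oplus> y) \<ominus> y" using assms subm_mem[OF assms(1)] by algebra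
  then show ?thesis using subm_diff[OF assms(1,4,3)] by simp
qed

lemma subm_add_cancel':
  assumes "subm R S N" "y \<in> carrier R" "x \<in> N" "x \<oplus> y \<in> N"
  shows "y \<in> N"
  using subm_add_cancel[OF assms(1,2,3)] assms by (simp add: a_comm subm_mem[OF assms(1,3)])

lemma subm_scalars: "subm R S N \<Longrightarrow> S' \<subseteq> S \<Longrightarrow> subm R S' N"
  by (auto simp: subm_def)

lemma ideal_iff_subm: "ideal I R \<longleftrightarrow> subm R (carrier R) I"
proof
  assume I: "ideal I R"
  interpret ideal I R by (rule I)
  show "subm R (carrier R) I" by (rule submI) (auto simp: I_l_closed a_Hcarr)
next
  assume I: "subm R (carrier R) I"
  show "ideal I R"
  proof (rule idealI[OF ring_axioms])
    show "subgroup I (add_monoid R)"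
      by (rule add.subgroupI) (use I in \<open>auto simp: subm_def simp flip: a_inv_def\<close>)
  qed (use I in \<open>auto simp: subm_def m_comm[of _ x for x]\<close>, metis I m_comm subm_mem subm_mult)
qed

lemma mem_set_add: "x \<in> A <+> B \<longleftrightarrow> (\<exists>a\<in>A. \<exists>b\<in>B. x = a \<oplus> b)"
  by (auto simp: set_add_def')

lemma set_add_le:
  assumes "subm R S C" "A \<subseteq> C" "B \<subseteq> C"
  shows "A <+> B \<subseteq> C"
  using assms by (auto simp: mem_set_add intro!: subm_add[OF assms(1)])

lemma set_add_upper1:
  assumes "subm R S B" "A \<subseteq> carrier R"
  shows "A \<subseteq> A <+> B"
proof
  fix x assume "x \<in> A"
  then have "x = x \<oplus> \<zero>" "x \<in> A" "\<zero> \<in> B" using assms subm_zero by auto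
  then show "x \<in> A <+> B" unfolding mem_set_add by blast
qed

lemma set_add_upper2:
  assumes "subm R S A" "B \<subseteq> carrier R"
  shows "B \<subseteq> A <+> B"
proof
  fix x assume "x \<in> B"
  then have "x = \<zero> \<oplus> x" "x \<in> B" "\<zero> \<in> A" using assms subm_zero by auto
  then show "x \<in> A <+> B" unfolding mem_set_add by blast
qed

lemma set_add_mono: "A \<subseteq> A' \<Longrightarrow> B \<subseteq> B' \<Longrightarrow> A <+> B \<subseteq> A' <+> B'"
  by (force simp: mem_set_add)

lemma subm_set_add:
  assumes A: "subm R S A" and B: "subm R S B" and S: "S \<subseteq> carrier R"
  shows "subm R S (A <+> B)"
proof (rule submI)
  note c = subm_mem[OF A] subm_mem[OF B]
  show "A <+> B \<subseteq> carrier R" using c by (auto simp: mem_set_add)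
  show "\<zero> \<in> A <+> B" using subm_zero[OF A] subm_zero[OF B] unfolding mem_set_add
    by (metis l_zero zero_closed)
  fix x assume "x \<in> A <+> B"
  then obtain a b where x: "x = a \<oplus> b" "a \<in> A" "b \<in> B" by (auto simp: mem_set_add)
  have "\<ominus> x = \<ominus> a \<oplus> \<ominus> b" using x c by (simp add: minus_add)
  then show "\<ominus> x \<in> A <+> B" using x subm_neg[OF A] subm_neg[OF B] unfolding mem_set_add by blast
  { fix y assume "y \<in> A <+> B"
    then obtain a' b' where y: "y = a' \<oplus> b'" "a' \<in> A" "b' \<in> B" by (auto simp: mem_set_add)
    have "x \<oplus> y = (a \<oplus> a') \<oplus> (b \<oplus> b')" using x y c by (simp add: add.m_ac)
    then show "x \<oplus> y \<in> A <+> B" using x y subm_add[OF A] subm_add[OF B] unfolding mem_set_add by blast }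
  fix s assume s: "s \<in> S"
  have "s \<otimes> x = s \<otimes> a \<oplus> s \<otimes> b" using x c s S by (auto simp: r_distr)
  then show "s \<otimes> x \<in> A <+> B" using x s subm_mult[OF A] subm_mult[OF B] unfolding mem_set_add by blast
qed

lemma subm_Int: "subm R S A \<Longrightarrow> subm R S B \<Longrightarrow> subm R S (A \<inter> B)"
  by (auto simp: subm_def)

lemma subm_carrier: "S \<subseteq> carrier R \<Longrightarrow> subm R S (carrier R)"
  by (auto simp: subm_def)

lemma subm_singleton_zero: "S \<subseteq> carrier R \<Longrightarrow> subm R S {\<zero>}"
  by (auto simp: subm_def)

lemma set_add_absorb1: "subm R S A \<Longrightarrow> subm R S B \<Longrightarrow> A \<subseteq> B \<Longrightarrow> A <+> B = B"
  by (meson order_refl set_add_le set_add_upper2 subm_carr subset_antisym)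

lemma set_add_absorb2: "subm R S A \<Longrightarrow> subm R S B \<Longrightarrow> B \<subseteq> A \<Longrightarrow> A <+> B = A"
  by (meson order_refl set_add_le set_add_upper1 subm_carr subset_antisym)

section \<open>Images and preimages under semilinear maps\<close>

lemma semilinearD:
  assumes "semilinear R S S' f"
  shows "x \<in> carrier R \<Longrightarrow> f x \<in> carrier R"
    and "x \<in> carrier R \<Longrightarrow> y \<in> carrier R \<Longrightarrow> f (x \<oplus> y) = f x \<oplus> f y"
    and "f \<zero> = \<zero>" and "x \<in> carrier R \<Longrightarrow> f (\<ominus> x) = \<ominus> f x"
proof -
  have cl: "x \<in> carrier R \<Longrightarrow> f x \<in> carrier R" for x using assms by (auto simp: semilinear_def)
  have ad: "x \<in> carrier R \<Longrightarrow> y \<in> carrier R \<Longrightarrow> f (x \<oplus> y) = f x \<oplus> f y" for x y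
    using assms by (auto simp: semilinear_def)
  have z: "f \<zero> = \<zero>" using ad[of \<zero> \<zero>] cl[of \<zero>] by (metis add.l_cancel_one' l_zero zero_closed)
  show "x \<in> carrier R \<Longrightarrow> f x \<in> carrier R"
    and "x \<in> carrier R \<Longrightarrow> y \<in> carrier R \<Longrightarrow> f (x \<oplus> y) = f x \<oplus> f y" and "f \<zero> = \<zero>"
    by (fact cl ad z)+
  assume x: "x \<in> carrier R"
  have "f x \<oplus> f (\<ominus> x) = \<zero>" using ad[of x "\<ominus> x"] x z by (simp add: r_neg)
  then show "f (\<ominus> x) = \<ominus> f x" using cl x by (metis add.inv_closed add.inv_unique' a_inv_def minus_equality a_comm)
qed

lemma subm_vimage:
  assumes f: "semilinear R S S' f" and A: "subm R S A" and B: "subm R S' B"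
  shows "subm R S {a \<in> A. f a \<in> B}"
proof (rule submI)
  note c = subm_mem[OF A]
  show "\<zero> \<in> {a \<in> A. f a \<in> B}" using subm_zero[OF A] subm_zero[OF B] semilinearD(3)[OF f] by auto
  fix s x assume s: "s \<in> S" and x: "x \<in> {a \<in> A. f a \<in> B}"
  obtain t where t: "t \<in> S'" "\<forall>x\<in>carrier R. f (s \<otimes> x) = t \<otimes> f x"
    using f s by (auto simp: semilinear_def)
  then show "s \<otimes> x \<in> {a \<in> A. f a \<in> B}" using x s c subm_mult[OF A s] subm_mult[OF B t(1)] by auto
qed (use subm_mem[OF A] semilinearD[OF f] subm_add[OF A] subm_add[OF B] subm_neg[OF A] subm_neg[OF B] in auto)

lemma subm_image:
  assumes f: "semilinear R S S' f" and A: "subm R S A"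
  shows "subm R S' (f ` A)"
proof (rule submI)
  note c = subm_mem[OF A]
  show "f ` A \<subseteq> carrier R" using c semilinearD(1)[OF f] by auto
  show "\<zero> \<in> f ` A" using subm_zero[OF A] semilinearD(3)[OF f] by (metis imageI)
  fix x assume "x \<in> f ` A"
  then obtain a where x: "x = f a" "a \<in> A" by auto
  show "\<ominus> x \<in> f ` A" using x c semilinearD(4)[OF f, of a] subm_neg[OF A, of a] by (metis imageI)
  { fix y assume "y \<in> f ` A"
    then obtain b where y: "y = f b" "b \<in> A" by auto
    show "x \<oplus> y \<in> f ` A" using x y c semilinearD(2)[OF f, of a b] subm_add[OF A, of a b] by (metis imageI) }
  fix t assume t: "t \<in> S'"
  obtain s where "s \<in> S" "\<forall>x\<in>carrier R. f (s \<otimes> x) = t \<otimes> f x"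
    using f t by (auto simp: semilinear_def)
  then show "t \<otimes> x \<in> f ` A" using x c subm_mult[OF A] by (metis imageI)
qed

lemma semilinear_mult:
  assumes "u \<in> carrier R" "S \<subseteq> carrier R"
  shows "semilinear R S S (\<lambda>x. u \<otimes> x)"
proof -
  have "\<forall>s\<in>S. \<forall>x\<in>carrier R. u \<otimes> (s \<otimes> x) = s \<otimes> (u \<otimes> x)" using assms by (auto simp: m_lcomm)
  then show ?thesis using assms by (auto simp: semilinear_def r_distr)
qed

lemma semilinear_id: "semilinear R S S (\<lambda>x. x)"
  by (auto simp: semilinear_def)

lemma subm_mult_image: "subm R S A \<Longrightarrow> u \<in> carrier R \<Longrightarrow> S \<subseteq> carrier R \<Longrightarrow> subm R S ((\<lambda>x. u \<otimes> x) ` A)"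
  by (rule subm_image[OF semilinear_mult])

lemma subm_colon: "subm R S A \<Longrightarrow> subm R S B \<Longrightarrow> u \<in> carrier R \<Longrightarrow> S \<subseteq> carrier R \<Longrightarrow> subm R S {a \<in> A. u \<otimes> a \<in> B}"
  by (rule subm_vimage[OF semilinear_mult])

text \<open>Cancellation in the modular lattice of submodules. It ensures that a strict step of a
  chain stays strict after adding \<open>B\<close> or after intersecting with
  \<open>B\<close>.\<close>

lemma modular_cancel:
  assumes N: "subm R S N" "subm R S N'" "subm R S B" and "N \<subseteq> N'" "N' \<inter> B \<subseteq> N" "N' \<subseteq> N <+> B"
  shows "N' \<subseteq> N"
proof
  fix x assume x: "x \<in> N'"
  then obtain a b where ab: "x = a \<oplus> b" "a \<in> N" "b \<in> B" using assms by (force simp: mem_set_add)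
  have "b \<in> N'" using subm_add_cancel'[OF N(2), of b a] ab x assms(4) subm_mem[OF N(3)] by auto
  then have "b \<in> N" using ab assms by auto
  then show "x \<in> N" using ab subm_add[OF N(1)] by auto
qed

section \<open>Length of an interval of submodules\<close>

lemma le_len_iff:
  "subm R S A \<Longrightarrow> B \<subseteq> A \<Longrightarrow>
     enat n \<le> len R S A B \<longleftrightarrow> (\<exists>C. strict_chain {N. subm R S N \<and> B \<subseteq> N \<and> N \<subseteq> A} n C)"
  unfolding len_def by (rule le_chain_height_iff) auto

text \<open>A chain between \<open>C\<close> and \<open>A\<close> is projected to the chains
  \<open>D i <+> B\<close> and \<open>D i \<inter> B\<close>; every strict step survives in at least
  one of them by \<open>modular_cancel\<close>. Conversely, chains below and above \<open>B\<close>
  are joined.\<close>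

lemma len_additive:
  assumes A: "subm R S A" and B: "subm R S B" and C: "subm R S C" and S: "S \<subseteq> carrier R"
    and BA: "B \<subseteq> A" and CB: "C \<subseteq> B"
  shows "len R S A C = len R S A B + len R S B C"
proof (rule antisym)
  let ?F = "\<lambda>A C. {N. subm R S N \<and> C \<subseteq> N \<and> N \<subseteq> A}"
  show "len R S A C \<le> len R S A B + len R S B C"
    unfolding len_def[of R S A C]
  proof (rule chain_height_leI)
    fix n D assume D: "strict_chain (?F A C) n D"
    let ?M = "\<lambda>i. D i <+> B" and ?Y = "\<lambda>i. D i \<inter> B"
    have Di: "subm R S (D i)" "C \<subseteq> D i" "D i \<subseteq> A" if "i \<le> n" for i
      using D that by (auto simp: strict_chain_def)
    have Dm: "D i \<subset> D (Suc i)" if "i < n" for i using D that by (auto simp: strict_chain_def)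
    let ?x = "{i. i < n \<and> ?M i \<noteq> ?M (Suc i)}" and ?y = "{i. i < n \<and> ?Y i \<noteq> ?Y (Suc i)}"
    have "enat (card ?x) \<le> chain_height (?F A B)"
    proof (rule weak_chain_card_le)
      fix i assume i: "i \<le> n"
      show "?M i \<in> ?F A B"
        using subm_set_add[OF Di(1)[OF i] B S] set_add_le[OF A Di(3)[OF i] BA]
          set_add_upper2[OF Di(1)[OF i] subm_carr[OF B]] by auto
    next
      fix i assume i: "i < n"
      show "?M i \<subseteq> ?M (Suc i)" using Dm[OF i] by (intro set_add_mono) auto
    qed
    moreover have "enat (card ?y) \<le> chain_height (?F B C)"
    proof (rule weak_chain_card_le)
      fix i assume i: "i \<le> n"
      show "?Y i \<in> ?F B C" using subm_Int[OF Di(1)[OF i] B] Di[OF i] CB by auto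
    next
      fix i assume i: "i < n"
      show "?Y i \<subseteq> ?Y (Suc i)" using Dm[OF i] by auto
    qed
    moreover have "enat n \<le> enat (card ?x) + enat (card ?y)"
    proof -
      have "{..<n} \<subseteq> ?x \<union> ?y"
      proof
        fix i assume "i \<in> {..<n}"
        then have i: "i < n" by simp
        show "i \<in> ?x \<union> ?y"
        proof (rule ccontr)
          assume "i \<notin> ?x \<union> ?y"
          then have e: "?M i = ?M (Suc i)" "?Y i = ?Y (Suc i)" using i by auto
          have "D (Suc i) \<subseteq> D i"
          proof (rule modular_cancel[OF Di(1) Di(1) B])
            show "D (Suc i) \<subseteq> D i <+> B"
              using e(1) set_add_upper1[OF B subm_carr[OF Di(1), of "Suc i"]] i by auto
          qed (use Dm[OF i] e(2) i in auto)
          with Dm[OF i] show False by auto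
        qed
      qed
      then have "card {..<n} \<le> card (?x \<union> ?y)" by (intro card_mono) auto
      also have "\<dots> \<le> card ?x + card ?y" by (rule card_Un_le)
      finally show ?thesis by simp
    qed
    ultimately show "enat n \<le> len R S A B + len R S B C"
      unfolding len_def by (meson add_mono order_trans)
  qed
  show "len R S A B + len R S B C \<le> len R S A C"
  proof (rule enat_add_leI)
    fix m n assume "enat m \<le> len R S A B" "enat n \<le> len R S B C"
    then obtain M Y where M: "strict_chain (?F A B) m M" and Y: "strict_chain (?F B C) n Y"
      using le_len_iff[OF A BA] le_len_iff[OF B CB] by auto
    \<comment> \<open>The top \<open>Y n\<close> of the lower chain is replaced by
      \<open>M 0\<close>, from which it may differ; strictness remains because
      \<open>Y n \<subseteq> B \<subseteq> M 0\<close>.\<close>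
    define Z where "Z i = (if i < n then Y i else if i = n then M 0 else M (i - n))" for i
    have Zle: "Z i = M (i - n)" if "\<not> i < n" for i using that by (auto simp: Z_def)
    have "strict_chain (?F A C) (m + n) Z"
      unfolding strict_chain_def
    proof (intro conjI allI impI)
      fix i assume i: "i \<le> m + n"
      show "Z i \<in> ?F A C"
      proof (cases "i < n")
        case True
        then have "Y i \<in> ?F B C" using Y unfolding strict_chain_def by simp
        then show ?thesis using True BA unfolding Z_def by auto
      next
        case False
        then have z: "Z i = M (i - n)" "i - n \<le> m" using Zle i by auto
        then have "M (i - n) \<in> ?F A B" using M unfolding strict_chain_def by blast
        then show ?thesis using CB unfolding z(1) by auto
      qed
    next
      fix i assume i: "i < m + n"
      consider "Suc i < n" | "Suc i = n" | "\<not> i < n" by linarith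
      then show "Z i \<subset> Z (Suc i)"
      proof cases
        case 1
        then show ?thesis using Y by (auto simp: Z_def strict_chain_def)
      next
        case 2
        have "Y i \<subset> Y n" using Y 2 by (auto simp: strict_chain_def)
        moreover have "Y n \<subseteq> B" "B \<subseteq> M 0" using M Y by (auto simp: strict_chain_def)
        ultimately show ?thesis using 2 by (auto simp: Z_def)
      next
        case 3
        then have "Z i = M (i - n)" "Z (Suc i) = M (Suc (i - n))" "i - n < m"
          using Zle[of i] Zle[of "Suc i"] i by (auto simp: Suc_diff_le)
        then show ?thesis using M by (auto simp: strict_chain_def)
      qed
    qed
    then show "enat (m + n) \<le> len R S A C" unfolding len_def by (rule strict_chain_imp_le)
  qed
qed

lemma len_self: "len R S A A = 0"
proof -
  have "len R S A A \<le> enat 0"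
    unfolding len_def
  proof (rule chain_height_leI)
    fix n C assume C: "strict_chain {N. subm R S N \<and> A \<subseteq> N \<and> N \<subseteq> A} n C"
    show "enat n \<le> enat 0"
    proof (cases n)
      case (Suc k)
      then have "C 0 \<subset> C (Suc 0)" "A \<subseteq> C 0" "C (Suc 0) \<subseteq> A"
        using C by (auto simp: strict_chain_def)
      then show ?thesis by auto
    qed simp
  qed
  then show ?thesis by (simp flip: zero_enat_def)
qed

lemma len_pos:
  assumes "subm R S A" "subm R S B" "B \<subset> A"
  shows "1 \<le> len R S A B"
proof -
  have "strict_chain {N. subm R S N \<and> B \<subseteq> N \<and> N \<subseteq> A} 1 (\<lambda>i. if i = 0 then B else A)"
    using assms by (auto simp: strict_chain_def)
  then show ?thesis unfolding len_def one_enat_def by (rule strict_chain_imp_le)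
qed

text \<open>The isomorphism of \<open>A\<close> modulo the preimage of \<open>B\<close> with
  \<open>f A + B\<close> modulo \<open>B\<close>. Each inequality needs only one strictly monotone
  map of submodules: the preimage, or the image plus \<open>B\<close>. With \<open>f\<close> the
  identity, a multiplication or a twisted Frobenius it yields the exact sequences below.\<close>

lemma len_image:
  assumes f: "semilinear R S S' f" and A: "subm R S A" and B: "subm R S' B" and S: "S' \<subseteq> carrier R"
  shows "len R S' (f ` A <+> B) B = len R S A {a \<in> A. f a \<in> B}"
proof (rule antisym)
  have fA: "subm R S' (f ` A)" by (rule subm_image[OF f A])
  let ?G = "\<lambda>N. {a \<in> A. f a \<in> N}"
  show "len R S' (f ` A <+> B) B \<le> len R S A (?G B)"
    unfolding len_def
  proof (rule chain_height_le_map[where f = ?G])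
    fix M assume "M \<in> {N. subm R S' N \<and> B \<subseteq> N \<and> N \<subseteq> f ` A <+> B}"
    then show "?G M \<in> {N. subm R S N \<and> ?G B \<subseteq> N \<and> N \<subseteq> A}"
      using subm_vimage[OF f A] by auto
  next
    fix M Y assume M: "M \<in> {N. subm R S' N \<and> B \<subseteq> N \<and> N \<subseteq> f ` A <+> B}"
      and Y: "Y \<in> {N. subm R S' N \<and> B \<subseteq> N \<and> N \<subseteq> f ` A <+> B}" and XY: "M \<subset> Y"
    then obtain y where y: "y \<in> Y" "y \<notin> M" by auto
    then obtain a b where ab: "y = f a \<oplus> b" "a \<in> A" "b \<in> B" using Y by (force simp: mem_set_add)
    have fa: "f a \<in> carrier R" using ab subm_mem[OF fA] by auto
    have "f a \<in> Y" using subm_add_cancel[of S' Y "f a" b] Y ab y fa by auto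
    moreover have "f a \<notin> M" using subm_add[of S' M "f a" b] M ab y by auto
    ultimately show "?G M \<subset> ?G Y" using ab XY by auto
  qed
  show "len R S A (?G B) \<le> len R S' (f ` A <+> B) B"
    unfolding len_def
  proof (rule chain_height_le_map[where f = "\<lambda>N. f ` N <+> B"])
    fix M assume "M \<in> {N. subm R S N \<and> ?G B \<subseteq> N \<and> N \<subseteq> A}"
    then have M: "subm R S M" "M \<subseteq> A" by auto
    then show "f ` M <+> B \<in> {N. subm R S' N \<and> B \<subseteq> N \<and> N \<subseteq> f ` A <+> B}"
      using subm_set_add[OF subm_image[OF f M(1)] B S] set_add_mono[of "f ` M" "f ` A" B B]
        set_add_upper2[OF subm_image[OF f M(1)] subm_carr[OF B]] by auto
  next
    fix M Y assume M: "M \<in> {N. subm R S N \<and> ?G B \<subseteq> N \<and> N \<subseteq> A}"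
      and Y: "Y \<in> {N. subm R S N \<and> ?G B \<subseteq> N \<and> N \<subseteq> A}" and XY: "M \<subset> Y"
    then obtain y where y: "y \<in> Y" "y \<notin> M" by auto
    have sX: "subm R S M" and sY: "subm R S Y" using M Y by auto
    have "f y \<notin> f ` M <+> B"
    proof
      assume "f y \<in> f ` M <+> B"
      then obtain x b where xb: "f y = f x \<oplus> b" "x \<in> M" "b \<in> B" by (force simp: mem_set_add)
      have c: "x \<in> carrier R" "y \<in> carrier R" "b \<in> carrier R" "x \<in> A" "y \<in> A"
        using xb y M Y subm_mem[OF A] subm_mem[OF B] by auto
      have "f (y \<ominus> x) = f y \<ominus> f x"
        using c semilinearD[OF f] by (simp add: a_minus_def)
      also have "\<dots> = b" using c semilinearD(1)[OF f c(1)] unfolding xb(1) by algebra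
      finally have "y \<ominus> x \<in> ?G B" using xb(3) subm_diff[OF A c(5,4)] by auto
      then have "y \<ominus> x \<in> M" using M by auto
      then have "(y \<ominus> x) \<oplus> x \<in> M" using subm_add[OF sX] xb by auto
      moreover have "(y \<ominus> x) \<oplus> x = y" using c by algebra
      ultimately show False using y by simp
    qed
    moreover have "f y \<in> f ` Y <+> B"
      using set_add_upper1[OF B subm_carr[OF subm_image[OF f sY]]] y by auto
    moreover have "f ` M <+> B \<subseteq> f ` Y <+> B" using XY by (intro set_add_mono) auto
    ultimately show "f ` M <+> B \<subset> f ` Y <+> B" by auto
  qed
qed

lemma len_set_add:
  assumes "subm R S A" "subm R S B" "S \<subseteq> carrier R"
  shows "len R S (A <+> B) B = len R S A (A \<inter> B)"
  using len_image[OF semilinear_id assms] by (simp add: Int_def)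

lemma len_mono:
  assumes "A \<subseteq> A'" "B' \<subseteq> B"
  shows "len R S A B \<le> len R S A' B'"
  unfolding len_def by (rule chain_height_le_map[where f = id]) (use assms in auto)

end

section \<open>Ideals, noetherian induction, powers\<close>

text \<open>The products of the elements of \<open>xs\<close> with \<open>V\<close>, summed by
  recursion so that arguments can remove one generator at a time. With \<open>V\<close> the whole
  ring this is the ideal generated by \<open>xs\<close>.\<close>

fun lsum :: "('a, 'b) ring_scheme \<Rightarrow> 'a list \<Rightarrow> 'a set \<Rightarrow> 'a set" where
  "lsum R [] V = {\<zero>\<^bsub>R\<^esub>}"
| "lsum R (x # xs) V = ((\<lambda>v. x \<otimes>\<^bsub>R\<^esub> v) ` V) <+>\<^bsub>R\<^esub> lsum R xs V"

context cring begin

abbreviation idl :: "'a set \<Rightarrow> bool" where "idl N \<equiv> subm R (carrier R) N"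

abbreviation prin :: "'a \<Rightarrow> 'a set" where "prin x \<equiv> (\<lambda>v. x \<otimes> v) ` carrier R"

lemma idl_carrier [simp]: "idl (carrier R)"
  by (rule subm_carrier) simp

lemma idl_set_add [intro]: "idl A \<Longrightarrow> idl B \<Longrightarrow> idl (A <+> B)"
  by (rule subm_set_add) auto

lemma idl_mult_image [intro]: "idl A \<Longrightarrow> u \<in> carrier R \<Longrightarrow> idl ((\<lambda>x. u \<otimes> x) ` A)"
  by (rule subm_mult_image) auto

lemma idl_colon: "idl A \<Longrightarrow> idl B \<Longrightarrow> u \<in> carrier R \<Longrightarrow> idl {a \<in> A. u \<otimes> a \<in> B}"
  by (rule subm_colon) auto

lemma idl_mult: "idl A \<Longrightarrow> r \<in> carrier R \<Longrightarrow> x \<in> A \<Longrightarrow> r \<otimes> x \<in> A"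
  by (rule subm_mult)

lemma idl_mult2: "idl A \<Longrightarrow> r \<in> carrier R \<Longrightarrow> x \<in> A \<Longrightarrow> x \<otimes> r \<in> A"
  using subm_mult[of "carrier R" A r x] subm_mem[of "carrier R" A x] by (simp add: m_comm)

lemma prin_le: "idl A \<Longrightarrow> x \<in> A \<Longrightarrow> prin x \<subseteq> A"
  by (auto intro: idl_mult2)

lemma mem_prin: "x \<in> carrier R \<Longrightarrow> x \<in> prin x"
  by (rule image_eqI[of _ _ \<one>]) auto

lemma idl_one: "idl A \<Longrightarrow> \<one> \<in> A \<Longrightarrow> A = carrier R"
  using subm_carr[of "carrier R" A] idl_mult2[of A _ \<one>] by fastforce

lemma subm_lsum:
  assumes "set xs \<subseteq> carrier R" "subm R S V" "S \<subseteq> carrier R"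
  shows "subm R S (lsum R xs V)"
  using assms(1)
proof (induction xs)
  case Nil
  then show ?case using subm_singleton_zero[OF assms(3)] by simp
next
  case (Cons x xs)
  then show ?case using subm_set_add[OF subm_mult_image[OF assms(2) _ assms(3)] _ assms(3)] by simp
qed

lemma idl_lsum [intro]: "set xs \<subseteq> carrier R \<Longrightarrow> idl V \<Longrightarrow> idl (lsum R xs V)"
  by (rule subm_lsum) auto

lemma lsum_le:
  assumes "subm R S C" "\<And>x v. x \<in> set xs \<Longrightarrow> v \<in> V \<Longrightarrow> x \<otimes> v \<in> C"
  shows "lsum R xs V \<subseteq> C"
  using assms(2)
proof (induction xs)
  case Nil
  then show ?case using subm_zero[OF assms(1)] by simp
next
  case (Cons x xs)
  then have "lsum R xs V \<subseteq> C" "(\<lambda>v. x \<otimes> v) ` V \<subseteq> C" by auto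
  then show ?case using set_add_le[OF assms(1)] by simp
qed

lemma lsum_mem:
  assumes xs: "set xs \<subseteq> carrier R" and V: "subm R S V" "S \<subseteq> carrier R" and x: "x \<in> set xs" "v \<in> V"
  shows "x \<otimes> v \<in> lsum R xs V"
  using xs x(1)
proof (induction xs)
  case (Cons y ys)
  have y: "y \<in> carrier R" "set ys \<subseteq> carrier R" using Cons by auto
  have i: "subm R S ((\<lambda>v. y \<otimes> v) ` V)" "subm R S (lsum R ys V)"
    using subm_mult_image[OF V(1) y(1) V(2)] subm_lsum[OF y(2) V] by auto
  show ?case
  proof (cases "x = y")
    case True
    then show ?thesis using set_add_upper1[OF i(2) subm_carr[OF i(1)]] x(2) by auto
  next
    case False
    then show ?thesis using set_add_upper2[OF i(1) subm_carr[OF i(2)]] Cons y by auto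
  qed
qed simp

lemma lsum_mono:
  assumes "set xs \<subseteq> carrier R" "subm R S V'" "S \<subseteq> carrier R" "V \<subseteq> V'"
  shows "lsum R xs V \<subseteq> lsum R xs V'"
  by (rule lsum_le[OF subm_lsum[OF assms(1-3)]]) (use lsum_mem[OF assms(1-3)] assms(4) in auto)

section \<open>Ordinary powers of ideals\<close>

definition ipow :: "'a set \<Rightarrow> nat \<Rightarrow> 'a set" where
  "ipow I n = ideal_pow R I n"

lemma ipow_0 [simp]: "ipow I 0 = carrier R"
  by (simp add: ipow_def ideal_pow_def nat_pow_def ideals_set_def)

lemma ipow_Suc: "ipow I (Suc n) = ipow I n \<cdot> I"
  by (simp add: ipow_def ideal_pow_def nat_pow_def ideals_set_def)

lemma idl_ipow [intro]: "idl I \<Longrightarrow> idl (ipow I n)"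
proof (induction n)
  case (Suc n)
  then show ?case using ideal_prod_is_ideal[of "ipow I n" I] by (simp add: ipow_Suc ideal_iff_subm)
qed simp

lemma ipow_Suc_mem: "a \<in> ipow I n \<Longrightarrow> b \<in> I \<Longrightarrow> a \<otimes> b \<in> ipow I (Suc n)"
  by (simp add: ipow_Suc ideal_prod.prod)

lemma ipow_Suc_le:
  assumes "subm R S D" "\<And>a b. a \<in> ipow I n \<Longrightarrow> b \<in> I \<Longrightarrow> a \<otimes> b \<in> D"
  shows "ipow I (Suc n) \<subseteq> D"
proof
  fix x assume "x \<in> ipow I (Suc n)"
  then show "x \<in> D" unfolding ipow_Suc
    by (induction rule: ideal_prod.induct) (auto intro: assms(2) subm_add[OF assms(1)])
qed

lemma ipow_1: assumes I: "idl I" shows "ipow I 1 = I"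
proof
  show "ipow I 1 \<subseteq> I" unfolding One_nat_def
    by (rule ipow_Suc_le[OF I]) (use idl_mult[OF I] in auto)
  show "I \<subseteq> ipow I 1"
  proof
    fix x assume x: "x \<in> I"
    then have "\<one> \<otimes> x \<in> ipow I (Suc 0)" by (intro ipow_Suc_mem) auto
    then show "x \<in> ipow I 1" using x subm_mem[OF I] by simp
  qed
qed

text \<open>The elements \<open>b\<close> with \<open>a b\<close> in a fixed ideal form an ideal, so
  a claim about a whole power needs checking on products only. This passage to a colon ideal recurs
  throughout.\<close>

lemma ipow_mult_mem:
  assumes I: "idl I" and a: "a \<in> ipow I m" and b: "b \<in> ipow I n"
  shows "a \<otimes> b \<in> ipow I (m + n)"
  using b
proof (induction n arbitrary: b)
  case 0
  then show ?case using idl_mult2[OF idl_ipow[OF I] _ a] by simp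
next
  case (Suc n)
  have ac: "a \<in> carrier R" using subm_mem[OF idl_ipow[OF I] a] .
  have "ipow I (Suc n) \<subseteq> {b \<in> carrier R. a \<otimes> b \<in> ipow I (Suc (m + n))}"
  proof (rule ipow_Suc_le)
    show "idl {b \<in> carrier R. a \<otimes> b \<in> ipow I (Suc (m + n))}"
      using idl_colon[OF idl_carrier idl_ipow[OF I] ac] .
    fix c d assume c: "c \<in> ipow I n" "d \<in> I"
    have cd: "c \<in> carrier R" "d \<in> carrier R" using c subm_mem[OF idl_ipow[OF I]] subm_mem[OF I] by auto
    have "(a \<otimes> c) \<otimes> d \<in> ipow I (Suc (m + n))" using c Suc.IH by (intro ipow_Suc_mem) auto
    then show "c \<otimes> d \<in> {b \<in> carrier R. a \<otimes> b \<in> ipow I (Suc (m + n))}"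
      using cd ac by (simp add: m_assoc)
  qed
  then show ?case using Suc.prems by auto
qed

lemma ipow_Suc_subset: assumes I: "idl I" shows "ipow I (Suc n) \<subseteq> ipow I n"
  by (rule ipow_Suc_le[OF idl_ipow[OF I]]) (use idl_mult2[OF idl_ipow[OF I]] subm_mem[OF I] in auto)

lemma ipow_antimono: assumes I: "idl I" and "m \<le> n" shows "ipow I n \<subseteq> ipow I m"
  using lift_Suc_antimono_le[of "ipow I", OF ipow_Suc_subset[OF I] assms(2)] .

lemma ipow_subset: "idl I \<Longrightarrow> 0 < n \<Longrightarrow> ipow I n \<subseteq> I"
  using ipow_antimono[of I 1 n] ipow_1[of I] by auto

lemma ipow_mono: assumes "idl I" "idl J" "I \<subseteq> J" shows "ipow I n \<subseteq> ipow J n"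
proof (induction n)
  case (Suc n)
  show ?case
    by (rule ipow_Suc_le[OF idl_ipow[OF assms(2)]]) (use Suc assms(3) ipow_Suc_mem in blast)
qed simp

lemma pow_mem_ipow: assumes I: "idl I" and x: "x \<in> ipow I a" shows "x [^] (q::nat) \<in> ipow I (a * q)"
proof (induction q)
  case (Suc q)
  then show ?case using ipow_mult_mem[OF I Suc x] by (simp add: add.commute)
qed simp

lemma ipow_Suc_lsum:
  assumes xs: "set xs \<subseteq> carrier R" and I: "I = lsum R xs (carrier R)"
  shows "ipow I (Suc n) = lsum R xs (ipow I n)"
proof
  have iI: "idl I" unfolding I using xs by auto
  have ii: "idl (lsum R xs (ipow I n))" using idl_lsum[OF xs idl_ipow[OF iI]] .
  show "ipow I (Suc n) \<subseteq> lsum R xs (ipow I n)"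
  proof (rule ipow_Suc_le[OF ii])
    fix a b assume a: "a \<in> ipow I n" and b: "b \<in> I"
    have ac: "a \<in> carrier R" using subm_mem[OF idl_ipow[OF iI] a] .
    have "I \<subseteq> {b \<in> carrier R. a \<otimes> b \<in> lsum R xs (ipow I n)}"
      unfolding I
    proof (rule lsum_le[OF idl_colon[OF idl_carrier ii[unfolded I] ac]])
      fix x v assume x: "x \<in> set xs" and v: "v \<in> carrier R"
      have "x \<otimes> (a \<otimes> v) \<in> lsum R xs (ipow I n)"
        by (rule lsum_mem[OF xs idl_ipow[OF iI] _ x]) (use idl_mult2[OF idl_ipow[OF iI] v a] in auto)
      then show "x \<otimes> v \<in> {b \<in> carrier R. a \<otimes> b \<in> lsum R xs (ipow (lsum R xs (carrier R)) n)}"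
        using x xs v ac unfolding I by (auto simp: m_lcomm)
    qed
    then show "a \<otimes> b \<in> lsum R xs (ipow I n)" using b by auto
  qed
  show "lsum R xs (ipow I n) \<subseteq> ipow I (Suc n)"
  proof (rule lsum_le[OF idl_ipow[OF iI]])
    fix x v assume x: "x \<in> set xs" and v: "v \<in> ipow I n"
    have "x \<otimes> \<one> \<in> I" unfolding I by (rule lsum_mem[OF xs idl_carrier _ x]) auto
    then show "x \<otimes> v \<in> ipow I (Suc n)"
      using ipow_Suc_mem[OF v, of x] x xs subm_mem[OF idl_ipow[OF iI] v] by (auto simp: m_comm)
  qed
qed

text \<open>A power of \<open>xR + I'\<close> is generated by the products \<open>x^i v\<close> with
  \<open>v\<close> in \<open>I'^(N-i)\<close>. Instead of expanding, the induction peels off one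
  factor, \<open>x\<close> or an element \<open>y\<close> of \<open>I'\<close>, and passes to the
  colon ideals \<open>D : x\<close> and \<open>D : y\<close>.\<close>

lemma ipow_Suc_split:
  assumes I': "idl I'" and x: "x \<in> carrier R" and D: "idl D"
    and h: "\<And>i v. i \<le> N \<Longrightarrow> v \<in> ipow I' (N - i) \<Longrightarrow> x [^] i \<otimes> v \<in> D"
  shows "ipow (prin x <+> I') N \<subseteq> D"
  using D h
proof (induction N arbitrary: D)
  case 0
  show ?case
  proof
    fix v assume "v \<in> ipow (prin x <+> I') 0"
    then show "v \<in> D" using "0.prems"(2)[of 0 v] by auto
  qed
next
  case (Suc N)
  let ?I = "prin x <+> I'"
  have iI: "idl ?I" by (intro idl_set_add idl_mult_image idl_carrier I' x)
  have x1: "ipow ?I N \<subseteq> {v \<in> carrier R. x \<otimes> v \<in> D}"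
  proof (rule Suc.IH[OF idl_colon[OF idl_carrier Suc.prems(1) x]])
    fix i v assume i: "i \<le> N" and v: "v \<in> ipow I' (N - i)"
    have vc: "v \<in> carrier R" using subm_mem[OF idl_ipow[OF I'] v] .
    have "x [^] (Suc i) \<otimes> v \<in> D" by (rule Suc.prems(2)) (use i v in auto)
    then show "x [^] i \<otimes> v \<in> {v \<in> carrier R. x \<otimes> v \<in> D}"
      using x vc by (simp add: m_ac)
  qed
  show ?case
  proof (rule ipow_Suc_le[OF Suc.prems(1)])
    fix a b assume a: "a \<in> ipow ?I N" and b: "b \<in> ?I"
    obtain r y where b': "b = x \<otimes> r \<oplus> y" "r \<in> carrier R" "y \<in> I'" using b by (auto simp: mem_set_add)
    have c: "a \<in> carrier R" "y \<in> carrier R" using subm_mem[OF idl_ipow[OF iI] a] subm_mem[OF I' b'(3)] by auto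
    have x2: "ipow ?I N \<subseteq> {v \<in> carrier R. y \<otimes> v \<in> D}"
    proof (rule Suc.IH[OF idl_colon[OF idl_carrier Suc.prems(1) c(2)]])
      fix i v assume i: "i \<le> N" and v: "v \<in> ipow I' (N - i)"
      have vc: "v \<in> carrier R" using subm_mem[OF idl_ipow[OF I'] v] .
      have "x [^] i \<otimes> (v \<otimes> y) \<in> D"
        by (rule Suc.prems(2)) (use i ipow_Suc_mem[OF v b'(3)] in \<open>auto simp: Suc_diff_le\<close>)
      then show "x [^] i \<otimes> v \<in> {v \<in> carrier R. y \<otimes> v \<in> D}"
        using x vc c by (simp add: m_ac)
    qed
    have "x \<otimes> a \<in> D" "y \<otimes> a \<in> D" using x1 x2 a by auto
    then have "r \<otimes> (x \<otimes> a) \<oplus> y \<otimes> a \<in> D"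
      using idl_mult[OF Suc.prems(1) b'(2)] subm_add[OF Suc.prems(1)] by simp
    moreover have "a \<otimes> b = r \<otimes> (x \<otimes> a) \<oplus> y \<otimes> a" using b' c x by (simp add: r_distr m_ac)
    ultimately show "a \<otimes> b \<in> D" by simp
  qed
qed

lemma pow_mem_split:
  fixes q :: nat
  assumes "x \<in> carrier R" "q \<le> i" shows "x [^] i = x [^] q \<otimes> x [^] (i - q)"
  using assms by (simp add: nat_pow_mult)

text \<open>A product of at least \<open>q\<close> times as many factors as there are generators contains some
  generator at least \<open>q\<close> times.\<close>

lemma ipow_pigeonhole:
  assumes xs: "set xs \<subseteq> carrier R" and I: "I = lsum R xs (carrier R)"
    and q: "0 < q" and N: "0 < N" "length xs * q \<le> N"
  shows "ipow I N \<subseteq> lsum R (map (\<lambda>x. x [^] q) xs) (ipow I (N - q))"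
  using xs I N
proof (induction xs arbitrary: I N)
  case Nil
  \<comment> \<open>\<open>0 < N\<close> matters here: the zeroth power of the zero ideal is the
    whole ring.\<close>
  then show ?case using ipow_subset[of "{\<zero>}" N] subm_singleton_zero[of "carrier R"] by auto
next
  case (Cons x xs)
  let ?D = "lsum R (map (\<lambda>x. x [^] q) (x # xs)) (ipow I (N - q))"
  let ?I' = "lsum R xs (carrier R)"
  have xc: "x \<in> carrier R" and xsc: "set xs \<subseteq> carrier R" using Cons.prems by auto
  have qc: "set (map (\<lambda>x. x [^] q) (x # xs)) \<subseteq> carrier R" using Cons.prems(1) by auto
  have I': "idl ?I'" using xsc by auto
  have I: "I = prin x <+> ?I'" using Cons.prems by simp
  have iI: "idl I" unfolding I by (intro idl_set_add idl_mult_image idl_carrier I' xc)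
  have I'I: "?I' \<subseteq> I" unfolding I
    by (rule set_add_upper2[OF idl_mult_image[OF idl_carrier xc] subm_carr[OF I']])
  have xI: "x \<in> I" unfolding I
    using set_add_upper1[OF I' subm_carr[OF idl_mult_image[OF idl_carrier xc]]] mem_prin[OF xc] by auto
  have D: "idl ?D" using idl_lsum[OF qc idl_ipow[OF iI]] .
  have xpow: "x [^] j \<in> ipow I j" for j :: nat
    using pow_mem_ipow[OF iI, of x 1 j] xI ipow_1[OF iI] by simp
  have "ipow (prin x <+> ?I') N \<subseteq> ?D"
  proof (rule ipow_Suc_split[OF I' xc D])
    fix i v assume i: "i \<le> N" and v: "v \<in> ipow ?I' (N - i)"
    have vc: "v \<in> carrier R" using subm_mem[OF idl_ipow[OF I'] v] .
    have vI: "v \<in> ipow I (N - i)" using v ipow_mono[OF I' iI I'I] by auto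
    show "x [^] i \<otimes> v \<in> ?D"
    proof (cases "q \<le> i")
      case True
      have "x [^] (i - q) \<otimes> v \<in> ipow I ((i - q) + (N - i))"
        by (rule ipow_mult_mem[OF iI xpow vI])
      then have "x [^] q \<otimes> (x [^] (i - q) \<otimes> v) \<in> ?D"
        using True i by (intro lsum_mem[OF qc idl_ipow[OF iI]]) auto
      then show ?thesis using pow_mem_split[OF xc True] xc vc by (simp add: m_assoc)
    next
      case False
      have "length xs * q \<le> N - i" "0 < N - i" using False Cons.prems(4) by auto
      then have "v \<in> lsum R (map (\<lambda>x. x [^] q) xs) (ipow ?I' (N - i - q))"
        using Cons.IH[OF xsc refl] v by blast
      moreover have "lsum R (map (\<lambda>x. x [^] q) xs) (ipow ?I' (N - i - q)) \<subseteq> {v \<in> carrier R. x [^] i \<otimes> v \<in> ?D}"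
      proof (rule lsum_le[OF idl_colon[OF idl_carrier D]])
        show "x [^] i \<in> carrier R" using xc by simp
        fix y w assume y: "y \<in> set (map (\<lambda>x. x [^] q) xs)" and w: "w \<in> ipow ?I' (N - i - q)"
        have wc: "w \<in> carrier R" using subm_mem[OF idl_ipow[OF I'] w] .
        have wI: "w \<in> ipow I (N - i - q)" using w ipow_mono[OF I' iI I'I] by auto
        have yc: "y \<in> carrier R" using y qc by auto
        \<comment> \<open>At least two generators are present, so \<open>N \<ge> 2 q\<close>;
          together with \<open>i < q\<close> this makes the truncated difference
          \<open>N - i - q\<close> a true one.\<close>
        have "xs \<noteq> []" using y by auto
        then have "q + q \<le> length (x # xs) * q" by (cases xs) auto
        then have "q + q \<le> N" using Cons.prems(4) by (rule order_trans)
        then have "i + (N - i - q) = N - q" using False by auto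
        then have "x [^] i \<otimes> w \<in> ipow I (N - q)" using ipow_mult_mem[OF iI xpow wI, of i] by simp
        then have "y \<otimes> (x [^] i \<otimes> w) \<in> ?D" using y by (intro lsum_mem[OF qc idl_ipow[OF iI]]) auto
        then show "y \<otimes> w \<in> {v \<in> carrier R. x [^] i \<otimes> v \<in> ?D}"
          using yc wc xc by (simp add: m_lcomm)
      qed
      ultimately show ?thesis by auto
    qed
  qed
  then show ?case unfolding I .
qed

end

locale noetherian_cring = cring R + noetherian_ring R for R (structure)
begin

section \<open>Finite generation and noetherian induction\<close>

lemma idl_fin_gen:
  assumes "idl I"
  obtains xs where "set xs \<subseteq> carrier R" "I = lsum R xs (carrier R)"
proof -
  obtain A where A: "A \<subseteq> carrier R" "finite A" "I = Idl A"
    using finetely_gen assms ideal_iff_subm by blast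
  obtain xs where xs: "set xs = A" using A(2) finite_list by blast
  have c: "set xs \<subseteq> carrier R" using xs A by simp
  have i: "idl (lsum R xs (carrier R))" using c by auto
  have "Idl A \<subseteq> lsum R xs (carrier R)"
  proof (rule genideal_minimal)
    show "ideal (lsum R xs (carrier R)) R" using i ideal_iff_subm by auto
    show "A \<subseteq> lsum R xs (carrier R)"
    proof
      fix a assume a: "a \<in> A"
      have "a \<otimes> \<one> \<in> lsum R xs (carrier R)" by (rule lsum_mem[OF c idl_carrier]) (use a xs in auto)
      then show "a \<in> lsum R xs (carrier R)" using a A by auto
    qed
  qed
  moreover have "lsum R xs (carrier R) \<subseteq> Idl A"
  proof (rule lsum_le)
    show "idl (Idl A)" using genideal_ideal[OF A(1)] ideal_iff_subm by auto
    then show "x \<otimes> v \<in> Idl A" if "x \<in> set xs" "v \<in> carrier R" for x v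
      using that genideal_self[OF A(1)] xs idl_mult2 by blast
  qed
  ultimately show ?thesis using that[of xs] c A by auto
qed

lemma idl_chain_stable:
  assumes A: "\<And>i::nat. idl (A i)" and mono: "\<And>i. A i \<subseteq> A (Suc i)"
  obtains j where "\<And>i. j \<le> i \<Longrightarrow> A i = A j"
proof -
  have m: "i \<le> j \<Longrightarrow> A i \<subseteq> A j" for i j using lift_Suc_mono_le[of A, OF mono] .
  have "A i \<subseteq> A j \<or> A j \<subseteq> A i" for i j using m[of i j] m[of j i] nat_le_linear[of i j] by blast
  then have lin: "\<forall>i j. A i \<subseteq> A j \<or> A j \<subseteq> A i" by blast
  have "\<Union>(range A) \<in> range A"
  proof (rule ideal_chain_is_trivial)
    show "subset.chain {I. ideal I R} (range A)"
      unfolding pred_on.chain_def using A lin by (auto simp: ideal_iff_subm simp flip: psubset_eq)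
  qed simp
  then obtain j where "\<Union>(range A) = A j" by auto
  then show ?thesis using that[of j] m by blast
qed

lemma idl_noetherian_induct [consumes 1, case_names step]:
  assumes K: "idl K" and step: "\<And>K. idl K \<Longrightarrow> (\<And>L. idl L \<Longrightarrow> K \<subset> L \<Longrightarrow> P L) \<Longrightarrow> P K"
  shows "P K"
proof (rule ccontr)
  assume "\<not> P K"
  have "\<exists>f. \<forall>n::nat. (idl (f n) \<and> \<not> P (f n)) \<and> f n \<subset> f (Suc n)"
    by (rule dependent_nat_choice) (use K \<open>\<not> P K\<close> step in blast)+
  then obtain f where f: "\<And>n::nat. idl (f n)" "\<And>n. f n \<subset> f (Suc n)" by blast
  obtain j where "\<And>i. j \<le> i \<Longrightarrow> f i = f j" using idl_chain_stable[of f] f by blast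
  then show False using f(2)[of j] by (metis le_add2 less_irrefl plus_1_eq_Suc psubsetE subset_refl)
qed

text \<open>This replaces prime filtrations: if \<open>a b\<close> lies in \<open>K\<close>, then
  \<open>R/K\<close> is built from the quotients by \<open>aR + K\<close> and by the colon ideal
  \<open>K : a\<close>, both strictly larger than \<open>K\<close>. Statements about colengths
  therefore reduce to prime ideals.\<close>

lemma idl_prime_induct [consumes 1, case_names top prime split]:
  assumes K: "idl K" and top: "P (carrier R)"
    and prime: "\<And>K. primeideal K R \<Longrightarrow> (\<And>L. idl L \<Longrightarrow> K \<subset> L \<Longrightarrow> P L) \<Longrightarrow> P K"
    and split: "\<And>K a b. idl K \<Longrightarrow> a \<in> carrier R \<Longrightarrow> b \<in> carrier R \<Longrightarrow> a \<notin> K \<Longrightarrow> b \<notin> K \<Longrightarrow> a \<otimes> b \<in> K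
      \<Longrightarrow> (\<And>L. idl L \<Longrightarrow> K \<subset> L \<Longrightarrow> P L) \<Longrightarrow> P K"
  shows "P K"
  using K
proof (induction K rule: idl_noetherian_induct)
  case (step K)
  show ?case
  proof (cases "primeideal K R \<or> K = carrier R")
    case True
    then show ?thesis using top prime step by blast
  next
    case False
    then obtain a b where "a \<in> carrier R" "b \<in> carrier R" "a \<otimes> b \<in> K" "a \<notin> K" "b \<notin> K"
      using primeidealI[OF _ is_cring, of K] step(1) ideal_iff_subm by metis
    then show ?thesis using split step by blast
  qed
qed

end

section \<open>Frobenius powers\<close>

context cring begin

lemma binomial_cring:
  assumes x: "x \<in> carrier R" and y: "y \<in> carrier R"
  shows "(x \<oplus> y) [^] (n::nat) = (\<Oplus>k\<in>{..n}. add_pow R (n choose k) (x [^] k \<otimes> y [^] (n - k)))"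
proof (induction n)
  case 0
  then show ?case using x y by simp
next
  case (Suc n)
  let ?t = "\<lambda>m k. add_pow R (m choose k) (x [^] k \<otimes> y [^] (m - k))"
  let ?u = "\<lambda>k. add_pow R (n choose k) (x [^] Suc k \<otimes> y [^] (n - k))"
  let ?v = "\<lambda>k. add_pow R (n choose k) (x [^] k \<otimes> y [^] (Suc n - k))"
  have c: "?t m k \<in> carrier R" "?u k \<in> carrier R" "?v k \<in> carrier R" for m k using x y by auto
  have "(x \<oplus> y) [^] Suc n = (\<Oplus>k\<in>{..n}. ?t n k) \<otimes> x \<oplus> (\<Oplus>k\<in>{..n}. ?t n k) \<otimes> y"
    using x y Suc c by (simp add: r_distr finsum_closed Pi_def)
  also have "(\<Oplus>k\<in>{..n}. ?t n k) \<otimes> x = (\<Oplus>k\<in>{..n}. ?u k)"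
    using x y by (subst finsum_ldistr) (auto intro!: finsum_cong' simp: add_pow_ldistr add_pow_rdistr m_ac)
  also have "(\<Oplus>k\<in>{..n}. ?t n k) \<otimes> y = (\<Oplus>k\<in>{..n}. ?v k)"
    using x y by (subst finsum_ldistr) (auto intro!: finsum_cong' simp: add_pow_ldistr add_pow_rdistr m_ac Suc_diff_le)
  also have "(\<Oplus>k\<in>{..n}. ?v k) = (\<Oplus>k\<in>{..Suc n}. ?v k)"
    using x y c by (subst finsum_Suc) (auto simp: finsum_closed Pi_def binomial_eq_0)
  also have "\<dots> = (\<Oplus>k\<in>{..n}. ?v (Suc k)) \<oplus> ?v 0"
    using c by (subst finsum_Suc2) auto
  also have "(\<Oplus>k\<in>{..n}. ?u k) \<oplus> ((\<Oplus>k\<in>{..n}. ?v (Suc k)) \<oplus> ?v 0)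
      = (\<Oplus>k\<in>{..n}. ?u k \<oplus> ?v (Suc k)) \<oplus> ?v 0"
  proof -
    have v: "?v (Suc k) \<in> carrier R" for k using c(3) .
    have "(\<Oplus>k\<in>{..n}. ?u k \<oplus> ?v (Suc k)) = (\<Oplus>k\<in>{..n}. ?u k) \<oplus> (\<Oplus>k\<in>{..n}. ?v (Suc k))"
      using c(2) v by (intro finsum_addf) (simp_all only: Pi_def mem_Collect_eq, blast+)
    moreover have "(\<Oplus>k\<in>{..n}. ?u k) \<in> carrier R" "(\<Oplus>k\<in>{..n}. ?v (Suc k)) \<in> carrier R"
      using c(2) v by (intro finsum_closed; simp only: Pi_def mem_Collect_eq; blast)+
    ultimately show ?thesis using c(3)[of 0] by (simp only: a_assoc)
  qed
  also have "(\<Oplus>k\<in>{..n}. ?u k \<oplus> ?v (Suc k)) = (\<Oplus>k\<in>{..n}. ?t (Suc n) (Suc k))"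
    using x y by (intro finsum_cong') (auto simp: add.nat_pow_mult simp del: nat_pow_Suc)
  also have "?v 0 = ?t (Suc n) 0" by simp
  also have "(\<Oplus>k\<in>{..n}. ?t (Suc n) (Suc k)) \<oplus> ?t (Suc n) 0 = (\<Oplus>k\<in>{..Suc n}. ?t (Suc n) k)"
    using c by (subst finsum_Suc2) auto
  finally show ?case .
qed

end

locale frobenius_cring = noetherian_cring R for R (structure) +
  fixes p :: nat
  assumes prime_p: "Factorial_Ring.prime p" and char_p: "add_pow R (p) \<one> = \<zero>"
begin

lemma char_p_mult: assumes "z \<in> carrier R" "p dvd m" shows "add_pow R (m) z = \<zero>"
proof -
  obtain k where k: "m = p * k" using assms by auto
  have "add_pow R (p) z = (add_pow R (p) \<one>) \<otimes> z" using assms by (simp add: add_pow_ldistr)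
  then have "add_pow R (p) z = \<zero>" using assms by (simp add: char_p)
  then show ?thesis unfolding k using assms add.nat_pow_pow[of z k p] by simp
qed

lemma frobenius_add_1:
  assumes x: "x \<in> carrier R" and y: "y \<in> carrier R"
  shows "(x \<oplus> y) [^] p = x [^] p \<oplus> y [^] p"
proof -
  let ?t = "\<lambda>k. add_pow R (p choose k) (x [^] k \<otimes> y [^] (p - k))"
  obtain q where q: "p = Suc q" "q > 0" using prime_p prime_gt_1_nat[of p] by (cases p) auto
  have c: "?t k \<in> carrier R" for k using x y by auto
  have z: "?t k = \<zero>" if "0 < k" "k < p" for k
    using x y that dvd_choose_prime[of k p] prime_p by (intro char_p_mult) auto
  have "(x \<oplus> y) [^] p = (\<Oplus>k\<in>{..Suc q}. ?t k)" using binomial_cring[OF x y, of p] q by simp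
  also have "\<dots> = ?t (Suc q) \<oplus> (\<Oplus>k\<in>{..q}. ?t k)" using c by (subst finsum_Suc) auto
  also have "{..q} = insert 0 {1..q}" by auto
  also have "(\<Oplus>k\<in>insert 0 {1..q}. ?t k) = ?t 0 \<oplus> (\<Oplus>k\<in>{1..q}. ?t k)" using c x y by (subst finsum_insert) auto
  also have "(\<Oplus>k\<in>{1..q}. ?t k) = (\<Oplus>k\<in>{1..q}. \<zero>)" using z q by (intro finsum_cong') auto
  also have "\<dots> = \<zero>" by simp
  finally show ?thesis using x y q by (simp add: a_comm)
qed

lemma frobenius_add:
  assumes x: "x \<in> carrier R" and y: "y \<in> carrier R"
  shows "(x \<oplus> y) [^] (p ^ e) = x [^] (p ^ e) \<oplus> y [^] (p ^ e)"
proof (induction e)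
  case 0
  then show ?case using assms by simp
next
  case (Suc e)
  have "z [^] (p ^ Suc e) = (z [^] (p ^ e)) [^] p" if "z \<in> carrier R" for z
    using that by (simp add: nat_pow_pow mult.commute)
  then show ?case using Suc x y frobenius_add_1 by simp
qed

lemma p_pos [simp]: "0 < p"
  using prime_p prime_gt_0_nat by simp

lemma p_pow_pos: "0 < p ^ e"
  by simp

lemma frobenius_zero: "\<zero> [^] (p ^ e) = \<zero>"
  using nat_pow_zero[of "p ^ e"] p_pow_pos[of e] by simp

lemma frobenius_neg:
  assumes x: "x \<in> carrier R"
  shows "(\<ominus> x) [^] (p ^ e) = \<ominus> (x [^] (p ^ e))"
proof -
  have "(\<ominus> x) [^] (p ^ e) \<oplus> x [^] (p ^ e) = \<zero>"
    using frobenius_add[of "\<ominus> x" x e] x frobenius_zero by (simp add: l_neg)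
  then show ?thesis using x by (simp add: minus_equality)
qed

definition scal :: "nat \<Rightarrow> 'a set" where "scal e = (\<lambda>a. a [^] (p ^ e)) ` carrier R"

lemma scal_subset: "scal e \<subseteq> carrier R"
  by (auto simp: scal_def)

text \<open>These are the linear maps from \<open>R\<close> to its Frobenius pushforward;
  \<open>u\<close> is the image of \<open>\<one>\<close>.\<close>

lemma semilinear_frobenius:
  assumes u: "u \<in> carrier R"
  shows "semilinear R (carrier R) (scal e) (\<lambda>a. a [^] (p ^ e) \<otimes> u)"
proof -
  have "\<forall>s\<in>carrier R. \<forall>x\<in>carrier R. (s \<otimes> x) [^] (p ^ e) \<otimes> u = s [^] (p ^ e) \<otimes> (x [^] (p ^ e) \<otimes> u)"
    using u by (auto simp: nat_pow_distrib m_assoc)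
  moreover have "\<forall>s\<in>carrier R. s [^] (p ^ e) \<in> scal e" by (auto simp: scal_def)
  ultimately show ?thesis using u
    by (auto simp: semilinear_def frobenius_add l_distr scal_def)
qed

lemma idl_frobenius_vimage:
  assumes D: "idl D" shows "idl {x \<in> carrier R. x [^] (p ^ e) \<in> D}"
proof -
  have "idl {x \<in> carrier R. x [^] (p ^ e) \<otimes> \<one> \<in> D}"
    by (rule subm_vimage[OF semilinear_frobenius idl_carrier subm_scalars[OF D scal_subset]]) simp
  moreover have "{x \<in> carrier R. x [^] (p ^ e) \<otimes> \<one> \<in> D} = {x \<in> carrier R. x [^] (p ^ e) \<in> D}" by auto
  ultimately show ?thesis by simp
qed

end

context cring begin

lemma frob_gen_subset: "J \<subseteq> carrier R \<Longrightarrow> (\<lambda>x. x [^] (q::nat)) ` J \<subseteq> carrier R"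
  by auto

lemma idl_frob [intro]: "J \<subseteq> carrier R \<Longrightarrow> idl (frob_pow R J q)"
  unfolding frob_pow_def using genideal_ideal[OF frob_gen_subset] ideal_iff_subm by auto

lemma frob_mem: "J \<subseteq> carrier R \<Longrightarrow> x \<in> J \<Longrightarrow> x [^] q \<in> frob_pow R J q"
  unfolding frob_pow_def using genideal_self[OF frob_gen_subset] by blast

lemma frob_le: "idl D \<Longrightarrow> (\<And>x. x \<in> J \<Longrightarrow> x [^] q \<in> D) \<Longrightarrow> frob_pow R J q \<subseteq> D"
  unfolding frob_pow_def by (rule genideal_minimal) (auto simp: ideal_iff_subm)

lemma frob_mono: "J \<subseteq> J' \<Longrightarrow> J' \<subseteq> carrier R \<Longrightarrow> frob_pow R J q \<subseteq> frob_pow R J' q"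
  by (rule frob_le) (auto intro: frob_mem)

lemma frob_subset_ipow: "idl I \<Longrightarrow> frob_pow R (ipow I a) q \<subseteq> ipow I (a * q)"
  by (rule frob_le[OF idl_ipow]) (auto intro: pow_mem_ipow)

lemma frob_subset_ipow_1: "idl I \<Longrightarrow> frob_pow R I q \<subseteq> ipow I q"
  using frob_subset_ipow[of I 1 q] ipow_1[of I] by simp

lemma frob_carrier: "frob_pow R (carrier R) q = carrier R"
  using frob_mem[of "carrier R" \<one> q] idl_one[of "frob_pow R (carrier R) q"] by auto

end

context frobenius_cring begin

lemma frob_frob:
  assumes J: "idl J"
  shows "frob_pow R (frob_pow R J (p ^ a)) (p ^ b) = frob_pow R J (p ^ (a + b))"
proof
  have c: "J \<subseteq> carrier R" using subm_carr[OF J] .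
  have c2: "frob_pow R J (p ^ a) \<subseteq> carrier R" using subm_carr[OF idl_frob[OF c]] .
  have pw: "x [^] (p ^ (a + b)) = (x [^] (p ^ a)) [^] (p ^ b)" if "x \<in> J" for x
    using that c by (auto simp: nat_pow_pow power_add)
  have "frob_pow R J (p ^ a) \<subseteq> {x \<in> carrier R. x [^] (p ^ b) \<in> frob_pow R J (p ^ (a + b))}"
    by (rule frob_le[OF idl_frobenius_vimage[OF idl_frob[OF c]]])
      (use c frob_mem[OF c] pw in \<open>auto simp flip: pw\<close>)
  then show "frob_pow R (frob_pow R J (p ^ a)) (p ^ b) \<subseteq> frob_pow R J (p ^ (a + b))"
    by (intro frob_le[OF idl_frob[OF c]]) auto
  show "frob_pow R J (p ^ (a + b)) \<subseteq> frob_pow R (frob_pow R J (p ^ a)) (p ^ b)"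
    by (rule frob_le[OF idl_frob[OF c2]]) (use pw frob_mem[OF c2] frob_mem[OF c] in auto)
qed

lemma frob_set_add:
  assumes A: "idl A" and B: "idl B"
  shows "frob_pow R (A <+> B) (p ^ e) = frob_pow R A (p ^ e) <+> frob_pow R B (p ^ e)"
proof
  note c = subm_carr[OF A] subm_carr[OF B]
  have AB: "A <+> B \<subseteq> carrier R" using subm_carr[OF idl_set_add[OF A B]] .
  have i: "idl (frob_pow R A (p ^ e) <+> frob_pow R B (p ^ e))" using c by auto
  have "A <+> B \<subseteq> {x \<in> carrier R. x [^] (p ^ e) \<in> frob_pow R A (p ^ e) <+> frob_pow R B (p ^ e)}"
  proof (rule set_add_le[OF idl_frobenius_vimage[OF i]])
    show "A \<subseteq> {x \<in> carrier R. x [^] (p ^ e) \<in> frob_pow R A (p ^ e) <+> frob_pow R B (p ^ e)}"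
      using c frob_mem[OF c(1)] set_add_upper1[OF idl_frob[OF c(2)] subm_carr[OF idl_frob[OF c(1)]]] by blast
    show "B \<subseteq> {x \<in> carrier R. x [^] (p ^ e) \<in> frob_pow R A (p ^ e) <+> frob_pow R B (p ^ e)}"
      using c frob_mem[OF c(2)] set_add_upper2[OF idl_frob[OF c(1)] subm_carr[OF idl_frob[OF c(2)]]] by blast
  qed
  then show "frob_pow R (A <+> B) (p ^ e) \<subseteq> frob_pow R A (p ^ e) <+> frob_pow R B (p ^ e)"
    by (intro frob_le[OF i]) auto
  show "frob_pow R A (p ^ e) <+> frob_pow R B (p ^ e) \<subseteq> frob_pow R (A <+> B) (p ^ e)"
    by (intro set_add_le[OF idl_frob[OF AB]] frob_mono AB set_add_upper1[OF B] set_add_upper2[OF A] c)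
qed

lemma frob_prin:
  assumes x: "x \<in> carrier R"
  shows "frob_pow R (prin x) (p ^ e) = prin (x [^] (p ^ e))"
proof
  have c: "prin x \<subseteq> carrier R" using x by auto
  show "frob_pow R (prin x) (p ^ e) \<subseteq> prin (x [^] (p ^ e))"
    by (rule frob_le) (use x in \<open>auto simp: nat_pow_distrib\<close>)
  show "prin (x [^] (p ^ e)) \<subseteq> frob_pow R (prin x) (p ^ e)"
    by (rule prin_le[OF idl_frob[OF c]]) (use frob_mem[OF c mem_prin[OF x]] in auto)
qed

lemma frob_lsum:
  assumes xs: "set xs \<subseteq> carrier R"
  shows "frob_pow R (lsum R xs (carrier R)) (p ^ e) = lsum R (map (\<lambda>x. x [^] (p ^ e)) xs) (carrier R)"
  using xs
proof (induction xs)
  case Nil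
  have "frob_pow R {\<zero>} (p ^ e) \<subseteq> {\<zero>}"
    by (rule frob_le) (auto simp: frobenius_zero intro: subm_singleton_zero)
  then show ?case using subm_zero[OF idl_frob[of "{\<zero>}" "p ^ e"]] by auto
next
  case (Cons x xs)
  then show ?case
    using frob_set_add[OF idl_mult_image[OF idl_carrier, of x] idl_lsum[OF _ idl_carrier, of xs], of e]
      frob_prin[of x e] by simp
qed

text \<open>Each use of the pigeonhole principle extracts the \<open>q\<close>-th power of one
  generator and keeps \<open>length xs * q\<close> factors in reserve for the next. Compared with
  \<open>(I^n)^[q] \<subseteq> I^(n q)\<close> the loss is independent of \<open>n\<close>, hence
  invisible in leading terms as \<open>n\<close> grows.\<close>

lemma ipow_subset_frob:
  assumes xs: "set xs \<subseteq> carrier R" and I: "I = lsum R xs (carrier R)"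
  shows "ipow I (length xs * p ^ e + n * p ^ e) \<subseteq> frob_pow R (ipow I n) (p ^ e)"
proof (induction n)
  case 0
  then show ?case using frob_carrier idl_ipow[of I] subm_carr I xs by (metis idl_carrier idl_lsum ipow_0)
next
  case (Suc n)
  let ?q = "p ^ e"
  let ?F = "frob_pow R (ipow I (Suc n)) ?q"
  have iI: "idl I" unfolding I using xs by auto
  have cn: "ipow I n \<subseteq> carrier R" "ipow I (Suc n) \<subseteq> carrier R" using subm_carr[OF idl_ipow[OF iI]] by auto
  have F: "idl ?F" using idl_frob[OF cn(2)] .
  have "ipow I (length xs * ?q + Suc n * ?q) \<subseteq>
      lsum R (map (\<lambda>x. x [^] ?q) xs) (ipow I (length xs * ?q + Suc n * ?q - ?q))"
    by (rule ipow_pigeonhole[OF xs I]) auto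
  also have "length xs * ?q + Suc n * ?q - ?q = length xs * ?q + n * ?q" by simp
  also have "lsum R (map (\<lambda>x. x [^] ?q) xs) (ipow I (length xs * ?q + n * ?q)) \<subseteq> ?F"
  proof (rule lsum_le[OF F])
    fix y v assume "y \<in> set (map (\<lambda>x. x [^] ?q) xs)" and v: "v \<in> ipow I (length xs * ?q + n * ?q)"
    then obtain x where x: "x \<in> set xs" "y = x [^] ?q" by auto
    have xc: "x \<in> carrier R" using x xs by auto
    have xI: "x \<in> I" unfolding I using lsum_mem[OF xs idl_carrier _ x(1), of \<one>] xc by simp
    have "frob_pow R (ipow I n) ?q \<subseteq> {v \<in> carrier R. y \<otimes> v \<in> ?F}"
    proof (rule frob_le[OF idl_colon[OF idl_carrier F]])
      show "y \<in> carrier R" using x xc by simp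
      fix w assume w: "w \<in> ipow I n"
      have wc: "w \<in> carrier R" using w cn by auto
      have "(w \<otimes> x) [^] ?q \<in> ?F" by (rule frob_mem[OF cn(2) ipow_Suc_mem[OF w xI]])
      then show "w [^] ?q \<in> {v \<in> carrier R. y \<otimes> v \<in> ?F}"
        using x xc wc by (simp add: nat_pow_distrib m_comm)
    qed
    then show "y \<otimes> v \<in> ?F" using v Suc by auto
  qed
  finally show ?case .
qed

lemma ipow_subset_frob_1:
  assumes xs: "set xs \<subseteq> carrier R" and I: "I = lsum R xs (carrier R)"
    and N: "length xs * p ^ e \<le> N" "0 < N"
  shows "ipow I N \<subseteq> frob_pow R I (p ^ e)"
proof -
  have iI: "idl I" unfolding I using xs by auto
  have "ipow I N \<subseteq> lsum R (map (\<lambda>x. x [^] (p ^ e)) xs) (ipow I (N - p ^ e))"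
    using N by (intro ipow_pigeonhole[OF xs I]) auto
  also have "\<dots> \<subseteq> lsum R (map (\<lambda>x. x [^] (p ^ e)) xs) (carrier R)"
    using xs subm_carr[OF idl_ipow[OF iI]] by (intro lsum_mono[OF _ idl_carrier]) auto
  finally show ?thesis unfolding I frob_lsum[OF xs] .
qed

text \<open>Generation is expressed through the least submodule, which avoids linear combinations.\<close>

lemma scal_generators:
  assumes "F_finite R p"
  shows "\<exists>bs. set bs \<subseteq> carrier R \<and> (\<forall>N. subm R (scal e) N \<and> set bs \<subseteq> N \<longrightarrow> N = carrier R)"
proof (induction e)
  case 0
  have "N = carrier R" if "subm R (scal 0) N" "\<one> \<in> N" for N
  proof -
    have "scal 0 = carrier R" by (auto simp: scal_def)
    then show ?thesis using that idl_one by auto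
  qed
  then show ?case by (intro exI[of _ "[\<one>]"]) auto
next
  case (Suc e)
  from assms obtain B where B: "B \<subseteq> carrier R" "finite B"
      "\<forall>x\<in>carrier R. \<exists>a\<in>B \<rightarrow> carrier R. x = (\<Oplus>b\<in>B. a b [^] p \<otimes> b)"
    unfolding F_finite_def finite_ring_hom_def by blast
  \<comment> \<open>The finite sums in the definition of a finite map are met only here, to restate
    generation by \<open>B\<close> without them.\<close>
  have gB: "N = carrier R" if N: "subm R (scal 1) N" "B \<subseteq> N" for N
  proof
    show "N \<subseteq> carrier R" using subm_carr[OF N(1)] .
    show "carrier R \<subseteq> N"
    proof
      fix x assume "x \<in> carrier R"
      then obtain a where a: "a \<in> B \<rightarrow> carrier R" "x = (\<Oplus>b\<in>B. a b [^] p \<otimes> b)" using B by blast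
      have "(\<Oplus>b\<in>B'. a b [^] p \<otimes> b) \<in> N" if "B' \<subseteq> B" for B'
        using finite_subset[OF that B(2)] that
      proof (induction B')
        case empty
        then show ?case using subm_zero[OF N(1)] by simp
      next
        case (insert b B')
        have "a b [^] p \<otimes> b \<in> N" using insert a N(2) by (intro subm_mult[OF N(1)]) (auto simp: scal_def)
        then show ?case using insert a B
          by (subst finsum_insert) (auto intro!: subm_add[OF N(1)] simp: Pi_def subset_iff)
      qed
      then show "x \<in> N" using a by auto
    qed
  qed
  obtain bs where bs: "set bs \<subseteq> carrier R" "\<And>N. subm R (scal e) N \<Longrightarrow> set bs \<subseteq> N \<Longrightarrow> N = carrier R"
    using Suc by auto
  \<comment> \<open>The products \<open>b b'^(p^e)\<close> generate for the exponent
    \<open>e + 1\<close>, as products of bases do in a tower of field extensions.\<close>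
  let ?C = "(\<lambda>(b, b'). b \<otimes> b' [^] (p ^ e)) ` (set bs \<times> B)"
  have "finite ?C" using B by auto
  then obtain cs where cs: "set cs = ?C" using finite_list by blast
  have "N = carrier R" if N: "subm R (scal (Suc e)) N" "set cs \<subseteq> N" for N
  proof -
    note Nc = subm_mem[OF N(1)]
    have 1: "b \<otimes> y [^] (p ^ e) \<in> N" if b: "b \<in> set bs" and y: "y \<in> carrier R" for b y
    proof -
      have bc: "b \<in> carrier R" using b bs by auto
      let ?M = "{y \<in> carrier R. b \<otimes> y [^] (p ^ e) \<in> N}"
      have "subm R (scal 1) ?M"
      proof (rule submI)
        show "\<zero> \<in> ?M" using subm_zero[OF N(1)] bc by (simp add: frobenius_zero)
        fix x assume x: "x \<in> ?M"
        show "\<ominus> x \<in> ?M" using x bc subm_neg[OF N(1)] by (simp add: frobenius_neg r_minus)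
        show "x \<oplus> z \<in> ?M" if "z \<in> ?M" for z
          using x bc that subm_add[OF N(1)] by (simp add: frobenius_add r_distr)
        fix s assume "s \<in> scal 1"
        then obtain a where a: "s = a [^] p" "a \<in> carrier R" by (auto simp: scal_def)
        have "a [^] (p ^ Suc e) \<in> scal (Suc e)" using a(2) unfolding scal_def by blast
        then have "a [^] (p ^ Suc e) \<otimes> (b \<otimes> x [^] (p ^ e)) \<in> N"
          using x by (elim subm_mult[OF N(1)]) auto
        moreover have "a [^] (p ^ Suc e) \<otimes> (b \<otimes> x [^] (p ^ e)) = b \<otimes> (s \<otimes> x) [^] (p ^ e)"
          using a x bc by (simp add: nat_pow_distrib nat_pow_pow m_lcomm)
        ultimately show "s \<otimes> x \<in> ?M" using a x by auto
      qed auto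
      moreover have "B \<subseteq> ?M" using B b cs N(2) by auto
      ultimately show ?thesis using gB[of ?M] y by auto
    qed
    \<comment> \<open>Quantifying over all \<open>y\<close> makes this set closed under
      \<open>p^e\<close>-th powers as scalars, although \<open>N\<close> is closed only under
      \<open>p^(e+1)\<close>-th powers.\<close>
    let ?M = "{z \<in> carrier R. \<forall>y\<in>carrier R. z \<otimes> y [^] (p ^ e) \<in> N}"
    have "subm R (scal e) ?M"
    proof (rule submI)
      show "\<zero> \<in> ?M" using subm_zero[OF N(1)] by simp
      fix x assume x: "x \<in> ?M"
      show "\<ominus> x \<in> ?M" using x subm_neg[OF N(1)] by (auto simp: l_minus)
      show "x \<oplus> z \<in> ?M" if "z \<in> ?M" for z
        using x that subm_add[OF N(1)] by (auto simp: l_distr)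
      fix s assume "s \<in> scal e"
      then obtain a where a: "s = a [^] (p ^ e)" "a \<in> carrier R" by (auto simp: scal_def)
      have "(s \<otimes> x) \<otimes> y [^] (p ^ e) = x \<otimes> (a \<otimes> y) [^] (p ^ e)" if "y \<in> carrier R" for y
        using a x that by (simp add: nat_pow_distrib m_ac)
      then show "s \<otimes> x \<in> ?M" using a x by auto
    qed auto
    moreover have "set bs \<subseteq> ?M" using 1 bs by auto
    ultimately have "?M = carrier R" using bs(2)[of ?M] by blast
    then have "z \<otimes> \<one> [^] (p ^ e) \<in> N" if "z \<in> carrier R" for z using that by blast
    then show ?thesis using subm_carr[OF N(1)] by auto
  qed
  moreover have "set cs \<subseteq> carrier R" using cs bs(1) B(1) by (auto simp: subset_iff)
  ultimately show ?case by blast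
qed

end

section \<open>Colengths\<close>

lemma enat_sum_finite:
  fixes a b c :: enat
  assumes "a = b + c" "a \<noteq> \<infinity>"
  shows "b \<noteq> \<infinity>" "c \<noteq> \<infinity>" "real (the_enat a) = real (the_enat b) + real (the_enat c)"
  using assms by (cases b; cases c; auto)+

context cring begin

text \<open>\<open>cl J\<close> is the colength only if \<open>cofin J\<close>; the value at other ideals is meaningless.\<close>

definition clen :: "'a set \<Rightarrow> enat" where "clen J = len R (carrier R) (carrier R) J"

definition cofin :: "'a set \<Rightarrow> bool" where "cofin J \<longleftrightarrow> idl J \<and> clen J \<noteq> \<infinity>"

definition cl :: "'a set \<Rightarrow> real" where "cl J = real (the_enat (clen J))"

lemma cofin_idl: "cofin J \<Longrightarrow> idl J" by (simp add: cofin_def)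

lemma cl_nonneg [simp]: "0 \<le> cl J" by (simp add: cl_def)

lemma clen_additive: "idl J \<Longrightarrow> idl K \<Longrightarrow> J \<subseteq> K \<Longrightarrow> clen J = clen K + len R (carrier R) K J"
  unfolding clen_def by (rule len_additive[OF idl_carrier]) (auto dest: subm_mem)

lemma cofin_mono: "cofin J \<Longrightarrow> idl K \<Longrightarrow> J \<subseteq> K \<Longrightarrow> cofin K"
  using enat_sum_finite(1)[OF clen_additive[of J K]] by (auto simp: cofin_def)

lemma cl_additive:
  assumes "cofin J" "idl K" "J \<subseteq> K"
  shows "cl J = cl K + real (the_enat (len R (carrier R) K J))" "len R (carrier R) K J \<noteq> \<infinity>"
  using enat_sum_finite[OF clen_additive[of J K]] assms by (auto simp: cofin_def cl_def)

lemma cl_antimono: "cofin J \<Longrightarrow> idl K \<Longrightarrow> J \<subseteq> K \<Longrightarrow> cl K \<le> cl J"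
  using cl_additive(1)[of J K] by simp

lemma cl_strict:
  assumes "cofin J" "idl K" "J \<subset> K"
  shows "cl K + 1 \<le> cl J"
proof -
  have "1 \<le> len R (carrier R) K J" using assms by (intro len_pos) (auto simp: cofin_def)
  moreover have "len R (carrier R) K J \<noteq> \<infinity>" using cl_additive(2)[of J K] assms by auto
  ultimately have "1 \<le> the_enat (len R (carrier R) K J)" by (cases "len R (carrier R) K J") (auto simp: one_enat_def)
  then show ?thesis using cl_additive(1)[of J K] assms by auto
qed

lemma clen_carrier [simp]: "clen (carrier R) = 0"
  by (simp add: clen_def len_self)

lemma cofin_carrier [simp]: "cofin (carrier R)"
  by (simp add: cofin_def)

lemma cl_carrier [simp]: "cl (carrier R) = 0"
  by (simp add: cl_def zero_enat_def)

lemma clen_map: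
  assumes A: "idl A" and B: "idl B" and u: "u \<in> carrier R"
  shows "len R (carrier R) ((\<lambda>x. u \<otimes> x) ` A <+> B) B = len R (carrier R) A {a \<in> A. u \<otimes> a \<in> B}"
  by (rule len_image[OF semilinear_mult]) (use assms in auto)

text \<open>The exact sequence in which multiplication by \<open>u\<close> embeds
  \<open>R/(B : u)\<close> into \<open>R/B\<close> with cokernel \<open>R/(uR + B)\<close>.\<close>

lemma clen_colon:
  assumes B: "idl B" and u: "u \<in> carrier R"
  shows "clen B = clen (prin u <+> B) + clen {a \<in> carrier R. u \<otimes> a \<in> B}"
proof -
  have "clen B = clen (prin u <+> B) + len R (carrier R) (prin u <+> B) B"
  proof (rule clen_additive[OF B])
    show "idl (prin u <+> B)" by (intro idl_set_add idl_mult_image idl_carrier assms)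
    show "B \<subseteq> prin u <+> B" by (rule set_add_upper2[OF idl_mult_image subm_carr]) (use assms in auto)
  qed
  then show ?thesis using clen_map[OF idl_carrier B u] by (simp add: clen_def)
qed

lemma cofin_colon:
  assumes "cofin B" "u \<in> carrier R"
  shows "cofin (prin u <+> B)" "cofin {a \<in> carrier R. u \<otimes> a \<in> B}"
    and "cl B = cl (prin u <+> B) + cl {a \<in> carrier R. u \<otimes> a \<in> B}"
  using enat_sum_finite[OF clen_colon[of B u]] assms idl_colon[OF idl_carrier, of B u]
    idl_set_add[OF idl_mult_image[OF idl_carrier], of u B]
  by (auto simp: cofin_def cl_def)

text \<open>Both sides of the equation are the length of \<open>(uA + B)/B\<close>. In this form,
  multiplication by a generator will become a difference equation for Hilbert functions.\<close>

lemma cl_map: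
  assumes A: "cofin A" and B: "cofin B" and u: "u \<in> carrier R"
  shows "cofin {a \<in> A. u \<otimes> a \<in> B}" "cofin ((\<lambda>x. u \<otimes> x) ` A <+> B)"
    and "cl B - cl ((\<lambda>x. u \<otimes> x) ` A <+> B) = cl {a \<in> A. u \<otimes> a \<in> B} - cl A"
proof -
  note i = cofin_idl[OF A] cofin_idl[OF B]
  let ?W = "{a \<in> A. u \<otimes> a \<in> B}" and ?V = "(\<lambda>x. u \<otimes> x) ` A <+> B"
  have V: "idl ?V" "B \<subseteq> ?V"
    using i u idl_mult_image set_add_upper2[OF idl_mult_image[OF i(1) u] subm_carr[OF i(2)]] by auto
  have W: "idl ?W" "?W \<subseteq> A" using idl_colon[OF i u] by auto
  have e: "len R (carrier R) ?V B = len R (carrier R) A ?W" by (rule clen_map[OF i u])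
  have f: "len R (carrier R) ?V B \<noteq> \<infinity>" by (rule cl_additive(2)[OF B V])
  have "clen ?W = clen A + len R (carrier R) A ?W" by (rule clen_additive[OF W(1) i(1) W(2)])
  then show cW: "cofin ?W" using W(1) f e A by (auto simp: cofin_def)
  show "cofin ?V" by (rule cofin_mono[OF B V])
  show "cl B - cl ?V = cl ?W - cl A"
    using cl_additive(1)[OF B V] cl_additive(1)[OF cW i(1) W(2)] e by simp
qed

text \<open>The exact sequence of \<open>R/(A \<inter> B)\<close>, \<open>R/A \<oplus> R/B\<close>
  and \<open>R/(A + B)\<close>, read off from multiplication by \<open>\<one>\<close>.\<close>

lemma cl_Int:
  assumes A: "cofin A" and B: "cofin B"
  shows "cofin (A \<inter> B)" "cl (A \<inter> B) + cl (A <+> B) = cl A + cl B"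
proof -
  note i = cofin_idl[OF A] cofin_idl[OF B]
  have e: "(\<lambda>x. \<one> \<otimes> x) ` A = A" "{a \<in> A. \<one> \<otimes> a \<in> B} = A \<inter> B"
    using subm_carr[OF i(1)] by (force simp: image_iff subset_iff)+
  show "cofin (A \<inter> B)" "cl (A \<inter> B) + cl (A <+> B) = cl A + cl B"
    using cl_map[OF A B, of \<one>] unfolding e by auto
qed

text \<open>Submodules of the quotient correspond to ideals above \<open>J\<close> through unions of cosets.\<close>

lemma module_length_quot:
  assumes J: "idl J"
  shows "module_length R (quot_module R J) = clen J"
proof -
  have iJ: "ideal J R" using J ideal_iff_subm by auto
  interpret J: ideal J R by (rule iJ)
  interpret Q: ring "R Quot J" by (rule J.quotient_is_ring)
  interpret M: module R "quot_module R J" by (rule module_quot_module[OF iJ])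
  have eqs: "carrier (quot_module R J) = carrier (R Quot J)"
    "ring.add (quot_module R J) = ring.add (R Quot J)" "\<zero>\<^bsub>quot_module R J\<^esub> = \<zero>\<^bsub>R Quot J\<^esub>"
    "\<And>r A. r \<odot>\<^bsub>quot_module R J\<^esub> A = (J +> r) \<otimes>\<^bsub>R Quot J\<^esub> A"
    by (simp_all add: quot_module_def ring.defs module.defs)
  have car: "carrier (R Quot J) = (\<lambda>x. J +> x) ` carrier R" by (auto simp: FactRing_simps)
  have add: "(J +> a) \<oplus>\<^bsub>R Quot J\<^esub> (J +> b) = J +> (a \<oplus> b)" if "a \<in> carrier R" "b \<in> carrier R" for a b
    using J.a_rcos_sum[OF that] by (simp add: FactRing_def)
  have mul: "(J +> a) \<otimes>\<^bsub>R Quot J\<^esub> (J +> b) = J +> (a \<otimes> b)" if "a \<in> carrier R" "b \<in> carrier R" for a b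
    using J.rcoset_mult_add[OF that] by (simp add: FactRing_def)
  have zero: "\<zero>\<^bsub>R Quot J\<^esub> = J" by (simp add: FactRing_def)
  have eqc: "J +> a = J +> b \<longleftrightarrow> a \<ominus> b \<in> J" if "a \<in> carrier R" "b \<in> carrier R" for a b
    using quotient_eq_iff_same_a_r_cos[OF iJ that] by auto
  have sub: "N \<subseteq> (\<lambda>x. J +> x) ` carrier R" "J \<in> N"
      "\<And>a b. a \<in> carrier R \<Longrightarrow> b \<in> carrier R \<Longrightarrow> J +> a \<in> N \<Longrightarrow> J +> b \<in> N \<Longrightarrow> J +> (a \<oplus> b) \<in> N"
      "\<And>r a. r \<in> carrier R \<Longrightarrow> a \<in> carrier R \<Longrightarrow> J +> a \<in> N \<Longrightarrow> J +> (r \<otimes> a) \<in> N"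
    if N: "submodule N R (quot_module R J)" for N
  proof -
    interpret N: submodule N R "quot_module R J" by (rule N)
    show "N \<subseteq> (\<lambda>x. J +> x) ` carrier R" using N.subset car by (simp add: eqs)
    show "J \<in> N" using N.one_closed by (simp add: eqs zero)
    show "J +> (a \<oplus> b) \<in> N" if "a \<in> carrier R" "b \<in> carrier R" "J +> a \<in> N" "J +> b \<in> N" for a b
      using N.m_closed[of "J +> a" "J +> b"] that add by (simp add: eqs)
    show "J +> (r \<otimes> a) \<in> N" if "r \<in> carrier R" "a \<in> carrier R" "J +> a \<in> N" for r a
      using N.smult_closed[of r "J +> a"] that mul by (simp add: eqs)
  qed
  have J0: "J +> \<zero> = J" using a_rcos_zero[OF iJ] subm_zero[OF J] by auto
  show ?thesis
  proof (rule antisym)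
    show "module_length R (quot_module R J) \<le> clen J"
      unfolding module_length_def clen_def len_def
    proof (rule chain_height_le_map[where f = "\<lambda>N. {x \<in> carrier R. J +> x \<in> N}"])
      fix N assume "N \<in> {N. submodule N R (quot_module R J)}"
      then have N: "submodule N R (quot_module R J)" by simp
      note s = sub[OF N]
      have "idl {x \<in> carrier R. J +> x \<in> N}"
      proof (rule submI)
        show "\<zero> \<in> {x \<in> carrier R. J +> x \<in> N}" using J0 s(2) by simp
        fix x assume x: "x \<in> {x \<in> carrier R. J +> x \<in> N}"
        show "\<ominus> x \<in> {x \<in> carrier R. J +> x \<in> N}" using s(4)[of "\<ominus> \<one>" x] x by (simp add: l_minus)
      qed (use s in auto)
      moreover have "J \<subseteq> {x \<in> carrier R. J +> x \<in> N}"
        using s(2) a_rcos_zero[OF iJ] subm_carr[OF J] by auto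
      ultimately show "{x \<in> carrier R. J +> x \<in> N} \<in> {N. idl N \<and> J \<subseteq> N \<and> N \<subseteq> carrier R}" by auto
    next
      fix N N' assume "N \<in> {N. submodule N R (quot_module R J)}" "N' \<in> {N. submodule N R (quot_module R J)}" "N \<subset> N'"
      then show "{x \<in> carrier R. J +> x \<in> N} \<subset> {x \<in> carrier R. J +> x \<in> N'}"
        using sub(1)[of N'] by blast
    qed
    show "clen J \<le> module_length R (quot_module R J)"
      unfolding module_length_def clen_def len_def
    proof (rule chain_height_le_map[where f = "\<lambda>K. (\<lambda>x. J +> x) ` K"])
      fix K assume "K \<in> {N. idl N \<and> J \<subseteq> N \<and> N \<subseteq> carrier R}"
      then have K: "idl K" "J \<subseteq> K" by auto
      have c: "x \<in> K \<Longrightarrow> x \<in> carrier R" for x using subm_mem[OF K(1)] .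
      have "submodule ((\<lambda>x. J +> x) ` K) R (quot_module R J)"
      proof (rule M.submoduleI)
        show "(\<lambda>x. J +> x) ` K \<subseteq> carrier (quot_module R J)" using c by (auto simp: eqs car)
        show "\<zero>\<^bsub>quot_module R J\<^esub> \<in> (\<lambda>x. J +> x) ` K"
          using J0 subm_zero[OF K(1)] by (metis eqs(3) imageI zero)
        fix A assume "A \<in> (\<lambda>x. J +> x) ` K"
        then obtain x where x: "A = J +> x" "x \<in> K" by auto
        have "\<ominus>\<^bsub>quot_module R J\<^esub> A = J +> (\<ominus> x)"
        proof (rule M.minus_equality)
          show "(J +> \<ominus> x) \<oplus>\<^bsub>quot_module R J\<^esub> A = \<zero>\<^bsub>quot_module R J\<^esub>"
            using x c by (simp add: eqs add zero l_neg J0)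
        qed (use x c in \<open>auto simp: eqs car\<close>)
        then show "\<ominus>\<^bsub>quot_module R J\<^esub> A \<in> (\<lambda>x. J +> x) ` K" using x subm_neg[OF K(1)] by auto
        { fix B assume "B \<in> (\<lambda>x. J +> x) ` K"
          then obtain y where y: "B = J +> y" "y \<in> K" by auto
          then show "A \<oplus>\<^bsub>quot_module R J\<^esub> B \<in> (\<lambda>x. J +> x) ` K"
            using x c add subm_add[OF K(1)] by (simp add: eqs) }
        fix r assume "r \<in> carrier R"
        then show "r \<odot>\<^bsub>quot_module R J\<^esub> A \<in> (\<lambda>x. J +> x) ` K"
          using x c mul subm_mult[OF K(1)] by (simp add: eqs)
      qed
      then show "(\<lambda>x. J +> x) ` K \<in> {N. submodule N R (quot_module R J)}" by simp
    next
      fix K K' assume K: "K \<in> {N. idl N \<and> J \<subseteq> N \<and> N \<subseteq> carrier R}"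
        and K': "K' \<in> {N. idl N \<and> J \<subseteq> N \<and> N \<subseteq> carrier R}" and KK: "K \<subset> K'"
      then obtain y where y: "y \<in> K'" "y \<notin> K" by auto
      have "J +> y \<notin> (\<lambda>x. J +> x) ` K"
      proof
        assume "J +> y \<in> (\<lambda>x. J +> x) ` K"
        then obtain x where x: "x \<in> K" "J +> y = J +> x" by auto
        have c: "x \<in> carrier R" "y \<in> carrier R" using x y K K' by auto
        then have "y \<ominus> x \<in> K" using eqc x K by auto
        then have "(y \<ominus> x) \<oplus> x \<in> K" using x K subm_add by blast
        moreover have "(y \<ominus> x) \<oplus> x = y" using c by algebra
        ultimately show False using y by simp
      qed
      then show "(\<lambda>x. J +> x) ` K \<subset> (\<lambda>x. J +> x) ` K'" using y KK by blast
    qed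
  qed
qed

lemma colength_eq_cl: "idl J \<Longrightarrow> colength R J = cl J"
  by (simp add: colength_def cl_def module_length_quot)

text \<open>The layer \<open>(x^i R + B)/(x^(i+1) R + B)\<close> is cyclic, generated by
  \<open>x^i\<close>, so it is \<open>R\<close> modulo a colon ideal. Upper and lower bounds for
  colengths arise by estimating this ideal from below and from above respectively.\<close>

lemma prin_pow_filtration:
  assumes B: "cofin B" and x: "x \<in> carrier R"
  shows "cl (prin (x [^] Suc i) <+> B)
      = cl (prin (x [^] i) <+> B) + cl {a \<in> carrier R. x [^] i \<otimes> a \<in> prin (x [^] Suc i) <+> B}"
proof -
  have iB: "idl B" using cofin_idl[OF B] .
  have ip: "idl (prin (x [^] n))" for n :: nat using x by auto
  have c: "cofin (prin (x [^] n) <+> B)" for n :: nat using cofin_colon(1)[OF B] x by auto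
  have s: "prin (x [^] Suc i) \<subseteq> prin (x [^] i)"
    by (rule prin_le[OF ip]) (use x in auto)
  have "prin (x [^] i) <+> (prin (x [^] Suc i) <+> B) = prin (x [^] i) <+> B"
  proof
    show "prin (x [^] i) <+> (prin (x [^] Suc i) <+> B) \<subseteq> prin (x [^] i) <+> B"
      by (intro set_add_le[OF cofin_idl[OF c]] set_add_mono s subset_refl set_add_upper1[OF iB subm_carr[OF ip]])
    show "prin (x [^] i) <+> B \<subseteq> prin (x [^] i) <+> (prin (x [^] Suc i) <+> B)"
      by (intro set_add_mono subset_refl set_add_upper2[OF ip subm_carr[OF iB]])
  qed
  then show ?thesis using cofin_colon(3)[OF c, of "x [^] i" "Suc i"] x by simp
qed

end

section \<open>Growth of colengths and dimension\<close>

context cring begin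

lemma primeideal_idl: "primeideal Q R \<Longrightarrow> idl Q"
  using primeideal.axioms(1) ideal_iff_subm by auto

lemma primeideal_ne: "primeideal Q R \<Longrightarrow> Q \<noteq> carrier R"
  using primeideal.I_notcarr by auto

lemma primeideal_mult:
  "primeideal Q R \<Longrightarrow> a \<in> carrier R \<Longrightarrow> b \<in> carrier R \<Longrightarrow> a \<otimes> b \<in> Q \<Longrightarrow> a \<in> Q \<or> b \<in> Q"
  by (rule primeideal.I_prime)

lemma primeideal_pow:
  assumes Q: "primeideal Q R" and a: "a \<in> carrier R"
  shows "a [^] (n::nat) \<in> Q \<Longrightarrow> a \<in> Q"
proof (induction n)
  case 0
  then show ?case using idl_one[OF primeideal_idl[OF Q]] primeideal_ne[OF Q] by auto
next
  case (Suc n)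
  then show ?case using primeideal_mult[OF Q, of "a [^] n" a] a by auto
qed

lemma prime_ipow_subset:
  assumes I: "idl I" and Q: "primeideal Q R" and s: "ipow I n \<subseteq> Q"
  shows "I \<subseteq> Q"
proof
  fix x assume x: "x \<in> I"
  have "x [^] n \<in> ipow I (1 * n)" by (rule pow_mem_ipow[OF I]) (use ipow_1[OF I] x in simp)
  then show "x \<in> Q" using primeideal_pow[OF Q subm_mem[OF I x]] s by auto
qed

text \<open>The quotient by \<open>K\<close> has dimension at most \<open>k\<close>;
  \<open>Suc k\<close> counts strict inclusions. As only the absence of a chain is asserted, the
  unit ideal is covered and qualifies for every \<open>k\<close>.\<close>

definition chain_free :: "'a set \<Rightarrow> nat \<Rightarrow> bool" where
  "chain_free K k \<longleftrightarrow> \<not> (\<exists>C. strict_chain {P. primeideal P R \<and> K \<subseteq> P} (Suc k) C)"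

lemma chain_free_mono: "chain_free K k \<Longrightarrow> K \<subseteq> L \<Longrightarrow> chain_free L k"
proof -
  assume a: "chain_free K k" "K \<subseteq> L"
  then have "strict_chain {P. primeideal P R \<and> K \<subseteq> P} (Suc k) C"
    if "strict_chain {P. primeideal P R \<and> L \<subseteq> P} (Suc k) C" for C
    unfolding strict_chain_def
  proof (intro conjI allI impI)
    fix i assume "i \<le> Suc k"
    then have "primeideal (C i) R \<and> L \<subseteq> C i" using that unfolding strict_chain_def by simp
    then show "C i \<in> {P. primeideal P R \<and> K \<subseteq> P}" using order_trans[OF a(2)] by simp
  next
    fix i assume "i < Suc k"
    then show "C i \<subset> C (Suc i)" using that unfolding strict_chain_def by simp
  qed
  then show "chain_free L k" using a(1) unfolding chain_free_def by metis
qed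

text \<open>A prime over \<open>K\<close> strictly inside the bottom of a chain over
  \<open>L\<close> prolongs that chain downwards. In the applications \<open>L\<close> contains an
  element outside the relevant primes, and each such element lowers the dimension.\<close>

lemma chain_free_above_prime:
  assumes cf: "chain_free K (Suc k)"
    and L: "\<And>Q. primeideal Q R \<Longrightarrow> L \<subseteq> Q \<Longrightarrow> \<exists>P. primeideal P R \<and> K \<subseteq> P \<and> P \<subset> Q"
  shows "chain_free L k"
  unfolding chain_free_def
proof
  assume "\<exists>C. strict_chain {P. primeideal P R \<and> L \<subseteq> P} (Suc k) C"
  then obtain C where C: "\<And>i. i \<le> Suc k \<Longrightarrow> primeideal (C i) R \<and> L \<subseteq> C i"
      "\<And>i. i < Suc k \<Longrightarrow> C i \<subset> C (Suc i)"
    by (auto simp: strict_chain_def)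
  obtain P where P: "primeideal P R" "K \<subseteq> P" "P \<subset> C 0" using L[of "C 0"] C(1)[of 0] by auto
  have C0: "C 0 \<subseteq> C i" if "i \<le> Suc k" for i
    using that
  proof (induction i)
    case (Suc j)
    then show ?case using C(2)[of j] by auto
  qed simp
  define D where "D i = (case i of 0 \<Rightarrow> P | Suc j \<Rightarrow> C j)" for i
  have "strict_chain {P. primeideal P R \<and> K \<subseteq> P} (Suc (Suc k)) D"
    unfolding strict_chain_def
  proof (intro conjI allI impI)
    fix i assume i: "i \<le> Suc (Suc k)"
    show "D i \<in> {P. primeideal P R \<and> K \<subseteq> P}"
    proof (cases i)
      case (Suc j)
      have "K \<subseteq> C 0" using P by auto
      then show ?thesis using Suc i C(1)[of j] C0[of j] by (auto simp: D_def)
    qed (use P in \<open>auto simp: D_def\<close>)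
  next
    fix i assume i: "i < Suc (Suc k)"
    show "D i \<subset> D (Suc i)"
      using i C(2) P by (cases i) (auto simp: D_def)
  qed
  then show False using cf unfolding chain_free_def by blast
qed

end

section \<open>Local rings with an ideal primary to the maximal ideal\<close>

locale local_cring = noetherian_cring R for R (structure) +
  fixes \<mm> I :: "'a set"
  assumes max_mm: "maximalideal \<mm> R" and max_unique: "\<And>M. maximalideal M R \<Longrightarrow> M = \<mm>"
    and idl_I: "idl I" and radical_I: "radical_ideal R I = \<mm>"
begin

lemma prime_mm: "primeideal \<mm> R"
  using maximalideal_prime[OF max_mm] .

lemma idl_mm: "idl \<mm>"
  using primeideal_idl[OF prime_mm] .

lemma I_subset_mm: "I \<subseteq> \<mm>"
proof
  fix x assume x: "x \<in> I"
  then have "x [^] (1::nat) \<in> I" using subm_mem[OF idl_I] by simp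
  then show "x \<in> \<mm>" using x subm_mem[OF idl_I] radical_I unfolding radical_ideal_def by blast
qed

lemma prime_above_I:
  assumes Q: "primeideal Q R" and "I \<subseteq> Q"
  shows "Q = \<mm>"
proof -
  have "\<mm> \<subseteq> Q"
    using primeideal_pow[OF Q] assms(2) radical_I unfolding radical_ideal_def by blast
  then show ?thesis
    using maximalideal.I_maximal[OF max_mm, of Q] primeideal_ne[OF Q] Q ideal_iff_subm primeideal_idl subm_carr by metis
qed

lemma prime_above_ipow: "primeideal Q R \<Longrightarrow> ipow I n \<subseteq> Q \<Longrightarrow> Q = \<mm>"
  using prime_above_I prime_ipow_subset[OF idl_I] by blast

lemma proper_subset_mm:
  assumes K: "idl K" "K \<noteq> carrier R"
  shows "K \<subseteq> \<mm>"
  using assms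
proof (induction K rule: idl_noetherian_induct)
  case (step K)
  show ?case
  proof (cases "\<exists>L. idl L \<and> K \<subset> L \<and> L \<noteq> carrier R")
    case True
    then show ?thesis using step by blast
  next
    case False
    have "maximalideal K R"
      by (rule maximalidealI) (use False step ideal_iff_subm in auto)
    then show ?thesis using max_unique by auto
  qed
qed

lemma cofin_mm: "cofin \<mm>" and cl_mm: "cl \<mm> \<le> 1"
proof -
  have "clen \<mm> \<le> enat 1"
    unfolding clen_def len_def
  proof (rule chain_height_leI)
    fix n C assume C: "strict_chain {N. idl N \<and> \<mm> \<subseteq> N \<and> N \<subseteq> carrier R} n C"
    show "enat n \<le> enat 1"
    proof (rule ccontr)
      assume "\<not> ?thesis"
      then have n: "2 \<le> n" by simp
      have in2: "N = \<mm> \<or> N = carrier R" if "idl N" "\<mm> \<subseteq> N" "N \<subseteq> carrier R" for N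
        using maximalideal.I_maximal[OF max_mm, of N] that ideal_iff_subm by auto
      have "C 0 \<subset> C 1" "C 1 \<subset> C 2" "C 1 \<in> {N. idl N \<and> \<mm> \<subseteq> N \<and> N \<subseteq> carrier R}"
        "C 0 \<in> {N. idl N \<and> \<mm> \<subseteq> N \<and> N \<subseteq> carrier R}" "C 2 \<in> {N. idl N \<and> \<mm> \<subseteq> N \<and> N \<subseteq> carrier R}"
        using C n unfolding strict_chain_def by (auto simp: numeral_2_eq_2)
      then show False using in2[of "C 0"] in2[of "C 1"] in2[of "C 2"] by auto
    qed
  qed
  then show "cofin \<mm>" "cl \<mm> \<le> 1"
    unfolding cofin_def cl_def using idl_mm by (cases "clen \<mm>"; auto)+
qed

text \<open>Reduction to primes by \<open>idl_prime_induct\<close>: a prime satisfying the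
  hypothesis is \<open>\<mm>\<close> itself, and the colon sequence adds finite lengths.\<close>

lemma cofinI:
  assumes "idl K" "\<And>Q. primeideal Q R \<Longrightarrow> K \<subseteq> Q \<Longrightarrow> Q = \<mm>"
  shows "cofin K"
  using assms
proof (induction K rule: idl_prime_induct)
  case (prime K)
  then show ?case using cofin_mm by blast
next
  case (split K a b)
  have L1: "idl (prin a <+> K)" "K \<subseteq> prin a <+> K" "a \<in> prin a <+> K"
    using split idl_mult_image[OF idl_carrier] set_add_upper1[OF split(1) subm_carr[OF idl_mult_image[OF idl_carrier, of a]]]
      set_add_upper2[OF idl_mult_image[OF idl_carrier] subm_carr[OF split(1)], of a] mem_prin[of a] by auto
  have L2: "idl {x \<in> carrier R. a \<otimes> x \<in> K}" "K \<subseteq> {x \<in> carrier R. a \<otimes> x \<in> K}" "b \<in> {x \<in> carrier R. a \<otimes> x \<in> K}"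
    using split idl_colon[OF idl_carrier split(1)] idl_mult[OF split(1)] subm_mem[OF split(1)] by auto
  have s: "K \<subset> prin a <+> K" "K \<subset> {x \<in> carrier R. a \<otimes> x \<in> K}" using L1 L2 split(4,5) by blast+
  have "cofin (prin a <+> K)" by (rule split(7)[OF L1(1) s(1)]) (use split(8) L1(2) in blast)
  moreover have "cofin {x \<in> carrier R. a \<otimes> x \<in> K}"
    by (rule split(7)[OF L2(1) s(2)]) (use split(8) L2(2) in blast)
  ultimately show ?case using clen_colon[OF split(1,2)] split(1) by (cases "clen K") (auto simp: cofin_def)
qed simp

lemma cofin_above_ipow: "idl K \<Longrightarrow> ipow I n \<subseteq> K \<Longrightarrow> cofin K"
  by (rule cofinI) (use prime_above_ipow order_trans in blast)+

lemma cofin_ipow [intro]: "cofin (ipow I n)"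
  by (rule cofin_above_ipow) (auto intro: idl_I)

lemma idl_add_ipow [intro]: "idl K \<Longrightarrow> idl (K <+> ipow I n)"
  using idl_I by auto

lemma ipow_subset_add: "idl K \<Longrightarrow> ipow I n \<subseteq> K <+> ipow I n"
  by (rule set_add_upper2[OF _ subm_carr[OF idl_ipow[OF idl_I]]])

lemma cofin_add_ipow [intro]: "idl K \<Longrightarrow> cofin (K <+> ipow I n)"
  by (rule cofin_above_ipow[OF idl_add_ipow ipow_subset_add])

text \<open>The colon sequence for \<open>a\<close>, weakened to ideals \<open>L1\<close> and
  \<open>L2\<close> inside \<open>aR + K\<close> and \<open>K : a\<close>. Once a power of
  \<open>I\<close> has been added to \<open>K\<close>, such smaller ideals are easier to name than
  the colon ideal itself.\<close>

lemma cl_split: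
  assumes K: "cofin K" and a: "a \<in> carrier R" and L1: "idl L1" "L1 \<subseteq> prin a <+> K" "cofin L1"
    and L2: "cofin L2" "\<And>x. x \<in> L2 \<Longrightarrow> a \<otimes> x \<in> K"
  shows "cl K \<le> cl L1 + cl L2"
proof -
  note c = cofin_colon[OF K a]
  have "cl (prin a <+> K) \<le> cl L1" using c L1 by (intro cl_antimono) (auto simp: cofin_def)
  moreover have "cl {x \<in> carrier R. a \<otimes> x \<in> K} \<le> cl L2"
    using c L2 subm_mem[OF cofin_idl[OF L2(1)]] by (intro cl_antimono) (auto simp: cofin_def)
  ultimately show ?thesis using c(3) by simp
qed

text \<open>Since \<open>x^n\<close> lies in \<open>I^n\<close>, the filtration by powers of
  \<open>x\<close> has \<open>n\<close> layers, each a quotient of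
  \<open>R/(xR + K + I^n)\<close>.\<close>

lemma cl_filtration_le:
  assumes K: "idl K" and x: "x \<in> I" and n: "1 \<le> n"
  shows "cl (K <+> ipow I n) \<le> real n * cl ((prin x <+> K) <+> ipow I n)"
proof -
  let ?B = "K <+> ipow I n" and ?L = "(prin x <+> K) <+> ipow I n"
  have xc: "x \<in> carrier R" using x subm_mem[OF idl_I] by auto
  have B: "cofin ?B" using K by auto
  have iB: "idl ?B" using cofin_idl[OF B] .
  have ipx: "idl (prin (x [^] i))" for i :: nat using xc by auto
  have ipx1: "idl (prin x)" using xc by auto
  have cA: "cofin (prin (x [^] i) <+> ?B)" for i :: nat using cofin_colon(1)[OF B] xc by auto
  have L: "cofin ?L" using K ipx1 by (intro cofin_add_ipow) auto
  have st: "cl (prin (x [^] Suc i) <+> ?B) \<le> cl (prin (x [^] i) <+> ?B) + cl ?L" for i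
  proof -
    let ?A = "prin (x [^] Suc i) <+> ?B"
    have xi: "x [^] i \<in> carrier R" using xc by simp
    have W: "idl {a \<in> carrier R. x [^] i \<otimes> a \<in> ?A}" using idl_colon[OF idl_carrier cofin_idl[OF cA] xi] .
    have BA: "?B \<subseteq> ?A" by (rule set_add_upper2[OF ipx subm_carr[OF iB]])
    have "?L \<subseteq> {a \<in> carrier R. x [^] i \<otimes> a \<in> ?A}"
    proof (intro set_add_le[OF W])
      show "prin x \<subseteq> {a \<in> carrier R. x [^] i \<otimes> a \<in> ?A}"
      proof (rule prin_le[OF W])
        have "x [^] Suc i \<in> prin (x [^] Suc i)" by (rule mem_prin) (use xc in simp)
        then have "x [^] Suc i \<in> ?A" by (rule subsetD[OF set_add_upper1[OF iB subm_carr[OF ipx]]])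
        then show "x \<in> {a \<in> carrier R. x [^] i \<otimes> a \<in> ?A}" using xc by simp
      qed
      have "?B \<subseteq> {a \<in> carrier R. x [^] i \<otimes> a \<in> ?A}"
        using BA idl_mult[OF iB xi] subm_mem[OF iB] by auto
      then show "K \<subseteq> {a \<in> carrier R. x [^] i \<otimes> a \<in> ?A}" "ipow I n \<subseteq> {a \<in> carrier R. x [^] i \<otimes> a \<in> ?A}"
        using ipow_subset_add[OF K] set_add_upper1[OF idl_ipow[OF idl_I] subm_carr[OF K]] by blast+
    qed
    then have "cl {a \<in> carrier R. x [^] i \<otimes> a \<in> ?A} \<le> cl ?L" by (rule cl_antimono[OF L W])
    then show ?thesis using prin_pow_filtration[OF B xc, of i] by simp
  qed
  have "cl (prin (x [^] i) <+> ?B) \<le> real i * cl ?L" for i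
  proof (induction i)
    case 0
    have "prin (x [^] (0::nat)) = carrier R" by (auto simp: image_iff)
    then have "prin (x [^] (0::nat)) <+> ?B = carrier R"
      using set_add_absorb2[OF idl_carrier iB subm_carr[OF iB]] by simp
    then show ?case by simp
  next
    case (Suc i)
    then show ?case using st[of i] by (simp add: algebra_simps)
  qed
  moreover have "x [^] n \<in> ipow I (1 * n)" by (rule pow_mem_ipow[OF idl_I]) (use x ipow_1[OF idl_I] in simp)
  then have "x [^] n \<in> ?B" using ipow_subset_add[OF K] by auto
  then have "prin (x [^] n) \<subseteq> ?B" by (rule prin_le[OF iB])
  then have "prin (x [^] n) <+> ?B = ?B" by (rule set_add_absorb1[OF ipx iB])
  ultimately show ?thesis by metis
qed

text \<open>The degree of growth is at most the dimension. After reduction to a prime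
  \<open>P\<close>, either \<open>P = \<mm>\<close> and the colengths are bounded, or some
  \<open>x\<close> in \<open>I\<close> is outside \<open>P\<close>; then \<open>xR + P\<close> has
  smaller dimension, and \<open>cl_filtration_le\<close> costs one factor \<open>n\<close>.\<close>

lemma cl_upper:
  assumes "idl K" "chain_free K k"
  shows "\<exists>c\<ge>0. \<forall>n\<ge>1. cl (K <+> ipow I n) \<le> c * real n ^ k"
  using assms
proof (induction k arbitrary: K)
  \<comment> \<open>The reduction to primes not containing \<open>I\<close>, shared by both cases of
    the induction on \<open>k\<close>.\<close>
  have *: "\<exists>c\<ge>0. \<forall>n\<ge>1. cl (K <+> ipow I n) \<le> c * real n ^ k"
    if K: "idl K" "chain_free K k"
      and pr: "\<And>P x. primeideal P R \<Longrightarrow> chain_free P k \<Longrightarrow> x \<in> I \<Longrightarrow> x \<notin> P \<Longrightarrow>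
        \<exists>c\<ge>0. \<forall>n\<ge>1. cl (P <+> ipow I n) \<le> c * real n ^ k" for K k
    using K
  proof (induction K rule: idl_prime_induct)
    case top
    have "carrier R <+> ipow I n = carrier R" for n
      using set_add_absorb2[OF idl_carrier idl_ipow[OF idl_I]] subm_carr[OF idl_ipow[OF idl_I]] by simp
    then show ?case by (intro exI[of _ 0]) auto
  next
    case (prime P)
    show ?case
    proof (cases "I \<subseteq> P")
      case True
      then have P: "P = \<mm>" using prime prime_above_I by auto
      have "cl (P <+> ipow I n) \<le> 1 * real n ^ k" if "n \<ge> 1" for n
      proof -
        have "P \<subseteq> P <+> ipow I n" unfolding P by (rule set_add_upper1[OF idl_ipow[OF idl_I] subm_carr[OF idl_mm]])
        then have "cl (P <+> ipow I n) \<le> cl P" unfolding P by (rule cl_antimono[OF cofin_mm idl_add_ipow[OF idl_mm]])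
        also have "\<dots> \<le> 1" using cl_mm P by simp
        also have "1 \<le> 1 * real n ^ k" using that by (simp add: one_le_power)
        finally show ?thesis .
      qed
      then show ?thesis by (intro exI[of _ 1]) auto
    next
      case False
      then show ?thesis using pr prime by blast
    qed
  next
    case (split K a b)
    have L1: "idl (prin a <+> K)" "K \<subseteq> prin a <+> K" "a \<in> prin a <+> K"
      using split idl_mult_image[OF idl_carrier] set_add_upper1[OF split(1) subm_carr[OF idl_mult_image[OF idl_carrier, of a]]]
        set_add_upper2[OF idl_mult_image[OF idl_carrier] subm_carr[OF split(1)], of a] mem_prin[of a] by auto
    have L2: "idl {x \<in> carrier R. a \<otimes> x \<in> K}" "K \<subseteq> {x \<in> carrier R. a \<otimes> x \<in> K}" "b \<in> {x \<in> carrier R. a \<otimes> x \<in> K}"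
      using split idl_colon[OF idl_carrier split(1)] idl_mult[OF split(1)] subm_mem[OF split(1)] by auto
    have s: "K \<subset> prin a <+> K" "K \<subset> {x \<in> carrier R. a \<otimes> x \<in> K}" using L1 L2 split(4,5) by blast+
    let ?L1 = "prin a <+> K" and ?L2 = "{x \<in> carrier R. a \<otimes> x \<in> K}"
    obtain c1 where c1: "c1 \<ge> 0" "\<And>n. n\<ge>1 \<Longrightarrow> cl (?L1 <+> ipow I n) \<le> c1 * real n ^ k"
      using split(7)[OF L1(1) s(1) chain_free_mono[OF split(8) L1(2)]] by blast
    obtain c2 where c2: "c2 \<ge> 0" "\<And>n. n\<ge>1 \<Longrightarrow> cl (?L2 <+> ipow I n) \<le> c2 * real n ^ k"
      using split(7)[OF L2(1) s(2) chain_free_mono[OF split(8) L2(2)]] by blast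
    have "cl (K <+> ipow I n) \<le> (c1 + c2) * real n ^ k" if n: "n \<ge> 1" for n
    proof -
      let ?B = "K <+> ipow I n"
      have B: "cofin ?B" using split by auto
      have iB: "idl ?B" using cofin_idl[OF B] .
      have KB: "K \<subseteq> ?B" by (rule set_add_upper1[OF idl_ipow[OF idl_I] subm_carr[OF split(1)]])
      have ia: "idl (prin a)" using split(2) by auto
      have iaB: "idl (prin a <+> ?B)" by (rule idl_set_add[OF ia iB])
      have BaB: "?B \<subseteq> prin a <+> ?B" by (rule set_add_upper2[OF ia subm_carr[OF iB]])
      have "cl ?B \<le> cl (?L1 <+> ipow I n) + cl (?L2 <+> ipow I n)"
      proof (rule cl_split[OF B split(2)])
        show "?L1 <+> ipow I n \<subseteq> prin a <+> ?B"
          by (intro set_add_le[OF iaB] set_add_upper1[OF iB subm_carr[OF ia]] order_trans[OF KB BaB]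
            order_trans[OF ipow_subset_add[OF split(1)] BaB])
        have "?L2 <+> ipow I n \<subseteq> {x \<in> carrier R. a \<otimes> x \<in> ?B}"
        proof (rule set_add_le[OF idl_colon[OF idl_carrier iB split(2)]])
          show "?L2 \<subseteq> {x \<in> carrier R. a \<otimes> x \<in> ?B}" using KB by auto
          show "ipow I n \<subseteq> {x \<in> carrier R. a \<otimes> x \<in> ?B}"
            using ipow_subset_add[OF split(1)] idl_mult[OF iB split(2)] subm_mem[OF iB] by blast
        qed
        then show "x \<in> ?L2 <+> ipow I n \<Longrightarrow> a \<otimes> x \<in> ?B" for x by auto
      qed (use L1 L2 in auto)
      then show ?thesis using c1(2)[OF n] c2(2)[OF n] by (simp add: algebra_simps)
    qed
    then show ?case using c1 c2 by (intro exI[of _ "c1 + c2"]) auto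
  qed
  {
    case 0
    show ?case
    proof (rule *[OF 0])
      fix P x assume P: "primeideal P R" "chain_free P 0" "x \<in> I" "x \<notin> P"
      \<comment> \<open>In dimension zero such a prime cannot occur: \<open>P\<close> and
        \<open>\<mm>\<close> would form a chain.\<close>
      have "P \<subset> \<mm>" using P proper_subset_mm[OF primeideal_idl primeideal_ne] I_subset_mm by blast
      then have "strict_chain {Q. primeideal Q R \<and> P \<subseteq> Q} (Suc 0) (\<lambda>i. if i = 0 then P else \<mm>)"
        using P prime_mm by (auto simp: strict_chain_def)
      then show "\<exists>c\<ge>0. \<forall>n\<ge>1. cl (P <+> ipow I n) \<le> c * real n ^ 0"
        using P(2) unfolding chain_free_def by blast
    qed
  next
    case (Suc k)
    show ?case
    proof (rule *[OF Suc.prems])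
      fix P x assume P: "primeideal P R" "chain_free P (Suc k)" "x \<in> I" "x \<notin> P"
      have iP: "idl P" using primeideal_idl[OF P(1)] .
      have xc: "x \<in> carrier R" using P(3) subm_mem[OF idl_I] by auto
      have ix: "idl (prin x)" using xc by auto
      have L: "idl (prin x <+> P)" by (rule idl_set_add[OF ix iP])
      have PL: "P \<subseteq> prin x <+> P" by (rule set_add_upper2[OF ix subm_carr[OF iP]])
      have xL: "x \<in> prin x <+> P" using set_add_upper1[OF iP subm_carr[OF ix]] mem_prin[OF xc] by auto
      have "chain_free (prin x <+> P) k"
        by (rule chain_free_above_prime[OF P(2)]) (use P PL xL in blast)
      then obtain c where c: "c \<ge> 0" "\<And>n. n \<ge> 1 \<Longrightarrow> cl ((prin x <+> P) <+> ipow I n) \<le> c * real n ^ k"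
        using Suc.IH[OF L] by auto
      have "cl (P <+> ipow I n) \<le> c * real n ^ Suc k" if "n \<ge> 1" for n
      proof -
        have "cl (P <+> ipow I n) \<le> real n * cl ((prin x <+> P) <+> ipow I n)"
          by (rule cl_filtration_le[OF iP P(3) that])
        also have "\<dots> \<le> real n * (c * real n ^ k)" using c(2)[OF that] by (intro mult_left_mono) auto
        finally show ?thesis by (simp add: algebra_simps)
      qed
      then show "\<exists>c\<ge>0. \<forall>n\<ge>1. cl (P <+> ipow I n) \<le> c * real n ^ Suc k" using c(1) by blast
    qed
  }
qed

end

section \<open>Graded families of ideals\<close>

context noetherian_cring begin

text \<open>A pair \<open>U \<subseteq> V\<close> of stable families stands for the graded module with components \<open>V n / U n\<close>,
  on which the entries of \<open>xs\<close> act as variables of degree one; \<open>push x V U\<close> presents its quotient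
  by \<open>x\<close>.\<close>

definition stable :: "'a list \<Rightarrow> (nat \<Rightarrow> 'a set) \<Rightarrow> bool" where
  "stable xs V \<longleftrightarrow> (\<forall>n. idl (V n)) \<and> (\<forall>n. \<forall>x\<in>set xs. \<forall>v\<in>V n. x \<otimes> v \<in> V (Suc n))"

text \<open>Generation in bounded degree, modulo \<open>U\<close>. Components up to degree
  \<open>n0\<close> carry no condition, since each is an ideal of a noetherian ring.\<close>

definition fgen :: "'a list \<Rightarrow> (nat \<Rightarrow> 'a set) \<Rightarrow> (nat \<Rightarrow> 'a set) \<Rightarrow> bool" where
  "fgen xs U V \<longleftrightarrow> (\<exists>n0. \<forall>n\<ge>n0. V (Suc n) \<subseteq> lsum R xs (V n) <+> U (Suc n))"

definition push :: "'a \<Rightarrow> (nat \<Rightarrow> 'a set) \<Rightarrow> (nat \<Rightarrow> 'a set) \<Rightarrow> nat \<Rightarrow> 'a set" where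
  "push x V U n = (case n of 0 \<Rightarrow> U 0 | Suc k \<Rightarrow> ((\<lambda>v. x \<otimes> v) ` V k) <+> U (Suc k))"

lemma push_0 [simp]: "push x V U 0 = U 0"
  and push_Suc [simp]: "push x V U (Suc k) = ((\<lambda>v. x \<otimes> v) ` V k) <+> U (Suc k)"
  by (simp_all add: push_def)

lemma stable_idl: "stable xs V \<Longrightarrow> idl (V n)"
  and stable_mult: "stable xs V \<Longrightarrow> x \<in> set xs \<Longrightarrow> v \<in> V n \<Longrightarrow> x \<otimes> v \<in> V (Suc n)"
  and stable_tail: "stable (x # xs) V \<Longrightarrow> stable xs V"
  by (auto simp: stable_def)

lemma stable_pow:
  assumes "stable xs V" "x \<in> set xs" "x \<in> carrier R" "v \<in> V n"
  shows "x [^] (j::nat) \<otimes> v \<in> V (n + j)"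
proof (induction j)
  case 0
  then show ?case using assms subm_mem[OF stable_idl[OF assms(1)] assms(4)] by simp
next
  case (Suc j)
  have "x \<otimes> (x [^] j \<otimes> v) \<in> V (Suc (n + j))" by (rule stable_mult[OF assms(1,2) Suc])
  then show ?case using assms subm_mem[OF stable_idl[OF assms(1)] assms(4)] by (simp add: m_ac)
qed

lemma push_props:
  assumes x: "x \<in> carrier R" and xs: "set xs \<subseteq> carrier R" and U: "stable (x # xs) U" and V: "stable (x # xs) V"
    and UV: "\<And>n. U n \<subseteq> V n"
  shows "stable xs (push x V U)" "\<And>n. U n \<subseteq> push x V U n" "\<And>n. push x V U n \<subseteq> V n"
proof -
  have iU: "idl (U n)" and iV: "idl (V n)" for n using stable_idl U V by auto
  have ix: "idl ((\<lambda>v. x \<otimes> v) ` V n)" for n using iV x by auto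
  have i: "idl (push x V U n)" for n using iU ix by (cases n) auto
  show Ule: "U n \<subseteq> push x V U n" for n
    using set_add_upper2[OF ix subm_carr[OF iU]] by (cases n) auto
  show "push x V U n \<subseteq> V n" for n
  proof (cases n)
    case (Suc k)
    have "(\<lambda>v. x \<otimes> v) ` V k \<subseteq> V n" using stable_mult[OF V, of x _ k] Suc by auto
    then show ?thesis using set_add_le[OF iV[of n] _ UV[of n]] Suc by simp
  qed (use UV in auto)
  have "y \<otimes> v \<in> push x V U (Suc n)" if y: "y \<in> set xs" and v: "v \<in> push x V U n" for n y v
  proof -
    have yc: "y \<in> carrier R" using y xs by auto
    have "push x V U n \<subseteq> {v \<in> carrier R. y \<otimes> v \<in> push x V U (Suc n)}"
    proof (cases n)
      case 0
      have "U 0 \<subseteq> {v \<in> carrier R. y \<otimes> v \<in> push x V U (Suc 0)}"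
        using stable_mult[OF U, of y _ 0] y Ule[of "Suc 0"] subm_mem[OF iU] by auto
      then show ?thesis using 0 by simp
    next
      case (Suc k)
      have J: "idl {v \<in> carrier R. y \<otimes> v \<in> push x V U (Suc n)}" by (rule idl_colon[OF idl_carrier i yc])
      have "y \<otimes> (x \<otimes> w) \<in> push x V U (Suc n)" if w: "w \<in> V k" for w
      proof -
        have wc: "w \<in> carrier R" using w subm_mem[OF iV] by auto
        have "y \<otimes> w \<in> V n" using stable_mult[OF V, of y w k] y w Suc by simp
        then have "x \<otimes> (y \<otimes> w) \<in> push x V U (Suc n)"
          using set_add_upper1[OF iU subm_carr[OF ix]] by auto
        then show ?thesis using wc yc x by (simp add: m_lcomm)
      qed
      moreover have "U n \<subseteq> {v \<in> carrier R. y \<otimes> v \<in> push x V U (Suc n)}"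
        using stable_mult[OF U, of y _ n] y Ule[of "Suc n"] subm_mem[OF iU] by auto
      ultimately have "((\<lambda>v. x \<otimes> v) ` V k) <+> U n \<subseteq> {v \<in> carrier R. y \<otimes> v \<in> push x V U (Suc n)}"
        using subm_mem[OF iV] x by (intro set_add_le[OF J]) auto
      then show ?thesis using Suc by simp
    qed
    then show ?thesis using v by auto
  qed
  then show "stable xs (push x V U)" using i by (auto simp: stable_def)
qed

text \<open>The union of the chain is generated from some degree \<open>n0\<close> on. Up to
  \<open>n0\<close>, finitely many chains of ideals of \<open>R\<close> become stationary at a
  common index \<open>j0\<close>; beyond \<open>n0\<close>, generation carries the equality from
  degree to degree.\<close>

lemma graded_chain_stable:
  assumes xs: "set xs \<subseteq> carrier R" and U: "stable xs U"
    and gen: "\<And>W. stable xs W \<Longrightarrow> (\<And>n. U n \<subseteq> W n \<and> W n \<subseteq> V n) \<Longrightarrow> fgen xs U W"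
    and W: "\<And>j. stable xs (W j)" "\<And>j n. U n \<subseteq> W j n" "\<And>j n. W j n \<subseteq> V n" and mono: "\<And>j n. W j n \<subseteq> W (Suc j) n"
  obtains j0 where "\<And>j n. j0 \<le> j \<Longrightarrow> W j n = W j0 n"
proof -
  have iW: "idl (W j n)" for j n using stable_idl W(1) by auto
  have iU: "idl (U n)" for n using stable_idl U by auto
  have mono': "j \<le> k \<Longrightarrow> W j n \<subseteq> W k n" for j k n
    using lift_Suc_mono_le[of "\<lambda>j. W j n"] mono by auto
  have "\<exists>j0. \<forall>i\<ge>j0. W i n = W j0 n" for n
    using idl_chain_stable[of "\<lambda>j. W j n"] iW mono by metis
  then obtain f where f: "\<And>n i. f n \<le> i \<Longrightarrow> W i n = W (f n) n" by metis
  define M where "M n = (\<Union>j. W j n)" for n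
  have WM: "W j n \<subseteq> M n" for j n unfolding M_def by auto
  have M: "M n = W (f n) n" for n
  proof -
    have "W j n \<subseteq> W (f n) n" for j
      using mono'[of j "max j (f n)" n] f[of n "max j (f n)"] by simp
    then show ?thesis unfolding M_def by blast
  qed
  have sM: "stable xs M"
    unfolding stable_def
  proof (intro conjI allI ballI)
    show "idl (M n)" for n unfolding M by (rule iW)
    fix n x v assume "x \<in> set xs" "v \<in> M n"
    then show "x \<otimes> v \<in> M (Suc n)" using stable_mult[OF W(1), of x v "f n" n] WM[of "f n" "Suc n"] M by auto
  qed
  have "fgen xs U M" by (rule gen[OF sM]) (use M W in auto)
  then obtain n0 where n0: "\<And>n. n \<ge> n0 \<Longrightarrow> M (Suc n) \<subseteq> lsum R xs (M n) <+> U (Suc n)" unfolding fgen_def by blast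
  define j0 where "j0 = Max (f ` {..n0})"
  have fj: "f n \<le> j0" if "n \<le> n0" for n unfolding j0_def using that by simp
  have Mj: "M n = W j0 n" if "n \<le> n0" for n using M[of n] f[OF fj[OF that]] by simp
  have "M n \<subseteq> W j0 n" for n
  proof (induction n)
    case 0
    show ?case using Mj[of 0] by simp
  next
    case (Suc n)
    show ?case
    proof (cases "Suc n \<le> n0")
      case True
      then show ?thesis using Mj by simp
    next
      case False
      have "lsum R xs (M n) \<subseteq> W j0 (Suc n)"
        by (rule lsum_le[OF iW]) (use Suc stable_mult[OF W(1)] in blast)
      then have "lsum R xs (M n) <+> U (Suc n) \<subseteq> W j0 (Suc n)" using W(2) by (intro set_add_le[OF iW])
      then show ?thesis using n0[of n] False by auto
    qed
  qed
  then show ?thesis using that[of j0] WM mono' by blast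
qed

text \<open>Hilbert's basis theorem, adding the variable \<open>x\<close>: the colon modules \<open>W : x^j\<close> become stationary
  modulo \<open>x\<close>, and an element of \<open>W\<close> is rewritten by splitting off multiples of \<open>x\<close> repeatedly.\<close>

lemma fgen_submodule_step:
  assumes x: "x \<in> carrier R" and xs: "set xs \<subseteq> carrier R"
    and U: "stable (x # xs) U" and V: "stable (x # xs) V" and UV: "\<And>n. U n \<subseteq> V n"
    and IH: "\<And>W. stable xs W \<Longrightarrow> (\<And>n. push x V U n \<subseteq> W n \<and> W n \<subseteq> V n) \<Longrightarrow> fgen xs (push x V U) W"
    and W: "stable (x # xs) W" and UW: "\<And>n. U n \<subseteq> W n" and WV: "\<And>n. W n \<subseteq> V n"
  shows "fgen (x # xs) U W"
proof -
  let ?U = "push x V U"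
  note pp = push_props[OF x xs U V UV]
  have iU: "idl (U n)" and iV: "idl (V n)" and iW: "idl (W n)" and iU': "idl (?U n)" for n
    using stable_idl U V W pp(1) by auto
  have xxs: "set (x # xs) \<subseteq> carrier R" using x xs by auto
  \<comment> \<open>The analogue of the ideals of coefficients at \<open>x^j\<close> in the basis
    theorem; they increase with \<open>j\<close>.\<close>
  define A where "A j n = {v \<in> V n. x [^] j \<otimes> v \<in> W (n + j)}" for j n
  have iA: "idl (A j n)" for j n unfolding A_def using idl_colon[OF iV iW] x by auto
  have Ac: "v \<in> A j n \<Longrightarrow> v \<in> carrier R" for v j n using subm_mem[OF iA] .
  have AV: "A j n \<subseteq> V n" for j n by (auto simp: A_def)
  have sA: "stable xs (A j)" for j
    unfolding stable_def
  proof (intro conjI allI ballI iA)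
    fix n y v assume y: "y \<in> set xs" and v: "v \<in> A j n"
    have yc: "y \<in> carrier R" using y xs by auto
    have "y \<otimes> (x [^] j \<otimes> v) \<in> W (Suc (n + j))" using v y by (intro stable_mult[OF W]) (auto simp: A_def)
    then show "y \<otimes> v \<in> A j (Suc n)"
      using stable_mult[OF V, of y v n] y v yc x Ac[OF v] by (auto simp: A_def m_lcomm)
  qed
  have mA: "A j n \<subseteq> A (Suc j) n" for j n
  proof
    fix v assume v: "v \<in> A j n"
    have "x \<otimes> (x [^] j \<otimes> v) \<in> W (Suc (n + j))" using v by (intro stable_mult[OF W]) (auto simp: A_def)
    then show "v \<in> A (Suc j) n" using v x Ac[OF v] by (auto simp: A_def m_ac)
  qed
  have mA': "i \<le> j \<Longrightarrow> A i n \<subseteq> A j n" for i j n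
    using lift_Suc_mono_le[of "\<lambda>j. A j n"] mA by auto
  define B where "B j n = A j n <+> ?U n" for j n
  have iB: "idl (B j n)" for j n unfolding B_def using iA iU' by auto
  have AB: "A j n \<subseteq> B j n" and UB: "?U n \<subseteq> B j n" and BV: "B j n \<subseteq> V n" for j n
    unfolding B_def using set_add_upper1[OF iU' subm_carr[OF iA]] set_add_upper2[OF iA subm_carr[OF iU']]
      set_add_le[OF iV AV pp(3)] by auto
  have sB: "stable xs (B j)" for j
    unfolding stable_def
  proof (intro conjI allI ballI iB)
    fix n y v assume y: "y \<in> set xs" and v: "v \<in> B j n"
    have yc: "y \<in> carrier R" using y xs by auto
    have "B j n \<subseteq> {v \<in> carrier R. y \<otimes> v \<in> B j (Suc n)}"
      unfolding B_def[of j n]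
    proof (rule set_add_le[OF idl_colon[OF idl_carrier iB yc]])
      show "A j n \<subseteq> {v \<in> carrier R. y \<otimes> v \<in> B j (Suc n)}"
        using stable_mult[OF sA y] AB[of j "Suc n"] Ac by blast
      show "?U n \<subseteq> {v \<in> carrier R. y \<otimes> v \<in> B j (Suc n)}"
        using stable_mult[OF pp(1) y] UB[of "Suc n" j] subm_mem[OF iU'] by blast
    qed
    then show "y \<otimes> v \<in> B j (Suc n)" using v by auto
  qed
  have mB: "B j n \<subseteq> B (Suc j) n" for j n unfolding B_def by (rule set_add_mono[OF mA subset_refl])
  obtain j0 where j0: "\<And>j n. j0 \<le> j \<Longrightarrow> B j n = B j0 n"
    using graded_chain_stable[of xs ?U V B, OF xs pp(1) IH sB UB BV mB] by blast
  have "fgen xs ?U (B j)" for j by (rule IH[OF sB]) (use UB BV in auto)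
  then obtain f where f: "\<And>j n. n \<ge> f j \<Longrightarrow> B j (Suc n) \<subseteq> lsum R xs (B j n) <+> ?U (Suc n)"
    unfolding fgen_def by metis
  \<comment> \<open>Degrees of generation are needed for the finitely many \<open>j \<le> j0\<close>
    only, since \<open>B j\<close> no longer changes afterwards.\<close>
  define N where "N = Max (f ` {..j0})"
  have fN: "f j \<le> N" if "j \<le> j0" for j unfolding N_def using that by simp
  have "W (Suc n) \<subseteq> lsum R (x # xs) (W n) <+> U (Suc n)" if n: "n \<ge> N + j0" for n
  proof -
    let ?L = "lsum R (x # xs) (W n)"
    let ?T = "?L <+> U (Suc n)"
    have iL: "idl ?L" using idl_lsum[OF xxs iW] .
    have iT: "idl ?T" using iL iU by auto
    have LT: "?L \<subseteq> ?T" by (rule set_add_upper1[OF iU subm_carr[OF iL]])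
    have UT: "U (Suc n) \<subseteq> ?T" by (rule set_add_upper2[OF iL subm_carr[OF iU]])
    have LW: "?L \<subseteq> W (Suc n)" by (rule lsum_le[OF iW]) (rule stable_mult[OF W])
    have xL: "x \<otimes> w \<in> ?L" if "w \<in> W n" for w by (rule lsum_mem[OF xxs iW]) (use that in auto)
    have xj: "x [^] j \<in> carrier R" for j :: nat using x by simp
    \<comment> \<open>The case of interest is \<open>j = 0\<close>. The total degree
      \<open>j + m\<close> stays fixed while multiples of \<open>x\<close> are split off, which
      raises \<open>j\<close> and lowers \<open>m\<close>.\<close>
    have main: "x [^] j \<otimes> v \<in> ?T" if "j + m = Suc n" "v \<in> A j m" for j m v
      using that
    proof (induction m arbitrary: j v)
      case 0
      then have "j0 \<le> j" "j0 \<le> n" using n by auto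
      then have "v \<in> B j0 0" using 0 AB[of j 0] j0[of j 0] by auto
      then obtain u u0 where u: "v = u \<oplus> u0" "u \<in> A j0 0" "u0 \<in> U 0" by (auto simp: B_def mem_set_add)
      have c: "u \<in> carrier R" "u0 \<in> carrier R" using u Ac subm_mem[OF iU] by auto
      have "u \<in> A n 0" using u mA'[OF \<open>j0 \<le> n\<close>] by auto
      then have "x \<otimes> (x [^] n \<otimes> u) \<in> ?L" using xL by (auto simp: A_def)
      moreover have "x [^] j \<otimes> u0 \<in> U (Suc n)" using stable_pow[OF U _ x u(3), of j] 0 by auto
      moreover have "x [^] j \<otimes> v = x \<otimes> (x [^] n \<otimes> u) \<oplus> x [^] j \<otimes> u0"
        using u c x 0 by (simp add: r_distr m_ac)
      ultimately show ?case unfolding mem_set_add by blast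
    next
      case (Suc m)
      have vc: "v \<in> carrier R" using Ac[OF Suc.prems(2)] .
      \<comment> \<open>Modulo \<open>U\<close> and multiples of \<open>x\<close>, the element
        \<open>v\<close> is replaced by some \<open>l\<close> for which \<open>x^j l\<close> is
        generated by \<open>W n\<close>: for \<open>j > j0\<close> because
        \<open>A j0 \<subseteq> A (j - 1)\<close> leaves a factor \<open>x\<close> to spare, for
        \<open>j \<le> j0\<close> because \<open>m\<close> is then large enough for generation by
        \<open>xs\<close>.\<close>
      have "\<exists>l t. v = l \<oplus> t \<and> l \<in> carrier R \<and> x [^] j \<otimes> l \<in> ?L \<and> t \<in> ?U (Suc m)"
      proof (cases "j0 < j")
        case True
        then obtain i where i: "j = Suc i" "j0 \<le> i" by (cases j) auto
        have "v \<in> B j0 (Suc m)" using Suc.prems(2) AB[of j "Suc m"] j0[of j "Suc m"] True by auto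
        then obtain l t where lt: "v = l \<oplus> t" "l \<in> A j0 (Suc m)" "t \<in> ?U (Suc m)"
          unfolding B_def mem_set_add by blast
        have lc: "l \<in> carrier R" using Ac lt by auto
        have "l \<in> A i (Suc m)" using lt mA'[OF i(2)] by auto
        then have "x [^] i \<otimes> l \<in> W (Suc m + i)" by (auto simp: A_def)
        also have "Suc m + i = n" using Suc.prems(1) i by simp
        finally have "x \<otimes> (x [^] i \<otimes> l) \<in> ?L" using xL by auto
        moreover have "x [^] j \<otimes> l = x \<otimes> (x [^] i \<otimes> l)" using i x lc by (simp add: m_ac)
        ultimately have "x [^] j \<otimes> l \<in> ?L" by (simp only:)
        then show ?thesis using lt lc by blast
      next
        case False
        then have "f j \<le> m" using fN[of j] n Suc.prems(1) by auto
        then have "v \<in> lsum R xs (B j m) <+> ?U (Suc m)" using f Suc.prems(2) AB[of j "Suc m"] by blast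
        moreover have "lsum R xs (B j m) \<subseteq> lsum R xs (A j m) <+> ?U (Suc m)"
        proof (rule lsum_le)
          have iLA: "idl (lsum R xs (A j m))" using idl_lsum[OF xs iA] .
          show iS: "idl (lsum R xs (A j m) <+> ?U (Suc m))" by (rule idl_set_add[OF iLA iU'])
          fix y b assume y: "y \<in> set xs" and b: "b \<in> B j m"
          obtain a u where au: "b = a \<oplus> u" "a \<in> A j m" "u \<in> ?U m" using b unfolding B_def mem_set_add by blast
          have "y \<otimes> a \<in> lsum R xs (A j m)" by (rule lsum_mem[OF xs iA _ y au(2)]) simp
          moreover have "y \<otimes> u \<in> ?U (Suc m)" by (rule stable_mult[OF pp(1) y au(3)])
          moreover have "y \<otimes> b = y \<otimes> a \<oplus> y \<otimes> u" using au y xs Ac subm_mem[OF iU'] by (auto simp: r_distr)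
          ultimately show "y \<otimes> b \<in> lsum R xs (A j m) <+> ?U (Suc m)" unfolding mem_set_add by blast
        qed
        ultimately obtain l t1 t2 where lt: "v = (l \<oplus> t1) \<oplus> t2" "l \<in> lsum R xs (A j m)" "t1 \<in> ?U (Suc m)" "t2 \<in> ?U (Suc m)"
          unfolding mem_set_add subset_iff by blast
        have c: "l \<in> carrier R" "t1 \<in> carrier R" "t2 \<in> carrier R"
          using lt subm_mem[OF idl_lsum[OF xs iA]] subm_mem[OF iU'] by blast+
        have "lsum R xs (A j m) \<subseteq> {l \<in> carrier R. x [^] j \<otimes> l \<in> ?L}"
        proof (rule lsum_le[OF idl_colon[OF idl_carrier iL xj]])
          fix y a assume y: "y \<in> set xs" and a: "a \<in> A j m"
          have yc: "y \<in> carrier R" using y xs by auto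
          have "x [^] j \<otimes> a \<in> W (m + j)" using a by (auto simp: A_def)
          also have "m + j = n" using Suc.prems(1) by simp
          finally have "y \<otimes> (x [^] j \<otimes> a) \<in> ?L" using y by (intro lsum_mem[OF xxs iW]) auto
          then show "y \<otimes> a \<in> {l \<in> carrier R. x [^] j \<otimes> l \<in> ?L}"
            using yc Ac[OF a] xj[of j] by (simp add: m_lcomm)
        qed
        then show ?thesis using lt c subm_add[OF iU' lt(3,4)] a_assoc[OF c] by blast
      qed
      then obtain l t where lt: "v = l \<oplus> t" "l \<in> carrier R" "x [^] j \<otimes> l \<in> ?L" "t \<in> ?U (Suc m)" by blast
      then obtain v' u0 where vu: "t = x \<otimes> v' \<oplus> u0" "v' \<in> V m" "u0 \<in> U (Suc m)"
        by (auto simp: mem_set_add)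
      have c: "v' \<in> carrier R" "u0 \<in> carrier R" using vu subm_mem[OF iV] subm_mem[OF iU] by auto
      have xu: "x [^] j \<otimes> u0 \<in> U (Suc n)" using stable_pow[OF U _ x vu(3), of j] Suc.prems(1) by (auto simp: add.commute)
      have e: "x [^] j \<otimes> v = (x [^] Suc j \<otimes> v') \<oplus> (x [^] j \<otimes> l \<oplus> x [^] j \<otimes> u0)"
        using lt vu c x by (simp add: r_distr m_ac a_ac)
      \<comment> \<open>All other terms of \<open>x^j v\<close> lie in \<open>W\<close>, so the
        remainder \<open>x^(j+1) v'\<close> does too, which puts \<open>v'\<close> into
        \<open>A (Suc j) m\<close>.\<close>
      have w1: "x [^] j \<otimes> v \<in> W (Suc n)" using Suc.prems by (auto simp: A_def add.commute)
      have w2: "x [^] j \<otimes> l \<oplus> x [^] j \<otimes> u0 \<in> W (Suc n)" using lt(3) LW xu UW subm_add[OF iW] by blast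
      have "x [^] Suc j \<otimes> v' \<in> carrier R" using x c by simp
      then have "x [^] Suc j \<otimes> v' \<in> W (Suc n)" by (rule subm_add_cancel[OF iW _ w2 w1[unfolded e]])
      moreover have "m + Suc j = Suc n" using Suc.prems(1) by simp
      ultimately have "v' \<in> A (Suc j) m" using vu unfolding A_def by simp
      then have "x [^] Suc j \<otimes> v' \<in> ?T" by (intro Suc.IH) (use Suc.prems in auto)
      moreover have "x [^] j \<otimes> l \<oplus> x [^] j \<otimes> u0 \<in> ?T" using lt(3) xu unfolding mem_set_add by blast
      ultimately show ?case unfolding e by (rule subm_add[OF iT])
    qed
    show ?thesis
    proof
      fix w assume w: "w \<in> W (Suc n)"
      have wc: "w \<in> carrier R" using w subm_mem[OF iW] by auto
      have "w \<in> A 0 (Suc n)" using w WV wc by (auto simp: A_def)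
      then show "w \<in> ?T" using main[of 0 "Suc n" w] wc by simp
    qed
  qed
  then show ?thesis unfolding fgen_def by blast
qed

lemma fgen_push:
  assumes x: "x \<in> carrier R" and xs: "set xs \<subseteq> carrier R" and U: "stable (x # xs) U" and V: "stable (x # xs) V"
    and UV: "\<And>n. U n \<subseteq> V n" and g: "fgen (x # xs) U V"
  shows "fgen xs (push x V U) V"
proof -
  note pp = push_props[OF x xs U V UV]
  have iU: "idl (U n)" and iV: "idl (V n)" and iU': "idl (push x V U n)" for n
    using stable_idl U V pp(1) by auto
  have iL: "idl (lsum R xs (V n))" for n using idl_lsum[OF xs iV] .
  obtain n0 where n0: "\<And>n. n \<ge> n0 \<Longrightarrow> V (Suc n) \<subseteq> lsum R (x # xs) (V n) <+> U (Suc n)"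
    using g unfolding fgen_def by blast
  have "lsum R (x # xs) (V n) <+> U (Suc n) \<subseteq> lsum R xs (V n) <+> push x V U (Suc n)" for n
  proof -
    let ?T = "lsum R xs (V n) <+> push x V U (Suc n)"
    have T: "idl ?T" by (rule idl_set_add[OF iL iU'])
    have L: "lsum R xs (V n) \<subseteq> ?T" by (rule set_add_upper1[OF iU' subm_carr[OF iL]])
    have P: "push x V U (Suc n) \<subseteq> ?T" by (rule set_add_upper2[OF iL subm_carr[OF iU']])
    have "(\<lambda>v. x \<otimes> v) ` V n \<subseteq> push x V U (Suc n)"
      using set_add_upper1[OF iU subm_carr[OF idl_mult_image[OF iV x]]] by simp
    then have "(\<lambda>v. x \<otimes> v) ` V n \<subseteq> ?T" using P by blast
    then have "lsum R (x # xs) (V n) \<subseteq> ?T" using L unfolding lsum.simps by (rule set_add_le[OF T])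
    moreover have "U (Suc n) \<subseteq> ?T" using pp(2) P by blast
    ultimately show ?thesis by (rule set_add_le[OF T])
  qed
  then show ?thesis unfolding fgen_def using n0 by (meson order_trans)
qed

text \<open>Induction on the variables: modulo \<open>x\<close>, the module \<open>V\<close> is
  generated over the remaining ones. Without variables, \<open>fgen\<close> forces \<open>V\<close>
  into \<open>U\<close> in high degrees, and \<open>W\<close> lies between them.\<close>

theorem fgen_submodule:
  assumes "set xs \<subseteq> carrier R" "stable xs U" "stable xs V" "\<And>n. U n \<subseteq> V n" "fgen xs U V"
    and "stable xs W" "\<And>n. U n \<subseteq> W n" "\<And>n. W n \<subseteq> V n"
  shows "fgen xs U W"
  using assms
proof (induction xs arbitrary: U V W)
  case Nil
  then obtain n0 where n0: "\<And>n. n \<ge> n0 \<Longrightarrow> V (Suc n) \<subseteq> lsum R [] (V n) <+> U (Suc n)" unfolding fgen_def by blast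
  then show ?case unfolding fgen_def using Nil.prems(8) by (metis lsum.simps(1) order_trans)
next
  case (Cons x xs)
  have x: "x \<in> carrier R" and xs: "set xs \<subseteq> carrier R" using Cons.prems(1) by auto
  note pp = push_props[OF x xs Cons.prems(2,3,4)]
  have g: "fgen xs (push x V U) V" using fgen_push[OF x xs Cons.prems(2,3,4,5)] .
  show ?case
    by (rule fgen_submodule_step[OF x xs Cons.prems(2,3,4) _ Cons.prems(6,7,8)])
      (rule Cons.IH[OF xs pp(1) stable_tail[OF Cons.prems(3)] pp(3) g], auto)
qed

end

section \<open>Functions with vanishing higher differences\<close>

text \<open>Functions that agree with a polynomial of degree below \<open>k\<close> for large
  arguments, in the form that an induction over generators produces.\<close>

fun diffzero :: "nat \<Rightarrow> (nat \<Rightarrow> real) \<Rightarrow> bool" where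
  "diffzero 0 H \<longleftrightarrow> (\<exists>N. \<forall>n\<ge>N. H n = 0)"
| "diffzero (Suc k) H \<longleftrightarrow> diffzero k (\<lambda>n. H (Suc n) - H n)"

lemma diffzero_diff: "diffzero k f \<Longrightarrow> diffzero k g \<Longrightarrow> diffzero k (\<lambda>n. f n - g n)"
proof (induction k arbitrary: f g)
  case 0
  then obtain M N where "\<forall>n\<ge>M. f n = 0" "\<forall>n\<ge>N. g n = 0" by auto
  then show ?case by (auto intro!: exI[of _ "max M N"])
next
  case (Suc k)
  then show ?case using Suc.IH[of "\<lambda>n. f (Suc n) - f n" "\<lambda>n. g (Suc n) - g n"] by (simp add: algebra_simps)
qed

lemma diffzero_shift: "diffzero k f \<Longrightarrow> diffzero k (\<lambda>n. f (Suc n))"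
proof (induction k arbitrary: f)
  case 0
  then obtain M where "\<forall>n\<ge>M. f n = 0" by auto
  then show ?case by (auto intro!: exI[of _ M])
next
  case (Suc k)
  then show ?case using Suc.IH[of "\<lambda>n. f (Suc n) - f n"] by simp
qed

text \<open>Newton's forward difference expansion at \<open>n0\<close>: the constant coefficient is
  the value there, the others are the coefficients of the difference function.\<close>

lemma diffzero_newton:
  "diffzero k H \<Longrightarrow> \<exists>n0 c. \<forall>m. H (n0 + m) = (\<Sum>j<k. c j * real (m choose j))"
proof (induction k arbitrary: H)
  case 0
  then show ?case by (auto intro: le_add1)
next
  case (Suc k)
  then obtain n0 c where c: "\<And>m. H (Suc (n0 + m)) - H (n0 + m) = (\<Sum>j<k. c j * real (m choose j))"
    by fastforce
  define c' where "c' j = (case j of 0 \<Rightarrow> H n0 | Suc i \<Rightarrow> c i)" for j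
  have "H (n0 + m) = H n0 + (\<Sum>j<k. c j * real (m choose Suc j))" for m
  proof (induction m)
    case (Suc m)
    have "H (n0 + Suc m) = H (n0 + m) + (\<Sum>j<k. c j * real (m choose j))" using c[of m] by simp
    also have "\<dots> = H n0 + (\<Sum>j<k. c j * real (m choose Suc j) + c j * real (m choose j))"
      unfolding Suc sum.distrib by simp
    also have "\<dots> = H n0 + (\<Sum>j<k. c j * real (Suc m choose Suc j))"
      by (simp add: algebra_simps)
    finally show ?case .
  qed simp
  then have "H (n0 + m) = (\<Sum>j<Suc k. c' j * real (m choose j))" for m
    unfolding sum.lessThan_Suc_shift by (simp add: c'_def)
  then show ?case by blast
qed

lemma binomial_over_power_tendsto:
  "(\<lambda>m. real (m choose j) / real m ^ j) \<longlonglongrightarrow> 1 / fact j"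
proof (induction j)
  case (Suc j)
  have "(\<lambda>m. (1 - real j / real m) / real (Suc j)) \<longlonglongrightarrow> (1 - 0) / real (Suc j)"
    by (intro tendsto_intros lim_const_over_n) auto
  from tendsto_mult[OF Suc this]
  have "(\<lambda>m. (real (m choose j) / real m ^ j) * ((1 - real j / real m) / real (Suc j))) \<longlonglongrightarrow> 1 / fact (Suc j)"
    by (simp add: field_simps)
  then show ?case
  proof (rule Lim_transform_eventually)
    show "\<forall>\<^sub>F m in sequentially. (real (m choose j) / real m ^ j) * ((1 - real j / real m) / real (Suc j))
        = real (m choose Suc j) / real m ^ Suc j"
      using eventually_gt_at_top[of j]
    proof eventually_elim
      fix m assume m: "j < m"
      have "Suc j * (m choose Suc j) = (m - j) * (m choose j)"
        using times_binomial_minus1_eq[of "Suc j" m] binomial_absorb_comp[of m j] by simp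
      then have "real (Suc j) * real (m choose Suc j) = (real m - real j) * real (m choose j)"
        using m by (metis of_nat_diff of_nat_mult less_imp_le)
      then show "(real (m choose j) / real m ^ j) * ((1 - real j / real m) / real (Suc j))
        = real (m choose Suc j) / real m ^ Suc j"
        using m by (simp add: divide_simps del: of_nat_Suc) (simp add: algebra_simps del: of_nat_Suc)
    qed
  qed
qed simp

lemma binomial_over_power_tendsto_le:
  assumes "j \<le> D"
  shows "(\<lambda>m. real (m choose j) / real m ^ D) \<longlonglongrightarrow> (if j = D then 1 / fact D else 0)"
proof (cases "j = D")
  case False
  have "(\<lambda>m. (1 / real m) ^ (D - j)) \<longlonglongrightarrow> 0 ^ (D - j)"
    by (intro tendsto_power lim_const_over_n)
  then have "(\<lambda>m. (1 / real m) ^ (D - j)) \<longlonglongrightarrow> 0" using False assms by (simp add: power_0_left)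
  from tendsto_mult[OF binomial_over_power_tendsto[of j] this]
  have "(\<lambda>m. real (m choose j) / real m ^ j * (1 / real m) ^ (D - j)) \<longlonglongrightarrow> 0" by simp
  moreover have "real (m choose j) / real m ^ j * (1 / real m) ^ (D - j) = real (m choose j) / real m ^ D" for m
    using assms by (simp add: power_divide power_add[symmetric])
  ultimately show ?thesis using False by simp
qed (use binomial_over_power_tendsto in simp)

lemma shift_over_power_tendsto:
  assumes "(\<lambda>m. H (n0 + m) / real m ^ D) \<longlonglongrightarrow> (L::real)"
  shows "(\<lambda>n. H n / real n ^ D) \<longlonglongrightarrow> L"
proof -
  have "(\<lambda>m. 1 / (1 + real n0 / real m)) \<longlonglongrightarrow> 1 / (1 + 0)"
    by (intro tendsto_intros lim_const_over_n) auto
  then have "(\<lambda>m. (1 / (1 + real n0 / real m)) ^ D) \<longlonglongrightarrow> 1 ^ D"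
    by (intro tendsto_power) simp
  from tendsto_mult[OF assms this]
  have "(\<lambda>m. H (n0 + m) / real m ^ D * (1 / (1 + real n0 / real m)) ^ D) \<longlonglongrightarrow> L" by simp
  then have "(\<lambda>m. H (m + n0) / real (m + n0) ^ D) \<longlonglongrightarrow> L"
  proof (rule Lim_transform_eventually)
    show "\<forall>\<^sub>F m in sequentially. H (n0 + m) / real m ^ D * (1 / (1 + real n0 / real m)) ^ D
        = H (m + n0) / real (m + n0) ^ D"
      using eventually_gt_at_top[of 0]
    proof eventually_elim
      fix m :: nat assume m: "0 < m"
      then have "1 / (1 + real n0 / real m) = real m / real (m + n0)" by (simp add: field_simps)
      then show "H (n0 + m) / real m ^ D * (1 / (1 + real n0 / real m)) ^ D = H (m + n0) / real (m + n0) ^ D"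
        using m by (simp add: power_divide add.commute)
    qed
  qed
  then show ?thesis by (rule LIMSEQ_offset)
qed

text \<open>The order \<open>k\<close> comes from the number of generators and may exceed the true
  degree. For an index \<open>k > d\<close> at the top, the limit of \<open>H n / n^k\<close> is the
  coefficient over \<open>k!\<close>, and the growth bound makes it vanish; such coefficients are
  removed one at a time.\<close>

lemma diffzero_tendsto:
  assumes H: "diffzero k H" and bd: "\<And>n. 1 \<le> n \<Longrightarrow> \<bar>H n\<bar> \<le> C * real n ^ d"
  shows "\<exists>L. (\<lambda>n. H n / real n ^ d) \<longlonglongrightarrow> L"
proof -
  obtain n0 c where c: "\<And>m. H (n0 + m) = (\<Sum>j<k. c j * real (m choose j))"
    using diffzero_newton[OF H] by blast
  have lim: "(\<lambda>m. H (n0 + m) / real m ^ D) \<longlonglongrightarrow> (\<Sum>j<k. c j * (if j = D then 1 / fact D else 0))"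
    if "\<And>m. H (n0 + m) = (\<Sum>j<k. c j * real (m choose j))" "k \<le> Suc D" for D k
  proof -
    have "(\<lambda>m. \<Sum>j<k. c j * (real (m choose j) / real m ^ D)) \<longlonglongrightarrow> (\<Sum>j<k. c j * (if j = D then 1 / fact D else 0))"
      using that(2) by (intro tendsto_sum tendsto_mult tendsto_const binomial_over_power_tendsto_le) auto
    then show ?thesis using that(1) by (simp add: sum_divide_distrib)
  qed
  show ?thesis
    using c
  proof (induction k)
    case 0
    then have "(\<lambda>m. H (n0 + m) / real m ^ d) \<longlonglongrightarrow> 0" by simp
    then show ?case using shift_over_power_tendsto by blast
  next
    case (Suc k)
    show ?case
    proof (cases "k \<le> d")
      case True
      then show ?thesis using lim[of "Suc k" d] Suc.prems shift_over_power_tendsto by blast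
    next
      case False
      have "(\<lambda>n. H n / real n ^ k) \<longlonglongrightarrow> (\<Sum>j<Suc k. c j * (if j = k then 1 / fact k else 0))"
        by (rule shift_over_power_tendsto[OF lim]) (use Suc.prems in auto)
      then have l: "(\<lambda>n. H n / real n ^ k) \<longlonglongrightarrow> c k / fact k" by simp
      have "(\<lambda>n. C * (1 / real n) ^ (k - d)) \<longlonglongrightarrow> C * 0 ^ (k - d)"
        by (intro tendsto_intros lim_const_over_n)
      moreover have "C * 0 ^ (k - d) = 0" using False by simp
      ultimately have z: "(\<lambda>n. C * (1 / real n) ^ (k - d)) \<longlonglongrightarrow> 0" by (simp only:)
      have "(\<lambda>n. H n / real n ^ k) \<longlonglongrightarrow> 0"
      proof (rule tendsto_rabs_zero_cancel, rule tendsto_sandwich[OF _ _ tendsto_const z])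
        show "\<forall>\<^sub>F n in sequentially. 0 \<le> \<bar>H n / real n ^ k\<bar>" by simp
        show "\<forall>\<^sub>F n in sequentially. \<bar>H n / real n ^ k\<bar> \<le> C * (1 / real n) ^ (k - d)"
          using eventually_gt_at_top[of 0]
        proof eventually_elim
          fix n :: nat assume n: "0 < n"
          have "\<bar>H n / real n ^ k\<bar> \<le> C * real n ^ d / real n ^ k"
            using bd[of n] n by (simp add: divide_right_mono)
          also have "\<dots> = C * (1 / real n) ^ (k - d)"
            using n False by (simp add: power_divide power_diff)
          finally show "\<bar>H n / real n ^ k\<bar> \<le> C * (1 / real n) ^ (k - d)" .
        qed
      qed
      from LIMSEQ_unique[OF l this] have "c k = 0" by simp
      then show ?thesis using Suc by simp
    qed
  qed
qed


section \<open>Hilbert functions\<close>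

context noetherian_cring begin

text \<open>Hilbert-Serre: kernel and cokernel of multiplication by \<open>x\<close> are killed by \<open>x\<close>.\<close>

lemma hilbert_function_diffzero:
  assumes "set xs \<subseteq> carrier R" "stable xs U" "stable xs V" "\<And>n. U n \<subseteq> V n" "fgen xs U V"
    and "\<And>n. cofin (U n)"
  shows "diffzero (length xs) (\<lambda>n. cl (U n) - cl (V n))"
  using assms
proof (induction xs arbitrary: U V)
  case Nil
  then obtain n0 where n0: "\<And>n. n \<ge> n0 \<Longrightarrow> V (Suc n) \<subseteq> lsum R [] (V n) <+> U (Suc n)" unfolding fgen_def by blast
  have "U n = V n" if n: "n \<ge> Suc n0" for n
  proof -
    obtain k where k: "n = Suc k" "k \<ge> n0" using n by (cases n) auto
    have "{\<zero>} <+> U n \<subseteq> U n"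
      using subm_zero[OF stable_idl[OF Nil(2)]] by (intro set_add_le[OF stable_idl[OF Nil(2)]]) auto
    then show ?thesis using n0[OF k(2)] k Nil(4)[of n] by auto
  qed
  then show ?case by (auto intro!: exI[of _ "Suc n0"])
next
  case (Cons x xs)
  note U = Cons.prems(2) and V = Cons.prems(3) and UV = Cons.prems(4) and cU = Cons.prems(6)
  have x: "x \<in> carrier R" and xs: "set xs \<subseteq> carrier R" using Cons.prems(1) by auto
  note pp = push_props[OF x xs U V UV]
  have iU: "idl (U n)" and iV: "idl (V n)" and iU': "idl (push x V U n)" for n
    using stable_idl U V pp(1) by auto
  \<comment> \<open>The kernel of multiplication by \<open>x\<close> on \<open>V/U\<close>; the
    cokernel is \<open>V\<close> modulo \<open>push x V U\<close>.\<close>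
  define W where "W n = {v \<in> V n. x \<otimes> v \<in> U (Suc n)}" for n
  have iW: "idl (W n)" for n unfolding W_def by (rule idl_colon[OF iV iU x])
  have UW: "U n \<subseteq> W n" for n unfolding W_def using UV stable_mult[OF U, of x _ n] by auto
  have WV: "W n \<subseteq> V n" for n unfolding W_def by auto
  have sW: "stable (x # xs) W"
    unfolding stable_def
  proof (intro conjI allI ballI iW)
    fix n y v assume y: "y \<in> set (x # xs)" and v: "v \<in> W n"
    have yc: "y \<in> carrier R" using y Cons.prems(1) by auto
    have "y \<otimes> (x \<otimes> v) \<in> U (Suc (Suc n))" using v stable_mult[OF U y] by (auto simp: W_def)
    then show "y \<otimes> v \<in> W (Suc n)"
      using v stable_mult[OF V y] yc x subm_mem[OF iW v] by (auto simp: W_def m_lcomm)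
  qed
  have "fgen (x # xs) U W"
    by (rule fgen_submodule[OF Cons.prems(1) U V UV Cons.prems(5) sW UW WV])
  then obtain n0 where n0: "\<And>n. n \<ge> n0 \<Longrightarrow> W (Suc n) \<subseteq> lsum R (x # xs) (W n) <+> U (Suc n)"
    unfolding fgen_def by blast
  have "lsum R (x # xs) (W n) <+> U (Suc n) \<subseteq> lsum R xs (W n) <+> U (Suc n)" for n
  proof -
    have iL: "idl (lsum R xs (W n))" using idl_lsum[OF xs iW] .
    have T: "idl (lsum R xs (W n) <+> U (Suc n))" by (rule idl_set_add[OF iL iU])
    have L: "lsum R xs (W n) \<subseteq> lsum R xs (W n) <+> U (Suc n)" by (rule set_add_upper1[OF iU subm_carr[OF iL]])
    have P: "U (Suc n) \<subseteq> lsum R xs (W n) <+> U (Suc n)" by (rule set_add_upper2[OF iL subm_carr[OF iU]])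
    have "(\<lambda>v. x \<otimes> v) ` W n \<subseteq> lsum R xs (W n) <+> U (Suc n)" using P by (auto simp: W_def)
    then have "lsum R (x # xs) (W n) \<subseteq> lsum R xs (W n) <+> U (Suc n)"
      using L unfolding lsum.simps by (rule set_add_le[OF T])
    then show ?thesis using P by (rule set_add_le[OF T])
  qed
  then have "fgen xs U W" unfolding fgen_def using n0 by (meson order_trans)
  then have d1: "diffzero (length xs) (\<lambda>n. cl (U n) - cl (W n))"
    using Cons.IH[OF xs stable_tail[OF U] stable_tail[OF sW] UW _ cU] by blast
  have cU': "cofin (push x V U n)" for n using cofin_mono[OF cU iU' pp(2)] .
  have cV: "cofin (V n)" for n using cofin_mono[OF cU iV UV] .
  have "diffzero (length xs) (\<lambda>n. cl (push x V U n) - cl (V n))"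
    by (rule Cons.IH[OF xs pp(1) stable_tail[OF V] pp(3) fgen_push[OF x xs U V UV Cons.prems(5)] cU'])
  from diffzero_diff[OF diffzero_shift[OF this] d1]
  have "diffzero (length xs) (\<lambda>n. cl (push x V U (Suc n)) - cl (V (Suc n)) - (cl (U n) - cl (W n)))" .
  \<comment> \<open>Cokernel in degree \<open>n + 1\<close> minus kernel in degree \<open>n\<close>
    is the first difference of the Hilbert function, so the order rises by one.\<close>
  moreover have "cl (push x V U (Suc n)) - cl (V (Suc n)) - (cl (U n) - cl (W n)) =
      (cl (U (Suc n)) - cl (V (Suc n))) - (cl (U n) - cl (V n))" for n
    using cl_map(3)[OF cV[of n] cU[of "Suc n"] x] by (simp add: W_def)
  ultimately show ?case by (simp only: list.size(4) diffzero.simps add_Suc_right add_0_right)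
qed

end

context local_cring begin

section \<open>Hilbert-Samuel functions of quotients of the local ring\<close>

lemma I_generators:
  obtains xs where "set xs \<subseteq> carrier R" "I = lsum R xs (carrier R)"
  using idl_fin_gen[OF idl_I] by blast

lemma add_ipow_Suc:
  assumes xs: "set xs \<subseteq> carrier R" and I: "I = lsum R xs (carrier R)" and K: "idl K" "idl J" "K \<subseteq> J"
  shows "K <+> ipow I (Suc n) \<subseteq> lsum R xs (K <+> ipow I n) <+> J"
proof -
  have iL: "idl (lsum R xs (K <+> ipow I n))" using idl_lsum[OF xs idl_add_ipow[OF K(1)]] .
  have iT: "idl (lsum R xs (K <+> ipow I n) <+> J)" using iL K by auto
  have "lsum R xs (ipow I n) \<subseteq> lsum R xs (K <+> ipow I n)"
    by (rule lsum_mono[OF xs idl_add_ipow[OF K(1)] _ ipow_subset_add[OF K(1)]]) simp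
  then have "ipow I (Suc n) \<subseteq> lsum R xs (K <+> ipow I n)" using ipow_Suc_lsum[OF xs I] by simp
  then show ?thesis
    using set_add_upper1[OF K(2) subm_carr[OF iL]] set_add_upper2[OF iL subm_carr[OF K(2)]] K(3)
    by (intro set_add_le[OF iT]) blast+
qed

lemma add_ipow_mult:
  assumes K: "idl K" and x: "x \<in> I" and v: "v \<in> K <+> ipow I n"
  shows "x \<otimes> v \<in> K <+> ipow I (Suc n)"
proof -
  obtain a b where ab: "v = a \<oplus> b" "a \<in> K" "b \<in> ipow I n" using v by (auto simp: mem_set_add)
  have c: "x \<in> carrier R" "a \<in> carrier R" "b \<in> carrier R"
    using x ab subm_mem[OF idl_I] subm_mem[OF K] subm_mem[OF idl_ipow[OF idl_I]] by auto
  have "x \<otimes> b \<in> ipow I (Suc n)" using ipow_Suc_mem[OF ab(3) x] c by (simp add: m_comm)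
  moreover have "x \<otimes> a \<in> K" using idl_mult[OF K c(1) ab(2)] .
  moreover have "x \<otimes> v = x \<otimes> a \<oplus> x \<otimes> b" using ab c by (simp add: r_distr)
  ultimately show ?thesis unfolding mem_set_add by blast
qed

lemma gen_in_I:
  assumes "set xs \<subseteq> carrier R" "I = lsum R xs (carrier R)" "x \<in> set xs"
  shows "x \<in> I"
  using lsum_mem[OF assms(1) idl_carrier _ assms(3), of \<one>] assms by auto

lemma add_ipow_antimono:
  assumes K: "idl K" and "m \<le> n"
  shows "K <+> ipow I n \<subseteq> K <+> ipow I m"
  by (rule set_add_mono[OF subset_refl ipow_antimono[OF idl_I assms(2)]])

text \<open>The quotients \<open>(K + I^n)/(K + I^(n+1))\<close> are the components of the
  associated graded ring of \<open>R/K\<close>; their lengths are the differences of the colengths,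
  whence the additional \<open>Suc\<close>.\<close>

lemma cl_add_ipow_diffzero:
  assumes K: "idl K"
  shows "\<exists>k. diffzero k (\<lambda>n. cl (K <+> ipow I n))"
proof -
  obtain xs where xs: "set xs \<subseteq> carrier R" and I: "I = lsum R xs (carrier R)" by (rule I_generators)
  let ?V = "\<lambda>n. K <+> ipow I n" and ?U = "\<lambda>n. K <+> ipow I (Suc n)"
  have "diffzero (length xs) (\<lambda>n. cl (?U n) - cl (?V n))"
  proof (rule hilbert_function_diffzero[OF xs])
    show "stable xs ?U" "stable xs ?V"
      unfolding stable_def using add_ipow_mult[OF K] gen_in_I[OF xs I] idl_add_ipow[OF K] by auto
    show "?U n \<subseteq> ?V n" for n by (rule add_ipow_antimono[OF K]) simp
    have "K \<subseteq> ?U (Suc n)" for n by (rule set_add_upper1[OF idl_ipow[OF idl_I] subm_carr[OF K]])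
    then show "fgen xs ?U ?V" unfolding fgen_def using add_ipow_Suc[OF xs I K idl_add_ipow[OF K]] by blast
    show "cofin (?U n)" for n using K by auto
  qed
  then show ?thesis by (intro exI[of _ "Suc (length xs)"]) simp
qed

lemma cl_add_ipow_tendsto:
  assumes K: "idl K" and "chain_free K d"
  shows "\<exists>L. (\<lambda>n. cl (K <+> ipow I n) / real n ^ d) \<longlonglongrightarrow> L"
proof -
  obtain c where "\<And>n. n \<ge> 1 \<Longrightarrow> cl (K <+> ipow I n) \<le> c * real n ^ d" using cl_upper[OF assms] by blast
  then show ?thesis using cl_add_ipow_diffzero[OF K] diffzero_tendsto[where C = c and d = d] by fastforce
qed

text \<open>Artin-Rees for the ideal generated by \<open>x\<close> modulo \<open>P\<close>, where \<open>x\<close> is a nonzerodivisor.\<close>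

lemma artin_rees_prime:
  assumes P: "primeideal P R" and x: "x \<in> carrier R" "x \<notin> P"
  obtains k where "1 \<le> k" "\<And>n v. v \<in> carrier R \<Longrightarrow> x \<otimes> v \<in> P <+> ipow I n \<Longrightarrow> v \<in> P <+> ipow I (n - k)"
proof -
  obtain xs where xs: "set xs \<subseteq> carrier R" and I: "I = lsum R xs (carrier R)" by (rule I_generators)
  have iP: "idl P" using primeideal_idl[OF P] .
  have ix: "idl (prin x)" using x by auto
  let ?U = "\<lambda>n::nat. P" and ?V = "\<lambda>n. P <+> ipow I n"
  \<comment> \<open>The graded submodule cut out by the ideal \<open>xR + P\<close>; the degree from
    which it is generated yields the Artin-Rees constant.\<close>
  define W where "W n = ?V n \<inter> (prin x <+> P)" for n
  have xP: "idl (prin x <+> P)" using ix iP by auto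
  have iV: "idl (?V n)" for n using idl_add_ipow[OF iP] .
  have sV: "stable xs ?V" and sU: "stable xs ?U"
    unfolding stable_def using add_ipow_mult[OF iP] gen_in_I[OF xs I] iV iP idl_mult[OF iP] xs by auto
  have sW: "stable xs W"
    unfolding stable_def W_def using add_ipow_mult[OF iP] gen_in_I[OF xs I] subm_Int[OF iV xP] idl_mult[OF xP] xs by auto
  have PV: "P \<subseteq> ?V n" for n by (rule set_add_upper1[OF idl_ipow[OF idl_I] subm_carr[OF iP]])
  have "fgen xs ?U ?V" unfolding fgen_def using add_ipow_Suc[OF xs I iP iP subset_refl] by blast
  then have "fgen xs ?U W"
    using PV set_add_upper2[OF ix subm_carr[OF iP]]
    by (intro fgen_submodule[OF xs sU sV PV _ sW]) (auto simp: W_def)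
  then obtain n1 where n1: "\<And>n. n \<ge> n1 \<Longrightarrow> W (Suc n) \<subseteq> lsum R xs (W n) <+> P" unfolding fgen_def by blast
  have ixI: "idl ((\<lambda>v. x \<otimes> v) ` ipow I j)" for j using x idl_ipow[OF idl_I] by auto
  have T: "idl ((\<lambda>v. x \<otimes> v) ` ipow I j <+> P)" for j using ixI iP by auto
  have W: "W (n1 + j) \<subseteq> (\<lambda>v. x \<otimes> v) ` ipow I j <+> P" for j
  proof (induction j)
    case 0
    then show ?case by (auto simp: W_def)
  next
    case (Suc j)
    have PT: "P \<subseteq> (\<lambda>v. x \<otimes> v) ` ipow I (Suc j) <+> P" by (rule set_add_upper2[OF ixI subm_carr[OF iP]])
    have "lsum R xs (W (n1 + j)) \<subseteq> (\<lambda>v. x \<otimes> v) ` ipow I (Suc j) <+> P"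
    proof (rule lsum_le[OF T])
      fix y v assume y: "y \<in> set xs" and v: "v \<in> W (n1 + j)"
      obtain w a where wa: "v = x \<otimes> w \<oplus> a" "w \<in> ipow I j" "a \<in> P" using v Suc unfolding mem_set_add subset_iff by blast
      have c: "y \<in> carrier R" "w \<in> carrier R" "a \<in> carrier R"
        using y xs wa subm_mem[OF iP] subm_mem[OF idl_ipow[OF idl_I]] by auto
      have "w \<otimes> y \<in> ipow I (Suc j)" by (rule ipow_Suc_mem[OF wa(2) gen_in_I[OF xs I y]])
      moreover have "y \<otimes> a \<in> P" using idl_mult[OF iP c(1) wa(3)] .
      moreover have "y \<otimes> v = x \<otimes> (w \<otimes> y) \<oplus> y \<otimes> a" using wa c x by (simp add: r_distr m_ac)
      ultimately show "y \<otimes> v \<in> (\<lambda>v. x \<otimes> v) ` ipow I (Suc j) <+> P" unfolding mem_set_add by blast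
    qed
    then have "lsum R xs (W (n1 + j)) <+> P \<subseteq> (\<lambda>v. x \<otimes> v) ` ipow I (Suc j) <+> P"
      using PT by (rule set_add_le[OF T])
    then show ?case using n1[of "n1 + j"] by auto
  qed
  have "v \<in> P <+> ipow I (n - Suc n1)" if v: "v \<in> carrier R" "x \<otimes> v \<in> P <+> ipow I n" for n v
  proof (cases "n1 \<le> n")
    case True
    have "x \<otimes> v \<in> prin x <+> P"
      using set_add_upper1[OF iP subm_carr[OF ix]] v by auto
    then have "x \<otimes> v \<in> W (n1 + (n - n1))" using v True by (simp add: W_def)
    then obtain w a where wa: "x \<otimes> v = x \<otimes> w \<oplus> a" "w \<in> ipow I (n - n1)" "a \<in> P"
      using W[of "n - n1"] unfolding mem_set_add subset_iff by blast
    have c: "w \<in> carrier R" "a \<in> carrier R" using wa subm_mem[OF iP] subm_mem[OF idl_ipow[OF idl_I]] by auto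
    have "x \<otimes> (v \<ominus> w) = (x \<otimes> v) \<ominus> (x \<otimes> w)" using x v c by algebra
    also have "\<dots> = a" unfolding wa(1) using x c by algebra
    finally have "v \<ominus> w \<in> P" using primeideal_mult[OF P x(1), of "v \<ominus> w"] x v c wa by auto
    moreover have "v = (v \<ominus> w) \<oplus> w" using v c by algebra
    ultimately have "v \<in> P <+> ipow I (n - n1)" using wa(2) unfolding mem_set_add by blast
    then show ?thesis by (rule subsetD[OF add_ipow_antimono[OF iP], rotated]) simp
  next
    case False
    then show ?thesis using v ipow_subset_add[OF iP, of 0] by auto
  qed
  \<comment> \<open>\<open>Suc\<close> makes the constant positive, so that it may later serve as a
    divisor.\<close>
  then show ?thesis using that[of "Suc n1"] by auto
qed

text \<open>With \<open>x\<close> in \<open>C 1\<close> outside \<open>C 0\<close>, each of the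
  first \<open>j\<close> layers of the filtration by powers of \<open>x\<close> has
  \<open>R/(C 1 + I^(n - j k0))\<close> as a quotient, where \<open>k0\<close> is the Artin-Rees
  constant. Taking \<open>j\<close> proportional to \<open>n\<close> gains one degree of growth for
  each inclusion of primes.\<close>

lemma cl_lower:
  assumes "strict_chain {P. primeideal P R} k C"
  shows "\<exists>c>0. \<exists>N. \<forall>n\<ge>N. c * real n ^ k \<le> cl (C 0 <+> ipow I n)"
  using assms
proof (induction k arbitrary: C)
  case 0
  then have P: "primeideal (C 0) R" by (auto simp: strict_chain_def)
  have iP: "idl (C 0)" using primeideal_idl[OF P] .
  have "1 * real n ^ 0 \<le> cl (C 0 <+> ipow I n)" if "n \<ge> 1" for n
  proof -
    have "ipow I n \<subseteq> \<mm>" using ipow_subset[OF idl_I, of n] that I_subset_mm by auto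
    then have "C 0 <+> ipow I n \<subseteq> \<mm>"
      using proper_subset_mm[OF iP primeideal_ne[OF P]] by (intro set_add_le[OF idl_mm])
    then have "C 0 <+> ipow I n \<subset> carrier R" using primeideal_ne[OF prime_mm] subm_carr[OF idl_mm] by auto
    then show ?thesis using cl_strict[OF cofin_add_ipow[OF iP] idl_carrier] by simp
  qed
  then show ?case by (intro exI[of _ 1]) auto
next
  case (Suc k)
  then have P: "primeideal (C 0) R" "primeideal (C 1) R" "C 0 \<subset> C 1" by (auto simp: strict_chain_def)
  have "strict_chain {P. primeideal P R} k (\<lambda>i. C (Suc i))" using Suc.prems by (auto simp: strict_chain_def)
  from Suc.IH[OF this] obtain c N where c: "c > 0" "\<And>n. n \<ge> N \<Longrightarrow> c * real n ^ k \<le> cl (C 1 <+> ipow I n)" by auto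
  define P0 where "P0 = C 0"
  have iP: "idl P0" and i1: "idl (C 1)" using primeideal_idl P P0_def by auto
  obtain x where x: "x \<in> C 1" "x \<notin> P0" using P P0_def by auto
  have xc: "x \<in> carrier R" using x subm_mem[OF i1] by auto
  obtain k0 where k0: "1 \<le> k0" "\<And>n v. v \<in> carrier R \<Longrightarrow> x \<otimes> v \<in> P0 <+> ipow I n \<Longrightarrow> v \<in> P0 <+> ipow I (n - k0)"
    using artin_rees_prime[of P0 x] P x xc P0_def by blast
  have AR: "v \<in> P0 <+> ipow I (n - i * k0)" if "v \<in> carrier R" "x [^] i \<otimes> v \<in> P0 <+> ipow I n" for i n v
    using that
  proof (induction i arbitrary: n)
    case (Suc i)
    have "x \<otimes> (x [^] i \<otimes> v) \<in> P0 <+> ipow I n" using Suc.prems xc by (simp add: m_ac)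
    then have "x [^] i \<otimes> v \<in> P0 <+> ipow I (n - k0)" using k0(2) Suc.prems xc by auto
    then have "v \<in> P0 <+> ipow I (n - k0 - i * k0)" using Suc by blast
    then show ?case by (simp add: algebra_simps)
  qed simp
  have main: "real j * cl (C 1 <+> ipow I (n - j * k0)) \<le> cl (P0 <+> ipow I n)" for j n
  proof -
    let ?B = "P0 <+> ipow I n" and ?g = "cl (C 1 <+> ipow I (n - j * k0))"
    have B: "cofin ?B" using iP by auto
    have iB: "idl ?B" using cofin_idl[OF B] .
    have ipx: "idl (prin (x [^] i))" for i :: nat using xc by auto
    have cA: "cofin (prin (x [^] i) <+> ?B)" for i :: nat using cofin_colon(1)[OF B] xc by auto
    have "real i * ?g \<le> cl (prin (x [^] i) <+> ?B)" if "i \<le> j" for i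
      using that
    proof (induction i)
      case (Suc i)
      have xi: "x [^] i \<in> carrier R" using xc by simp
      let ?W = "{a \<in> carrier R. x [^] i \<otimes> a \<in> prin (x [^] Suc i) <+> ?B}"
      have W: "cofin ?W" using cofin_colon(2)[OF cA xi] .
      have "?W \<subseteq> C 1 <+> ipow I (n - j * k0)"
      proof
        fix a assume a: "a \<in> ?W"
        then have "x [^] i \<otimes> a \<in> prin (x [^] Suc i) <+> ?B" by simp
        then obtain y z where yz: "x [^] i \<otimes> a = y \<oplus> z" "y \<in> prin (x [^] Suc i)" "z \<in> ?B"
          unfolding mem_set_add[of "x [^] i \<otimes> a"] by blast
        then obtain b where bz: "x [^] i \<otimes> a = x [^] Suc i \<otimes> b \<oplus> z" "b \<in> carrier R" "z \<in> ?B" by blast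
        have c: "a \<in> carrier R" "z \<in> carrier R" using a bz subm_mem[OF iB] by auto
        have "x [^] i \<otimes> (a \<ominus> x \<otimes> b) = x [^] i \<otimes> a \<ominus> (x [^] i \<otimes> x) \<otimes> b"
          using c(1) bz(2) xc xi by (simp add: a_minus_def r_distr r_minus m_assoc)
        also have "\<dots> = (x [^] Suc i \<otimes> b \<oplus> z) \<ominus> x [^] Suc i \<otimes> b" unfolding bz(1) by simp
        also have "\<dots> = z"
        proof -
          have "(w \<oplus> z) \<ominus> w = z" if "w \<in> carrier R" for w using that c(2) by algebra
          then show ?thesis using xc bz(2) by simp
        qed
        finally have "a \<ominus> x \<otimes> b \<in> P0 <+> ipow I (n - i * k0)" using AR c bz xc by simp
        moreover have "P0 <+> ipow I (n - i * k0) \<subseteq> C 1 <+> ipow I (n - j * k0)"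
          using P P0_def Suc.prems by (intro set_add_mono ipow_antimono[OF idl_I] diff_le_mono2 mult_le_mono1) auto
        ultimately have 1: "a \<ominus> x \<otimes> b \<in> C 1 <+> ipow I (n - j * k0)" by auto
        have "x \<otimes> b \<in> C 1" using idl_mult2[OF i1 bz(2) x(1)] .
        then have 2: "x \<otimes> b \<in> C 1 <+> ipow I (n - j * k0)"
          using set_add_upper1[OF idl_ipow[OF idl_I] subm_carr[OF i1]] by auto
        have "a = (a \<ominus> x \<otimes> b) \<oplus> x \<otimes> b" using c xc bz(2) by algebra
        then show "a \<in> C 1 <+> ipow I (n - j * k0)" using subm_add[OF idl_add_ipow[OF i1] 1 2] by simp
      qed
      then have "?g \<le> cl ?W" by (rule cl_antimono[OF W idl_add_ipow[OF i1]])
      then show ?case using Suc prin_pow_filtration[OF B xc, of i] by (simp add: algebra_simps)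
    qed simp
    from this[of j] have "real j * ?g \<le> cl (prin (x [^] j) <+> ?B)" by simp
    also have "\<dots> \<le> cl ?B"
      by (rule cl_antimono[OF B cofin_idl[OF cA] set_add_upper2[OF ipx subm_carr[OF iB]]])
    finally show ?thesis .
  qed
  have "c / (4 * real k0 * 2 ^ k) * real n ^ Suc k \<le> cl (P0 <+> ipow I n)" if n: "n \<ge> 2 * N + 4 * k0" for n
  proof -
    \<comment> \<open>Half of the exponent is spent: \<open>j k0 \<le> n/2\<close> leaves at least
      \<open>n/2\<close>, which is at least \<open>N\<close> since \<open>n \<ge> 2 N\<close>; and
      \<open>n \<ge> 4 k0\<close> gives \<open>j \<ge> n/(4 k0)\<close> despite the
      rounding.\<close>
    define j where "j = n div (2 * k0)"
    have j0: "j * (2 * k0) \<le> n" unfolding j_def by (simp add: mult.commute)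
    then have "j * k0 \<le> n" by simp
    moreover have "real (j * (2 * k0)) \<le> real n" using j0 by (rule of_nat_mono)
    ultimately have j1: "real n / 2 \<le> real (n - j * k0)" "N \<le> n - j * k0"
      using n j0 by (auto simp: of_nat_diff)
    have "n < Suc j * (2 * k0)" unfolding j_def using k0(1) dividend_less_div_times[of "2 * k0" n] by (simp add: add.commute)
    then have "real n < (real j + 1) * (2 * real k0)" by (metis of_nat_Suc of_nat_less_iff of_nat_mult of_nat_numeral add.commute)
    moreover have "real n \<ge> 4 * real k0" using n by linarith
    ultimately have j2: "real n / (4 * real k0) \<le> real j" using k0 by (simp add: field_simps)
    have "c / (4 * real k0 * 2 ^ k) * real n ^ Suc k = (real n / (4 * real k0)) * (c * (real n / 2) ^ k)"
      by (simp add: power_divide)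
    also have "\<dots> \<le> real j * (c * real (n - j * k0) ^ k)"
      using c(1) j1 j2 by (intro mult_mono power_mono) auto
    also have "\<dots> \<le> real j * cl (C 1 <+> ipow I (n - j * k0))" using c(2)[OF j1(2)] by (intro mult_left_mono) auto
    also have "\<dots> \<le> cl (P0 <+> ipow I n)" by (rule main)
    finally show ?thesis .
  qed
  moreover have "c / (4 * real k0 * 2 ^ k) > 0" using c k0 by simp
  ultimately show ?case unfolding P0_def by blast
qed

end

section \<open>Dimension at most one\<close>

context local_cring begin

text \<open>A graded family \<open>U\<close> is a homogeneous ideal of the associated graded ring of \<open>I\<close>. By noetherian
  induction it may be assumed prime. Then a generator \<open>x\<close> outside \<open>U\<close> acts injectively on the
  quotient, whose Hilbert function is bounded in dimension one, so \<open>x\<close> is eventually bijective.\<close>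

definition graded_family :: "'a list \<Rightarrow> (nat \<Rightarrow> 'a set) \<Rightarrow> bool" where
  "graded_family xs U \<longleftrightarrow> stable xs U \<and> (\<forall>n. ipow I (Suc n) \<subseteq> U n \<and> U n \<subseteq> ipow I n)"

text \<open>The bound \<open>c\<close> is uniform in \<open>q\<close>; this is what keeps the shift
  in \<open>I^(c+q)\<close> constant later.\<close>

definition power_generated :: "'a list \<Rightarrow> (nat \<Rightarrow> 'a set) \<Rightarrow> bool" where
  "power_generated xs U \<longleftrightarrow> (\<exists>c. \<forall>n\<ge>c. \<forall>q\<ge>1.
     ipow I (n + q) \<subseteq> lsum R (map (\<lambda>x. x [^] q) xs) (ipow I n) <+> U (n + q))"

lemma stable_ipow:
  assumes "set xs \<subseteq> carrier R" "I = lsum R xs (carrier R)"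
  shows "stable xs (ipow I)" "stable xs (\<lambda>n. ipow I (Suc n))"
proof -
  have "x \<otimes> v \<in> ipow I (Suc n)" if "x \<in> set xs" "v \<in> ipow I n" for x v n
    using ipow_Suc_mem[OF that(2) gen_in_I[OF assms that(1)]] assms(1) that subm_mem[OF idl_ipow[OF idl_I] that(2)]
    by (auto simp: m_comm)
  then show "stable xs (ipow I)" "stable xs (\<lambda>n. ipow I (Suc n))"
    unfolding stable_def using idl_I by auto
qed

text \<open>Noetherian induction in the associated graded ring, whose ascending chain condition is
  \<open>graded_chain_stable\<close> for families between \<open>I^(n+1)\<close> and
  \<open>I^n\<close>.\<close>

lemma graded_family_induct:
  assumes xs: "set xs \<subseteq> carrier R" and I: "I = lsum R xs (carrier R)" and U: "graded_family xs U"
    and step: "\<And>U. graded_family xs U \<Longrightarrow>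
      (\<And>U'. graded_family xs U' \<Longrightarrow> (\<And>n. U n \<subseteq> U' n) \<Longrightarrow> U \<noteq> U' \<Longrightarrow> P U') \<Longrightarrow> P U"
  shows "P U"
proof (rule ccontr)
  assume "\<not> P U"
  have "\<exists>f. \<forall>j::nat. (graded_family xs (f j) \<and> \<not> P (f j)) \<and> ((\<forall>n. f j n \<subseteq> f (Suc j) n) \<and> f j \<noteq> f (Suc j))"
  proof (rule dependent_nat_choice)
    show "\<exists>U. graded_family xs U \<and> \<not> P U" using U \<open>\<not> P U\<close> by blast
    show "\<exists>y. (graded_family xs y \<and> \<not> P y) \<and> (\<forall>n. x n \<subseteq> y n) \<and> x \<noteq> y"
      if "graded_family xs x \<and> \<not> P x" for x and j :: nat using that step[of x] by blast
  qed
  then obtain f where f: "\<And>j. graded_family xs (f j)" "\<And>j n. f j n \<subseteq> f (Suc j) n" "\<And>j. f j \<noteq> f (Suc j)" by blast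
  have le: "ipow I (Suc n) \<subseteq> ipow I n" for n by (rule ipow_antimono[OF idl_I]) simp
  have "lsum R xs (ipow I n) <+> ipow I (Suc (Suc n)) \<supseteq> ipow I (Suc n)" for n
    using set_add_upper1[OF idl_ipow[OF idl_I] subm_carr[OF idl_lsum[OF xs idl_ipow[OF idl_I]]]]
      ipow_Suc_lsum[OF xs I, of n] by simp
  then have g: "fgen xs (\<lambda>n. ipow I (Suc n)) (ipow I)" unfolding fgen_def by blast
  have "\<exists>j0. \<forall>j n. j0 \<le> j \<longrightarrow> f j n = f j0 n"
  proof (rule graded_chain_stable[of xs "\<lambda>n. ipow I (Suc n)" "ipow I" f])
    show "fgen xs (\<lambda>n. ipow I (Suc n)) W" if "stable xs W" "\<And>n. ipow I (Suc n) \<subseteq> W n \<and> W n \<subseteq> ipow I n" for W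
      using fgen_submodule[OF xs stable_ipow(2)[OF xs I] stable_ipow(1)[OF xs I] le g that(1)] that(2) by blast
  qed (use xs f stable_ipow[OF xs I] in \<open>auto simp: graded_family_def\<close>)
  then obtain j0 where "\<And>n. f (Suc j0) n = f j0 n" by (metis le_SucI order_refl)
  then show False using f(3)[of j0] by auto
qed

lemma graded_family_mult:
  assumes xs: "set xs \<subseteq> carrier R" and I: "I = lsum R xs (carrier R)" and U: "stable xs U"
    and f: "f \<in> ipow I k" and u: "u \<in> U n"
  shows "f \<otimes> u \<in> U (n + k)"
  using f u
proof (induction k arbitrary: f u n)
  case 0
  then show ?case using idl_mult[OF stable_idl[OF U]] by auto
next
  case (Suc k)
  have iU: "idl (U n)" for n using stable_idl[OF U] .
  have 1: "b \<otimes> u \<in> U (Suc n)" if b: "b \<in> I" and u: "u \<in> U n" for b u n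
  proof -
    have uc: "u \<in> carrier R" using u subm_mem[OF iU] by auto
    have "lsum R xs (carrier R) \<subseteq> {b \<in> carrier R. u \<otimes> b \<in> U (Suc n)}"
    proof (rule lsum_le[OF idl_colon[OF idl_carrier iU uc]])
      fix x v assume x: "x \<in> set xs" and v: "v \<in> carrier R"
      have "v \<otimes> (x \<otimes> u) \<in> U (Suc n)" using idl_mult[OF iU v stable_mult[OF U x u]] .
      then show "x \<otimes> v \<in> {b \<in> carrier R. u \<otimes> b \<in> U (Suc n)}" using x xs v uc by (auto simp: m_ac)
    qed
    then have "u \<otimes> b \<in> U (Suc n)" using b unfolding I by auto
    then show ?thesis using uc b subm_mem[OF idl_I] by (simp add: m_comm)
  qed
  have uc: "u \<in> carrier R" using Suc.prems(2) subm_mem[OF iU] by auto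
  have "ipow I (Suc k) \<subseteq> {f \<in> carrier R. u \<otimes> f \<in> U (n + Suc k)}"
  proof (rule ipow_Suc_le[OF idl_colon[OF idl_carrier iU uc]])
    fix a b assume a: "a \<in> ipow I k" and b: "b \<in> I"
    have c: "a \<in> carrier R" "b \<in> carrier R" using a b subm_mem[OF idl_ipow[OF idl_I]] subm_mem[OF idl_I] by auto
    have "a \<otimes> (b \<otimes> u) \<in> U (Suc n + k)" by (rule Suc.IH[OF a 1[OF b Suc.prems(2)]])
    then show "a \<otimes> b \<in> {f \<in> carrier R. u \<otimes> f \<in> U (n + Suc k)}" using c uc by (simp add: m_ac)
  qed
  then have "u \<otimes> f \<in> U (n + Suc k)" using Suc.prems(1) by auto
  then show ?case using uc subm_mem[OF idl_ipow[OF idl_I] Suc.prems(1)] by (simp add: m_comm)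
qed

text \<open>\<open>U1\<close> is \<open>U\<close> enlarged by the multiples of \<open>f\<close>, and
  \<open>U2\<close> is the colon family \<open>U : f\<close>. Modulo \<open>U1\<close> an element is
  generated up to \<open>U\<close> and some \<open>f v\<close>; generating \<open>v\<close> modulo
  \<open>U2\<close> and multiplying by \<open>f\<close> leaves an error in \<open>U\<close>. The
  degree \<open>k\<close> of \<open>f\<close> shifts the bound belonging to
  \<open>U2\<close>.\<close>

lemma power_generated_split:
  assumes xs: "set xs \<subseteq> carrier R" and I: "I = lsum R xs (carrier R)" and U: "graded_family xs U"
    and f: "f \<in> ipow I k" "f \<notin> U k" and g: "g \<in> ipow I m" "g \<notin> U m" and fg: "f \<otimes> g \<in> U (m + k)"
    and IH: "\<And>U'. graded_family xs U' \<Longrightarrow> (\<And>n. U n \<subseteq> U' n) \<Longrightarrow> U \<noteq> U' \<Longrightarrow> power_generated xs U'"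
  shows "power_generated xs U"
proof -
  have sU: "stable xs U" using U by (simp add: graded_family_def)
  have iU: "idl (U n)" for n using stable_idl[OF sU] .
  have Ule: "U n \<subseteq> ipow I n" "ipow I (Suc n) \<subseteq> U n" for n using U by (auto simp: graded_family_def)
  have iI: "idl (ipow I n)" for n using idl_I by auto
  have fc: "f \<in> carrier R" using f subm_mem[OF iI] by auto
  have ifI: "idl ((\<lambda>v. f \<otimes> v) ` ipow I n)" for n using iI fc by auto
  define U1 where "U1 n = (if k \<le> n then ((\<lambda>v. f \<otimes> v) ` ipow I (n - k)) <+> U n else U n)" for n
  define U2 where "U2 n = {v \<in> ipow I n. f \<otimes> v \<in> U (n + k)}" for n
  have i1: "idl (U1 n)" for n unfolding U1_def using ifI iU by auto
  have i2: "idl (U2 n)" for n unfolding U2_def by (rule idl_colon[OF iI iU fc])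
  have UU1: "U n \<subseteq> U1 n" for n unfolding U1_def using set_add_upper2[OF ifI subm_carr[OF iU]] by auto
  have UU2: "U n \<subseteq> U2 n" for n unfolding U2_def using Ule graded_family_mult[OF xs I sU f(1)] by auto
  have g1: "graded_family xs U1"
    unfolding graded_family_def stable_def
  proof (intro conjI allI ballI i1)
    show "ipow I (Suc n) \<subseteq> U1 n" for n using Ule UU1 by blast
    have "(\<lambda>v. f \<otimes> v) ` ipow I (n - k) \<subseteq> ipow I n" if "k \<le> n" for n
      using ipow_mult_mem[OF idl_I f(1), of _ "n - k"] that by auto
    then show "U1 n \<subseteq> ipow I n" for n unfolding U1_def using Ule(1) set_add_le[OF iI] by simp
    fix n y u assume y: "y \<in> set xs" and u: "u \<in> U1 n"
    have yc: "y \<in> carrier R" using y xs by auto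
    show "y \<otimes> u \<in> U1 (Suc n)"
    proof (cases "k \<le> n")
      case True
      then obtain w v where wv: "u = f \<otimes> w \<oplus> v" "w \<in> ipow I (n - k)" "v \<in> U n"
        using u unfolding U1_def by (auto simp: mem_set_add)
      have c: "w \<in> carrier R" "v \<in> carrier R" using wv subm_mem[OF iI] subm_mem[OF iU] by auto
      have "y \<otimes> w \<in> ipow I (Suc n - k)"
        using stable_mult[OF stable_ipow(1)[OF xs I] y wv(2)] True by (simp add: Suc_diff_le)
      moreover have "y \<otimes> v \<in> U (Suc n)" using stable_mult[OF sU y wv(3)] .
      moreover have "y \<otimes> u = f \<otimes> (y \<otimes> w) \<oplus> y \<otimes> v" using wv c yc fc by (simp add: r_distr m_lcomm)
      ultimately have "y \<otimes> u \<in> ((\<lambda>v. f \<otimes> v) ` ipow I (Suc n - k)) <+> U (Suc n)" unfolding mem_set_add by blast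
      then show ?thesis using True by (simp add: U1_def)
    next
      case False
      then show ?thesis using u stable_mult[OF sU y, of u n] UU1[of "Suc n"] by (auto simp: U1_def)
    qed
  qed
  have g2: "graded_family xs U2"
    unfolding graded_family_def stable_def
  proof (intro conjI allI ballI i2)
    fix n
    show "U2 n \<subseteq> ipow I n" by (auto simp: U2_def)
    show "ipow I (Suc n) \<subseteq> U2 n"
    proof
      fix v assume v: "v \<in> ipow I (Suc n)"
      have "f \<otimes> v \<in> ipow I (k + Suc n)" by (rule ipow_mult_mem[OF idl_I f(1) v])
      also have "k + Suc n = Suc (n + k)" by simp
      finally have "f \<otimes> v \<in> U (n + k)" using Ule by blast
      then show "v \<in> U2 n" using v ipow_Suc_subset[OF idl_I, of n] by (auto simp: U2_def)
    qed
    fix y u assume y: "y \<in> set xs" and u: "u \<in> U2 n"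
    have "y \<otimes> (f \<otimes> u) \<in> U (Suc (n + k))" using u by (intro stable_mult[OF sU y]) (auto simp: U2_def)
    moreover have "y \<otimes> u \<in> ipow I (Suc n)" using u by (intro stable_mult[OF stable_ipow(1)[OF xs I] y]) (auto simp: U2_def)
    moreover have "y \<otimes> (f \<otimes> u) = f \<otimes> (y \<otimes> u)" using y xs fc subm_mem[OF i2 u] by (auto simp: m_lcomm)
    ultimately show "y \<otimes> u \<in> U2 (Suc n)" by (simp add: U2_def)
  qed
  have "f \<in> U1 k"
  proof -
    have "f = f \<otimes> \<one> \<oplus> \<zero>" using fc by simp
    then show ?thesis using subm_zero[OF iU] unfolding U1_def by (auto simp: mem_set_add)
  qed
  then have "U \<noteq> U1" using f by auto
  then obtain c1 where c1: "\<And>n q. n \<ge> c1 \<Longrightarrow> q \<ge> 1 \<Longrightarrow>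
      ipow I (n + q) \<subseteq> lsum R (map (\<lambda>x. x [^] q) xs) (ipow I n) <+> U1 (n + q)"
    using IH[OF g1 UU1] unfolding power_generated_def by blast
  have "g \<in> U2 m" using g fg by (simp add: U2_def)
  then have "U \<noteq> U2" using g by auto
  then obtain c2 where c2: "\<And>n q. n \<ge> c2 \<Longrightarrow> q \<ge> 1 \<Longrightarrow>
      ipow I (n + q) \<subseteq> lsum R (map (\<lambda>x. x [^] q) xs) (ipow I n) <+> U2 (n + q)"
    using IH[OF g2 UU2] unfolding power_generated_def by blast
  have "ipow I (n + q) \<subseteq> lsum R (map (\<lambda>x. x [^] q) xs) (ipow I n) <+> U (n + q)"
    if n: "n \<ge> max c1 (c2 + k)" and q: "q \<ge> 1" for n and q :: nat
  proof -
    let ?ys = "map (\<lambda>x. x [^] q) xs"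
    let ?T = "lsum R ?ys (ipow I n) <+> U (n + q)"
    have ys: "set ?ys \<subseteq> carrier R" using xs by auto
    have iL: "idl (lsum R ?ys (ipow I n))" using idl_lsum[OF ys iI] .
    have iT: "idl ?T" using iL iU by auto
    have LT: "lsum R ?ys (ipow I n) \<subseteq> ?T" by (rule set_add_upper1[OF iU subm_carr[OF iL]])
    have UT: "U (n + q) \<subseteq> ?T" by (rule set_add_upper2[OF iL subm_carr[OF iU]])
    have "ipow I (n - k + q) \<subseteq> lsum R ?ys (ipow I (n - k)) <+> U2 (n - k + q)" by (rule c2) (use n q in auto)
    also have "\<dots> \<subseteq> {v \<in> carrier R. f \<otimes> v \<in> ?T}"
    proof (rule set_add_le[OF idl_colon[OF idl_carrier iT fc]])
      show "lsum R ?ys (ipow I (n - k)) \<subseteq> {v \<in> carrier R. f \<otimes> v \<in> ?T}"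
      proof (rule lsum_le[OF idl_colon[OF idl_carrier iT fc]])
        fix y v assume y: "y \<in> set ?ys" and v: "v \<in> ipow I (n - k)"
        have c: "y \<in> carrier R" "v \<in> carrier R" using y ys v subm_mem[OF iI] by auto
        have "f \<otimes> v \<in> ipow I n" using ipow_mult_mem[OF idl_I f(1) v] n by simp
        then have "y \<otimes> (f \<otimes> v) \<in> ?T" using LT lsum_mem[OF ys iI _ y] by blast
        then show "y \<otimes> v \<in> {v \<in> carrier R. f \<otimes> v \<in> ?T}" using c fc by (simp add: m_lcomm)
      qed
      show "U2 (n - k + q) \<subseteq> {v \<in> carrier R. f \<otimes> v \<in> ?T}"
      proof
        fix v assume v: "v \<in> U2 (n - k + q)"
        then have "f \<otimes> v \<in> U (n - k + q + k)" by (simp add: U2_def)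
        also have "n - k + q + k = n + q" using n by simp
        finally show "v \<in> {v \<in> carrier R. f \<otimes> v \<in> ?T}" using UT subm_mem[OF i2 v] by auto
      qed
    qed
    finally have "(\<lambda>v. f \<otimes> v) ` ipow I (n - k + q) \<subseteq> ?T" by auto
    moreover have "n - k + q = n + q - k" "k \<le> n + q" using n by auto
    ultimately have "U1 (n + q) \<subseteq> ?T" unfolding U1_def using set_add_le[OF iT _ UT] by simp
    then have "lsum R ?ys (ipow I n) <+> U1 (n + q) \<subseteq> ?T" by (rule set_add_le[OF iT LT])
    then show ?thesis using c1[of n q] n q by auto
  qed
  then show ?thesis unfolding power_generated_def by blast
qed

lemma power_generated_prime:
  assumes xs: "set xs \<subseteq> carrier R" and I: "I = lsum R xs (carrier R)" and U: "graded_family xs U"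
    and dim: "\<And>n. 1 \<le> n \<Longrightarrow> cl (ipow I n) \<le> C * real n"
    and pr: "\<And>f g k m. f \<in> ipow I k \<Longrightarrow> g \<in> ipow I m \<Longrightarrow> f \<otimes> g \<in> U (m + k) \<Longrightarrow> f \<in> U k \<or> g \<in> U m"
  shows "power_generated xs U"
proof (cases "set xs \<subseteq> U 1")
  case True
  have sU: "stable xs U" using U by (simp add: graded_family_def)
  have iU: "idl (U n)" for n using stable_idl[OF sU] .
  have iI: "idl (ipow I n)" for n using idl_I by auto
  have "ipow I (n + q) \<subseteq> lsum R (map (\<lambda>x. x [^] q) xs) (ipow I n) <+> U (n + q)" if q: "q \<ge> 1" for n q :: nat
  proof -
    obtain m where m: "n + q = Suc m" using q by (cases "n + q") auto
    \<comment> \<open>If \<open>U\<close> contains all generators, it contains every component of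
      positive degree; \<open>q \<ge> 1\<close> excludes degree zero.\<close>
    have "lsum R xs (ipow I m) \<subseteq> U (Suc m)"
    proof (rule lsum_le[OF iU])
      fix x v assume x: "x \<in> set xs" and v: "v \<in> ipow I m"
      have "v \<otimes> x \<in> U (1 + m)" by (rule graded_family_mult[OF xs I sU v]) (use x True in auto)
      then show "x \<otimes> v \<in> U (Suc m)" using x xs subm_mem[OF iI v] by (auto simp: m_comm)
    qed
    then have "ipow I (n + q) \<subseteq> U (n + q)" unfolding m ipow_Suc_lsum[OF xs I] .
    moreover have "U (n + q) \<subseteq> lsum R (map (\<lambda>x. x [^] q) xs) (ipow I n) <+> U (n + q)"
      by (rule set_add_upper2[OF idl_lsum[OF _ iI] subm_carr[OF iU]]) (use xs in auto)
    ultimately show ?thesis by auto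
  qed
  then show ?thesis unfolding power_generated_def by blast
next
  case False
  then obtain x where x: "x \<in> set xs" "x \<notin> U 1" by auto
  have sU: "stable xs U" using U by (simp add: graded_family_def)
  have iU: "idl (U n)" for n using stable_idl[OF sU] .
  have Ule: "U n \<subseteq> ipow I n" "ipow I (Suc n) \<subseteq> U n" for n using U by (auto simp: graded_family_def)
  have iI: "idl (ipow I n)" for n using idl_I by auto
  have xc: "x \<in> carrier R" using x xs by auto
  have x1: "x \<in> ipow I 1" using gen_in_I[OF xs I x(1)] ipow_1[OF idl_I] by simp
  have cU: "cofin (U n)" for n by (rule cofin_above_ipow[OF iU Ule(2)])
  let ?A = "\<lambda>n. (\<lambda>v. x \<otimes> v) ` ipow I n <+> U (Suc n)"
  have cA: "cofin (?A n)" for n using cl_map(2)[OF cofin_ipow cU xc] .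
  have AI: "?A n \<subseteq> ipow I (Suc n)" for n
    using stable_mult[OF stable_ipow(1)[OF xs I] x(1)] Ule by (intro set_add_le[OF iI]) auto
  \<comment> \<open>Primality makes \<open>x\<close> injective on the quotient by \<open>U\<close>,
    so the Hilbert function \<open>h\<close> below is nondecreasing and its increments are the
    lengths of the cokernels.\<close>
  have "{v \<in> ipow I n. x \<otimes> v \<in> U (Suc n)} = U n" for n
    using pr[OF x1, of _ n] x(2) Ule(1)[of n] stable_mult[OF sU x(1), of _ n] by auto
  then have eq: "cl (U (Suc n)) - cl (?A n) = cl (U n) - cl (ipow I n)" for n
    using cl_map(3)[OF cofin_ipow cU xc, of "Suc n" n] by simp
  define h where "h n = cl (U n) - cl (ipow I n)" for n
  have h_mono1: "h n \<le> h (Suc n)" for n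
    using eq[of n] cl_antimono[OF cA iI AI, of n] unfolding h_def by linarith
  have h_mono: "m \<le> n \<Longrightarrow> h m \<le> h n" for m n using lift_Suc_mono_le[of h, OF h_mono1] .
  have hI: "h n \<le> cl (ipow I (Suc n)) - cl (ipow I n)" for n
    using cl_antimono[OF cofin_ipow iU Ule(2), of n] by (simp add: h_def)
  \<comment> \<open>The sum of \<open>h\<close> over consecutive degrees stays below the colength of
    a power of \<open>I\<close>, which grows with slope at most \<open>C\<close>; a nondecreasing
    \<open>h\<close> exceeding \<open>C\<close> would outgrow it.\<close>
  have h_bd: "h n \<le> C" for n
  proof (rule ccontr)
    assume "\<not> h n \<le> C"
    then have pos: "h n - C > 0" by simp
    have s: "real i * h n \<le> cl (ipow I (n + i))" for i
    proof (induction i)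
      case (Suc i)
      have "h n \<le> cl (ipow I (n + Suc i)) - cl (ipow I (n + i))"
        using h_mono[of n "n + i"] hI[of "n + i"] by simp
      then show ?case using Suc by (simp add: algebra_simps)
    qed simp
    obtain i where i: "real i * (h n - C) > C * real n" using reals_Archimedean3[OF pos] by blast
    have "real (Suc i) * h n \<le> C * real (n + Suc i)" using s[of "Suc i"] dim[of "n + Suc i"] by simp
    then have "real i * (h n - C) + (h n - C) \<le> C * real n" by (simp add: algebra_simps)
    then show False using i pos by linarith
  qed
  \<comment> \<open>Being integer-valued and bounded, \<open>h\<close> attains its maximum and is
    constant from there on, so the cokernel of \<open>x\<close> vanishes.\<close>
  define g where "g n = the_enat (clen (U n)) - the_enat (clen (ipow I n))" for n
  have hg: "h n = real (g n)" for n
  proof -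
    have "cl (ipow I n) \<le> cl (U n)" using cl_antimono[OF cU iI Ule(1)] .
    then show ?thesis by (simp add: h_def g_def cl_def of_nat_diff)
  qed
  have "g n \<le> nat \<lceil>C\<rceil>" for n using h_bd[of n] unfolding hg by linarith
  then have "range g \<subseteq> {..nat \<lceil>C\<rceil>}" by auto
  then have fin: "finite (range g)" by (rule finite_subset) simp
  have "Max (range g) \<in> range g" by (rule Max_in[OF fin]) auto
  then obtain N where N: "g N = Max (range g)" by auto
  have hN: "h n = h N" if "n \<ge> N" for n
  proof -
    have "g n \<le> g N" unfolding N using fin by simp
    then show ?thesis using h_mono[OF that] unfolding hg by simp
  qed
  have step: "ipow I (Suc n) \<subseteq> ?A n" if n: "n \<ge> N" for n
  proof (rule ccontr)
    assume "\<not> ?thesis"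
    then have "?A n \<subset> ipow I (Suc n)" using AI[of n] by auto
    then have "cl (ipow I (Suc n)) + 1 \<le> cl (?A n)" by (rule cl_strict[OF cA iI])
    then show False using eq[of n] hN[of n] hN[of "Suc n"] n unfolding h_def by simp
  qed
  have main: "ipow I (n + q) \<subseteq> (\<lambda>v. x [^] q \<otimes> v) ` ipow I n <+> U (n + q)" if n: "n \<ge> N" for n q :: nat
  proof (induction q)
    case 0
    have "ipow I n = (\<lambda>v. x [^] (0::nat) \<otimes> v) ` ipow I n" using subm_mem[OF iI] by (force simp: image_iff)
    then show ?case using set_add_upper1[OF iU subm_carr[OF iI], of n n] by simp
  next
    case (Suc q)
    let ?T = "(\<lambda>v. x [^] Suc q \<otimes> v) ` ipow I n <+> U (n + Suc q)"
    have ix: "idl ((\<lambda>v. x [^] Suc q \<otimes> v) ` ipow I n)" using iI xc by auto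
    have iT: "idl ?T" by (rule idl_set_add[OF ix iU])
    have UT: "U (n + Suc q) \<subseteq> ?T" by (rule set_add_upper2[OF ix subm_carr[OF iU]])
    have "ipow I (n + q) \<subseteq> {v \<in> carrier R. x \<otimes> v \<in> ?T}"
    proof
      fix v assume v: "v \<in> ipow I (n + q)"
      then have "v \<in> (\<lambda>v. x [^] q \<otimes> v) ` ipow I n <+> U (n + q)" using Suc by (rule subsetD[rotated])
      then obtain y u where "v = y \<oplus> u" "y \<in> (\<lambda>v. x [^] q \<otimes> v) ` ipow I n" "u \<in> U (n + q)"
        unfolding mem_set_add[of v] by blast
      then obtain w where wu: "v = x [^] q \<otimes> w \<oplus> u" "w \<in> ipow I n" "u \<in> U (n + q)" by blast
      have c: "w \<in> carrier R" "u \<in> carrier R" using wu subm_mem[OF iI] subm_mem[OF iU] by auto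
      have "x \<otimes> u \<in> U (n + Suc q)" using stable_mult[OF sU x(1) wu(3)] by simp
      moreover have "x \<otimes> v = x [^] Suc q \<otimes> w \<oplus> x \<otimes> u" using wu c xc by (simp add: r_distr m_ac)
      ultimately have "x \<otimes> v \<in> ?T" using wu(2) unfolding mem_set_add by blast
      then show "v \<in> {v \<in> carrier R. x \<otimes> v \<in> ?T}" using subm_mem[OF iI v] by simp
    qed
    then have "(\<lambda>v. x \<otimes> v) ` ipow I (n + q) \<subseteq> ?T" by auto
    then have "?A (n + q) \<subseteq> ?T" using UT by (intro set_add_le[OF iT]) auto
    then show ?case using step[of "n + q"] n by auto
  qed
  have "ipow I (n + q) \<subseteq> lsum R (map (\<lambda>x. x [^] q) xs) (ipow I n) <+> U (n + q)" if n: "n \<ge> N" for n q :: nat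
  proof -
    have ys: "set (map (\<lambda>x. x [^] q) xs) \<subseteq> carrier R" using xs by auto
    have "(\<lambda>v. x [^] q \<otimes> v) ` ipow I n \<subseteq> lsum R (map (\<lambda>x. x [^] q) xs) (ipow I n)"
      using lsum_mem[OF ys iI, of "x [^] q"] x(1) by auto
    then show ?thesis using main[OF n, of q] set_add_mono[of _ _ "U (n + q)" "U (n + q)"] by (meson order_refl order_trans)
  qed
  then show ?thesis unfolding power_generated_def by blast
qed

lemma power_generated_all:
  assumes xs: "set xs \<subseteq> carrier R" and I: "I = lsum R xs (carrier R)" and U: "graded_family xs U"
    and dim: "\<And>n. 1 \<le> n \<Longrightarrow> cl (ipow I n) \<le> C * real n"
  shows "power_generated xs U"
  using xs I U
proof (rule graded_family_induct)
  fix U assume U: "graded_family xs U"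
    and IH: "\<And>U'. graded_family xs U' \<Longrightarrow> (\<And>n. U n \<subseteq> U' n) \<Longrightarrow> U \<noteq> U' \<Longrightarrow> power_generated xs U'"
  show "power_generated xs U"
  proof (cases "\<exists>f g k m. f \<in> ipow I k \<and> f \<notin> U k \<and> g \<in> ipow I m \<and> g \<notin> U m \<and> f \<otimes> g \<in> U (m + k)")
    case True
    then show ?thesis using power_generated_split[OF xs I U] IH by blast
  next
    case False
    then show ?thesis using power_generated_prime[OF xs I U dim] by blast
  qed
qed

text \<open>The zero ideal of the associated graded ring gives generation by \<open>q\<close>-th
  powers up to the next power of \<open>I\<close>. Repetition raises the exponent of this error
  above \<open>length xs * q\<close>, where the pigeonhole principle places it among the multiples
  of the \<open>q\<close>-th powers.\<close>

theorem ipow_subset_powers: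
  assumes xs: "set xs \<subseteq> carrier R" and I: "I = lsum R xs (carrier R)"
    and dim: "\<And>n. 1 \<le> n \<Longrightarrow> cl (ipow I n) \<le> C * real n"
  obtains c where "\<And>q. 1 \<le> q \<Longrightarrow> ipow I (c + q) \<subseteq> lsum R (map (\<lambda>x. x [^] q) xs) (carrier R)"
proof -
  have "graded_family xs (\<lambda>n. ipow I (Suc n))"
    unfolding graded_family_def using stable_ipow[OF xs I] ipow_Suc_subset[OF idl_I] by auto
  then obtain c where c: "\<And>n q. n \<ge> c \<Longrightarrow> q \<ge> 1 \<Longrightarrow>
      ipow I (n + q) \<subseteq> lsum R (map (\<lambda>x. x [^] q) xs) (ipow I n) <+> ipow I (Suc (n + q))"
    using power_generated_all[OF xs I _ dim] unfolding power_generated_def by blast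
  have "ipow I (c + q) \<subseteq> lsum R (map (\<lambda>x. x [^] q) xs) (carrier R)" if q: "1 \<le> q" for q :: nat
  proof -
    let ?ys = "map (\<lambda>x. x [^] q) xs"
    let ?L = "lsum R ?ys (carrier R)"
    have ys: "set ?ys \<subseteq> carrier R" using xs by auto
    have iL: "idl ?L" using idl_lsum[OF ys idl_carrier] .
    have iI: "idl (ipow I n)" for n using idl_I by auto
    have sub: "lsum R ?ys (ipow I n) \<subseteq> ?L" for n by (rule lsum_mono[OF ys idl_carrier _ subm_carr[OF iI]]) simp
    have "ipow I (c + q) \<subseteq> ?L <+> ipow I (c + q + j)" for j
    proof (induction j)
      case 0
      then show ?case using set_add_upper2[OF iL subm_carr[OF iI]] by simp
    next
      case (Suc j)
      have T: "idl (?L <+> ipow I (c + q + Suc j))" using iL iI by auto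
      have LT: "?L \<subseteq> ?L <+> ipow I (c + q + Suc j)" by (rule set_add_upper1[OF iI subm_carr[OF iL]])
      have "ipow I (c + j + q) \<subseteq> lsum R ?ys (ipow I (c + j)) <+> ipow I (Suc (c + j + q))" by (rule c) (use q in auto)
      also have "\<dots> \<subseteq> ?L <+> ipow I (Suc (c + j + q))" by (rule set_add_mono[OF sub subset_refl])
      finally have "ipow I (c + q + j) \<subseteq> ?L <+> ipow I (c + q + Suc j)" by (simp add: add_ac)
      then have "?L <+> ipow I (c + q + j) \<subseteq> ?L <+> ipow I (c + q + Suc j)" by (rule set_add_le[OF T LT])
      then show ?case using Suc by blast
    qed
    from this[of "length xs * q"] have "ipow I (c + q) \<subseteq> ?L <+> ipow I (c + q + length xs * q)" .
    moreover have "ipow I (c + q + length xs * q) \<subseteq> ?L"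
      using ipow_pigeonhole[OF xs I, of q "c + q + length xs * q"] sub q by (meson le_add2 order_trans add_gr_0 less_le_trans zero_less_one)
    then have "?L <+> ipow I (c + q + length xs * q) \<subseteq> ?L" by (intro set_add_le[OF iL]) auto
    ultimately show ?thesis by auto
  qed
  then show ?thesis using that by blast
qed

end

section \<open>Colengths under Frobenius\<close>

locale local_frobenius = local_cring R \<mm> I + frobenius_cring R p
  for R (structure) and \<mm> I :: "'a set" and p :: nat +
  assumes F_fin: "F_finite R p"

context frobenius_cring begin

text \<open>\<open>T\<close> plus the span of \<open>us\<close> through the Frobenius, with
  coefficients from \<open>K\<close>. The ideal \<open>K\<close> is a parameter because the span
  over \<open>J\<close> is compared with the span over the whole ring.\<close>

fun span_over :: "nat \<Rightarrow> 'a set \<Rightarrow> 'a set \<Rightarrow> 'a list \<Rightarrow> 'a set" where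
  "span_over e T K [] = T"
| "span_over e T K (u # us) = ((\<lambda>a. a [^] (p ^ e) \<otimes> u) ` K) <+> span_over e T K us"

text \<open>Linear independence over \<open>R/P\<close> in triangular form: an element enters the
  span of those after it only through coefficients in \<open>P\<close>.\<close>

fun independent_over :: "nat \<Rightarrow> 'a set \<Rightarrow> 'a set \<Rightarrow> 'a list \<Rightarrow> bool" where
  "independent_over e T P [] \<longleftrightarrow> True"
| "independent_over e T P (u # us) \<longleftrightarrow> independent_over e T P us
     \<and> (\<forall>a\<in>carrier R. a [^] (p ^ e) \<otimes> u \<in> span_over e T (carrier R) us \<longrightarrow> a \<in> P)"

lemma subm_frobenius_image: "idl K \<Longrightarrow> u \<in> carrier R \<Longrightarrow> subm R (scal e) ((\<lambda>a. a [^] (p ^ e) \<otimes> u) ` K)"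
  by (rule subm_image[OF semilinear_frobenius])

lemma subm_span:
  "idl K \<Longrightarrow> subm R (scal e) T \<Longrightarrow> set us \<subseteq> carrier R \<Longrightarrow> subm R (scal e) (span_over e T K us)"
  by (induction us) (auto intro!: subm_set_add subm_frobenius_image scal_subset)

lemma base_subset_span:
  assumes "idl K" "subm R (scal e) T" "set us \<subseteq> carrier R"
  shows "T \<subseteq> span_over e T K us"
  using assms(3)
proof (induction us)
  case (Cons u us)
  then have "span_over e T K us \<subseteq> span_over e T K (u # us)"
    using set_add_upper2[OF subm_frobenius_image[OF assms(1)] subm_carr[OF subm_span[OF assms(1,2)]]] by auto
  then show ?case using Cons by auto
qed simp

lemma span_mem:
  assumes "idl K" "subm R (scal e) T" "set us \<subseteq> carrier R" "u \<in> set us" "a \<in> K"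
  shows "a [^] (p ^ e) \<otimes> u \<in> span_over e T K us"
  using assms(3,4)
proof (induction us)
  case (Cons v us)
  have i: "subm R (scal e) ((\<lambda>a. a [^] (p ^ e) \<otimes> v) ` K)" "subm R (scal e) (span_over e T K us)"
    using Cons assms by (auto intro: subm_frobenius_image subm_span)
  show ?case
  proof (cases "u = v")
    case True
    then show ?thesis using set_add_upper1[OF i(2) subm_carr[OF i(1)]] assms(5) by auto
  next
    case False
    then show ?thesis using set_add_upper2[OF i(1) subm_carr[OF i(2)]] Cons by auto
  qed
qed simp

lemma span_le:
  assumes "subm R S C" "T \<subseteq> C" "\<And>u a. u \<in> set us \<Longrightarrow> a \<in> K \<Longrightarrow> a [^] (p ^ e) \<otimes> u \<in> C"
  shows "span_over e T K us \<subseteq> C"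
  using assms(3)
proof (induction us)
  case (Cons u us)
  then show ?case unfolding span_over.simps by (intro set_add_le[OF assms(1)]) auto
qed (use assms(2) in simp)

lemma span_mono:
  assumes "idl K'" "subm R (scal e) T" "set us \<subseteq> carrier R" "K \<subseteq> K'"
  shows "span_over e T K us \<subseteq> span_over e T K' us"
  by (rule span_le[OF subm_span[OF assms(1-3)] base_subset_span[OF assms(1-3)]])
    (use span_mem[OF assms(1-3)] assms(4) in auto)

lemma len_frobenius_image:
  assumes "u \<in> carrier R" "subm R (scal e) N"
  shows "len R (scal e) ((\<lambda>a. a [^] (p ^ e) \<otimes> u) ` carrier R <+> N) N = clen {a \<in> carrier R. a [^] (p ^ e) \<otimes> u \<in> N}"
  unfolding clen_def by (rule len_image[OF semilinear_frobenius[OF assms(1)] idl_carrier assms(2) scal_subset])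

text \<open>Each generator contributes a cyclic module killed by \<open>K\<close>.\<close>

lemma len_span_le:
  assumes N: "subm R (scal e) N" and K: "idl K" and us: "set us \<subseteq> carrier R"
    and KN: "\<And>a x. a \<in> K \<Longrightarrow> x \<in> carrier R \<Longrightarrow> a [^] (p ^ e) \<otimes> x \<in> N"
  shows "len R (scal e) (span_over e N (carrier R) us) N \<le> of_nat (length us) * clen K"
  using us
proof (induction us)
  case Nil
  then show ?case by (simp add: len_self)
next
  case (Cons u us)
  let ?M = "span_over e N (carrier R) us" and ?i = "(\<lambda>a. a [^] (p ^ e) \<otimes> u) ` carrier R"
  have uc: "u \<in> carrier R" "set us \<subseteq> carrier R" using Cons.prems by auto
  have M: "subm R (scal e) ?M" using subm_span[OF idl_carrier N uc(2)] .
  have i: "subm R (scal e) ?i" using subm_frobenius_image[OF idl_carrier uc(1)] .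
  have NM: "N \<subseteq> ?M" using base_subset_span[OF idl_carrier N uc(2)] .
  have "len R (scal e) (?i <+> ?M) N = len R (scal e) (?i <+> ?M) ?M + len R (scal e) ?M N"
    by (rule len_additive[OF subm_set_add[OF i M scal_subset] M N scal_subset
      set_add_upper2[OF i subm_carr[OF M]] NM])
  moreover have "len R (scal e) (?i <+> ?M) ?M \<le> clen K"
    unfolding len_frobenius_image[OF uc(1) M] unfolding clen_def
    by (rule len_mono) (use KN NM uc subm_mem[OF K] in auto)
  ultimately have "len R (scal e) (?i <+> ?M) N \<le> clen K + of_nat (length us) * clen K"
    using Cons uc by (simp add: add_mono)
  then show ?case by (simp add: distrib_right)
qed

lemma frobenius_diff:
  assumes "a \<in> carrier R" "b \<in> carrier R"
  shows "(a \<ominus> b) [^] (p ^ e) = a [^] (p ^ e) \<ominus> b [^] (p ^ e)"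
  using assms by (simp add: a_minus_def frobenius_add frobenius_neg)

text \<open>Modulo \<open>T\<close> the span of \<open>us\<close> is free over \<open>R/P\<close>:
  \<open>P\<close> kills it, and independence allows no other relation. Reduction modulo
  \<open>J\<close> leaves one copy of \<open>R/(P + J)\<close> for each element.\<close>

lemma len_independent_span:
  assumes P: "idl P" and J: "idl J" and T: "subm R (scal e) T" and us: "set us \<subseteq> carrier R"
    and PT: "\<And>a x. a \<in> P \<Longrightarrow> x \<in> carrier R \<Longrightarrow> a [^] (p ^ e) \<otimes> x \<in> T"
    and ind: "independent_over e T P us"
  shows "len R (scal e) (span_over e T (carrier R) us) (span_over e T J us) = of_nat (length us) * clen (P <+> J)"
  using us ind
proof (induction us)
  case Nil
  then show ?case by (simp add: len_self)
next
  case (Cons u us)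
  let ?f = "\<lambda>a. a [^] (p ^ e) \<otimes> u"
  let ?M = "span_over e T (carrier R) us" and ?D = "span_over e T J us"
  let ?R = "?f ` carrier R" and ?J = "?f ` J"
  have uc: "u \<in> carrier R" "set us \<subseteq> carrier R" using Cons.prems by auto
  have ind: "independent_over e T P us" "\<And>a. a \<in> carrier R \<Longrightarrow> ?f a \<in> ?M \<Longrightarrow> a \<in> P" using Cons.prems by auto
  have M: "subm R (scal e) ?M" using subm_span[OF idl_carrier T uc(2)] .
  have D: "subm R (scal e) ?D" using subm_span[OF J T uc(2)] .
  have DM: "?D \<subseteq> ?M" using span_mono[OF idl_carrier T uc(2) subm_carr[OF J]] .
  have TD: "T \<subseteq> ?D" using base_subset_span[OF J T uc(2)] .
  have r: "subm R (scal e) ?R" using subm_frobenius_image[OF idl_carrier uc(1)] .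
  have j: "subm R (scal e) ?J" using subm_frobenius_image[OF J uc(1)] .
  have jr: "?J \<subseteq> ?R" using subm_carr[OF J] by auto
  have jM: "subm R (scal e) (?J <+> ?M)" using subm_set_add[OF j M scal_subset] .
  have rM: "subm R (scal e) (?R <+> ?M)" using subm_set_add[OF r M scal_subset] .
  have jD: "subm R (scal e) (?J <+> ?D)" using subm_set_add[OF j D scal_subset] .
  have "len R (scal e) (?R <+> ?M) (?J <+> ?D) = len R (scal e) (?R <+> ?M) (?J <+> ?M) + len R (scal e) (?J <+> ?M) (?J <+> ?D)"
    by (rule len_additive[OF rM jM jD scal_subset set_add_mono[OF jr subset_refl] set_add_mono[OF subset_refl DM]])
  moreover have "len R (scal e) (?R <+> ?M) (?J <+> ?M) = clen (P <+> J)"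
  proof -
    have "?R <+> ?M = ?R <+> (?J <+> ?M)"
    proof
      show "?R <+> ?M \<subseteq> ?R <+> (?J <+> ?M)"
        by (rule set_add_mono[OF subset_refl set_add_upper2[OF j subm_carr[OF M]]])
      show "?R <+> (?J <+> ?M) \<subseteq> ?R <+> ?M"
        by (intro set_add_le[OF rM] set_add_mono jr subset_refl set_add_upper1[OF M subm_carr[OF r]])
    qed
    then have "len R (scal e) (?R <+> ?M) (?J <+> ?M) = clen {a \<in> carrier R. ?f a \<in> ?J <+> ?M}"
      using len_frobenius_image[OF uc(1) jM] by simp
    also have "{a \<in> carrier R. ?f a \<in> ?J <+> ?M} = P <+> J"
    proof
      show "{a \<in> carrier R. ?f a \<in> ?J <+> ?M} \<subseteq> P <+> J"
      proof
        fix a assume "a \<in> {a \<in> carrier R. ?f a \<in> ?J <+> ?M}"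
        then have a: "a \<in> carrier R" "?f a \<in> ?J <+> ?M" by auto
        then obtain y m where "?f a = y \<oplus> m" "y \<in> ?J" "m \<in> ?M" unfolding mem_set_add[of "?f a"] by blast
        with a(1) obtain b where b: "a \<in> carrier R" "?f a = ?f b \<oplus> m" "b \<in> J" "m \<in> ?M" by blast
        have c: "b \<in> carrier R" "m \<in> carrier R" using b subm_mem[OF J] subm_mem[OF M] by auto
        have "?f (a \<ominus> b) = ?f a \<ominus> ?f b"
          unfolding frobenius_diff[OF b(1) c(1)] using b(1) c uc by (simp add: a_minus_def l_distr l_minus)
        also have "\<dots> = m"
        proof -
          have "(w \<oplus> m) \<ominus> w = m" if "w \<in> carrier R" for w using that c(2) by algebra
          then show ?thesis unfolding b(2) using c uc by simp
        qed
        finally have "a \<ominus> b \<in> P" using ind(2)[of "a \<ominus> b"] b c by simp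
        moreover have "a = (a \<ominus> b) \<oplus> b" using b c by algebra
        ultimately show "a \<in> P <+> J" using b unfolding mem_set_add by blast
      qed
      show "P <+> J \<subseteq> {a \<in> carrier R. ?f a \<in> ?J <+> ?M}"
      proof
        fix a assume "a \<in> P <+> J"
        then obtain s b where sb: "a = s \<oplus> b" "s \<in> P" "b \<in> J" by (auto simp: mem_set_add)
        have c: "s \<in> carrier R" "b \<in> carrier R" using sb subm_mem[OF P] subm_mem[OF J] by auto
        have "?f s \<in> ?M" using PT[OF sb(2) uc(1)] TD DM by auto
        moreover have "?f a = ?f b \<oplus> ?f s" using sb c uc by (simp add: frobenius_add l_distr a_comm)
        ultimately have "?f a \<in> ?J <+> ?M" using sb(3) unfolding mem_set_add by blast
        then show "a \<in> {a \<in> carrier R. ?f a \<in> ?J <+> ?M}" using sb c by simp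
      qed
    qed
    finally show ?thesis .
  qed
  moreover have "len R (scal e) (?J <+> ?M) (?J <+> ?D) = len R (scal e) ?M ?D"
  proof -
    have "?J <+> ?M = ?M <+> (?J <+> ?D)"
    proof
      show "?J <+> ?M \<subseteq> ?M <+> (?J <+> ?D)"
        using set_add_upper1[OF D subm_carr[OF j]] set_add_upper2[OF M subm_carr[OF jD]]
          set_add_upper1[OF jD subm_carr[OF M]]
        by (intro set_add_le[OF subm_set_add[OF M jD scal_subset]]) blast+
      show "?M <+> (?J <+> ?D) \<subseteq> ?J <+> ?M"
        by (intro set_add_le[OF jM] set_add_mono DM subset_refl set_add_upper2[OF j subm_carr[OF M]])
    qed
    then have "len R (scal e) (?J <+> ?M) (?J <+> ?D) = len R (scal e) ?M (?M \<inter> (?J <+> ?D))"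
      using len_set_add[OF M jD scal_subset] by simp
    also have "?M \<inter> (?J <+> ?D) = ?D"
    proof
      show "?D \<subseteq> ?M \<inter> (?J <+> ?D)" using DM set_add_upper2[OF j subm_carr[OF D]] by auto
      show "?M \<inter> (?J <+> ?D) \<subseteq> ?D"
      proof
        fix x assume x: "x \<in> ?M \<inter> (?J <+> ?D)"
        then have "x \<in> ?J <+> ?D" by simp
        then obtain y z where "x = y \<oplus> z" "y \<in> ?J" "z \<in> ?D" unfolding mem_set_add[of x] by blast
        then obtain b where bz: "x = ?f b \<oplus> z" "b \<in> J" "z \<in> ?D" by blast
        have bc: "b \<in> carrier R" using bz subm_mem[OF J] by auto
        have "?f b \<in> ?M" using subm_add_cancel[OF M, of "?f b" z] bz x DM bc uc by auto
        then have "b \<in> P" using ind(2) bc by auto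
        then have "?f b \<in> ?D" using PT[OF _ uc(1)] TD by auto
        then show "x \<in> ?D" using bz subm_add[OF D] by auto
      qed
    qed
    finally show ?thesis .
  qed
  ultimately show ?case using Cons uc ind by (simp add: distrib_right)
qed

text \<open>The generators are tested one by one. If \<open>b\<close> is dependent, a witness
  \<open>a\<close> outside \<open>P\<close> is multiplied into the common denominator
  \<open>c\<close>, which stays outside \<open>P\<close> because \<open>P\<close> is prime.\<close>

lemma independent_exists:
  assumes P: "primeideal P R" and T: "subm R (scal e) T" and bs: "set bs \<subseteq> carrier R"
  shows "\<exists>us c. set us \<subseteq> carrier R \<and> independent_over e T P us \<and> c \<in> carrier R \<and> c \<notin> P \<and>
    (\<forall>b\<in>set bs. c [^] (p ^ e) \<otimes> b \<in> span_over e T (carrier R) us)"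
  using bs
proof (induction bs)
  case Nil
  have "\<one> \<notin> P" using idl_one[OF primeideal_idl[OF P]] primeideal_ne[OF P] by auto
  then show ?case by (intro exI[of _ "[]"] exI[of _ \<one>]) auto
next
  case (Cons b bs)
  then obtain us c where us: "set us \<subseteq> carrier R" "independent_over e T P us"
    and c: "c \<in> carrier R" "c \<notin> P" "\<And>b. b \<in> set bs \<Longrightarrow> c [^] (p ^ e) \<otimes> b \<in> span_over e T (carrier R) us" by auto
  have bc: "b \<in> carrier R" using Cons.prems by auto
  have M: "subm R (scal e) (span_over e T (carrier R) us)" using subm_span[OF idl_carrier T us(1)] .
  show ?case
  proof (cases "\<forall>a\<in>carrier R. a [^] (p ^ e) \<otimes> b \<in> span_over e T (carrier R) us \<longrightarrow> a \<in> P")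
    case True
    have us': "set (b # us) \<subseteq> carrier R" using us bc by auto
    have sub: "span_over e T (carrier R) us \<subseteq> span_over e T (carrier R) (b # us)"
      using set_add_upper2[OF subm_frobenius_image[OF idl_carrier bc] subm_carr[OF M]] by simp
    have "c [^] (p ^ e) \<otimes> b \<in> span_over e T (carrier R) (b # us)"
      by (rule span_mem[OF idl_carrier T us' _ c(1)]) simp
    then have "\<forall>b'\<in>set (b # bs). c [^] (p ^ e) \<otimes> b' \<in> span_over e T (carrier R) (b # us)"
      using c(3) sub by auto
    moreover have "independent_over e T P (b # us)" using us True by simp
    ultimately show ?thesis using us' c by blast
  next
    case False
    then obtain a where a: "a \<in> carrier R" "a \<notin> P" "a [^] (p ^ e) \<otimes> b \<in> span_over e T (carrier R) us" by auto
    have "(a \<otimes> c) [^] (p ^ e) \<otimes> b' \<in> span_over e T (carrier R) us" if b': "b' \<in> set (b # bs)" for b'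
    proof (cases "b' = b")
      case True
      have "c [^] (p ^ e) \<otimes> (a [^] (p ^ e) \<otimes> b) \<in> span_over e T (carrier R) us"
        using c by (intro subm_mult[OF M _ a(3)]) (auto simp: scal_def)
      then show ?thesis using True a c bc by (simp add: nat_pow_distrib m_ac)
    next
      case False
      then have b'': "b' \<in> set bs" "b' \<in> carrier R" using b' Cons.prems by auto
      have "a [^] (p ^ e) \<otimes> (c [^] (p ^ e) \<otimes> b') \<in> span_over e T (carrier R) us"
        using a by (intro subm_mult[OF M _ c(3)[OF b''(1)]]) (auto simp: scal_def)
      then show ?thesis using b'' a c by (simp add: nat_pow_distrib m_ac)
    qed
    moreover have "a \<otimes> c \<notin> P" using primeideal_mult[OF P a(1) c(1)] a c by auto
    ultimately show ?thesis using us a c by (metis m_closed)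
  qed
qed

text \<open>A maximal independent family of \<open>r\<close> elements embeds \<open>(R/P)^r\<close> into \<open>R/T\<close>, seen through the Frobenius,
  and \<open>c\<close> maps \<open>R/T\<close> back into it. Both cokernels are killed by \<open>c\<close>, whence the error terms.\<close>

lemma frobenius_len_bounds:
  assumes F: "F_finite R p" and P: "primeideal P R" and T: "idl T" and PT: "\<And>a. a \<in> P \<Longrightarrow> a [^] (p ^ e) \<in> T"
  shows "\<exists>r s :: nat. \<exists>c\<in>carrier R - P. \<forall>J. idl J \<longrightarrow>
    len R (scal e) (carrier R) (T <+> frob_pow R J (p ^ e))
      \<le> of_nat r * clen (P <+> J) + of_nat s * clen (prin c <+> (P <+> J)) \<and>
    of_nat r * clen (P <+> J)
      \<le> of_nat r * clen (prin c <+> (P <+> J)) + len R (scal e) (carrier R) (T <+> frob_pow R J (p ^ e))"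
proof -
  let ?S = "scal e" and ?q = "p ^ e"
  have S: "?S \<subseteq> carrier R" by (rule scal_subset)
  have iP: "idl P" using primeideal_idl[OF P] .
  have sT: "subm R ?S T" by (rule subm_scalars[OF T S])
  have PT': "a [^] ?q \<otimes> x \<in> T" if "a \<in> P" "x \<in> carrier R" for a x
    using idl_mult2[OF T that(2) PT[OF that(1)]] .
  obtain bs where bs: "set bs \<subseteq> carrier R" "\<And>N. subm R ?S N \<Longrightarrow> set bs \<subseteq> N \<Longrightarrow> N = carrier R"
    using scal_generators[OF F, of e] by blast
  obtain us c where us: "set us \<subseteq> carrier R" "independent_over e T P us"
    and c: "c \<in> carrier R" "c \<notin> P" "\<And>b. b \<in> set bs \<Longrightarrow> c [^] ?q \<otimes> b \<in> span_over e T (carrier R) us"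
    using independent_exists[OF P sT bs(1)] by blast
  let ?M = "span_over e T (carrier R) us"
  have M: "subm R ?S ?M" using subm_span[OF idl_carrier sT us(1)] .
  have TM: "T \<subseteq> ?M" using base_subset_span[OF idl_carrier sT us(1)] .
  have cq: "c [^] ?q \<in> carrier R" using c by simp
  \<comment> \<open>The colon of \<open>?M\<close> by \<open>c^q\<close> is a submodule over the
    \<open>q\<close>-th powers, so containing the generators \<open>bs\<close> makes it
    everything.\<close>
  have "{x \<in> carrier R. c [^] ?q \<otimes> x \<in> ?M} = carrier R"
    by (rule bs(2)[OF subm_colon[OF subm_carrier[OF S] M cq S]]) (use bs(1) c in auto)
  then have cM: "c [^] ?q \<otimes> x \<in> ?M" if "x \<in> carrier R" for x using that by auto
  have main: "len R ?S (carrier R) (T <+> frob_pow R J ?q)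
      \<le> of_nat (length us) * clen (P <+> J) + of_nat (length bs) * clen (prin c <+> (P <+> J)) \<and>
    of_nat (length us) * clen (P <+> J)
      \<le> of_nat (length us) * clen (prin c <+> (P <+> J)) + len R ?S (carrier R) (T <+> frob_pow R J ?q)"
    if J: "idl J" for J
  proof -
    let ?K = "prin c <+> (P <+> J)" and ?F = "frob_pow R J ?q"
    let ?X = "T <+> ?F" and ?D = "span_over e T J us"
    have ic: "idl (prin c)" using c by auto
    have iPJ: "idl (P <+> J)" using iP J by auto
    have K: "idl ?K" using ic iPJ by auto
    have iF: "idl ?F" using idl_frob[OF subm_carr[OF J]] .
    have X: "idl ?X" using T iF by auto
    have sX: "subm R ?S ?X" by (rule subm_scalars[OF X S])
    have TX: "T \<subseteq> ?X" by (rule set_add_upper1[OF iF subm_carr[OF T]])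
    have FX: "?F \<subseteq> ?X" by (rule set_add_upper2[OF T subm_carr[OF iF]])
    have D: "subm R ?S ?D" using subm_span[OF J sT us(1)] .
    have DM: "?D \<subseteq> ?M" using span_mono[OF idl_carrier sT us(1) subm_carr[OF J]] .
    have TD: "T \<subseteq> ?D" using base_subset_span[OF J sT us(1)] .
    have DX: "?D \<subseteq> ?X"
    proof (rule span_le[OF X TX])
      fix u a assume u: "u \<in> set us" and a: "a \<in> J"
      have "a [^] ?q \<in> ?X" using frob_mem[OF subm_carr[OF J] a] FX by auto
      then show "a [^] ?q \<otimes> u \<in> ?X" using idl_mult2[OF X] u us by auto
    qed
    have MD: "len R ?S ?M ?D = of_nat (length us) * clen (P <+> J)"
      by (rule len_independent_span[OF iP J sT us(1) PT' us(2)])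
    have MX: "subm R ?S (?M <+> ?X)" by (rule subm_set_add[OF M sX S])
    have XMX: "?X \<subseteq> ?M <+> ?X" by (rule set_add_upper2[OF M subm_carr[OF X]])
    have MMX: "?M \<subseteq> ?M <+> ?X" by (rule set_add_upper1[OF sX subm_carr[OF M]])
    have K_elim: "\<exists>a s j. k = c \<otimes> a \<oplus> (s \<oplus> j) \<and> a \<in> carrier R \<and> s \<in> P \<and> j \<in> J" if k: "k \<in> ?K" for k
    proof -
      obtain y z where yz: "k = y \<oplus> z" "y \<in> prin c" "z \<in> P <+> J" using k unfolding mem_set_add[of k] by blast
      obtain s j where sj: "z = s \<oplus> j" "s \<in> P" "j \<in> J" using yz(3) unfolding mem_set_add[of z] by blast
      obtain a where "y = c \<otimes> a" "a \<in> carrier R" using yz(2) by blast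
      then show ?thesis using yz(1) sj by blast
    qed
    \<comment> \<open>The cokernel \<open>R/(?M + ?X)\<close> is killed by \<open>c\<close>,
      \<open>P\<close> and \<open>J\<close>, hence by \<open>?K\<close>; it has
      \<open>length bs\<close> generators.\<close>
    have KX: "k [^] ?q \<otimes> x \<in> ?M <+> ?X" if k: "k \<in> ?K" and x: "x \<in> carrier R" for k x
    proof -
      obtain a s j where asj: "k = c \<otimes> a \<oplus> (s \<oplus> j)" "a \<in> carrier R" "s \<in> P" "j \<in> J" using K_elim[OF k] by blast
      have cs: "s \<in> carrier R" "j \<in> carrier R" using asj subm_mem[OF iP] subm_mem[OF J] by auto
      have "k [^] ?q \<otimes> x = c [^] ?q \<otimes> (a [^] ?q \<otimes> x) \<oplus> (s [^] ?q \<otimes> x \<oplus> j [^] ?q \<otimes> x)"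
        using asj cs c x by (simp add: frobenius_add nat_pow_distrib l_distr m_assoc)
      moreover have "c [^] ?q \<otimes> (a [^] ?q \<otimes> x) \<in> ?M" using cM asj x by simp
      moreover have "s [^] ?q \<otimes> x \<in> ?X" using PT'[OF asj(3) x] TX by auto
      moreover have "j [^] ?q \<otimes> x \<in> ?X" using idl_mult2[OF X x] frob_mem[OF subm_carr[OF J] asj(4)] FX by auto
      ultimately show ?thesis using subm_add[OF X] unfolding mem_set_add[of "k [^] ?q \<otimes> x"] by blast
    qed
    have "b \<in> span_over e (?M <+> ?X) (carrier R) bs" if "b \<in> set bs" for b
      using span_mem[OF idl_carrier MX bs(1) that one_closed] that bs(1) by auto
    then have "span_over e (?M <+> ?X) (carrier R) bs = carrier R"
      by (intro bs(2)[OF subm_span[OF idl_carrier MX bs(1)]]) auto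
    then have 1: "len R ?S (carrier R) (?M <+> ?X) \<le> of_nat (length bs) * clen ?K"
      using len_span_le[OF MX K bs(1) KX] by simp
    have 0: "len R ?S (?M <+> ?X) ?X \<le> len R ?S ?M ?D"
      unfolding len_set_add[OF M sX S] by (rule len_mono) (use DM DX in auto)
    have "len R ?S (carrier R) ?X = len R ?S (carrier R) (?M <+> ?X) + len R ?S (?M <+> ?X) ?X"
      by (rule len_additive[OF subm_carrier[OF S] MX sX S subm_carr[OF MX] XMX])
    then have upper: "len R ?S (carrier R) ?X
        \<le> of_nat (length us) * clen (P <+> J) + of_nat (length bs) * clen ?K"
      using add_mono[OF 1 0] MD by (simp add: add.commute)
    let ?C = "(\<lambda>x. c [^] ?q \<otimes> x) ` carrier R"
    have sC: "subm R ?S ?C" by (rule subm_mult_image[OF subm_carrier[OF S] cq S])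
    have CD: "subm R ?S (?C <+> ?D)" by (rule subm_set_add[OF sC D S])
    have CCD: "?C \<subseteq> ?C <+> ?D" by (rule set_add_upper1[OF D subm_carr[OF sC]])
    have DCD: "?D \<subseteq> ?C <+> ?D" by (rule set_add_upper2[OF sC subm_carr[OF D]])
    have CDM: "?C <+> ?D \<subseteq> ?M" using cM DM by (intro set_add_le[OF M]) auto
    have "len R ?S (?C <+> ?D) ?D = len R ?S (carrier R) {x \<in> carrier R. c [^] ?q \<otimes> x \<in> ?D}"
      by (rule len_image[OF semilinear_mult[OF cq S] subm_carrier[OF S] D S])
    also have "\<dots> \<le> len R ?S (carrier R) ?X"
    proof (rule len_mono[OF subset_refl])
      \<comment> \<open>\<open>?D\<close> is closed only under \<open>q\<close>-th powers as
        scalars, whereas the Frobenius power of \<open>J\<close> is a full ideal. Asking for all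
        multiples \<open>y x\<close> gives an ideal, so that testing the generators
        \<open>j^q\<close> is enough.\<close>
      have "idl {y \<in> carrier R. \<forall>x\<in>carrier R. c [^] ?q \<otimes> (y \<otimes> x) \<in> ?D}"
      proof (rule submI)
        show "\<zero> \<in> {y \<in> carrier R. \<forall>x\<in>carrier R. c [^] ?q \<otimes> (y \<otimes> x) \<in> ?D}" using cq subm_zero[OF D] by simp
        fix y assume y: "y \<in> {y \<in> carrier R. \<forall>x\<in>carrier R. c [^] ?q \<otimes> (y \<otimes> x) \<in> ?D}"
        show "\<ominus> y \<in> {y \<in> carrier R. \<forall>x\<in>carrier R. c [^] ?q \<otimes> (y \<otimes> x) \<in> ?D}"
          using y cq subm_neg[OF D] by (simp add: l_minus r_minus)
        show "y \<oplus> z \<in> {y \<in> carrier R. \<forall>x\<in>carrier R. c [^] ?q \<otimes> (y \<otimes> x) \<in> ?D}"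
          if "z \<in> {y \<in> carrier R. \<forall>x\<in>carrier R. c [^] ?q \<otimes> (y \<otimes> x) \<in> ?D}" for z
          using y that cq subm_add[OF D] by (simp add: l_distr r_distr)
        show "s \<otimes> y \<in> {y \<in> carrier R. \<forall>x\<in>carrier R. c [^] ?q \<otimes> (y \<otimes> x) \<in> ?D}" if "s \<in> carrier R" for s
        proof -
          have "s \<otimes> y \<otimes> x = y \<otimes> (s \<otimes> x)" if "x \<in> carrier R" for x
            using that \<open>s \<in> carrier R\<close> y by (simp add: m_ac)
          then show ?thesis using y that by auto
        qed
      qed auto
      moreover have "j [^] ?q \<in> {y \<in> carrier R. \<forall>x\<in>carrier R. c [^] ?q \<otimes> (y \<otimes> x) \<in> ?D}" if j: "j \<in> J" for j
      proof -
        have jc: "j \<in> carrier R" using j subm_mem[OF J] by auto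
        have jM: "?M \<subseteq> {m \<in> carrier R. j [^] ?q \<otimes> m \<in> ?D}"
        proof (rule span_le[OF subm_colon[OF subm_carrier[OF S] D _ S]])
          show "j [^] ?q \<in> carrier R" using jc by simp
          show "T \<subseteq> {m \<in> carrier R. j [^] ?q \<otimes> m \<in> ?D}"
            using TD idl_mult[OF T, of "j [^] ?q"] jc subm_mem[OF T] by auto
          fix u a assume u: "u \<in> set us" and a: "a \<in> carrier R"
          have "(j \<otimes> a) [^] ?q \<otimes> u \<in> ?D"
            by (rule span_mem[OF J sT us(1) u idl_mult2[OF J a j]])
          then show "a [^] ?q \<otimes> u \<in> {m \<in> carrier R. j [^] ?q \<otimes> m \<in> ?D}"
            using a u us jc by (auto simp: nat_pow_distrib m_assoc)
        qed
        have "c [^] ?q \<otimes> (j [^] ?q \<otimes> x) \<in> ?D" if x: "x \<in> carrier R" for x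
        proof -
          have "j [^] ?q \<otimes> (c [^] ?q \<otimes> x) \<in> ?D" using jM cM[OF x] by auto
          then show ?thesis using jc cq x by (simp add: m_lcomm)
        qed
        then show ?thesis using jc by simp
      qed
      ultimately have "?F \<subseteq> {y \<in> carrier R. \<forall>x\<in>carrier R. c [^] ?q \<otimes> (y \<otimes> x) \<in> ?D}" by (rule frob_le)
      then have "?F \<subseteq> {x \<in> carrier R. c [^] ?q \<otimes> x \<in> ?D}" by (fastforce dest: bspec[OF _ one_closed])
      moreover have "T \<subseteq> {x \<in> carrier R. c [^] ?q \<otimes> x \<in> ?D}" using idl_mult[OF T cq] TD subm_mem[OF T] by auto
      ultimately show "?X \<subseteq> {x \<in> carrier R. c [^] ?q \<otimes> x \<in> ?D}"
        by (intro set_add_le[OF subm_colon[OF subm_carrier[OF S] D cq S]])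
    qed
    finally have 2: "len R ?S (?C <+> ?D) ?D \<le> len R ?S (carrier R) ?X" .
    \<comment> \<open>What remains of the span \<open>?M\<close> modulo \<open>c^q R + ?D\<close> is
      bounded by \<open>length us\<close> copies of \<open>R/?K\<close>.\<close>
    have "span_over e T ?K us \<subseteq> ?C <+> ?D"
    proof (rule span_le[OF CD])
      show "T \<subseteq> ?C <+> ?D" using TD DCD by auto
      fix u k assume u: "u \<in> set us" and k: "k \<in> ?K"
      have uc: "u \<in> carrier R" using u us by auto
      obtain a s j where asj: "k = c \<otimes> a \<oplus> (s \<oplus> j)" "a \<in> carrier R" "s \<in> P" "j \<in> J" using K_elim[OF k] by blast
      have cs: "s \<in> carrier R" "j \<in> carrier R" using asj subm_mem[OF iP] subm_mem[OF J] by auto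
      have "k [^] ?q \<otimes> u = c [^] ?q \<otimes> (a [^] ?q \<otimes> u) \<oplus> (s [^] ?q \<otimes> u \<oplus> j [^] ?q \<otimes> u)"
        using asj cs c uc by (simp add: frobenius_add nat_pow_distrib l_distr m_assoc)
      moreover have "c [^] ?q \<otimes> (a [^] ?q \<otimes> u) \<in> ?C" using asj uc by simp
      moreover have "s [^] ?q \<otimes> u \<in> ?D" using PT'[OF asj(3) uc] TD by auto
      moreover have "j [^] ?q \<otimes> u \<in> ?D" by (rule span_mem[OF J sT us(1) u asj(4)])
      ultimately show "k [^] ?q \<otimes> u \<in> ?C <+> ?D" using subm_add[OF D] unfolding mem_set_add[of "k [^] ?q \<otimes> u"] by blast
    qed
    then have "len R ?S ?M (?C <+> ?D) \<le> len R ?S ?M (span_over e T ?K us)" by (intro len_mono) auto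
    also have "\<dots> = of_nat (length us) * clen (P <+> ?K)"
      by (rule len_independent_span[OF iP K sT us(1) PT' us(2)])
    also have "P <+> ?K = ?K"
    proof (rule set_add_absorb1[OF iP K])
      show "P \<subseteq> ?K" using set_add_upper1[OF J subm_carr[OF iP]] set_add_upper2[OF ic subm_carr[OF iPJ]] by blast
    qed
    finally have 3: "len R ?S ?M (?C <+> ?D) \<le> of_nat (length us) * clen ?K" .
    have "len R ?S ?M ?D = len R ?S ?M (?C <+> ?D) + len R ?S (?C <+> ?D) ?D"
      by (rule len_additive[OF M CD D S CDM DCD])
    then have "of_nat (length us) * clen (P <+> J) \<le> of_nat (length us) * clen ?K + len R ?S (carrier R) ?X"
      using 2 3 MD by (metis add_mono)
    then show ?thesis using upper by blast
  qed
  have "c \<in> carrier R - P" using c by simp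
  then show ?thesis using main by blast
qed

end

context local_frobenius begin

text \<open>This length is the degree of the residue field over its subfield of \<open>q\<close>-th
  powers, finite because the Frobenius is.\<close>

lemma len_scal_mm: "1 \<le> len R (scal e) (carrier R) \<mm>" "len R (scal e) (carrier R) \<mm> \<noteq> \<infinity>"
proof -
  have s: "subm R (scal e) \<mm>" by (rule subm_scalars[OF idl_mm scal_subset])
  show "1 \<le> len R (scal e) (carrier R) \<mm>"
    using primeideal_ne[OF prime_mm] subm_carr[OF idl_mm] by (intro len_pos subm_carrier s scal_subset) auto
  obtain bs where bs: "set bs \<subseteq> carrier R" "\<And>N. subm R (scal e) N \<Longrightarrow> set bs \<subseteq> N \<Longrightarrow> N = carrier R"
    using scal_generators[OF F_fin, of e] by blast
  have "b \<in> span_over e \<mm> (carrier R) bs" if "b \<in> set bs" for b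
    using span_mem[OF idl_carrier s bs(1) that one_closed] that bs(1) by auto
  then have "span_over e \<mm> (carrier R) bs = carrier R"
    by (intro bs(2)[OF subm_span[OF idl_carrier s bs(1)]]) auto
  moreover have "a [^] (p ^ e) \<otimes> x \<in> \<mm>" if "a \<in> \<mm>" "x \<in> carrier R" for a x
  proof -
    obtain k where k: "p ^ e = Suc k" using p_pow_pos[of e] gr0_conv_Suc by blast
    have ac: "a \<in> carrier R" using subm_mem[OF idl_mm that(1)] .
    then have "(a [^] k \<otimes> x) \<otimes> a \<in> \<mm>" using that by (intro idl_mult[OF idl_mm]) auto
    then show ?thesis unfolding k using ac that by (simp add: m_ac)
  qed
  ultimately have "len R (scal e) (carrier R) \<mm> \<le> of_nat (length bs) * clen \<mm>"
    using len_span_le[OF s idl_mm bs(1)] by simp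
  moreover obtain k where "clen \<mm> = enat k" using cofin_mm by (auto simp: cofin_def)
  ultimately have "len R (scal e) (carrier R) \<mm> \<le> enat (length bs * k)" by (simp add: of_nat_eq_enat)
  then show "len R (scal e) (carrier R) \<mm> \<noteq> \<infinity>" by (cases "len R (scal e) (carrier R) \<mm>") auto
qed

text \<open>All simple factors are copies of \<open>R/\<mm>\<close>, so changing scalars multiplies
  every length by the same residue degree. The induction splits off the lowest factor
  \<open>B1/B\<close>.\<close>

lemma len_scal_eq:
  assumes "idl A" "idl B" "B \<subseteq> A" "len R (carrier R) A B = enat k"
  shows "len R (scal e) A B = of_nat k * len R (scal e) (carrier R) \<mm>"
  using assms
proof (induction k arbitrary: B)
  case 0
  have "B = A"
  proof (rule ccontr)
    assume "B \<noteq> A"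
    then have "1 \<le> len R (carrier R) A B" using 0 by (intro len_pos) auto
    then show False using 0(4) by (simp add: one_enat_def)
  qed
  then show ?case by (simp add: len_self)
next
  case (Suc k)
  obtain C where C: "strict_chain {N. idl N \<and> B \<subseteq> N \<and> N \<subseteq> A} (Suc k) C"
    using le_len_iff[OF Suc.prems(1,3), of "Suc k"] Suc.prems(4) by auto
  define B1 where "B1 = C 1"
  have Ci: "idl (C i)" "B \<subseteq> C i" "C i \<subseteq> A" if "i \<le> Suc k" for i using C that by (auto simp: strict_chain_def)
  have B1: "idl B1" "B \<subset> B1" "B1 \<subseteq> A"
    using Ci[of 0] Ci[of 1] C unfolding B1_def strict_chain_def by auto
  have mono: "C 1 \<subseteq> C (Suc i)" if "i \<le> k" for i
    using that
  proof (induction i)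
    case (Suc i)
    have "C (Suc i) \<subset> C (Suc (Suc i))" using C Suc.prems by (auto simp: strict_chain_def)
    then show ?case using Suc by auto
  qed simp
  have "strict_chain {N. idl N \<and> B1 \<subseteq> N \<and> N \<subseteq> A} k (\<lambda>i. C (Suc i))"
    unfolding strict_chain_def B1_def
  proof (intro conjI allI impI)
    show "C (Suc i) \<in> {N. idl N \<and> C 1 \<subseteq> N \<and> N \<subseteq> A}" if "i \<le> k" for i using Ci[of "Suc i"] mono that by auto
    show "C (Suc i) \<subset> C (Suc (Suc i))" if "i < k" for i using C that by (auto simp: strict_chain_def)
  qed
  then have "enat k \<le> len R (carrier R) A B1" unfolding len_def by (rule strict_chain_imp_le)
  moreover have sum: "len R (carrier R) A B = len R (carrier R) A B1 + len R (carrier R) B1 B"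
    by (rule len_additive[OF Suc.prems(1) B1(1) Suc.prems(2) subset_refl B1(3)]) (use B1 in auto)
  moreover have "1 \<le> len R (carrier R) B1 B" by (rule len_pos[OF B1(1) Suc.prems(2) B1(2)])
  ultimately have l: "len R (carrier R) A B1 = enat k" "len R (carrier R) B1 B = 1"
    using Suc.prems(4) by (cases "len R (carrier R) A B1"; cases "len R (carrier R) B1 B"; auto simp: one_enat_def)+
  obtain u where u: "u \<in> B1" "u \<notin> B" using B1 by auto
  have uc: "u \<in> carrier R" using u subm_mem[OF B1(1)] by auto
  have simple: "N = B \<or> N = B1" if "idl N" "B \<subseteq> N" "N \<subseteq> B1" for N
  proof (rule ccontr)
    assume "\<not> ?thesis"
    then have "1 \<le> len R (carrier R) B1 N" "1 \<le> len R (carrier R) N B"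
      using that Suc.prems(2) B1 by (auto intro!: len_pos)
    moreover have "len R (carrier R) B1 B = len R (carrier R) B1 N + len R (carrier R) N B"
      by (rule len_additive[OF B1(1) that(1) Suc.prems(2) subset_refl that(3,2)])
    ultimately show False using l(2)
      by (cases "len R (carrier R) B1 N"; cases "len R (carrier R) N B"; auto simp: one_enat_def)
  qed
  have iu: "idl (prin u)" using uc by auto
  have uB: "prin u <+> B = B1"
  proof -
    have "prin u <+> B \<subseteq> B1" using prin_le[OF B1(1) u(1)] B1 by (intro set_add_le[OF B1(1)]) auto
    moreover have "B \<subseteq> prin u <+> B" "u \<in> prin u <+> B"
      using set_add_upper2[OF iu subm_carr[OF Suc.prems(2)]] set_add_upper1[OF Suc.prems(2) subm_carr[OF iu]] mem_prin[OF uc] by auto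
    ultimately show ?thesis using simple[OF idl_set_add[OF iu Suc.prems(2)]] u by auto
  qed
  let ?D = "{a \<in> carrier R. u \<otimes> a \<in> B}"
  have iD: "idl ?D" by (rule idl_colon[OF idl_carrier Suc.prems(2) uc])
  have lD: "len R (carrier R) (carrier R) ?D = 1"
    using clen_map[OF idl_carrier Suc.prems(2) uc] uB l by simp
  \<comment> \<open>The annihilator of a generator of the simple factor has colength one.\<close>
  have "maximalideal ?D R"
  proof (rule maximalidealI)
    show "ideal ?D R" using iD ideal_iff_subm by auto
    have "\<one> \<notin> ?D" using u uc by simp
    then show "carrier R \<noteq> ?D" by blast
    fix N assume "ideal N R" "?D \<subseteq> N" "N \<subseteq> carrier R"
    then have N: "idl N" "?D \<subseteq> N" "N \<subseteq> carrier R" using ideal_iff_subm by auto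
    show "N = ?D \<or> N = carrier R"
    proof (rule ccontr)
      assume "\<not> ?thesis"
      then have "1 \<le> len R (carrier R) (carrier R) N" "1 \<le> len R (carrier R) N ?D"
        using N iD by (auto intro!: len_pos)
      moreover have "len R (carrier R) (carrier R) ?D = len R (carrier R) (carrier R) N + len R (carrier R) N ?D"
        by (rule len_additive[OF idl_carrier N(1) iD subset_refl N(3,2)])
      ultimately show False using lD
        by (cases "len R (carrier R) (carrier R) N"; cases "len R (carrier R) N ?D"; auto simp: one_enat_def)
    qed
  qed
  then have D: "?D = \<mm>" by (rule max_unique)
  have S: "scal e \<subseteq> carrier R" by (rule scal_subset)
  have sB: "subm R (scal e) B" by (rule subm_scalars[OF Suc.prems(2) S])
  have "len R (scal e) B1 B = len R (scal e) (carrier R) \<mm>"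
    using len_image[OF semilinear_mult[OF uc S] subm_carrier[OF S] sB S] uB D by simp
  moreover have "len R (scal e) A B = len R (scal e) A B1 + len R (scal e) B1 B"
    using B1 by (intro len_additive[OF _ _ sB S]) (auto intro: subm_scalars[OF _ S] Suc.prems)
  moreover have "len R (scal e) A B1 = of_nat k * len R (scal e) (carrier R) \<mm>"
    by (rule Suc.IH[OF Suc.prems(1) B1(1,3) l(1)])
  ultimately show ?case by (simp add: distrib_right add.commute)
qed

definition frob_degree :: "nat \<Rightarrow> real" where
  "frob_degree e = real (the_enat (len R (scal e) (carrier R) \<mm>))"

lemma frob_degree_pos: "0 < frob_degree e"
proof -
  have "0 < the_enat (len R (scal e) (carrier R) \<mm>)"
    using len_scal_mm[of e] by (cases "len R (scal e) (carrier R) \<mm>") (auto simp: one_enat_def)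
  then show ?thesis by (simp add: frob_degree_def)
qed

lemma len_scal_cofin:
  assumes "cofin B"
  shows "len R (scal e) (carrier R) B \<noteq> \<infinity>"
    "real (the_enat (len R (scal e) (carrier R) B)) = frob_degree e * cl B"
proof -
  obtain k where k: "clen B = enat k" using assms by (auto simp: cofin_def)
  obtain w where w: "len R (scal e) (carrier R) \<mm> = enat w" using len_scal_mm(2)[of e] by auto
  have "len R (scal e) (carrier R) B = of_nat k * len R (scal e) (carrier R) \<mm>"
    using cofin_idl[OF assms] k subm_carr[of "carrier R" B]
    by (intro len_scal_eq) (auto simp: clen_def)
  then have "len R (scal e) (carrier R) B = enat (k * w)" using w by (simp add: of_nat_eq_enat)
  then show "len R (scal e) (carrier R) B \<noteq> \<infinity>"
    "real (the_enat (len R (scal e) (carrier R) B)) = frob_degree e * cl B"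
    using k w by (auto simp: frob_degree_def cl_def)
qed

text \<open>The bounds of \<open>frobenius_len_bounds\<close> are divided by the residue degree, so
  \<open>\<omega>\<close> is the size of the independent family over that degree. The error lives on
  \<open>cR + P\<close>, of dimension at most \<open>k\<close>, and as \<open>J\<close> contains
  \<open>I^n\<close> it is bounded through \<open>I^n\<close> alone, uniformly in
  \<open>J\<close>.\<close>

theorem frobenius_compare:
  assumes P: "primeideal P R" and T: "idl T" and PT: "\<And>a. a \<in> P \<Longrightarrow> a [^] (p ^ e) \<in> T"
    and dim: "chain_free {\<zero>} (Suc k)"
  shows "\<exists>\<omega>\<ge>0. \<exists>C\<ge>0. \<forall>n\<ge>1. \<forall>J. idl J \<and> ipow I n \<subseteq> J \<longrightarrow>
    \<bar>cl (T <+> frob_pow R J (p ^ e)) - \<omega> * cl (P <+> J)\<bar> \<le> C * real n ^ k"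
proof -
  let ?q = "p ^ e" and ?w = "frob_degree e"
  have iP: "idl P" using primeideal_idl[OF P] .
  obtain r s :: nat and c where c: "c \<in> carrier R" "c \<notin> P" and
    b: "\<And>J. idl J \<Longrightarrow> len R (scal e) (carrier R) (T <+> frob_pow R J ?q)
      \<le> of_nat r * clen (P <+> J) + of_nat s * clen (prin c <+> (P <+> J))"
    "\<And>J. idl J \<Longrightarrow> of_nat r * clen (P <+> J)
      \<le> of_nat r * clen (prin c <+> (P <+> J)) + len R (scal e) (carrier R) (T <+> frob_pow R J ?q)"
    using frobenius_len_bounds[OF F_fin P T PT] by blast
  have ic: "idl (prin c)" using c by auto
  have cP: "idl (prin c <+> P)" by (rule idl_set_add[OF ic iP])
  have sub: "P \<subseteq> prin c <+> P" "c \<in> prin c <+> P"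
    using set_add_upper2[OF ic subm_carr[OF iP]] set_add_upper1[OF iP subm_carr[OF ic]] mem_prin[OF c(1)] by auto
  have "chain_free (prin c <+> P) k"
  proof (rule chain_free_above_prime[OF dim])
    fix Q assume "primeideal Q R" "prin c <+> P \<subseteq> Q"
    then show "\<exists>P. primeideal P R \<and> {\<zero>} \<subseteq> P \<and> P \<subset> Q"
      using P sub c subm_zero[OF iP] by (intro exI[of _ P]) auto
  qed
  then obtain C where C: "C \<ge> 0" "\<And>n. n \<ge> 1 \<Longrightarrow> cl ((prin c <+> P) <+> ipow I n) \<le> C * real n ^ k"
    using cl_upper[OF cP] by blast
  have main: "\<bar>cl (T <+> frob_pow R J ?q) - real r / ?w * cl (P <+> J)\<bar> \<le> ((real r + real s) / ?w * C) * real n ^ k"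
    if n: "n \<ge> 1" and J: "idl J" "ipow I n \<subseteq> J" for n J
  proof -
    let ?X = "T <+> frob_pow R J ?q" and ?K = "prin c <+> (P <+> J)"
    obtain xs where xs: "set xs \<subseteq> carrier R" "I = lsum R xs (carrier R)" by (rule I_generators)
    have iF: "idl (frob_pow R J ?q)" using idl_frob[OF subm_carr[OF J(1)]] .
    have X: "idl ?X" using T iF by auto
    have "ipow I (length xs * ?q + n * ?q) \<subseteq> frob_pow R (ipow I n) ?q" by (rule ipow_subset_frob[OF xs])
    also have "\<dots> \<subseteq> frob_pow R J ?q" by (rule frob_mono[OF J(2) subm_carr[OF J(1)]])
    also have "\<dots> \<subseteq> ?X" by (rule set_add_upper2[OF T subm_carr[OF iF]])
    finally have cX: "cofin ?X" by (rule cofin_above_ipow[OF X])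
    have iPJ: "idl (P <+> J)" using iP J by auto
    have JPJ: "J \<subseteq> P <+> J" by (rule set_add_upper2[OF iP subm_carr[OF J(1)]])
    have cPJ: "cofin (P <+> J)" by (rule cofin_above_ipow[OF iPJ]) (use JPJ J in blast)
    have iK: "idl ?K" using ic iPJ by auto
    have PJK: "P <+> J \<subseteq> ?K" by (rule set_add_upper2[OF ic subm_carr[OF iPJ]])
    have cK: "cofin ?K" by (rule cofin_mono[OF cPJ iK PJK])
    have PK: "P \<subseteq> ?K" using set_add_upper1[OF J(1) subm_carr[OF iP]] PJK by blast
    have cK': "prin c \<subseteq> ?K" by (rule set_add_upper1[OF iPJ subm_carr[OF ic]])
    have "(prin c <+> P) <+> ipow I n \<subseteq> ?K"
      using PK cK' J(2) JPJ PJK by (intro set_add_le[OF iK]) blast+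
    then have "cl ?K \<le> cl ((prin c <+> P) <+> ipow I n)" by (rule cl_antimono[OF cofin_add_ipow[OF cP] iK])
    then have K: "cl ?K \<le> C * real n ^ k" using C(2)[OF n] by simp
    obtain lx where lx: "len R (scal e) (carrier R) ?X = enat lx" "real lx = ?w * cl ?X"
      using len_scal_cofin[OF cX, of e] by auto
    obtain a where a: "clen (P <+> J) = enat a" "real a = cl (P <+> J)" using cPJ by (auto simp: cofin_def cl_def)
    obtain k' where k': "clen ?K = enat k'" "real k' = cl ?K" using cK by (auto simp: cofin_def cl_def)
    have "lx \<le> r * a + s * k'" using b(1)[OF J(1)] lx a k' by (simp add: of_nat_eq_enat)
    then have "real lx \<le> real (r * a + s * k')" by (rule of_nat_mono)
    then have u: "?w * cl ?X \<le> real r * cl (P <+> J) + real s * cl ?K" using lx a k' by simp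
    have "r * a \<le> r * k' + lx" using b(2)[OF J(1)] lx a k' by (simp add: of_nat_eq_enat)
    then have "real (r * a) \<le> real (r * k' + lx)" by (rule of_nat_mono)
    then have l: "real r * cl (P <+> J) \<le> real r * cl ?K + ?w * cl ?X" using lx a k' by simp
    have rs: "real s * cl ?K \<le> (real r + real s) * (C * real n ^ k)" "real r * cl ?K \<le> (real r + real s) * (C * real n ^ k)"
      using K by (auto intro!: mult_mono)
    have "\<bar>?w * cl ?X - real r * cl (P <+> J)\<bar> \<le> (real r + real s) * (C * real n ^ k)"
      using u l rs by linarith
    moreover have "?w * cl ?X - real r * cl (P <+> J) = ?w * (cl ?X - real r / ?w * cl (P <+> J))"
      using frob_degree_pos[of e] by (simp add: field_simps)
    ultimately have "?w * \<bar>cl ?X - real r / ?w * cl (P <+> J)\<bar> \<le> (real r + real s) * (C * real n ^ k)"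
      using frob_degree_pos[of e] by (simp add: abs_mult)
    then show ?thesis using frob_degree_pos[of e] by (simp add: field_simps)
  qed
  have "0 \<le> real r / ?w" "0 \<le> (real r + real s) / ?w * C" using frob_degree_pos[of e] C by auto
  then show ?thesis using main by blast
qed

end

section \<open>Decomposition along primes\<close>

context noetherian_cring begin

text \<open>If \<open>a b\<close> lies in \<open>K\<close>, then the product of
  \<open>aR + K\<close> and \<open>bR + K\<close> is contained in \<open>K\<close>, so the exponents
  found for the two larger ideals add up.\<close>

lemma prime_decomposition:
  assumes "idl K"
  shows "\<exists>F. finite F \<and> (\<forall>P\<in>F. primeideal P R) \<and>
    (\<forall>x\<in>carrier R. (\<forall>P\<in>F. x \<in> P) \<longrightarrow> (\<exists>n::nat. x [^] n \<in> K))"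
  using assms
proof (induction K rule: idl_prime_induct)
  case top
  show ?case by (intro exI[of _ "{}"]) auto
next
  case (prime P)
  have "\<exists>n::nat. x [^] n \<in> P" if "x \<in> P" for x
    using that subm_mem[OF primeideal_idl[OF prime(1)]] by (intro exI[of _ 1]) simp
  then show ?case using prime(1) by (intro exI[of _ "{P}"]) auto
next
  case (split K a b)
  have L: "idl (prin u <+> K)" "K \<subset> prin u <+> K" if "u \<in> carrier R" "u \<notin> K" for u
  proof -
    have iu: "idl (prin u)" using that by auto
    show "idl (prin u <+> K)" by (rule idl_set_add[OF iu split(1)])
    show "K \<subset> prin u <+> K"
      using set_add_upper1[OF split(1) subm_carr[OF iu]] set_add_upper2[OF iu subm_carr[OF split(1)]] mem_prin[OF that(1)] that by auto
  qed
  obtain F1 where F1: "finite F1 \<and> (\<forall>P\<in>F1. primeideal P R) \<and>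
      (\<forall>x\<in>carrier R. (\<forall>P\<in>F1. x \<in> P) \<longrightarrow> (\<exists>n::nat. x [^] n \<in> prin a <+> K))"
    using split(7)[OF L[OF split(2,4)]] by (elim exE)
  obtain F2 where F2: "finite F2 \<and> (\<forall>P\<in>F2. primeideal P R) \<and>
      (\<forall>x\<in>carrier R. (\<forall>P\<in>F2. x \<in> P) \<longrightarrow> (\<exists>n::nat. x [^] n \<in> prin b <+> K))"
    using split(7)[OF L[OF split(3,5)]] by (elim exE)
  have "\<exists>n::nat. x [^] n \<in> K" if x: "x \<in> carrier R" "\<forall>P\<in>F1 \<union> F2. x \<in> P" for x
  proof -
    obtain n :: nat where n: "x [^] n \<in> prin a <+> K" using F1 x by auto
    obtain m :: nat where m: "x [^] m \<in> prin b <+> K" using F2 x by auto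
    obtain r k where rk: "x [^] n = a \<otimes> r \<oplus> k" "r \<in> carrier R" "k \<in> K" using n by (auto simp: mem_set_add)
    obtain r' k' where rk': "x [^] m = b \<otimes> r' \<oplus> k'" "r' \<in> carrier R" "k' \<in> K" using m by (auto simp: mem_set_add)
    have c: "k \<in> carrier R" "k' \<in> carrier R" using rk rk' subm_mem[OF split(1)] by auto
    have "x [^] (n + m) = (a \<otimes> r \<oplus> k) \<otimes> (b \<otimes> r' \<oplus> k')" using x rk rk' by (simp flip: nat_pow_mult)
    also have "\<dots> = (r \<otimes> r') \<otimes> (a \<otimes> b) \<oplus> ((a \<otimes> r) \<otimes> k' \<oplus> (b \<otimes> r' \<oplus> k') \<otimes> k)"
      using c rk(2) rk'(2) split(2,3) by (simp add: l_distr r_distr m_ac a_ac)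
    also have "\<dots> \<in> K"
      using idl_mult[OF split(1) _ split(6), of "r \<otimes> r'"] idl_mult[OF split(1) _ rk'(3), of "a \<otimes> r"]
        idl_mult[OF split(1) _ rk(3), of "b \<otimes> r' \<oplus> k'"] c rk(2) rk'(2) split(2,3)
      by (intro subm_add[OF split(1)]) auto
    finally show ?thesis by blast
  qed
  then show ?case using F1 F2 by (intro exI[of _ "F1 \<union> F2"]) auto
qed

text \<open>A family of least cardinality is chosen. Without \<open>P\<close> it no longer detects
  nilpotency, and a witness of this lies in all other members but not in \<open>P\<close>; this is
  \<open>c P\<close>.\<close>

lemma separating_primes:
  obtains F :: "'a set set" and c :: "'a set \<Rightarrow> 'a" where "finite F" "\<And>P. P \<in> F \<Longrightarrow> primeideal P R"
    "\<And>x. x \<in> carrier R \<Longrightarrow> (\<And>P. P \<in> F \<Longrightarrow> x \<in> P) \<Longrightarrow> \<exists>n::nat. x [^] n = \<zero>"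
    "\<And>P. P \<in> F \<Longrightarrow> c P \<in> carrier R \<and> c P \<notin> P"
    "\<And>P Q. P \<in> F \<Longrightarrow> Q \<in> F \<Longrightarrow> P \<noteq> Q \<Longrightarrow> c P \<in> Q"
proof -
  define good where "good F \<longleftrightarrow> finite F \<and> (\<forall>P\<in>F. primeideal P R) \<and>
    (\<forall>x\<in>carrier R. (\<forall>P\<in>F. x \<in> P) \<longrightarrow> (\<exists>n::nat. x [^] n = \<zero>))" for F
  have "\<exists>F. good F" using prime_decomposition[OF subm_singleton_zero] unfolding good_def by simp
  then obtain F where F: "good F" and min: "\<And>G. good G \<Longrightarrow> card F \<le> card G"
    using ex_has_least_nat[of good _ card] by blast
  have "\<exists>c. c \<in> carrier R \<and> c \<notin> P \<and> (\<forall>Q\<in>F. P \<noteq> Q \<longrightarrow> c \<in> Q)" if P: "P \<in> F" for P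
  proof -
    have "card (F - {P}) < card F" using P F by (intro card_Diff1_less) (auto simp: good_def)
    then have "\<not> good (F - {P})" using min[of "F - {P}"] by auto
    then obtain x where x: "x \<in> carrier R" "\<forall>Q\<in>F - {P}. x \<in> Q" "\<not> (\<exists>n::nat. x [^] n = \<zero>)"
      using F unfolding good_def by auto
    then have "x \<notin> P" using F unfolding good_def by blast
    then show ?thesis using x by blast
  qed
  then obtain c where "\<And>P. P \<in> F \<Longrightarrow> c P \<in> carrier R \<and> c P \<notin> P \<and> (\<forall>Q\<in>F. P \<noteq> Q \<longrightarrow> c P \<in> Q)" by metis
  then show ?thesis using that[of F c] F unfolding good_def by blast
qed

text \<open>Otherwise a product of elements outside \<open>Q\<close>, one from each member of
  \<open>F\<close>, would be nilpotent and yet outside the prime \<open>Q\<close>.\<close>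

lemma prime_contains_some:
  assumes F: "finite F" "\<And>P. P \<in> F \<Longrightarrow> primeideal P R"
    and nil: "\<And>x. x \<in> carrier R \<Longrightarrow> (\<And>P. P \<in> F \<Longrightarrow> x \<in> P) \<Longrightarrow> \<exists>n::nat. x [^] n = \<zero>"
    and Q: "primeideal Q R"
  obtains P where "P \<in> F" "P \<subseteq> Q"
proof (rule ccontr)
  assume "\<not> thesis"
  then have no: "P \<in> F \<Longrightarrow> \<not> P \<subseteq> Q" for P using that by blast
  have "\<exists>y\<in>carrier R. y \<notin> Q \<and> (\<forall>P\<in>G. y \<in> P)" if "G \<subseteq> F" for G
    using finite_subset[OF that F(1)] that
  proof (induction G)
    case empty
    have "\<one> \<notin> Q" using idl_one[OF primeideal_idl[OF Q]] primeideal_ne[OF Q] by auto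
    then show ?case by auto
  next
    case (insert P G)
    then obtain y where y: "y \<in> carrier R" "y \<notin> Q" "\<forall>P\<in>G. y \<in> P" by auto
    obtain x where x: "x \<in> P" "x \<notin> Q" using no[of P] insert by auto
    have iP: "idl P" using primeideal_idl F insert by auto
    have xc: "x \<in> carrier R" using x subm_mem[OF iP] by auto
    have "x \<otimes> y \<notin> Q" using primeideal_mult[OF Q xc y(1)] x y by auto
    moreover have "x \<otimes> y \<in> P" using idl_mult2[OF iP y(1) x(1)] .
    moreover have "x \<otimes> y \<in> P'" if "P' \<in> G" for P'
      using idl_mult[of P' x y] primeideal_idl[of P'] F(2)[of P'] insert that xc y by auto
    ultimately show ?case using xc y by (intro bexI[of _ "x \<otimes> y"]) auto
  qed
  from this[of F] obtain y where y: "y \<in> carrier R" "y \<notin> Q" "\<forall>P\<in>F. y \<in> P" by auto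
  obtain n :: nat where "y [^] n = \<zero>" using nil[OF y(1)] y(3) by blast
  then have "y \<in> Q" using primeideal_pow[OF Q y(1), of n] subm_zero[OF primeideal_idl[OF Q]] by simp
  then show False using y by simp
qed

end

context cring begin

lemma cl_Int_le: "cofin A \<Longrightarrow> cofin B \<Longrightarrow> cl (A \<inter> B) \<le> cl A + cl B"
  using cl_Int(2)[of A B] cl_nonneg[of "A <+> B"] by linarith

text \<open>The maps \<open>R \<rightarrow> \<Prod> R/T P\<close> and multiplication by \<open>\<Sum> e P\<close> are inverse to each other up to
  factors killed by the \<open>e P\<close>. The kernel of the sum on \<open>R/K\<close> has the length of its cokernel.\<close>

lemma cl_orthogonal_bounds:
  assumes F: "finite F" and e: "\<And>P. P \<in> F \<Longrightarrow> e P \<in> carrier R"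
    and orth: "\<And>P Q. P \<in> F \<Longrightarrow> Q \<in> F \<Longrightarrow> P \<noteq> Q \<Longrightarrow> e P \<otimes> e Q = \<zero>"
    and K: "cofin K"
  defines "T \<equiv> \<lambda>P. {x \<in> carrier R. e P \<otimes> x \<in> {\<zero>}}"
  shows "(\<Sum>P\<in>F. cl (T P <+> K) - cl (prin (e P) <+> (T P <+> K))) \<le> cl K"
    and "cl K \<le> (\<Sum>P\<in>F. cl (T P <+> K)) + cl (prin (\<Oplus>P\<in>F. e P) <+> K)"
proof -
  have iK: "idl K" using cofin_idl[OF K] .
  have iT: "idl (T P)" if "P \<in> F" for P
    unfolding T_def using idl_colon[OF idl_carrier subm_singleton_zero e[OF that]] by simp
  define B where "B P = T P <+> K" for P
  have iB: "idl (B P)" if "P \<in> F" for P unfolding B_def using iT[OF that] iK by auto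
  have KB: "K \<subseteq> B P" if "P \<in> F" for P unfolding B_def by (rule set_add_upper2[OF iT[OF that] subm_carr[OF iK]])
  have TB: "T P \<subseteq> B P" if "P \<in> F" for P unfolding B_def by (rule set_add_upper1[OF iK subm_carr[OF iT[OF that]]])
  have cB: "cofin (B P)" if "P \<in> F" for P by (rule cofin_mono[OF K iB[OF that] KB[OF that]])
  \<comment> \<open>\<open>M F\<close> is the kernel of the map to the product of the
    \<open>R/B P\<close>; its colength is followed while one prime at a time is added.\<close>
  define M where "M G = carrier R \<inter> (\<Inter>P\<in>G. B P)" for G
  have ind: "cofin (M G) \<and> (\<Sum>P\<in>G. cl (B P) - cl (prin (e P) <+> B P)) \<le> cl (M G) \<and> cl (M G) \<le> (\<Sum>P\<in>G. cl (B P))"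
    if "G \<subseteq> F" for G
    using finite_subset[OF that F] that
  proof (induction G)
    case empty
    then show ?case by (simp add: M_def)
  next
    case (insert Q G)
    then have Q: "Q \<in> F" and IH: "cofin (M G)" "(\<Sum>P\<in>G. cl (B P) - cl (prin (e P) <+> B P)) \<le> cl (M G)"
      "cl (M G) \<le> (\<Sum>P\<in>G. cl (B P))" by auto
    have Meq: "M (insert Q G) = M G \<inter> B Q" by (auto simp: M_def)
    note I = cl_Int[OF IH(1) cB[OF Q]]
    have iM: "idl (M G)" using cofin_idl[OF IH(1)] .
    have ie: "idl (prin (e Q))" using e[OF Q] by auto
    \<comment> \<open>Orthogonality puts \<open>e Q\<close> into every other \<open>T P\<close>, so
      the correction term \<open>M G + B Q\<close> in the formula for intersections has at most the
      colength of \<open>e Q R + B Q\<close>.\<close>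
    have "e Q \<in> M G"
    proof -
      have "e Q \<in> B P" if "P \<in> G" for P
      proof -
        have "P \<in> F" "P \<noteq> Q" using insert that by auto
        then have "e Q \<in> T P" using orth[of P Q] e Q by (simp add: T_def)
        then show ?thesis using TB \<open>P \<in> F\<close> by auto
      qed
      then show ?thesis using e[OF Q] by (auto simp: M_def)
    qed
    then have "prin (e Q) \<subseteq> M G" by (rule prin_le[OF iM])
    then have "prin (e Q) <+> B Q \<subseteq> M G <+> B Q" by (rule set_add_mono[OF _ subset_refl])
    moreover have "cofin (prin (e Q) <+> B Q)" using cofin_colon(1)[OF cB[OF Q] e[OF Q]] .
    ultimately have "cl (M G <+> B Q) \<le> cl (prin (e Q) <+> B Q)" using cl_antimono iM iB[OF Q] idl_set_add by blast
    then have "(\<Sum>P\<in>insert Q G. cl (B P) - cl (prin (e P) <+> B P)) \<le> cl (M (insert Q G))"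
      using I(2) IH(2) insert.hyps Meq by simp
    moreover have "cl (M (insert Q G)) \<le> (\<Sum>P\<in>insert Q G. cl (B P))"
      using cl_Int_le[OF IH(1) cB[OF Q]] IH(3) insert.hyps Meq by simp
    ultimately show ?case using I(1) Meq by simp
  qed
  note MF = ind[OF subset_refl]
  have KM: "K \<subseteq> M F" using KB subm_carr[OF iK] by (auto simp: M_def)
  have iM: "idl (M F)" using MF cofin_idl by auto
  show "(\<Sum>P\<in>F. cl (T P <+> K) - cl (prin (e P) <+> (T P <+> K))) \<le> cl K"
    using MF cl_antimono[OF K iM KM] unfolding B_def by linarith
  let ?e = "\<Oplus>P\<in>F. e P"
  have ec: "?e \<in> carrier R" using e by (intro finsum_closed) auto
  \<comment> \<open>Each \<open>e P\<close> kills \<open>T P\<close> and hence maps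
    \<open>B P\<close> into \<open>K\<close>; therefore the sum of the \<open>e P\<close> maps
    \<open>M F\<close> into \<open>K\<close>.\<close>
  have "M F \<subseteq> {x \<in> carrier R. ?e \<otimes> x \<in> K}"
  proof
    fix x assume x: "x \<in> M F"
    have xc: "x \<in> carrier R" using x by (simp add: M_def)
    have each: "e P \<otimes> x \<in> K" if P: "P \<in> F" for P
    proof -
      have "x \<in> T P <+> K" using x P by (auto simp: M_def B_def)
      then obtain t k where tk: "x = t \<oplus> k" "t \<in> T P" "k \<in> K" unfolding mem_set_add[of x] by blast
      have c: "t \<in> carrier R" "k \<in> carrier R" using tk subm_mem[OF iT[OF P]] subm_mem[OF iK] by auto
      have "e P \<otimes> x = e P \<otimes> k" using tk c e[OF P] by (simp add: r_distr T_def)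
      then show ?thesis using idl_mult[OF iK e[OF P] tk(3)] by simp
    qed
    have "(\<Oplus>P\<in>G. e P \<otimes> x) \<in> K" if "G \<subseteq> F" for G
      using finite_subset[OF that F] that
    proof (induction G)
      case empty
      then show ?case using subm_zero[OF iK] by simp
    next
      case (insert P G)
      then show ?case using e xc each by (subst finsum_insert) (auto intro!: subm_add[OF iK] simp: Pi_def subset_iff)
    qed
    moreover have "?e \<otimes> x = (\<Oplus>P\<in>F. e P \<otimes> x)" using F xc e by (intro finsum_ldistr) auto
    ultimately show "x \<in> {x \<in> carrier R. ?e \<otimes> x \<in> K}" using xc by auto
  qed
  moreover note col = cofin_colon[OF K ec]
  ultimately have "cl {x \<in> carrier R. ?e \<otimes> x \<in> K} \<le> cl (M F)" using MF cl_antimono cofin_idl by blast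
  then show "cl K \<le> (\<Sum>P\<in>F. cl (T P <+> K)) + cl (prin ?e <+> K)" using col(3) MF unfolding B_def by linarith
qed

end

context frobenius_cring begin

text \<open>The kernels of the iterated Frobenius form an ascending chain of ideals, and every
  nilpotent element lies in one of them.\<close>

lemma nilpotent_uniform:
  obtains e where "\<And>x n. x \<in> carrier R \<Longrightarrow> x [^] (n::nat) = \<zero> \<Longrightarrow> x [^] (p ^ e) = \<zero>"
proof -
  define A where "A e = {x \<in> carrier R. x [^] (p ^ e) \<in> {\<zero>}}" for e
  have iA: "idl (A e)" for e unfolding A_def by (rule idl_frobenius_vimage[OF subm_singleton_zero]) simp
  have up: "x [^] m = \<zero>" if "x \<in> carrier R" "x [^] n = \<zero>" "n \<le> m" for x and n m :: nat
    using that pow_mem_split[of x n m] by simp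
  have "p ^ e \<le> p ^ Suc e" for e by (rule power_increasing) (auto simp: Suc_le_eq)
  then have "A e \<subseteq> A (Suc e)" for e unfolding A_def using up by blast
  then obtain j where j: "\<And>i. j \<le> i \<Longrightarrow> A i = A j" using idl_chain_stable[of A] iA by blast
  have "x [^] (p ^ j) = \<zero>" if x: "x \<in> carrier R" "x [^] n = \<zero>" for x and n :: nat
  proof -
    have "n < p ^ n" using power_gt_expt[of p n] prime_gt_1_nat[OF prime_p] by simp
    also have "p ^ n \<le> p ^ (n + j)" by (rule power_increasing) (auto simp: Suc_le_eq)
    finally have "x \<in> A (n + j)" using up[OF x] x unfolding A_def by simp
    then show ?thesis using j[of "n + j"] unfolding A_def by auto
  qed
  then show ?thesis using that by blast
qed

end

context local_frobenius begin

text \<open>For \<open>P \<noteq> Q\<close> the product \<open>c P c Q\<close>, and for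
  \<open>a\<close> in \<open>P\<close> the product \<open>c P a\<close>, lie in every member of
  \<open>F\<close>, so their \<open>q\<close>-th powers vanish. Hence the
  \<open>\<epsilon> P\<close> are orthogonal, and the annihilator \<open>T P\<close> of
  \<open>\<epsilon> P\<close> contains \<open>a^q\<close> for \<open>a\<close> in \<open>P\<close>.
  Then \<open>cl_orthogonal_bounds\<close> splits the colength among the \<open>T P\<close>, and
  \<open>frobenius_compare\<close> passes from \<open>T P\<close> to \<open>P\<close>.\<close>

theorem frobenius_decomposition:
  assumes dim: "chain_free {\<zero>} (Suc k)"
  obtains e F \<omega> C where "finite F" "\<And>P. P \<in> F \<Longrightarrow> primeideal P R" "0 \<le> C"
    "\<And>n J. 1 \<le> n \<Longrightarrow> idl J \<Longrightarrow> ipow I n \<subseteq> J \<Longrightarrow>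
      \<bar>cl (frob_pow R J (p ^ e)) - (\<Sum>P\<in>F. \<omega> P * cl (P <+> J))\<bar> \<le> C * real n ^ k"
proof -
  obtain F c where F: "finite F" "\<And>P. P \<in> F \<Longrightarrow> primeideal P R"
    and nil: "\<And>x. x \<in> carrier R \<Longrightarrow> (\<And>P. P \<in> F \<Longrightarrow> x \<in> P) \<Longrightarrow> \<exists>n::nat. x [^] n = \<zero>"
    and c: "\<And>P. P \<in> F \<Longrightarrow> c P \<in> carrier R \<and> c P \<notin> P"
    "\<And>P Q. P \<in> F \<Longrightarrow> Q \<in> F \<Longrightarrow> P \<noteq> Q \<Longrightarrow> c P \<in> Q"
    using separating_primes by blast
  obtain e0 where e0: "\<And>x n. x \<in> carrier R \<Longrightarrow> x [^] (n::nat) = \<zero> \<Longrightarrow> x [^] (p ^ e0) = \<zero>"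
    using nilpotent_uniform by blast
  let ?q = "p ^ e0"
  have nil': "x [^] ?q = \<zero>" if "x \<in> carrier R" "\<And>P. P \<in> F \<Longrightarrow> x \<in> P" for x
    using nil[OF that] e0[OF that(1)] by blast
  define \<epsilon> where "\<epsilon> P = c P [^] ?q" for P
  define T where "T P = {x \<in> carrier R. \<epsilon> P \<otimes> x \<in> {\<zero>}}" for P
  have iF: "idl P" if "P \<in> F" for P using primeideal_idl F that by auto
  have ec: "\<epsilon> P \<in> carrier R" if "P \<in> F" for P using c(1)[OF that] by (simp add: \<epsilon>_def)
  have en: "\<epsilon> P \<notin> P" if "P \<in> F" for P
    using primeideal_pow[OF F(2)[OF that], of "c P" ?q] c(1)[OF that] unfolding \<epsilon>_def by blast
  have em: "\<epsilon> P \<in> Q" if "P \<in> F" "Q \<in> F" "P \<noteq> Q" for P Q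
  proof -
    obtain j where j: "?q = Suc j" using p_pow_pos[of e0] gr0_conv_Suc by blast
    show ?thesis unfolding \<epsilon>_def j
      using idl_mult[OF iF[OF that(2)], of "c P [^] j" "c P"] c(1)[OF that(1)] c(2)[OF that] by simp
  qed
  have orth: "\<epsilon> P \<otimes> \<epsilon> Q = \<zero>" if PQ: "P \<in> F" "Q \<in> F" "P \<noteq> Q" for P Q
  proof -
    have "c P \<otimes> c Q \<in> P'" if P': "P' \<in> F" for P'
    proof (cases "P' = P")
      case True
      then show ?thesis using idl_mult[OF iF[OF PQ(1)], of "c P" "c Q"] c PQ by auto
    next
      case False
      then show ?thesis using idl_mult2[OF iF[OF P'], of "c Q" "c P"] c PQ P' by auto
    qed
    then have "(c P \<otimes> c Q) [^] ?q = \<zero>" using c PQ by (intro nil') auto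
    then show ?thesis using c PQ by (simp add: \<epsilon>_def nat_pow_distrib)
  qed
  have iT: "idl (T P)" if "P \<in> F" for P
    unfolding T_def using idl_colon[OF idl_carrier subm_singleton_zero ec[OF that]] by simp
  have PT: "a [^] ?q \<in> T P" if P: "P \<in> F" and a: "a \<in> P" for P a
  proof -
    have ac: "a \<in> carrier R" using a subm_mem[OF iF[OF P]] by auto
    have "c P \<otimes> a \<in> P'" if P': "P' \<in> F" for P'
    proof (cases "P' = P")
      case True
      then show ?thesis using idl_mult[OF iF[OF P], of "c P" a] c a P by auto
    next
      case False
      then show ?thesis using idl_mult2[OF iF[OF P'], of a "c P"] c P P' ac by auto
    qed
    then have "(c P \<otimes> a) [^] ?q = \<zero>" using c P ac by (intro nil') auto
    then show ?thesis using c P ac by (simp add: \<epsilon>_def T_def nat_pow_distrib)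
  qed
  have "\<exists>\<omega> C. 0 \<le> C \<and> (\<forall>n\<ge>1. \<forall>J. idl J \<and> ipow I n \<subseteq> J \<longrightarrow>
      \<bar>cl (T P <+> frob_pow R J ?q) - \<omega> * cl (P <+> J)\<bar> \<le> C * real n ^ k)" if "P \<in> F" for P
    using frobenius_compare[OF F(2)[OF that] iT[OF that] PT[OF that] dim] by blast
  then obtain \<omega> C1 where C1: "\<And>P. P \<in> F \<Longrightarrow> 0 \<le> C1 P"
    "\<And>P n J. P \<in> F \<Longrightarrow> n \<ge> 1 \<Longrightarrow> idl J \<Longrightarrow> ipow I n \<subseteq> J \<Longrightarrow>
      \<bar>cl (T P <+> frob_pow R J ?q) - \<omega> P * cl (P <+> J)\<bar> \<le> C1 P * real n ^ k" by metis
  have "chain_free (prin (\<epsilon> P) <+> T P) k" if P: "P \<in> F" for P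
  proof (rule chain_free_above_prime[OF dim])
    fix Q assume Q: "primeideal Q R" "prin (\<epsilon> P) <+> T P \<subseteq> Q"
    have ie: "idl (prin (\<epsilon> P))" using ec[OF P] by auto
    have "\<epsilon> P \<in> Q" "T P \<subseteq> Q"
      using Q(2) set_add_upper1[OF iT[OF P] subm_carr[OF ie]] set_add_upper2[OF ie subm_carr[OF iT[OF P]]] mem_prin[OF ec[OF P]] by auto
    moreover have "P \<subseteq> Q"
      using PT[OF P] \<open>T P \<subseteq> Q\<close> primeideal_pow[OF Q(1), of _ ?q] subm_mem[OF iF[OF P]] by blast
    ultimately show "\<exists>P. primeideal P R \<and> {\<zero>} \<subseteq> P \<and> P \<subset> Q"
      using F(2)[OF P] en[OF P] subm_zero[OF iF[OF P]] by (intro exI[of _ P]) auto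
  qed
  then have "\<exists>C\<ge>0. \<forall>n\<ge>1. cl ((prin (\<epsilon> P) <+> T P) <+> ipow I n) \<le> C * real n ^ k" if "P \<in> F" for P
    using cl_upper[OF idl_set_add[OF idl_mult_image[OF idl_carrier ec[OF that]] iT[OF that]]] that by blast
  then obtain C2 where C2: "\<And>P. P \<in> F \<Longrightarrow> 0 \<le> C2 P"
    "\<And>P n. P \<in> F \<Longrightarrow> n \<ge> 1 \<Longrightarrow> cl ((prin (\<epsilon> P) <+> T P) <+> ipow I n) \<le> C2 P * real n ^ k" by metis
  \<comment> \<open>Modulo a member \<open>Q\<close> of \<open>F\<close> only the summand
    \<open>\<epsilon> Q\<close> survives, so the sum lies outside all members and the quotient by it
    has dimension at most \<open>k\<close>.\<close>
  define \<eta> where "\<eta> = (\<Oplus>P\<in>F. \<epsilon> P)"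
  have hc: "\<eta> \<in> carrier R" unfolding \<eta>_def using ec by (intro finsum_closed) auto
  have hn: "\<eta> \<notin> Q" if Q: "Q \<in> F" for Q
  proof
    assume h: "\<eta> \<in> Q"
    have "(\<Oplus>P\<in>G. \<epsilon> P) \<in> Q" if "G \<subseteq> F - {Q}" for G
      using finite_subset[OF that] F(1) that
    proof (induction G rule: infinite_finite_induct)
      case (insert P G)
      then have "\<epsilon> P \<in> Q" "(\<Oplus>P\<in>G. \<epsilon> P) \<in> Q" using em[of P Q] Q by auto
      then show ?case using insert ec by (subst finsum_insert) (auto intro!: subm_add[OF iF[OF Q]] simp: Pi_def subset_iff)
    qed (use subm_zero[OF iF[OF Q]] in auto)
    then have r: "(\<Oplus>P\<in>F - {Q}. \<epsilon> P) \<in> Q" by simp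
    have "\<eta> = (\<Oplus>P\<in>insert Q (F - {Q}). \<epsilon> P)" unfolding \<eta>_def using Q by (simp add: insert_absorb)
    also have "\<dots> = \<epsilon> Q \<oplus> (\<Oplus>P\<in>F - {Q}. \<epsilon> P)" using F(1) ec Q by (subst finsum_insert) auto
    finally have "\<epsilon> Q \<in> Q" using subm_add_cancel[OF iF[OF Q] ec[OF Q] r] h by simp
    then show False using en[OF Q] by simp
  qed
  have ih: "idl (prin \<eta>)" using hc by auto
  have "chain_free (prin \<eta>) k"
  proof (rule chain_free_above_prime[OF dim])
    fix Q assume Q: "primeideal Q R" "prin \<eta> \<subseteq> Q"
    obtain P where P: "P \<in> F" "P \<subseteq> Q" using prime_contains_some[OF F nil Q(1)] by blast
    have "\<eta> \<in> Q" using Q(2) mem_prin[OF hc] by auto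
    then show "\<exists>P. primeideal P R \<and> {\<zero>} \<subseteq> P \<and> P \<subset> Q"
      using P F(2)[OF P(1)] hn[OF P(1)] subm_zero[OF iF[OF P(1)]] by (intro exI[of _ P]) auto
  qed
  then obtain C3 where C3: "0 \<le> C3" "\<And>n. n \<ge> 1 \<Longrightarrow> cl (prin \<eta> <+> ipow I n) \<le> C3 * real n ^ k"
    using cl_upper[OF ih] by blast
  obtain xs where xs: "set xs \<subseteq> carrier R" "I = lsum R xs (carrier R)" by (rule I_generators)
  \<comment> \<open>\<open>J^[q]\<close> contains \<open>I^N\<close> for some
    \<open>N \<le> (r + 1) q n\<close>, with \<open>r\<close> generators; \<open>\<rho>\<close> is
    the factor by which bounds in \<open>N^k\<close> become bounds in \<open>n^k\<close>.\<close>
  define \<rho> where "\<rho> = real ((length xs + 1) * ?q) ^ k"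
  have rho: "0 \<le> \<rho>" by (simp add: \<rho>_def)
  define C where "C = (\<Sum>P\<in>F. C1 P + C2 P * \<rho>) + C3 * \<rho>"
  have sum_nonneg': "0 \<le> (\<Sum>P\<in>F. C2 P * \<rho>)" using C2 rho by (intro sum_nonneg) auto
  have main: "\<bar>cl (frob_pow R J ?q) - (\<Sum>P\<in>F. \<omega> P * cl (P <+> J))\<bar> \<le> C * real n ^ k"
    if n: "1 \<le> n" and J: "idl J" "ipow I n \<subseteq> J" for n J
  proof -
    let ?K = "frob_pow R J ?q" and ?N = "length xs * ?q + n * ?q"
    have iK: "idl ?K" using idl_frob[OF subm_carr[OF J(1)]] .
    have IK: "ipow I ?N \<subseteq> ?K"
      using ipow_subset_frob[OF xs, of e0 n] frob_mono[OF J(2) subm_carr[OF J(1)], of ?q] by blast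
    have K: "cofin ?K" by (rule cofin_above_ipow[OF iK IK])
    have "1 \<le> n * ?q" using n by (simp add: Suc_le_eq)
    then have N1: "1 \<le> ?N" by (rule trans_le_add2)
    have "?N \<le> (length xs + 1) * ?q * n"
    proof -
      have "length xs * ?q \<le> length xs * ?q * n" using n by simp
      then show ?thesis by (simp add: algebra_simps)
    qed
    then have "real ?N \<le> real ((length xs + 1) * ?q) * real n" by (metis of_nat_le_iff of_nat_mult)
    then have Nk: "real ?N ^ k \<le> \<rho> * real n ^ k"
      unfolding \<rho>_def power_mult_distrib[symmetric] by (intro power_mono) auto
    have eT: "cl (prin (\<epsilon> P) <+> (T P <+> ?K)) \<le> C2 P * \<rho> * real n ^ k" if P: "P \<in> F" for P
    proof -
      have ie: "idl (prin (\<epsilon> P))" using ec[OF P] by auto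
      have iTK: "idl (T P <+> ?K)" using iT[OF P] iK by auto
      have iA: "idl (prin (\<epsilon> P) <+> (T P <+> ?K))" by (rule idl_set_add[OF ie iTK])
      have a: "prin (\<epsilon> P) \<subseteq> prin (\<epsilon> P) <+> (T P <+> ?K)" by (rule set_add_upper1[OF iTK subm_carr[OF ie]])
      have b: "T P <+> ?K \<subseteq> prin (\<epsilon> P) <+> (T P <+> ?K)" by (rule set_add_upper2[OF ie subm_carr[OF iTK]])
      have "T P \<subseteq> T P <+> ?K" "?K \<subseteq> T P <+> ?K"
        using set_add_upper1[OF iK subm_carr[OF iT[OF P]]] set_add_upper2[OF iT[OF P] subm_carr[OF iK]] by auto
      then have "(prin (\<epsilon> P) <+> T P) <+> ipow I ?N \<subseteq> prin (\<epsilon> P) <+> (T P <+> ?K)"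
        using a b IK by (intro set_add_le[OF iA]) blast+
      then have "cl (prin (\<epsilon> P) <+> (T P <+> ?K)) \<le> cl ((prin (\<epsilon> P) <+> T P) <+> ipow I ?N)"
        by (rule cl_antimono[OF cofin_add_ipow[OF idl_set_add[OF ie iT[OF P]]] iA])
      also have "\<dots> \<le> C2 P * real ?N ^ k" by (rule C2(2)[OF P N1])
      also have "\<dots> \<le> C2 P * (\<rho> * real n ^ k)" by (rule mult_left_mono[OF Nk C2(1)[OF P]])
      finally show ?thesis by simp
    qed
    have eh: "cl (prin \<eta> <+> ?K) \<le> C3 * \<rho> * real n ^ k"
    proof -
      have "cl (prin \<eta> <+> ?K) \<le> cl (prin \<eta> <+> ipow I ?N)"
        by (rule cl_antimono[OF cofin_add_ipow[OF ih] idl_set_add[OF ih iK] set_add_mono[OF subset_refl IK]])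
      also have "\<dots> \<le> C3 * real ?N ^ k" by (rule C3(2)[OF N1])
      also have "\<dots> \<le> C3 * (\<rho> * real n ^ k)" by (rule mult_left_mono[OF Nk C3(1)])
      finally show ?thesis by simp
    qed
    have cmp: "\<bar>cl (T P <+> ?K) - \<omega> P * cl (P <+> J)\<bar> \<le> C1 P * real n ^ k" if "P \<in> F" for P
      by (rule C1(2)[OF that n J])
    have lo: "(\<Sum>P\<in>F. cl (T P <+> ?K) - cl (prin (\<epsilon> P) <+> (T P <+> ?K))) \<le> cl ?K"
      and up: "cl ?K \<le> (\<Sum>P\<in>F. cl (T P <+> ?K)) + cl (prin \<eta> <+> ?K)"
      using cl_orthogonal_bounds[of F \<epsilon> ?K, OF F(1) ec orth K] unfolding T_def \<eta>_def by auto
    have "(\<Sum>P\<in>F. \<omega> P * cl (P <+> J)) - (\<Sum>P\<in>F. (C1 P + C2 P * \<rho>) * real n ^ k) \<le>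
        (\<Sum>P\<in>F. cl (T P <+> ?K) - cl (prin (\<epsilon> P) <+> (T P <+> ?K)))"
      unfolding sum_subtractf[symmetric]
    proof (rule sum_mono)
      fix P assume P: "P \<in> F"
      show "\<omega> P * cl (P <+> J) - (C1 P + C2 P * \<rho>) * real n ^ k \<le> cl (T P <+> ?K) - cl (prin (\<epsilon> P) <+> (T P <+> ?K))"
        using cmp[OF P] eT[OF P] by (simp add: distrib_right)
    qed
    moreover have "(\<Sum>P\<in>F. cl (T P <+> ?K)) \<le> (\<Sum>P\<in>F. \<omega> P * cl (P <+> J)) + (\<Sum>P\<in>F. C1 P * real n ^ k)"
      unfolding sum.distrib[symmetric]
    proof (rule sum_mono)
      fix P assume P: "P \<in> F"
      show "cl (T P <+> ?K) \<le> \<omega> P * cl (P <+> J) + C1 P * real n ^ k" using cmp[OF P] by linarith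
    qed
    moreover have "C * real n ^ k = (\<Sum>P\<in>F. C1 P * real n ^ k) + (\<Sum>P\<in>F. C2 P * \<rho>) * real n ^ k + C3 * \<rho> * real n ^ k"
      unfolding C_def by (simp add: distrib_right sum.distrib sum_distrib_right)
    moreover have "(\<Sum>P\<in>F. (C1 P + C2 P * \<rho>) * real n ^ k) = (\<Sum>P\<in>F. C1 P * real n ^ k) + (\<Sum>P\<in>F. C2 P * \<rho>) * real n ^ k"
      by (simp add: distrib_right sum.distrib sum_distrib_right)
    moreover have "0 \<le> (\<Sum>P\<in>F. C2 P * \<rho>) * real n ^ k" "0 \<le> C3 * \<rho> * real n ^ k"
      using sum_nonneg' C3(1) rho by auto
    ultimately show ?thesis using lo up eh by linarith
  qed
  have "0 \<le> C" unfolding C_def using C1(1) C2(1) C3(1) rho by (intro add_nonneg_nonneg sum_nonneg mult_nonneg_nonneg) auto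
  then show ?thesis using that[of F C e0 \<omega>] F main by blast
qed

end

section \<open>Convergence\<close>

text \<open>Substitution of \<open>n = t m\<close>, asymptotically \<open>s b m\<close>, into the
  growth law of \<open>g\<close>.\<close>

lemma tendsto_rescale:
  fixes g :: "nat \<Rightarrow> real" and t :: "nat \<Rightarrow> nat" and b :: "nat \<Rightarrow> real"
  assumes g: "(\<lambda>n. g n / real n ^ d) \<longlonglongrightarrow> L" and t: "(\<lambda>m. real (t m) / b m) \<longlonglongrightarrow> s"
    and s: "0 < s" and b: "filterlim b at_top sequentially"
  shows "(\<lambda>m. g (t m) / b m ^ d) \<longlonglongrightarrow> L * s ^ d"
proof -
  have b0: "\<forall>\<^sub>F m in sequentially. 0 < b m" using b filterlim_at_top_dense by blast
  have "filterlim (\<lambda>m. real (t m) / b m * b m) at_top sequentially"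
    by (rule filterlim_tendsto_pos_mult_at_top[OF t s b])
  then have rt: "filterlim (\<lambda>m. real (t m)) at_top sequentially"
    by (rule filterlim_cong[THEN iffD1, OF refl refl, rotated]) (use b0 in \<open>eventually_elim, auto\<close>)
  have tt: "filterlim t at_top sequentially"
    unfolding filterlim_at_top
  proof
    fix Z
    have "\<forall>\<^sub>F m in sequentially. real Z \<le> real (t m)" using rt unfolding filterlim_at_top by blast
    then show "\<forall>\<^sub>F m in sequentially. Z \<le> t m" by simp
  qed
  have "(\<lambda>m. g (t m) / real (t m) ^ d) \<longlonglongrightarrow> L" by (rule filterlim_compose[OF g tt])
  from tendsto_mult[OF this tendsto_power[OF t, of d]]
  have "(\<lambda>m. g (t m) / real (t m) ^ d * (real (t m) / b m) ^ d) \<longlonglongrightarrow> L * s ^ d" .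
  then show ?thesis
  proof (rule Lim_transform_eventually)
    have "\<forall>\<^sub>F m in sequentially. 1 \<le> t m" using tt unfolding filterlim_at_top by blast
    then show "\<forall>\<^sub>F m in sequentially. g (t m) / real (t m) ^ d * (real (t m) / b m) ^ d = g (t m) / b m ^ d"
      by eventually_elim (simp add: power_divide)
  qed
qed

text \<open>Adding \<open>2 c (1/2)^m\<close>, the sum of all increases still allowed, makes the
  sequence decreasing.\<close>

lemma almost_decreasing_convergent:
  fixes z :: "nat \<Rightarrow> real"
  assumes "\<And>m. 0 \<le> z m" "\<And>m. z (Suc m) \<le> z m + c * (1 / 2) ^ m" "0 \<le> c"
  shows "\<exists>l. z \<longlonglongrightarrow> l"
proof -
  define w where "w m = z m + 2 * c * (1 / 2) ^ m" for m
  have "w (Suc m) \<le> w m" for m using assms(2)[of m] by (simp add: w_def)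
  then have "decseq w" by (rule decseq_SucI)
  moreover have "0 \<le> w m" for m using assms(1)[of m] assms(3) by (simp add: w_def)
  ultimately obtain l where l: "w \<longlonglongrightarrow> l" using decseq_convergent[of w 0] by blast
  have "(\<lambda>m. 2 * c * (1 / 2) ^ m) \<longlonglongrightarrow> 2 * c * 0" by (intro tendsto_intros LIMSEQ_power_zero) simp
  from tendsto_diff[OF l this] have "z \<longlonglongrightarrow> l" by (simp add: w_def)
  then show ?thesis by blast
qed

context frobenius_cring begin

lemma p_gt_1: "1 < real p"
  using prime_gt_1_nat[OF prime_p] by simp

lemma p_ge_2: "2 \<le> real p"
  using prime_ge_2_nat[OF prime_p] by simp

lemma p_power_at_top: "filterlim (\<lambda>m. real p ^ m) at_top sequentially"
  unfolding filterlim_at_top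
proof
  fix Z :: real
  obtain N :: nat where N: "Z \<le> real N" using real_arch_simple by blast
  have "Z \<le> real p ^ m" if "m \<ge> N" for m
  proof -
    have "real m < 2 ^ m" by (rule of_nat_less_two_power)
    also have "\<dots> \<le> real p ^ m" using p_ge_2 by (intro power_mono) auto
    finally show ?thesis using N that by linarith
  qed
  then show "\<forall>\<^sub>F m in sequentially. Z \<le> real p ^ m" unfolding eventually_sequentially by blast
qed

lemma inverse_p_power_tendsto: "(\<lambda>m. c / real p ^ m) \<longlonglongrightarrow> 0"
  by (rule tendsto_divide_0[OF tendsto_const]) (rule filterlim_at_top_imp_at_infinity[OF p_power_at_top])

definition expo :: "real \<Rightarrow> nat \<Rightarrow> nat" where
  "expo s m = nat \<lceil>s * real p ^ m\<rceil>"

lemma expo_bounds: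
  assumes "0 < s"
  shows "s * real p ^ m \<le> real (expo s m)" "real (expo s m) \<le> s * real p ^ m + 1" "1 \<le> expo s m"
proof -
  have "0 < s * real p ^ m" using assms p_gt_1 by simp
  then have c: "1 \<le> \<lceil>s * real p ^ m\<rceil>" by linarith
  then have e: "real (expo s m) = of_int \<lceil>s * real p ^ m\<rceil>" unfolding expo_def by simp
  show "s * real p ^ m \<le> real (expo s m)" "real (expo s m) \<le> s * real p ^ m + 1"
    unfolding e by linarith+
  show "1 \<le> expo s m" using c unfolding expo_def by linarith
qed

lemma expo_tendsto:
  assumes "0 < s"
  shows "(\<lambda>m. real (expo s m) / real p ^ m) \<longlonglongrightarrow> s"
proof (rule tendsto_sandwich[OF _ _ tendsto_const])
  have pp: "0 < real p ^ m" for m using p_gt_1 by simp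
  show "\<forall>\<^sub>F m in sequentially. s \<le> real (expo s m) / real p ^ m"
    using expo_bounds(1)[OF assms] pp by (auto simp: pos_le_divide_eq)
  have "real (expo s m) / real p ^ m \<le> s + 1 / real p ^ m" for m
  proof -
    have "real (expo s m) / real p ^ m \<le> (s * real p ^ m + 1) / real p ^ m"
      using expo_bounds(2)[OF assms] pp[of m] by (intro divide_right_mono) auto
    also have "\<dots> = s + 1 / real p ^ m" using pp[of m] by (simp only: add_divide_distrib) simp
    finally show ?thesis .
  qed
  then show "\<forall>\<^sub>F m in sequentially. real (expo s m) / real p ^ m \<le> s + 1 / real p ^ m" by simp
  show "(\<lambda>m. s + 1 / real p ^ m) \<longlonglongrightarrow> s"
    using tendsto_add[OF tendsto_const inverse_p_power_tendsto, of s 1] by simp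
qed

text \<open>Rounding up before multiplying by \<open>p^e\<close> can only enlarge the exponent. For
  this reason the Frobenius power of \<open>hideal s m\<close> lies in
  \<open>hideal s (m + e)\<close>.\<close>

lemma expo_add_le:
  assumes s: "0 < s"
  shows "expo s (m + e) \<le> expo s m * p ^ e"
proof -
  have "s * real p ^ (m + e) = (s * real p ^ m) * real p ^ e" by (simp add: power_add)
  also have "\<dots> \<le> real (expo s m) * real p ^ e" using expo_bounds(1)[OF s] p_gt_1 by (intro mult_right_mono) auto
  finally have "s * real p ^ (m + e) \<le> real (expo s m * p ^ e)" by simp
  then have "\<lceil>s * real p ^ (m + e)\<rceil> \<le> int (expo s m * p ^ e)" by (simp add: ceiling_le_iff)
  then show ?thesis unfolding expo_def by linarith
qed

end

context local_frobenius begin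

definition hideal :: "real \<Rightarrow> nat \<Rightarrow> 'a set" where
  "hideal s m = ipow I (expo s m) <+> frob_pow R I (p ^ m)"

lemma idl_frob_I [intro]: "idl (frob_pow R I q)"
  using idl_frob[OF subm_carr[OF idl_I]] .

lemma idl_hideal [intro]: "idl (hideal s m)"
  unfolding hideal_def using idl_I by auto

lemma ipow_subset_hideal: "ipow I (expo s m) \<subseteq> hideal s m"
  unfolding hideal_def by (rule set_add_upper1[OF idl_frob_I subm_carr[OF idl_ipow[OF idl_I]]])

lemma cofin_hideal [intro]: "cofin (hideal s m)"
  by (rule cofin_above_ipow[OF idl_hideal ipow_subset_hideal])

lemma frob_hideal:
  "frob_pow R (hideal s m) (p ^ e) = frob_pow R (ipow I (expo s m)) (p ^ e) <+> frob_pow R I (p ^ (m + e))"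
  unfolding hideal_def frob_set_add[OF idl_ipow[OF idl_I] idl_frob_I] frob_frob[OF idl_I] ..

lemma frob_hideal_subset:
  assumes "0 < s"
  shows "frob_pow R (hideal s m) (p ^ e) \<subseteq> hideal s (m + e)"
  unfolding frob_hideal unfolding hideal_def
  using frob_subset_ipow[OF idl_I, of "expo s m" "p ^ e"] ipow_antimono[OF idl_I expo_add_le[OF assms, of m e]]
  by (intro set_add_mono) auto

text \<open>The factor \<open>\<mu>\<close> relating the colengths of \<open>P + J^[p]\<close> and \<open>P + J\<close> does not depend on \<open>J\<close>; evaluating it
  on the powers of \<open>I\<close> gives \<open>p^d\<close>, which makes the normalized colengths almost decreasing.\<close>

lemma prime_hideal_tendsto:
  assumes P: "primeideal P R" and dim: "chain_free {\<zero>} (Suc k)" and s: "0 < s"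
  shows "\<exists>l. (\<lambda>m. cl (P <+> hideal s m) / real p ^ (m * Suc k)) \<longlonglongrightarrow> l"
proof -
  let ?d = "Suc k"
  have iP: "idl P" using primeideal_idl[OF P] .
  have cf: "chain_free P ?d" by (rule chain_free_mono[OF dim]) (use subm_zero[OF iP] in auto)
  obtain L where L: "(\<lambda>n. cl (P <+> ipow I n) / real n ^ ?d) \<longlonglongrightarrow> L"
    using cl_add_ipow_tendsto[OF iP cf] by blast
  have pp: "0 < real p ^ m" for m using p_gt_1 by simp
  have iPh: "idl (P <+> hideal s m)" for m using iP by auto
  have y_le: "cl (P <+> hideal s m) \<le> cl (P <+> ipow I (expo s m))" for m
    by (rule cl_antimono[OF cofin_add_ipow[OF iP] iPh set_add_mono[OF subset_refl ipow_subset_hideal]])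
  show ?thesis
  proof (cases "L = 0")
    case True
    \<comment> \<open>For \<open>L = 0\<close> the powers of \<open>I\<close> already force the
      limit \<open>0\<close>; the leading terms would not determine \<open>\<mu>\<close> in this
      case.\<close>
    have "(\<lambda>m. cl (P <+> ipow I (expo s m)) / (real p ^ m) ^ ?d) \<longlonglongrightarrow> L * s ^ ?d"
      by (rule tendsto_rescale[OF L expo_tendsto[OF s] s p_power_at_top])
    then have u: "(\<lambda>m. cl (P <+> ipow I (expo s m)) / real p ^ (m * ?d)) \<longlonglongrightarrow> 0"
      using True by (simp only: power_mult[symmetric] mult_zero_left)
    have "(\<lambda>m. cl (P <+> hideal s m) / real p ^ (m * ?d)) \<longlonglongrightarrow> 0"
    proof (rule tendsto_sandwich[OF _ _ tendsto_const u])
      show "\<forall>\<^sub>F m in sequentially. 0 \<le> cl (P <+> hideal s m) / real p ^ (m * ?d)"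
        using pp by (intro always_eventually allI divide_nonneg_nonneg) (auto simp: less_imp_le)
      show "\<forall>\<^sub>F m in sequentially. cl (P <+> hideal s m) / real p ^ (m * ?d)
          \<le> cl (P <+> ipow I (expo s m)) / real p ^ (m * ?d)"
        using y_le pp by (intro always_eventually allI divide_right_mono) (auto simp: less_imp_le)
    qed
    then show ?thesis by blast
  next
    case False
    have Pp: "a [^] (p ^ 1) \<in> P" if "a \<in> P" for a
    proof -
      have "a [^] (p ^ 1) \<in> ipow P (1 * (p ^ 1))" by (rule pow_mem_ipow[OF iP]) (use that ipow_1[OF iP] in simp)
      then show ?thesis using ipow_subset[OF iP, of "1 * (p ^ 1)"] p_pos by auto
    qed
    obtain \<mu> C where C: "0 \<le> C" "\<And>n J. n \<ge> 1 \<Longrightarrow> idl J \<Longrightarrow> ipow I n \<subseteq> J \<Longrightarrow>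
        \<bar>cl (P <+> frob_pow R J (p ^ 1)) - \<mu> * cl (P <+> J)\<bar> \<le> C * real n ^ k" and lam0: "0 \<le> \<mu>"
      using frobenius_compare[OF P iP Pp dim] by blast
    obtain xs where xs: "set xs \<subseteq> carrier R" "I = lsum R xs (carrier R)" by (rule I_generators)
    let ?r = "length xs"
    \<comment> \<open>Evaluation of \<open>\<mu>\<close> on \<open>J = I^n\<close>: the Frobenius
      power lies between \<open>I^((n + r) p)\<close> and \<open>I^(n p)\<close>, whose colengths
      have the same leading term.\<close>
    define f where "f n = cl (P <+> frob_pow R (ipow I n) (p ^ 1))" for n
    have iI: "idl (ipow I n)" for n using idl_I by auto
    have iFr: "idl (frob_pow R (ipow I n) q)" for n q using idl_frob[OF subm_carr[OF iI]] .
    have iPF: "idl (P <+> frob_pow R (ipow I n) q)" for n q using iP iFr by auto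
    have sub1: "P <+> frob_pow R (ipow I n) (p ^ 1) \<subseteq> P <+> ipow I (n * p)" for n
      using frob_subset_ipow[OF idl_I, of n "p ^ 1"] by (intro set_add_mono) auto
    have sub2: "P <+> ipow I (?r * p + n * p) \<subseteq> P <+> frob_pow R (ipow I n) (p ^ 1)" for n
      using ipow_subset_frob[OF xs, of 1 n] by (intro set_add_mono) auto
    have cPF: "cofin (P <+> frob_pow R (ipow I n) (p ^ 1))" for n
      by (rule cofin_mono[OF cofin_add_ipow[OF iP] iPF sub2])
    have lo: "cl (P <+> ipow I (n * p)) \<le> f n" for n
      unfolding f_def by (rule cl_antimono[OF cPF idl_add_ipow[OF iP] sub1])
    have up: "f n \<le> cl (P <+> ipow I (?r * p + n * p))" for n
      unfolding f_def by (rule cl_antimono[OF cofin_add_ipow[OF iP] iPF sub2])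
    have at: "filterlim (\<lambda>n. real n) at_top sequentially" by (rule filterlim_real_sequentially)
    have "(\<lambda>n. real (n * p) / real n) \<longlonglongrightarrow> real p"
      by (rule Lim_transform_eventually[OF tendsto_const])
        (use eventually_gt_at_top[of 0] in \<open>eventually_elim, simp\<close>)
    from tendsto_rescale[OF L this _ at] have l1: "(\<lambda>n. cl (P <+> ipow I (n * p)) / real n ^ ?d) \<longlonglongrightarrow> L * real p ^ ?d"
      using p_gt_1 by simp
    have "(\<lambda>n. real (?r * p) / real n + real p) \<longlonglongrightarrow> 0 + real p"
      by (intro tendsto_add lim_const_over_n tendsto_const)
    then have "(\<lambda>n. real (?r * p + n * p) / real n) \<longlonglongrightarrow> 0 + real p"
      by (rule Lim_transform_eventually)
        (use eventually_gt_at_top[of 0] in \<open>eventually_elim, simp add: add_divide_distrib\<close>)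
    from tendsto_rescale[OF L this _ at] have l2: "(\<lambda>n. cl (P <+> ipow I (?r * p + n * p)) / real n ^ ?d) \<longlonglongrightarrow> L * real p ^ ?d"
      using p_gt_1 by simp
    have f1: "(\<lambda>n. f n / real n ^ ?d) \<longlonglongrightarrow> L * real p ^ ?d"
    proof (rule tendsto_sandwich[OF _ _ l1 l2])
      show "\<forall>\<^sub>F n in sequentially. cl (P <+> ipow I (n * p)) / real n ^ ?d \<le> f n / real n ^ ?d"
        using lo by (intro always_eventually allI divide_right_mono) auto
      show "\<forall>\<^sub>F n in sequentially. f n / real n ^ ?d \<le> cl (P <+> ipow I (?r * p + n * p)) / real n ^ ?d"
        using up by (intro always_eventually allI divide_right_mono) auto
    qed
    have d0: "(\<lambda>n. f n / real n ^ ?d - \<mu> * (cl (P <+> ipow I n) / real n ^ ?d)) \<longlonglongrightarrow> 0"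
    proof (rule tendsto_rabs_zero_cancel, rule tendsto_sandwich[OF _ _ tendsto_const lim_const_over_n[of C]])
      show "\<forall>\<^sub>F n in sequentially. 0 \<le> \<bar>f n / real n ^ ?d - \<mu> * (cl (P <+> ipow I n) / real n ^ ?d)\<bar>" by simp
      show "\<forall>\<^sub>F n in sequentially. \<bar>f n / real n ^ ?d - \<mu> * (cl (P <+> ipow I n) / real n ^ ?d)\<bar> \<le> C / real n"
        using eventually_gt_at_top[of 0]
      proof eventually_elim
        fix n :: nat assume n: "0 < n"
        have "f n / real n ^ ?d - \<mu> * (cl (P <+> ipow I n) / real n ^ ?d) = (f n - \<mu> * cl (P <+> ipow I n)) / real n ^ ?d"
          by (simp add: diff_divide_distrib)
        then have "\<bar>f n / real n ^ ?d - \<mu> * (cl (P <+> ipow I n) / real n ^ ?d)\<bar> = \<bar>f n - \<mu> * cl (P <+> ipow I n)\<bar> / real n ^ ?d"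
          by (simp add: abs_divide)
        also have "\<dots> \<le> C * real n ^ k / real n ^ ?d"
          using C(2)[OF _ iI subset_refl, of n] n unfolding f_def by (intro divide_right_mono) auto
        also have "\<dots> = C / real n" using n by simp
        finally show "\<bar>f n / real n ^ ?d - \<mu> * (cl (P <+> ipow I n) / real n ^ ?d)\<bar> \<le> C / real n" .
      qed
    qed
    have "(\<lambda>n. f n / real n ^ ?d - \<mu> * (cl (P <+> ipow I n) / real n ^ ?d)) \<longlonglongrightarrow> L * real p ^ ?d - \<mu> * L"
      by (intro tendsto_diff f1 tendsto_mult tendsto_const L)
    from LIMSEQ_unique[OF d0 this] have lam: "\<mu> = real p ^ ?d" using False by (simp add: mult.commute)
    \<comment> \<open>With \<open>\<mu> = p^d\<close> the normalization absorbs the main term; the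
      error of order \<open>p^(m k)\<close>, divided by \<open>p^((m+1) d)\<close>, is
      summable.\<close>
    define z where "z m = cl (P <+> hideal s m) / real p ^ (m * ?d)" for m
    have "z (Suc m) \<le> z m + (C * (s + 1) ^ k) * (1 / 2) ^ m" for m
    proof -
      let ?N = "expo s m"
      have fc: "hideal s m \<subseteq> carrier R" using subm_carr[OF idl_hideal] .
      have iA: "idl (P <+> frob_pow R (hideal s m) (p ^ 1))" using iP idl_frob[OF fc] by auto
      have "ipow I (?r * p ^ 1 + ?N * p ^ 1) \<subseteq> frob_pow R (hideal s m) (p ^ 1)"
        using ipow_subset_frob[OF xs, of 1 ?N] frob_mono[OF ipow_subset_hideal fc, of "p ^ 1"] by blast
      also have "\<dots> \<subseteq> P <+> frob_pow R (hideal s m) (p ^ 1)" by (rule set_add_upper2[OF iP subm_carr[OF idl_frob[OF fc]]])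
      finally have cA: "cofin (P <+> frob_pow R (hideal s m) (p ^ 1))" by (rule cofin_above_ipow[OF iA])
      have "P <+> frob_pow R (hideal s m) (p ^ 1) \<subseteq> P <+> hideal s (m + 1)"
        by (rule set_add_mono[OF subset_refl frob_hideal_subset[OF s]])
      from cl_antimono[OF cA iPh this]
      have "cl (P <+> hideal s (Suc m)) \<le> cl (P <+> frob_pow R (hideal s m) (p ^ 1))" by simp
      also have "\<dots> \<le> \<mu> * cl (P <+> hideal s m) + C * real ?N ^ k"
        using C(2)[OF expo_bounds(3)[OF s] idl_hideal ipow_subset_hideal, of m] by linarith
      also have "C * real ?N ^ k \<le> C * ((s + 1) * real p ^ m) ^ k"
      proof (intro mult_left_mono power_mono C(1))
        have "1 \<le> real p ^ m" using p_gt_1 by (intro one_le_power) auto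
        then show "real ?N \<le> (s + 1) * real p ^ m" using expo_bounds(2)[OF s, of m] by (simp add: distrib_right)
      qed auto
      finally have "cl (P <+> hideal s (Suc m)) \<le> real p ^ ?d * cl (P <+> hideal s m) + C * (s + 1) ^ k * real p ^ (m * k)"
        unfolding lam by (simp add: power_mult_distrib power_mult mult.assoc)
      then have "z (Suc m) \<le> (real p ^ ?d * cl (P <+> hideal s m) + C * (s + 1) ^ k * real p ^ (m * k)) / real p ^ (Suc m * ?d)"
        unfolding z_def using pp[of "Suc m * ?d"] by (intro divide_right_mono) auto
      also have "\<dots> = z m + C * (s + 1) ^ k * (real p ^ (m * k) / real p ^ (Suc m * ?d))"
        unfolding z_def using p_gt_1 by (simp add: add_divide_distrib power_add)
      also have "real p ^ (m * k) / real p ^ (Suc m * ?d) \<le> (1 / 2) ^ m"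
      proof -
        have e: "Suc m * ?d = m * k + (m + ?d)" by simp
        have "real p ^ (m * k) / real p ^ (Suc m * ?d) = 1 / real p ^ (m + ?d)"
          unfolding e power_add[of _ "m * k"] using p_gt_1 by simp
        also have "\<dots> \<le> 1 / 2 ^ m"
        proof (rule divide_left_mono)
          have "(2::real) ^ m \<le> real p ^ m" using p_ge_2 by (intro power_mono) auto
          also have "\<dots> \<le> real p ^ (m + ?d)" using p_gt_1 by (intro power_increasing) auto
          finally show "(2::real) ^ m \<le> real p ^ (m + ?d)" .
        qed (use pp in auto)
        finally show ?thesis by (simp add: power_divide)
      qed
      then have "C * (s + 1) ^ k * (real p ^ (m * k) / real p ^ (Suc m * ?d)) \<le> C * (s + 1) ^ k * (1 / 2) ^ m"
        using C(1) s by (intro mult_left_mono) auto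
      finally show ?thesis by simp
    qed
    moreover have "0 \<le> z m" for m unfolding z_def using pp by (intro divide_nonneg_nonneg) (auto simp: less_imp_le)
    moreover have "0 \<le> C * (s + 1) ^ k" using C(1) s by simp
    ultimately obtain l where "z \<longlonglongrightarrow> l" using almost_decreasing_convergent[of z] by blast
    then show ?thesis unfolding z_def by blast
  qed
qed

text \<open>\<open>(A + B)/(A' + B)\<close> is a quotient of \<open>A/A'\<close>.\<close>

lemma cl_shift_le:
  assumes A: "cofin A'" "idl A" "A' \<subseteq> A" and B: "idl B"
  shows "cl (A' <+> B) \<le> cl (A <+> B) + (cl A' - cl A)"
proof -
  have cA: "cofin A" by (rule cofin_mono[OF A])
  have iA': "idl A'" using cofin_idl[OF A(1)] .
  have iAB: "idl (A' <+> B)" using iA' B by auto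
  have sub: "A' \<subseteq> A' <+> B" by (rule set_add_upper1[OF B subm_carr[OF iA']])
  have cAB: "cofin (A' <+> B)" by (rule cofin_mono[OF A(1) iAB sub])
  have sB: "B \<subseteq> A' <+> B" by (rule set_add_upper2[OF iA' subm_carr[OF B]])
  have iABA: "idl ((A' <+> B) <+> A)" using iAB A(2) by auto
  have AB: "idl (A <+> B)" using A(2) B by auto
  have e: "(A' <+> B) <+> A = A <+> B"
  proof
    show "(A' <+> B) <+> A \<subseteq> A <+> B"
      using set_add_upper1[OF B subm_carr[OF A(2)]] by (intro set_add_le[OF AB] set_add_mono A(3)) auto
    show "A <+> B \<subseteq> (A' <+> B) <+> A"
      using set_add_upper2[OF iAB subm_carr[OF A(2)]] set_add_upper1[OF A(2) subm_carr[OF iAB]] sB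
      by (intro set_add_le[OF iABA]) blast+
  qed
  note I = cl_Int[OF cAB cA]
  have "cl ((A' <+> B) \<inter> A) \<le> cl A'"
    by (rule cl_antimono[OF A(1) cofin_idl[OF I(1)]]) (use sub A(3) in auto)
  then show ?thesis using I(2) unfolding e by linarith
qed

text \<open>The decomposition gives convergence for the Frobenius powers of
  \<open>hideal s m\<close>. Such a power is compared with \<open>hideal s (m + e)\<close>, from
  which it differs only in the part coming from powers of \<open>I\<close>. Both exponents
  concerned, \<open>M m\<close> and \<open>expo s (m + e)\<close>, are asymptotic to
  \<open>s p^(m+e)\<close>, and \<open>cl_shift_le\<close> makes the difference negligible.\<close>

theorem hideal_tendsto:
  assumes dim: "chain_free {\<zero>} (Suc k)" and s: "0 < s"
  shows "\<exists>l. (\<lambda>m. cl (hideal s m) / real p ^ (m * Suc k)) \<longlonglongrightarrow> l"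
proof -
  let ?d = "Suc k"
  obtain e F \<omega> C where F: "finite F" "\<And>P. P \<in> F \<Longrightarrow> primeideal P R" and C: "0 \<le> C"
    and cmp: "\<And>n J. 1 \<le> n \<Longrightarrow> idl J \<Longrightarrow> ipow I n \<subseteq> J \<Longrightarrow>
      \<bar>cl (frob_pow R J (p ^ e)) - (\<Sum>P\<in>F. \<omega> P * cl (P <+> J))\<bar> \<le> C * real n ^ k"
    by (rule frobenius_decomposition[OF dim]) blast
  have "\<exists>l. (\<lambda>m. cl (P <+> hideal s m) / real p ^ (m * ?d)) \<longlonglongrightarrow> l" if "P \<in> F" for P
    by (rule prime_hideal_tendsto[OF F(2)[OF that] dim s])
  then obtain l where l: "\<And>P. P \<in> F \<Longrightarrow> (\<lambda>m. cl (P <+> hideal s m) / real p ^ (m * ?d)) \<longlonglongrightarrow> l P" by metis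
  define Y where "Y m = cl (frob_pow R (hideal s m) (p ^ e))" for m
  define Z where "Z m = (\<Sum>P\<in>F. \<omega> P * cl (P <+> hideal s m))" for m
  have pp: "0 < real p ^ m" for m using p_gt_1 by simp
  have Zl: "(\<lambda>m. Z m / real p ^ (m * ?d)) \<longlonglongrightarrow> (\<Sum>P\<in>F. \<omega> P * l P)"
    unfolding Z_def sum_divide_distrib times_divide_eq_right[symmetric]
    by (intro tendsto_sum tendsto_mult tendsto_const l)
  have YZ: "(\<lambda>m. Y m / real p ^ (m * ?d) - Z m / real p ^ (m * ?d)) \<longlonglongrightarrow> 0"
  proof (rule tendsto_rabs_zero_cancel, rule tendsto_sandwich[OF _ _ tendsto_const inverse_p_power_tendsto[of "C * (s + 1) ^ k"]])
    show "\<forall>\<^sub>F m in sequentially. 0 \<le> \<bar>Y m / real p ^ (m * ?d) - Z m / real p ^ (m * ?d)\<bar>" by simp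
    have "\<bar>Y m / real p ^ (m * ?d) - Z m / real p ^ (m * ?d)\<bar> \<le> C * (s + 1) ^ k / real p ^ m" for m
    proof -
      have "\<bar>Y m / real p ^ (m * ?d) - Z m / real p ^ (m * ?d)\<bar> = \<bar>Y m - Z m\<bar> / real p ^ (m * ?d)"
        using pp[of "m * ?d"] by (simp add: abs_divide flip: diff_divide_distrib)
      also have "\<dots> \<le> C * real (expo s m) ^ k / real p ^ (m * ?d)"
        unfolding Y_def Z_def using cmp[OF expo_bounds(3)[OF s] idl_hideal ipow_subset_hideal, of m] pp[of "m * ?d"]
        by (intro divide_right_mono) auto
      also have "\<dots> \<le> C * ((s + 1) * real p ^ m) ^ k / real p ^ (m * ?d)"
      proof (intro divide_right_mono mult_left_mono power_mono C)
        have "1 \<le> real p ^ m" using p_gt_1 by (intro one_le_power) auto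
        then show "real (expo s m) \<le> (s + 1) * real p ^ m" using expo_bounds(2)[OF s, of m] by (simp add: distrib_right)
      qed (use pp[of "m * ?d"] in auto)
      also have "\<dots> = C * (s + 1) ^ k / real p ^ m"
        using p_gt_1 by (simp add: power_mult_distrib power_add flip: power_mult)
      finally show ?thesis .
    qed
    then show "\<forall>\<^sub>F m in sequentially. \<bar>Y m / real p ^ (m * ?d) - Z m / real p ^ (m * ?d)\<bar> \<le> C * (s + 1) ^ k / real p ^ m"
      by simp
  qed
  have Yl: "(\<lambda>m. Y m / real p ^ (m * ?d)) \<longlonglongrightarrow> (\<Sum>P\<in>F. \<omega> P * l P)"
    using tendsto_add[OF YZ Zl] by simp
  obtain xs where xs: "set xs \<subseteq> carrier R" "I = lsum R xs (carrier R)" by (rule I_generators)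
  define M where "M m = length xs * p ^ e + expo s m * p ^ e" for m
  have Mle: "expo s (m + e) \<le> M m" for m using expo_add_le[OF s, of m e] by (simp add: M_def trans_le_add2)
  have iI: "idl (ipow I n)" for n using idl_I by auto
  have up: "cl (hideal s (m + e)) \<le> Y m" for m
  proof -
    have "ipow I (M m) \<subseteq> frob_pow R (hideal s m) (p ^ e)"
      unfolding M_def using ipow_subset_frob[OF xs, of e "expo s m"] frob_mono[OF ipow_subset_hideal subm_carr[OF idl_hideal], of s m "p ^ e"] by blast
    then have "cofin (frob_pow R (hideal s m) (p ^ e))" by (intro cofin_above_ipow[OF idl_frob[OF subm_carr[OF idl_hideal]]])
    then show ?thesis unfolding Y_def by (intro cl_antimono[OF _ idl_hideal frob_hideal_subset[OF s]])
  qed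
  have lo: "Y m \<le> cl (hideal s (m + e)) + (cl (ipow I (M m)) - cl (ipow I (expo s (m + e))))" for m
  proof -
    let ?A = "ipow I (M m) <+> frob_pow R I (p ^ (m + e))"
    have iA: "idl ?A" using iI by auto
    have "cofin ?A" by (rule cofin_above_ipow[OF iA set_add_upper1[OF idl_frob_I subm_carr[OF iI]]])
    moreover have "?A \<subseteq> frob_pow R (hideal s m) (p ^ e)"
      unfolding frob_hideal M_def by (rule set_add_mono[OF ipow_subset_frob[OF xs] subset_refl])
    ultimately have "Y m \<le> cl ?A" unfolding Y_def by (intro cl_antimono[OF _ idl_frob[OF subm_carr[OF idl_hideal]]])
    also have "\<dots> \<le> cl (hideal s (m + e)) + (cl (ipow I (M m)) - cl (ipow I (expo s (m + e))))"
      unfolding hideal_def by (rule cl_shift_le[OF cofin_ipow iI ipow_antimono[OF idl_I Mle] idl_frob_I])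
    finally show ?thesis .
  qed
  have zz: "{\<zero>} <+> ipow I n = ipow I n" for n
    by (rule set_add_absorb1[OF subm_singleton_zero iI]) (use subm_zero[OF iI] in auto)
  obtain L where "(\<lambda>n. cl ({\<zero>} <+> ipow I n) / real n ^ ?d) \<longlonglongrightarrow> L"
    using cl_add_ipow_tendsto[OF subm_singleton_zero dim] by auto
  then have L: "(\<lambda>n. cl (ipow I n) / real n ^ ?d) \<longlonglongrightarrow> L" unfolding zz .
  let ?b = "\<lambda>m. real p ^ (m + e)"
  have bt: "filterlim ?b at_top sequentially"
    using filterlim_compose[OF p_power_at_top filterlim_add_const_nat_at_top[of e]] by simp
  have t1: "(\<lambda>m. real (expo s (m + e)) / ?b m) \<longlonglongrightarrow> s" using LIMSEQ_ignore_initial_segment[OF expo_tendsto[OF s], of e] .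
  have "(\<lambda>m. real (length xs) / real p ^ m + real (expo s m) / real p ^ m) \<longlonglongrightarrow> 0 + s"
    by (intro tendsto_add inverse_p_power_tendsto expo_tendsto s)
  moreover have "real (length xs) / real p ^ m + real (expo s m) / real p ^ m = real (M m) / ?b m" for m
    unfolding M_def using p_gt_1 by (simp add: power_add add_divide_distrib)
  ultimately have t2: "(\<lambda>m. real (M m) / ?b m) \<longlonglongrightarrow> s" by simp
  have "(\<lambda>m. cl (ipow I (M m)) / ?b m ^ ?d - cl (ipow I (expo s (m + e))) / ?b m ^ ?d) \<longlonglongrightarrow> L * s ^ ?d - L * s ^ ?d"
    by (intro tendsto_diff tendsto_rescale[OF L t1 s bt] tendsto_rescale[OF L t2 s bt])
  then have E: "(\<lambda>m. (cl (ipow I (M m)) - cl (ipow I (expo s (m + e)))) / ?b m ^ ?d) \<longlonglongrightarrow> 0"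
    by (simp only: diff_divide_distrib diff_self)
  have bd: "?b m ^ ?d = real p ^ (m * ?d) * real p ^ (e * ?d)" for m
    by (simp only: power_add power_mult_distrib power_mult)
  have "(\<lambda>m. Y m / real p ^ (m * ?d) * (1 / real p ^ (e * ?d))) \<longlonglongrightarrow> (\<Sum>P\<in>F. \<omega> P * l P) * (1 / real p ^ (e * ?d))"
    by (intro tendsto_mult Yl tendsto_const)
  then have Yb: "(\<lambda>m. Y m / ?b m ^ ?d) \<longlonglongrightarrow> (\<Sum>P\<in>F. \<omega> P * l P) / real p ^ (e * ?d)"
    unfolding bd by simp
  have bpos: "0 < ?b m ^ ?d" for m using pp[of "m + e"] by simp
  have "(\<lambda>m. cl (hideal s (m + e)) / ?b m ^ ?d) \<longlonglongrightarrow> (\<Sum>P\<in>F. \<omega> P * l P) / real p ^ (e * ?d)"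
  proof (rule tendsto_sandwich[OF _ _ _ Yb])
    show "\<forall>\<^sub>F m in sequentially. Y m / ?b m ^ ?d - (cl (ipow I (M m)) - cl (ipow I (expo s (m + e)))) / ?b m ^ ?d
        \<le> cl (hideal s (m + e)) / ?b m ^ ?d"
      unfolding diff_divide_distrib[symmetric] using lo bpos
      by (intro always_eventually allI divide_right_mono) (auto simp: less_imp_le algebra_simps)
    show "\<forall>\<^sub>F m in sequentially. cl (hideal s (m + e)) / ?b m ^ ?d \<le> Y m / ?b m ^ ?d"
      using up bpos by (intro always_eventually allI divide_right_mono) (auto simp: less_imp_le)
    show "(\<lambda>m. Y m / ?b m ^ ?d - (cl (ipow I (M m)) - cl (ipow I (expo s (m + e)))) / ?b m ^ ?d)
        \<longlonglongrightarrow> (\<Sum>P\<in>F. \<omega> P * l P) / real p ^ (e * ?d)"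
      using tendsto_diff[OF Yb E] by simp
  qed
  then have "(\<lambda>m. cl (hideal s (m + e)) / real p ^ ((m + e) * ?d)) \<longlonglongrightarrow> (\<Sum>P\<in>F. \<omega> P * l P) / real p ^ (e * ?d)"
    by (simp only: power_mult)
  then have "(\<lambda>m. cl (hideal s m) / real p ^ (m * ?d)) \<longlonglongrightarrow> (\<Sum>P\<in>F. \<omega> P * l P) / real p ^ (e * ?d)"
    by (rule LIMSEQ_offset[where f = "\<lambda>m. cl (hideal s m) / real p ^ (m * ?d)"])
  then show ?thesis by blast
qed

end

section \<open>The equivalences\<close>

lemma finite_chain_height:
  assumes "chain_height F = enat d" "F \<noteq> {}"
  shows "\<exists>C. strict_chain F d C" "\<not> (\<exists>C. strict_chain F (Suc d) C)"
  using le_chain_height_iff[OF assms(2)] assms(1) by (metis order_refl, metis enat_ord_simps(1) Suc_n_not_le_n)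

context local_cring begin

text \<open>Each new generator adds a cyclic module killed by its \<open>A\<close>. The applications
  are \<open>x^q\<close> with a power of \<open>I\<close> as annihilator, and \<open>g^q\<close>
  with a tight closure multiplier in the annihilator.\<close>

lemma cl_add_generators:
  assumes B: "cofin B" and ys: "set ys \<subseteq> carrier R"
    and A: "\<And>y. y \<in> set ys \<Longrightarrow> \<exists>A. cofin A \<and> cl A \<le> \<beta> \<and> (\<forall>a\<in>A. y \<otimes> a \<in> B)"
  shows "cl B \<le> cl (lsum R ys (carrier R) <+> B) + real (length ys) * \<beta>"
  using ys A
proof (induction ys)
  case Nil
  have "{\<zero>} <+> B = B"
    by (rule set_add_absorb1[OF subm_singleton_zero cofin_idl[OF B]]) (use subm_zero[OF cofin_idl[OF B]] in auto)
  then show ?case by simp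
next
  case (Cons y ys)
  have iB: "idl B" using cofin_idl[OF B] .
  have y: "y \<in> carrier R" and ysc: "set ys \<subseteq> carrier R" using Cons.prems by auto
  let ?L = "lsum R ys (carrier R)"
  have iL: "idl ?L" using idl_lsum[OF ysc idl_carrier] .
  have iy: "idl (prin y)" using y by auto
  have LB: "idl (?L <+> B)" using iL iB by auto
  have sB: "B \<subseteq> ?L <+> B" by (rule set_add_upper2[OF iL subm_carr[OF iB]])
  have sL: "?L \<subseteq> ?L <+> B" by (rule set_add_upper1[OF iB subm_carr[OF iL]])
  have cLB: "cofin (?L <+> B)" by (rule cofin_mono[OF B LB sB])
  obtain A where A: "cofin A" "cl A \<le> \<beta>" "\<forall>a\<in>A. y \<otimes> a \<in> B" using Cons.prems(2)[of y] by auto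
  have yLB: "idl (prin y <+> (?L <+> B))" by (rule idl_set_add[OF iy LB])
  have yL: "idl ((prin y <+> ?L) <+> B)" using iy iL iB by auto
  have "(prin y <+> ?L) <+> B \<subseteq> prin y <+> (?L <+> B)"
    using set_add_upper1[OF LB subm_carr[OF iy]] set_add_upper2[OF iy subm_carr[OF LB]] sL sB
    by (intro set_add_le[OF yLB]) blast+
  moreover have "cofin ((prin y <+> ?L) <+> B)"
    by (rule cofin_mono[OF B yL set_add_upper2[OF _ subm_carr[OF iB]]]) (use iy iL in auto)
  ultimately have "cl (prin y <+> (?L <+> B)) \<le> cl ((prin y <+> ?L) <+> B)" using cl_antimono yLB by blast
  moreover have "cl (?L <+> B) \<le> cl (prin y <+> (?L <+> B)) + cl A"
    by (rule cl_split[OF cLB y yLB subset_refl cofin_colon(1)[OF cLB y] A(1)]) (use A(3) sB in auto)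
  moreover have "cl B \<le> cl (?L <+> B) + real (length ys) * \<beta>" using Cons.IH[OF ysc] Cons.prems(2) by auto
  ultimately have "cl B \<le> cl ((prin y <+> ?L) <+> B) + (real (length ys) * \<beta> + \<beta>)" using A(2) by linarith
  then show ?case by (simp add: algebra_simps)
qed

lemma cl_ipow_tendsto:
  assumes "chain_free {\<zero>} d"
  obtains L where "(\<lambda>n. cl (ipow I n) / real n ^ d) \<longlonglongrightarrow> L"
proof -
  have "{\<zero>} <+> ipow I n = ipow I n" for n
    by (rule set_add_absorb1[OF subm_singleton_zero idl_ipow[OF idl_I]]) (use subm_zero[OF idl_ipow[OF idl_I]] in auto)
  then show ?thesis using cl_add_ipow_tendsto[OF subm_singleton_zero assms] that by auto
qed

lemma cl_ipow_upper:
  assumes "chain_free {\<zero>} d"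
  obtains C where "0 \<le> C" "\<And>n. 1 \<le> n \<Longrightarrow> cl (ipow I n) \<le> C * real n ^ d"
proof -
  have "{\<zero>} <+> ipow I n = ipow I n" for n
    by (rule set_add_absorb1[OF subm_singleton_zero idl_ipow[OF idl_I]]) (use subm_zero[OF idl_ipow[OF idl_I]] in auto)
  then show ?thesis using cl_upper[OF subm_singleton_zero assms] that by auto
qed

text \<open>Passing to the quotient by the bottom prime of the chain only lowers colengths, and
  there \<open>cl_lower\<close> applies.\<close>

lemma cl_ipow_limit_pos:
  assumes C: "strict_chain {P. primeideal P R} d C" and L: "(\<lambda>n. cl (ipow I n) / real n ^ d) \<longlonglongrightarrow> L"
  shows "0 < L"
proof -
  obtain c N where c: "c > 0" "\<And>n. n \<ge> N \<Longrightarrow> c * real n ^ d \<le> cl (C 0 <+> ipow I n)" using cl_lower[OF C] by auto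
  have iP: "idl (C 0)" using C primeideal_idl by (auto simp: strict_chain_def)
  have "c \<le> cl (ipow I n) / real n ^ d" if "n \<ge> max N 1" for n
  proof -
    have "c * real n ^ d \<le> cl (C 0 <+> ipow I n)" using c(2) that by simp
    also have "\<dots> \<le> cl (ipow I n)" by (rule cl_antimono[OF cofin_ipow idl_add_ipow[OF iP] ipow_subset_add[OF iP]])
    finally show ?thesis using that by (simp add: pos_le_divide_eq)
  qed
  then have "c \<le> L" by (intro LIMSEQ_le_const[OF L]) blast
  then show ?thesis using c by simp
qed

end

context local_frobenius begin

section \<open>Translation of the invariants into limits of colengths\<close>

lemma colength_ideal_pow: "colength R (ideal_pow R I n) = cl (ipow I n)"
  using colength_eq_cl[OF idl_ipow[OF idl_I, of n]] by (simp add: ipow_def)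

lemma colength_frob: "colength R (frob_pow R I q) = cl (frob_pow R I q)"
  by (rule colength_eq_cl) auto

lemma colength_hideal:
  "colength R (ideal_pow R I (nat \<lceil>s * real p ^ n\<rceil>) <+> frob_pow R I (p ^ n)) = cl (hideal s n)"
  using colength_eq_cl[OF idl_hideal[of s n]] by (simp add: hideal_def expo_def ipow_def)

lemma hilbert_samuel_eq:
  assumes "(\<lambda>n. cl (ipow I n) / real n ^ d) \<longlonglongrightarrow> L"
  shows "hilbert_samuel_mult R d I = fact d * L"
proof -
  have "(\<lambda>n. fact d * (cl (ipow I n) / real n ^ d)) \<longlonglongrightarrow> fact d * L" by (intro tendsto_intros assms)
  then show ?thesis unfolding hilbert_samuel_mult_def colength_ideal_pow by (intro limI) simp
qed

lemma hilbert_kunz_eq: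
  "(\<lambda>n. cl (frob_pow R I (p ^ n)) / real p ^ (n * d)) \<longlonglongrightarrow> h \<Longrightarrow> hilbert_kunz_mult R p d I = h"
  unfolding hilbert_kunz_mult_def colength_frob by (rule limI)

lemma h_function_eq:
  "(\<lambda>n. cl (hideal s n) / real p ^ (n * d)) \<longlonglongrightarrow> h \<Longrightarrow> h_function R p d I s = h"
  unfolding h_function_def colength_hideal by (rule limI)

lemma cofin_frob_I: "cofin (frob_pow R I (p ^ e))"
proof -
  obtain xs where xs: "set xs \<subseteq> carrier R" "I = lsum R xs (carrier R)" by (rule I_generators)
  show ?thesis by (rule cofin_above_ipow[OF idl_frob_I ipow_subset_frob_1[OF xs, of e "Suc (length xs * p ^ e)"]]) auto
qed

lemma ipow_p_tendsto:
  assumes L: "(\<lambda>n. cl (ipow I n) / real n ^ d) \<longlonglongrightarrow> L" and t: "(\<lambda>m. real (t m) / real p ^ m) \<longlonglongrightarrow> s" "0 < s"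
  shows "(\<lambda>m. cl (ipow I (t m)) / real p ^ (m * d)) \<longlonglongrightarrow> L * s ^ d"
  using tendsto_rescale[OF L t p_power_at_top] by (simp only: power_mult)

text \<open>With \<open>q = p^m\<close>, the ideals in both limits lie between
  \<open>I^(c + q)\<close> and \<open>I^q\<close> for a fixed \<open>c\<close>, and the colengths of
  these two have the same limit.\<close>

lemma low_dim_limits:
  assumes dim: "chain_free {\<zero>} d" and d: "d \<le> 1" and L: "(\<lambda>n. cl (ipow I n) / real n ^ d) \<longlonglongrightarrow> L"
  shows "(\<lambda>n. cl (frob_pow R I (p ^ n)) / real p ^ (n * d)) \<longlonglongrightarrow> L"
    and "1 < s \<Longrightarrow> (\<lambda>n. cl (hideal s n) / real p ^ (n * d)) \<longlonglongrightarrow> L"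
    and "ideal_pow R I (p ^ e + 1) \<subseteq> tight_closure R p (frob_pow R I (p ^ e))"
proof -
  obtain xs where xs: "set xs \<subseteq> carrier R" "I = lsum R xs (carrier R)" by (rule I_generators)
  obtain C where C: "0 \<le> C" "\<And>n. 1 \<le> n \<Longrightarrow> cl (ipow I n) \<le> C * real n ^ d" using cl_ipow_upper[OF dim] by blast
  have "cl (ipow I n) \<le> C * real n" if "1 \<le> n" for n
  proof -
    have "real n ^ d \<le> real n ^ 1" using that d by (intro power_increasing) auto
    then have "C * real n ^ d \<le> C * real n" using C(1) by (intro mult_left_mono) auto
    then show ?thesis using C(2)[OF that] by linarith
  qed
  then obtain c where c: "\<And>q. 1 \<le> q \<Longrightarrow> ipow I (c + q) \<subseteq> lsum R (map (\<lambda>x. x [^] q) xs) (carrier R)"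
    using ipow_subset_powers[OF xs] by blast
  have sub: "ipow I (c + p ^ m) \<subseteq> frob_pow R I (p ^ m)" for m
    using c[of "p ^ m"] frob_lsum[OF xs(1), of m] xs(2) p_pow_pos[of m] by (simp add: Suc_le_eq)
  have pp: "0 < real p ^ m" for m using p_gt_1 by simp
  have "(\<lambda>m. real (p ^ m) / real p ^ m) \<longlonglongrightarrow> 1" using p_gt_1 by simp
  from ipow_p_tendsto[OF L this] have l1: "(\<lambda>m. cl (ipow I (p ^ m)) / real p ^ (m * d)) \<longlonglongrightarrow> L" by simp
  have "(\<lambda>m. real c / real p ^ m + 1) \<longlonglongrightarrow> 0 + 1" by (intro tendsto_add inverse_p_power_tendsto tendsto_const)
  moreover have "real c / real p ^ m + 1 = real (c + p ^ m) / real p ^ m" for m using pp[of m] by (simp add: add_divide_distrib)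
  ultimately have "(\<lambda>m. real (c + p ^ m) / real p ^ m) \<longlonglongrightarrow> 1" by simp
  from ipow_p_tendsto[OF L this] have l2: "(\<lambda>m. cl (ipow I (c + p ^ m)) / real p ^ (m * d)) \<longlonglongrightarrow> L" by simp
  have sandwich: "(\<lambda>m. cl (J m) / real p ^ (m * d)) \<longlonglongrightarrow> L"
    if J: "\<And>m. idl (J m)" "\<And>m. ipow I (c + p ^ m) \<subseteq> J m" "\<And>m. J m \<subseteq> ipow I (p ^ m)" for J
  proof (rule tendsto_sandwich[OF _ _ l1 l2])
    have "cl (ipow I (p ^ m)) \<le> cl (J m)" "cl (J m) \<le> cl (ipow I (c + p ^ m))" for m
      using cl_antimono[OF cofin_ipow J(1,2), of m] cl_antimono[OF cofin_above_ipow[OF J(1,2)] idl_ipow[OF idl_I] J(3), of m] by auto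
    then show "\<forall>\<^sub>F m in sequentially. cl (ipow I (p ^ m)) / real p ^ (m * d) \<le> cl (J m) / real p ^ (m * d)"
      "\<forall>\<^sub>F m in sequentially. cl (J m) / real p ^ (m * d) \<le> cl (ipow I (c + p ^ m)) / real p ^ (m * d)"
      using pp by (auto intro!: always_eventually divide_right_mono simp: less_imp_le)
  qed
  show "(\<lambda>n. cl (frob_pow R I (p ^ n)) / real p ^ (n * d)) \<longlonglongrightarrow> L"
    by (rule sandwich[OF idl_frob_I sub frob_subset_ipow_1[OF idl_I]])
  show "(\<lambda>n. cl (hideal s n) / real p ^ (n * d)) \<longlonglongrightarrow> L" if s: "1 < s"
  proof (rule sandwich[OF idl_hideal])
    fix m
    have "frob_pow R I (p ^ m) \<subseteq> hideal s m"
      unfolding hideal_def by (rule set_add_upper2[OF idl_ipow[OF idl_I] subm_carr[OF idl_frob_I]])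
    then show "ipow I (c + p ^ m) \<subseteq> hideal s m" using sub by blast
    \<comment> \<open>As \<open>s > 1\<close>, the exponent is at least \<open>p^m\<close>, so the
      added power of \<open>I\<close> stays inside \<open>I^(p^m)\<close>.\<close>
    have "real (p ^ m) \<le> s * real p ^ m" using s pp[of m] by simp
    also have "\<dots> \<le> real (expo s m)" using expo_bounds(1) s by simp
    finally have "p ^ m \<le> expo s m" by (simp only: of_nat_le_iff)
    then show "hideal s m \<subseteq> ipow I (p ^ m)"
      unfolding hideal_def
      by (intro set_add_le[OF idl_ipow[OF idl_I]] ipow_antimono[OF idl_I] frob_subset_ipow_1[OF idl_I])
  qed
  show "ideal_pow R I (p ^ e + 1) \<subseteq> tight_closure R p (frob_pow R I (p ^ e))"
  proof
    fix x assume "x \<in> ideal_pow R I (p ^ e + 1)"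
    then have x: "x \<in> ipow I (p ^ e + 1)" by (simp add: ipow_def)
    have xc: "x \<in> carrier R" using subm_mem[OF idl_ipow[OF idl_I] x] .
    have "\<one> \<otimes> x [^] (p ^ n) \<in> frob_pow R (frob_pow R I (p ^ e)) (p ^ n)" if n: "n \<ge> c" for n
    proof -
      \<comment> \<open>The summand \<open>p^n\<close> of \<open>(p^e + 1) p^n\<close> absorbs the
        constant \<open>c\<close> as soon as \<open>n \<ge> c\<close>.\<close>
      have "c < p ^ c" using power_gt_expt[of p c] prime_gt_1_nat[OF prime_p] by simp
      also have "p ^ c \<le> p ^ n" using n by (intro power_increasing) (auto simp: Suc_le_eq)
      finally have "c + p ^ (e + n) \<le> (p ^ e + 1) * p ^ n" by (simp add: power_add)
      then have "ipow I ((p ^ e + 1) * p ^ n) \<subseteq> ipow I (c + p ^ (e + n))" by (rule ipow_antimono[OF idl_I])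
      then have "x [^] (p ^ n) \<in> frob_pow R I (p ^ (e + n))" using pow_mem_ipow[OF idl_I x, of "p ^ n"] sub by blast
      then show ?thesis using xc unfolding frob_frob[OF idl_I] by simp
    qed
    then have ev: "\<forall>\<^sub>F n in sequentially. \<one> \<otimes> x [^] (p ^ n) \<in> frob_pow R (frob_pow R I (p ^ e)) (p ^ n)"
      unfolding eventually_sequentially by blast
    have "\<one> \<notin> P" if "minimal_prime R P" for P
      using that idl_one[OF primeideal_idl[of P]] primeideal_ne[of P] by (auto simp: minimal_prime_def)
    then show "x \<in> tight_closure R p (frob_pow R I (p ^ e))"
      unfolding tight_closure_def using xc ev by (intro CollectI conjI bexI[of _ \<one>]) blast+
  qed
qed

text \<open>For \<open>s = r + 1\<close>, with \<open>r\<close> generators, the power of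
  \<open>I\<close> is contained in \<open>I^[q]\<close>, so the sequence is the one already treated
  for \<open>h(s)\<close>.\<close>

lemma hilbert_kunz_tendsto:
  assumes dim: "chain_free {\<zero>} (Suc k)"
  obtains h where "(\<lambda>n. cl (frob_pow R I (p ^ n)) / real p ^ (n * Suc k)) \<longlonglongrightarrow> h"
proof -
  obtain xs where xs: "set xs \<subseteq> carrier R" "I = lsum R xs (carrier R)" by (rule I_generators)
  define s where "s = real (length xs) + 1"
  have s: "0 < s" by (simp add: s_def)
  have "hideal s m = frob_pow R I (p ^ m)" for m
  proof -
    have "real (length xs * p ^ m) \<le> s * real p ^ m" unfolding s_def by (simp add: distrib_right)
    also have "\<dots> \<le> real (expo s m)" by (rule expo_bounds(1)[OF s])
    finally have "length xs * p ^ m \<le> expo s m" by (simp only: of_nat_le_iff)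
    then have "ipow I (expo s m) \<subseteq> frob_pow R I (p ^ m)"
      using expo_bounds(3)[OF s, of m] by (intro ipow_subset_frob_1[OF xs]) auto
    then show ?thesis unfolding hideal_def by (rule set_add_absorb1[OF idl_ipow[OF idl_I] idl_frob_I])
  qed
  then show ?thesis using hideal_tendsto[OF dim s] that by auto
qed

text \<open>In the limit, \<open>L (1 + \<epsilon>)^d - r L \<epsilon>^d \<le> h\<close>. Up to the
  factor \<open>L\<close>, the gain is at least \<open>d \<epsilon> \<ge> 2 \<epsilon>\<close> and
  the loss is \<open>r \<epsilon>^d \<le> r \<epsilon>^2 \<le> \<epsilon>\<close>; both estimates
  rest on \<open>1 \<le> k\<close>.\<close>

lemma hilbert_kunz_gt:
  assumes k: "1 \<le> k" and L: "(\<lambda>n. cl (ipow I n) / real n ^ Suc k) \<longlonglongrightarrow> L" "0 < L"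
    and h: "(\<lambda>n. cl (frob_pow R I (p ^ n)) / real p ^ (n * Suc k)) \<longlonglongrightarrow> h"
  shows "L < h"
proof -
  let ?d = "Suc k"
  obtain xs where xs: "set xs \<subseteq> carrier R" "I = lsum R xs (carrier R)" by (rule I_generators)
  let ?r = "length xs"
  have pp: "0 < real p ^ m" for m using p_gt_1 by simp
  have iI: "idl (ipow I n)" for n using idl_I by auto
  have b: "cl (ipow I (p ^ m + t)) \<le> cl (frob_pow R I (p ^ m)) + real ?r * cl (ipow I t)" for m t
  proof -
    let ?ys = "map (\<lambda>x. x [^] (p ^ m)) xs" and ?B = "ipow I (p ^ m + t)"
    have ys: "set ?ys \<subseteq> carrier R" using xs by auto
    have "cl ?B \<le> cl (lsum R ?ys (carrier R) <+> ?B) + real (length ?ys) * cl (ipow I t)"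
    proof (rule cl_add_generators[OF cofin_ipow ys])
      fix y assume "y \<in> set ?ys"
      then obtain x where x: "x \<in> set xs" "y = x [^] (p ^ m)" by auto
      have "x \<in> ipow I 1" using gen_in_I[OF xs x(1)] ipow_1[OF idl_I] by simp
      then have "y \<in> ipow I (p ^ m)" using pow_mem_ipow[OF idl_I, of x 1 "p ^ m"] x by simp
      then show "\<exists>A. cofin A \<and> cl A \<le> cl (ipow I t) \<and> (\<forall>a\<in>A. y \<otimes> a \<in> ?B)"
        using ipow_mult_mem[OF idl_I] by (intro exI[of _ "ipow I t"]) auto
    qed
    moreover have "cl (lsum R ?ys (carrier R) <+> ?B) \<le> cl (frob_pow R I (p ^ m))"
      unfolding frob_lsum[OF xs(1), of m, folded xs(2), symmetric]
      by (rule cl_antimono[OF cofin_frob_I idl_set_add[OF idl_frob_I iI] set_add_upper1[OF iI subm_carr[OF idl_frob_I]]])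
    ultimately show ?thesis by simp
  qed
  \<comment> \<open>Taking \<open>\<epsilon> = p^(-j)\<close> makes
    \<open>t = \<epsilon> p^(i+j) = p^i\<close> an integer and gives
    \<open>r \<epsilon> < 1\<close>.\<close>
  obtain j where "real ?r < real p ^ j"
    using p_power_at_top unfolding filterlim_at_top_dense eventually_sequentially by blast
  define \<epsilon> where "\<epsilon> = 1 / real p ^ j"
  have e: "0 < \<epsilon>" "real ?r * \<epsilon> < 1" using \<open>real ?r < real p ^ j\<close> pp[of j] by (auto simp: \<epsilon>_def)
  have e1: "\<epsilon> \<le> 1" unfolding \<epsilon>_def using p_gt_1 by simp
  let ?b = "\<lambda>i. real p ^ (i + j)"
  have bt: "filterlim ?b at_top sequentially"
    using filterlim_compose[OF p_power_at_top filterlim_add_const_nat_at_top[of j]] by simp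
  have "real (p ^ (i + j) + p ^ i) / ?b i = 1 + \<epsilon>" for i
    unfolding \<epsilon>_def using p_gt_1 by (simp add: power_add field_simps)
  then have t1: "(\<lambda>i. real (p ^ (i + j) + p ^ i) / ?b i) \<longlonglongrightarrow> 1 + \<epsilon>" by simp
  have "real (p ^ i) / ?b i = \<epsilon>" for i unfolding \<epsilon>_def using p_gt_1 by (simp add: power_add)
  then have t2: "(\<lambda>i. real (p ^ i) / ?b i) \<longlonglongrightarrow> \<epsilon>" by simp
  have lim1: "(\<lambda>i. cl (ipow I (p ^ (i + j) + p ^ i)) / ?b i ^ ?d - real ?r * (cl (ipow I (p ^ i)) / ?b i ^ ?d))
      \<longlonglongrightarrow> L * (1 + \<epsilon>) ^ ?d - real ?r * (L * \<epsilon> ^ ?d)"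
    using e by (intro tendsto_diff tendsto_mult tendsto_const tendsto_rescale[OF L(1) t1 _ bt] tendsto_rescale[OF L(1) t2 _ bt]) auto
  have lim2: "(\<lambda>i. cl (frob_pow R I (p ^ (i + j))) / ?b i ^ ?d) \<longlonglongrightarrow> h"
    using LIMSEQ_ignore_initial_segment[OF h, of j] by (simp only: power_mult)
  have "cl (ipow I (p ^ (i + j) + p ^ i)) / ?b i ^ ?d - real ?r * (cl (ipow I (p ^ i)) / ?b i ^ ?d)
      \<le> cl (frob_pow R I (p ^ (i + j))) / ?b i ^ ?d" for i
  proof -
    have "0 \<le> ?b i ^ ?d" using pp[of "i + j"] by (simp add: less_imp_le)
    from divide_right_mono[OF b[of "i + j" "p ^ i"] this] show ?thesis by (simp add: add_divide_distrib)
  qed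
  then have "L * (1 + \<epsilon>) ^ ?d - real ?r * (L * \<epsilon> ^ ?d) \<le> h" by (intro LIMSEQ_le[OF lim1 lim2]) blast
  moreover have "L * (1 + \<epsilon>) \<le> L * (1 + \<epsilon>) ^ ?d - real ?r * (L * \<epsilon> ^ ?d)"
  proof -
    have "1 + real ?d * \<epsilon> \<le> (1 + \<epsilon>) ^ ?d" using e by (intro Bernoulli_inequality) auto
    moreover have "2 * \<epsilon> \<le> real ?d * \<epsilon>" using k e by (intro mult_right_mono) auto
    moreover have "real ?r * \<epsilon> ^ ?d \<le> \<epsilon>"
    proof -
      have "\<epsilon> ^ ?d \<le> \<epsilon> ^ 2" using e e1 k by (intro power_decreasing) auto
      then have "real ?r * \<epsilon> ^ ?d \<le> real ?r * \<epsilon> ^ 2" by (intro mult_left_mono) auto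
      also have "\<dots> = (real ?r * \<epsilon>) * \<epsilon>" by (simp add: power2_eq_square)
      also have "\<dots> \<le> 1 * \<epsilon>" using e by (intro mult_right_mono) auto
      finally show ?thesis by simp
    qed
    ultimately have "1 + \<epsilon> \<le> (1 + \<epsilon>) ^ ?d - real ?r * \<epsilon> ^ ?d" by linarith
    then have "L * (1 + \<epsilon>) \<le> L * ((1 + \<epsilon>) ^ ?d - real ?r * \<epsilon> ^ ?d)" using L(2) by (intro mult_left_mono) auto
    then show ?thesis by (simp add: algebra_simps)
  qed
  moreover have "L < L * (1 + \<epsilon>)" using L(2) e by (simp add: algebra_simps)
  ultimately show ?thesis by linarith
qed

lemma h_function_less:
  assumes dim: "chain_free {\<zero>} (Suc k)" and L: "(\<lambda>n. cl (ipow I n) / real n ^ Suc k) \<longlonglongrightarrow> L" "L < h"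
  obtains s where "1 < s" "h_function R p (Suc k) I s < h"
proof -
  let ?d = "Suc k"
  \<comment> \<open>Continuity of \<open>L s^d\<close> at \<open>1\<close> supplies an
    \<open>s = 1 + 1/n\<close> with \<open>L s^d < h\<close>.\<close>
  have "(\<lambda>n. L * (1 + 1 / real n) ^ ?d) \<longlonglongrightarrow> L * (1 + 0) ^ ?d"
    by (intro tendsto_intros lim_const_over_n)
  then have "\<forall>\<^sub>F n in sequentially. L * (1 + 1 / real n) ^ ?d < h" using L(2) by (intro order_tendstoD(2)) auto
  then have "\<forall>\<^sub>F n in sequentially. 0 < n \<and> L * (1 + 1 / real n) ^ ?d < h"
    using eventually_gt_at_top[of 0] by eventually_elim simp
  then obtain n where n: "0 < n" "L * (1 + 1 / real n) ^ ?d < h" unfolding eventually_sequentially by blast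
  define s where "s = 1 + 1 / real n"
  have s: "1 < s" "0 < s" using n by (auto simp: s_def intro: add_pos_pos)
  obtain l where l: "(\<lambda>m. cl (hideal s m) / real p ^ (m * ?d)) \<longlonglongrightarrow> l" using hideal_tendsto[OF dim s(2)] by blast
  have "l \<le> L * s ^ ?d"
  proof (rule LIMSEQ_le[OF l ipow_p_tendsto[OF L(1) expo_tendsto[OF s(2)] s(2)]])
    have "cl (hideal s m) \<le> cl (ipow I (expo s m))" for m by (rule cl_antimono[OF cofin_ipow idl_hideal ipow_subset_hideal])
    then show "\<exists>N. \<forall>m\<ge>N. cl (hideal s m) / real p ^ (m * ?d) \<le> cl (ipow I (expo s m)) / real p ^ (m * ?d)"
      using p_gt_1 by (auto intro!: divide_right_mono)
  qed
  then have "h_function R p ?d I s < h" using h_function_eq[OF l] n by (simp add: s_def)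
  then show ?thesis using that s by blast
qed

text \<open>Let \<open>Q = p^e\<close> and \<open>q = p^n\<close>. Adding the generators
  \<open>g^q\<close> of \<open>(I^(Q+1))^[q]\<close> to \<open>I^[Q q]\<close> changes the colength
  little: \<open>c g\<close> carries \<open>g^q\<close> into \<open>I^[Q q]\<close>, and
  \<open>R/(c g)\<close> has dimension below \<open>d\<close> because \<open>c g\<close> avoids the
  minimal primes. The enlarged ideal contains \<open>I^((r + Q + 1) q)\<close>, which accounts for
  the main term.\<close>

lemma tight_closure_bound:
  assumes dim: "chain_free {\<zero>} (Suc k)" and L: "(\<lambda>n. cl (ipow I n) / real n ^ Suc k) \<longlonglongrightarrow> L"
    and h: "(\<lambda>n. cl (frob_pow R I (p ^ n)) / real p ^ (n * Suc k)) \<longlonglongrightarrow> h"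
    and xs: "set xs \<subseteq> carrier R" "I = lsum R xs (carrier R)"
    and tc: "ideal_pow R I (p ^ e + 1) \<subseteq> tight_closure R p (frob_pow R I (p ^ e))"
  shows "h \<le> L * (1 + real (length xs + 1) / real p ^ e) ^ Suc k"
proof -
  let ?d = "Suc k" and ?r = "length xs" and ?Q = "p ^ e"
  have pp: "0 < real p ^ m" for m using p_gt_1 by simp
  have iI: "idl (ipow I n)" for n using idl_I by auto
  obtain gs where gs: "set gs \<subseteq> carrier R" "ipow I (?Q + 1) = lsum R gs (carrier R)" using idl_fin_gen[OF iI] by blast
  have gI: "g \<in> ipow I (?Q + 1)" if "g \<in> set gs" for g
    unfolding gs(2) using lsum_mem[OF gs(1) idl_carrier _ that, of \<one>] gs(1) that by auto
  have "\<exists>c C N. c \<in> carrier R \<and> 0 \<le> C \<and> (\<forall>n\<ge>1. cl (prin c <+> ipow I n) \<le> C * real n ^ k) \<and>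
      (\<forall>n\<ge>N. c \<otimes> g [^] (p ^ n) \<in> frob_pow R I (p ^ (e + n)))" if g: "g \<in> set gs" for g
  proof -
    have "g \<in> tight_closure R p (frob_pow R I ?Q)" using gI[OF g] tc by (auto simp: ipow_def)
    then obtain c N where c: "c \<in> carrier R" "\<And>P. minimal_prime R P \<Longrightarrow> c \<notin> P"
      "\<And>n. n \<ge> N \<Longrightarrow> c \<otimes> g [^] (p ^ n) \<in> frob_pow R (frob_pow R I ?Q) (p ^ n)"
      unfolding tight_closure_def eventually_sequentially by blast
    have ic: "idl (prin c)" using c by auto
    have "chain_free (prin c) k"
    proof (rule chain_free_above_prime[OF dim])
      fix Q assume Q: "primeideal Q R" "prin c \<subseteq> Q"
      then have "c \<in> Q" using mem_prin[OF c(1)] by auto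
      then have "\<not> minimal_prime R Q" using c(2) by blast
      then obtain P where P: "primeideal P R" "P \<subset> Q" using Q(1) by (auto simp: minimal_prime_def)
      then show "\<exists>P. primeideal P R \<and> {\<zero>} \<subseteq> P \<and> P \<subset> Q"
        using subm_zero[OF primeideal_idl[OF P(1)]] by (intro exI[of _ P]) auto
    qed
    then obtain C where "0 \<le> C" "\<forall>n\<ge>1. cl (prin c <+> ipow I n) \<le> C * real n ^ k" using cl_upper[OF ic] by blast
    then show ?thesis using c(1,3) unfolding frob_frob[OF idl_I] by blast
  qed
  then obtain c C N where cC: "\<And>g. g \<in> set gs \<Longrightarrow> c g \<in> carrier R"
    "\<And>g. g \<in> set gs \<Longrightarrow> 0 \<le> (C g :: real)"
    "\<And>g n. g \<in> set gs \<Longrightarrow> 1 \<le> n \<Longrightarrow> cl (prin (c g) <+> ipow I n) \<le> C g * real n ^ k"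
    "\<And>g n. g \<in> set gs \<Longrightarrow> n \<ge> N g \<Longrightarrow> c g \<otimes> g [^] (p ^ n) \<in> frob_pow R I (p ^ (e + n))"
    by metis
  define D where "D = (\<Sum>g\<in>set gs. C g)"
  have CD: "C g \<le> D" if "g \<in> set gs" for g
    unfolding D_def using that cC(2) by (intro member_le_sum) auto
  have D0: "0 \<le> D" unfolding D_def using cC(2) by (intro sum_nonneg) auto
  \<comment> \<open>A common threshold from which the multipliers of all generators work.\<close>
  define M where "M = (\<Sum>g\<in>set gs. N g)"
  have NM: "N g \<le> M" if "g \<in> set gs" for g unfolding M_def using that by (intro member_le_sum) auto
  let ?t = "\<lambda>n. ?r * p ^ n + (?Q + 1) * p ^ n"
  have bound: "cl (frob_pow R I (p ^ (e + n))) \<le> cl (ipow I (?t n)) + real (length gs) * (D * (real (?r + 1) * real p ^ (e + n)) ^ k)"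
    if n: "n \<ge> M" for n
  proof -
    \<comment> \<open>The exponent \<open>?m\<close> is proportional to \<open>p^(e+n)\<close> and
      satisfies \<open>I^?m \<subseteq> ?B\<close>, so the bound for \<open>c g R + I^?m\<close>
      becomes an error of order \<open>p^((e+n) k)\<close>.\<close>
    let ?B = "frob_pow R I (p ^ (e + n))" and ?ys = "map (\<lambda>g. g [^] (p ^ n)) gs" and ?m = "(?r + 1) * p ^ (e + n)"
    have ys: "set ?ys \<subseteq> carrier R" using gs by auto
    have m1: "1 \<le> ?m" using p_pow_pos[of "e + n"] by (simp add: Suc_le_eq)
    have mB: "ipow I ?m \<subseteq> ?B" by (rule ipow_subset_frob_1[OF xs]) (use m1 in auto)
    have "cl ?B \<le> cl (lsum R ?ys (carrier R) <+> ?B) + real (length ?ys) * (D * real ?m ^ k)"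
    proof (rule cl_add_generators[OF cofin_frob_I ys])
      fix y assume "y \<in> set ?ys"
      then obtain g where g: "g \<in> set gs" "y = g [^] (p ^ n)" by auto
      have yc: "y \<in> carrier R" using g gs by auto
      have ic: "idl (prin (c g))" using cC(1)[OF g(1)] by auto
      let ?A = "prin (c g) <+> ipow I ?m"
      have "cl ?A \<le> C g * real ?m ^ k" by (rule cC(3)[OF g(1) m1])
      also have "\<dots> \<le> D * real ?m ^ k" using CD[OF g(1)] by (intro mult_right_mono) auto
      finally have "cl ?A \<le> D * real ?m ^ k" .
      moreover have "?A \<subseteq> {a \<in> carrier R. y \<otimes> a \<in> ?B}"
      proof (rule set_add_le[OF idl_colon[OF idl_carrier idl_frob_I yc]])
        have "c g \<otimes> y \<in> ?B" using cC(4)[OF g(1), of n] NM[OF g(1)] n g(2) by simp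
        then have "c g \<in> {a \<in> carrier R. y \<otimes> a \<in> ?B}" using cC(1)[OF g(1)] yc by (simp add: m_comm)
        then show "prin (c g) \<subseteq> {a \<in> carrier R. y \<otimes> a \<in> ?B}"
          by (rule prin_le[OF idl_colon[OF idl_carrier idl_frob_I yc]])
        show "ipow I ?m \<subseteq> {a \<in> carrier R. y \<otimes> a \<in> ?B}"
          using mB idl_mult[OF idl_frob_I yc] subm_mem[OF iI] by blast
      qed
      ultimately show "\<exists>A. cofin A \<and> cl A \<le> D * real ?m ^ k \<and> (\<forall>a\<in>A. y \<otimes> a \<in> ?B)"
        using cofin_add_ipow[OF ic] by blast
    qed
    moreover have "cl (lsum R ?ys (carrier R) <+> ?B) \<le> cl (ipow I (?t n))"
    proof (rule cl_antimono[OF cofin_ipow idl_set_add[OF idl_lsum[OF ys idl_carrier] idl_frob_I]])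
      have "ipow I (?t n) \<subseteq> lsum R ?ys (carrier R)"
        using ipow_subset_frob[OF xs, of n "?Q + 1"] frob_lsum[OF gs(1), of n] gs(2) by simp
      then show "ipow I (?t n) \<subseteq> lsum R ?ys (carrier R) <+> ?B"
        using set_add_upper1[OF idl_frob_I subm_carr[OF idl_lsum[OF ys idl_carrier]]] by blast
    qed
    moreover have "real ?m = real (?r + 1) * real p ^ (e + n)" by (simp only: of_nat_mult of_nat_power)
    ultimately show ?thesis unfolding length_map by simp
  qed
  let ?b = "\<lambda>n. real p ^ (e + n)"
  have bt: "filterlim ?b at_top sequentially"
    using filterlim_compose[OF p_power_at_top filterlim_add_const_nat_at_top[of e]] by (simp add: add.commute)
  have "real (?t n) / ?b n = 1 + real (?r + 1) / real ?Q" for n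
    using p_gt_1 by (simp add: power_add field_simps)
  then have "(\<lambda>n. real (?t n) / ?b n) \<longlonglongrightarrow> 1 + real (?r + 1) / real p ^ e" by simp
  from tendsto_rescale[OF L this _ bt]
  have t: "(\<lambda>n. cl (ipow I (?t n)) / ?b n ^ ?d) \<longlonglongrightarrow> L * (1 + real (?r + 1) / real p ^ e) ^ ?d"
    using pp[of e] by (simp add: add_pos_nonneg)
  define K where "K = real (length gs) * D * real (?r + 1) ^ k"
  have "(\<lambda>n. K / real p ^ (n + e)) \<longlonglongrightarrow> 0" using LIMSEQ_ignore_initial_segment[OF inverse_p_power_tendsto, of K e] .
  then have K: "(\<lambda>n. K / ?b n) \<longlonglongrightarrow> 0" by (simp add: add.commute)
  have "(\<lambda>n. cl (frob_pow R I (p ^ (n + e))) / real p ^ ((n + e) * ?d)) \<longlonglongrightarrow> h" using LIMSEQ_ignore_initial_segment[OF h, of e] .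
  then have h': "(\<lambda>n. cl (frob_pow R I (p ^ (e + n))) / ?b n ^ ?d) \<longlonglongrightarrow> h"
    by (simp only: power_mult add.commute[of _ e])
  have "h \<le> L * (1 + real (?r + 1) / real p ^ e) ^ ?d + 0"
  proof (rule LIMSEQ_le[OF h' tendsto_add[OF t K]])
    have "cl (frob_pow R I (p ^ (e + n))) / ?b n ^ ?d \<le> cl (ipow I (?t n)) / ?b n ^ ?d + K / ?b n" if n: "n \<ge> M" for n
    proof -
      have "0 \<le> ?b n ^ ?d" using pp[of "e + n"] by (simp add: less_imp_le)
      from divide_right_mono[OF bound[OF n] this]
      have "cl (frob_pow R I (p ^ (e + n))) / ?b n ^ ?d \<le>
          cl (ipow I (?t n)) / ?b n ^ ?d + real (length gs) * (D * (real (?r + 1) * ?b n) ^ k) / ?b n ^ ?d"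
        by (simp only: add_divide_distrib)
      also have "real (length gs) * (D * (real (?r + 1) * ?b n) ^ k) / ?b n ^ ?d = K / ?b n"
        unfolding K_def power_mult_distrib using p_gt_1 by (simp add: field_simps)
      finally show ?thesis .
    qed
    then show "\<exists>N. \<forall>n\<ge>N. cl (frob_pow R I (p ^ (e + n))) / ?b n ^ ?d \<le> cl (ipow I (?t n)) / ?b n ^ ?d + K / ?b n" by blast
  qed
  then show ?thesis by simp
qed

lemma exists_not_in_tight_closure:
  assumes dim: "chain_free {\<zero>} (Suc k)" and L: "(\<lambda>n. cl (ipow I n) / real n ^ Suc k) \<longlonglongrightarrow> L" "L < h"
    and h: "(\<lambda>n. cl (frob_pow R I (p ^ n)) / real p ^ (n * Suc k)) \<longlonglongrightarrow> h"
  shows "\<exists>e. \<not> ideal_pow R I (p ^ e + 1) \<subseteq> tight_closure R p (frob_pow R I (p ^ e))"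
proof (rule ccontr)
  assume no: "\<not> ?thesis"
  obtain xs where xs: "set xs \<subseteq> carrier R" "I = lsum R xs (carrier R)" by (rule I_generators)
  have "(\<lambda>e. L * (1 + real (length xs + 1) / real p ^ e) ^ Suc k) \<longlonglongrightarrow> L * (1 + 0) ^ Suc k"
    by (intro tendsto_intros inverse_p_power_tendsto)
  moreover have "h \<le> L * (1 + real (length xs + 1) / real p ^ e) ^ Suc k" for e
    using tight_closure_bound[OF dim L(1) h xs] no by blast
  ultimately have "h \<le> L * (1 + 0) ^ Suc k" by (intro LIMSEQ_le_const) auto
  then show False using L(2) by simp
qed

theorem equivalences_of_krull_dim:
  assumes dim_eq: "krull_dim R = enat d"
  shows "(hilbert_kunz_mult R p d I > hilbert_samuel_mult R d I / fact d
            \<longleftrightarrow> min_stable_point R p d I > 1)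
       \<and> (min_stable_point R p d I > 1
            \<longleftrightarrow> (\<exists>e::nat. \<not> ideal_pow R I (p ^ e + 1)
                               \<subseteq> tight_closure R p (frob_pow R I (p ^ e))))"
proof -
  \<comment> \<open>Every prime contains zero, so chains over the zero ideal are all chains of
    primes, and \<open>chain_free {\<zero>} d\<close> bounds the Krull dimension by
    \<open>d\<close>.\<close>
  have pr: "{P. primeideal P R \<and> {\<zero>} \<subseteq> P} = {P. primeideal P R}"
    using subm_zero[OF primeideal_idl] by auto
  have dim: "chain_free {\<zero>} d"
    using finite_chain_height(2)[of "{P. primeideal P R}" d] dim_eq prime_mm
    unfolding chain_free_def pr krull_dim_def by blast
  obtain C where C: "strict_chain {P. primeideal P R} d C"
    using finite_chain_height(1)[of "{P. primeideal P R}" d] dim_eq prime_mm unfolding krull_dim_def by blast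
  obtain L where L: "(\<lambda>n. cl (ipow I n) / real n ^ d) \<longlonglongrightarrow> L" using cl_ipow_tendsto[OF dim] by blast
  have HS: "hilbert_samuel_mult R d I / fact d = L" using hilbert_samuel_eq[OF L] by simp
  show ?thesis
  proof (cases "d \<le> 1")
    case True
    note low = low_dim_limits[OF dim True L]
    have HK: "hilbert_kunz_mult R p d I = L" by (rule hilbert_kunz_eq[OF low(1)])
    have "h_function R p d I s = L" if "1 < s" for s by (rule h_function_eq[OF low(2)[OF that]])
    then have "s \<le> 1" if "h_function R p d I s \<noteq> hilbert_kunz_mult R p d I" for s
      using that HK by (meson not_le)
    then have "min_stable_point R p d I \<le> 1"
      unfolding min_stable_point_def by (intro Sup_least) auto
    then show ?thesis using HK HS low(3) by auto
  next
    case False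
    then obtain k where k: "d = Suc k" "1 \<le> k" by (cases d) auto
    note dim' = dim[unfolded k(1)] and L' = L[unfolded k(1)]
    have L0: "0 < L" by (rule cl_ipow_limit_pos[OF C L])
    obtain h where h: "(\<lambda>n. cl (frob_pow R I (p ^ n)) / real p ^ (n * Suc k)) \<longlonglongrightarrow> h"
      using hilbert_kunz_tendsto[OF dim'] by blast
    have HK: "hilbert_kunz_mult R p d I = h" unfolding k(1) by (rule hilbert_kunz_eq[OF h])
    have Lh: "L < h" by (rule hilbert_kunz_gt[OF k(2) L' L0 h])
    obtain s where s: "1 < s" "h_function R p (Suc k) I s < h" using h_function_less[OF dim' L' Lh] by blast
    have "ereal s \<le> min_stable_point R p d I"
      unfolding min_stable_point_def using s HK k by (intro Sup_upper) auto
    moreover have "1 < ereal s" using s by simp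
    ultimately have "1 < min_stable_point R p d I" by (rule less_le_trans[rotated])
    then show ?thesis using HS HK Lh exists_not_in_tight_closure[OF dim' L' Lh h] by auto
  qed
qed

end

theorem proposition8p1:
  fixes R :: "('a, 'b) ring_scheme" and \<mm> I :: "'a set" and p d :: nat
  assumes "local_ring R \<mm>" and "noetherian_ring R"
    and "Factorial_Ring.prime p" and "ring_char R = p" and "F_finite R p"
    and "krull_dim R = enat d"
    and "primary_to R \<mm> I"
  shows "(hilbert_kunz_mult R p d I > hilbert_samuel_mult R d I / fact d
            \<longleftrightarrow> min_stable_point R p d I > 1)
       \<and> (min_stable_point R p d I > 1
            \<longleftrightarrow> (\<exists>e::nat. \<not> ideal_pow R I (p ^ e + 1)
                               \<subseteq> tight_closure R p (frob_pow R I (p ^ e))))"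
proof -
  have R: "cring R" using assms(1) by (simp add: local_ring_def)
  then interpret cring R .
  have nc: "noetherian_cring R" by (rule noetherian_cring.intro[OF R assms(2)])
  have char: "add_pow R p \<one>\<^bsub>R\<^esub> = \<zero>\<^bsub>R\<^esub>"
    using group.pow_ord_eq_1[OF a_group, of "\<one>\<^bsub>R\<^esub>"] assms(4) by (simp add: ring_char_def add_pow_def)
  have I: "subm R (carrier R) I" "radical_ideal R I = \<mm>"
    using assms(7) ideal_iff_subm by (auto simp: primary_to_def primary_ideal_def)
  have max: "maximalideal \<mm> R" "\<And>M. maximalideal M R \<Longrightarrow> M = \<mm>"
    using assms(1) unfolding local_ring_def by blast+
  have "local_cring R \<mm> I" by (rule local_cring.intro[OF nc local_cring_axioms.intro[OF max I]])
  moreover have "frobenius_cring R p" by (rule frobenius_cring.intro[OF nc frobenius_cring_axioms.intro[OF assms(3) char]])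
  ultimately have "local_frobenius R \<mm> I p"
    by (rule local_frobenius.intro[OF _ _ local_frobenius_axioms.intro[OF assms(5)]])
  then show ?thesis by (rule local_frobenius.equivalences_of_krull_dim[OF _ assms(6)])
qed

end
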